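(* Let $n\ge 2$, let $M$ be an invariant subspace of $H^2(\mathbb D^n)$, and let $\Theta(z_1)$ be the operator inner function for $M$ with respect to the variable $z_1$, i.e. $\Theta\in H^\infty(B(H^2(\mathbb D^{n-1})))$ is operator inner and $M=\hat\Theta H^2(\mathbb D^n)$. Then $M$ is of the form $$M=f_1(z_1)H^2(\mathbb D^n)+f_2(z_2,\dots,z_n)H^2(\mathbb D^n)$$ for some $f_1\in H^\infty(\mathbb D)$ with $f_1^{-1}\in L^\infty(\mathbb T)$ and some $f_2\in H^\infty(\mathbb D^{n-1})$ with $f_2^{-1}\in L^\infty(\mathbb T^{n-1})$ if and only if $$\Theta(z_1)=f_1(z_1)P_0+P_1$$ for some $f_1\in H^\infty(\mathbb D)$ with $f_1^{-1}\in L^\infty(\mathbb T)$, where $P_1$ is an orthogonal projection from $H^2(\mathbb D^{n-1})$ onto an invariant subspace of $H^2(\mathbb D^{n-1})$ generated by a single function and $P_0$ is the complementary projection of $P_1$, i.e. $P_0P_1=0$ and $P_0+P_1=I$.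
   Context: $\mathbb D$ is the open unit disc, $\mathbb T$ the unit circle. $H^2(\mathbb D^m)$ is the Hardy space of holomorphic functions $f(z)=\sum_{\alpha\in\mathbb Z_+^m}c(\alpha)z^\alpha$ on $\mathbb D^m$ with $\|f\|_2^2=\sum_\alpha|c(\alpha)|^2<\infty$; $f^*$ denotes the radial boundary function, defined a.e. on $\mathbb T^m$. $H^\infty(\mathbb D^m)$ is the space of bounded holomorphic functions on $\mathbb D^m$. For $f\in H^\infty(\mathbb D^m)$, "$f^{-1}\in L^\infty(\mathbb T^m)$" means $1/f^*\in L^\infty(\mathbb T^m)$. An invariant subspace of $H^2(\mathbb D^m)$ is a closed linear subspace that is mapped into itself by multiplication by each of the coordinate variables. An invariant subspace $N$ of $H^2(\mathbb D^m)$ is generated by a single function if there is $f\in H^2(\mathbb D^m)$ such that the smallest invariant subspace containing $f$ equals $fH^2(\mathbb D^m)$ and $N=fH^2(\mathbb D^m)$. Operator-valued functions: for a separable infinite-dimensional Hilbert space $K$, $H^2(K)$ is the Hilbert space of $K$-valued analytic functions $\sum_{j\ge0}x_jz^j$ on $\mathbb D$ with $\sum_j\|x_j\|_K^2<\infty$; $H^\infty(B(K))$ is the space of bounded analytic functions $W:\mathbb D\to B(K)$, $B(K)$ being the bounded operators on $K$; each such $W$ defines a bounded operator $\hat W$ on $H^2(K)$ by $(\hat W\varphi)(z)=W(z)\varphi(z)$. $W$ is operator inner if its boundary values satisfy $W(\xi)^*W(\xi)=I_K$ for almost all $\xi\in\mathbb T$. Here $H^2(\mathbb D^n)$ is identified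 with $H^2(K)$, $K=H^2(\mathbb D^{n-1})$ being the Hardy space in $z_2,\dots,z_n$ and $z=z_1$ being the independent variable. By the Beurling-Lax-Halmos theorem an invariant subspace $M$ can be written as $M=\hat\Theta H^2(\mathbb D^n)$ with $\Theta$ operator inner; such a $\Theta$ is what is called the operator inner function for $M$.
   Formalization: The equation Θ(z₁)=f₁(z₁)P₀+P₁ is stated up to a constant unitary, as Θ(z₁)U=f₁(z₁)P₀+P₁ for some unitary U on H²(Dⁿ⁻¹), and the single function generating the range of P₁ is required to be nonzero; the claim is false otherwise. *)

theory Defs
  imports "HOL-Analysis.Analysis"
begin

text \<open>
  A point of the polydisc in the coordinates \<open>z\<^sub>i\<close>, \<open>i \<in> I\<close>, is an extensional function on the
  finite index set \<open>I\<close>.  Thus \<open>\<D>\<^sup>n\<close> is \<open>polydisc {1..n}\<close>, and \<open>polydisc {2..n}\<close> is the copy of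
  \<open>\<D>\<^bsup>n-1\<^esup>\<close> with coordinates \<open>z\<^sub>2, \<dots>, z\<^sub>n\<close>.
\<close>

type_synonym point = "nat \<Rightarrow> complex"
type_synonym func = "point \<Rightarrow> complex"
type_synonym oper = "func \<Rightarrow> func"

definition polydisc :: "nat set \<Rightarrow> point set" where
  "polydisc I = (\<Pi>\<^sub>E i\<in>I. ball 0 1)"

definition multi_indices :: "nat set \<Rightarrow> (nat \<Rightarrow> nat) set" where
  "multi_indices I = (\<Pi>\<^sub>E i\<in>I. UNIV)"

text \<open>
  A function is holomorphic on the polydisc iff it is the (absolutely convergent) sum of a power
  series there.
\<close>

definition has_power_series :: "nat set \<Rightarrow> ((nat \<Rightarrow> nat) \<Rightarrow> complex) \<Rightarrow> func \<Rightarrow> bool" where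
  "has_power_series I c f \<longleftrightarrow>
     (\<forall>z\<in>polydisc I. ((\<lambda>\<alpha>. c \<alpha> * (\<Prod>i\<in>I. z i ^ \<alpha> i)) has_sum f z) (multi_indices I))"

definition holomorphic_polydisc :: "nat set \<Rightarrow> func \<Rightarrow> bool" where
  "holomorphic_polydisc I f \<longleftrightarrow> (\<exists>c. has_power_series I c f)"


section \<open>The Hardy space \<open>H\<^sup>2\<close> of the polydisc\<close>

text \<open>
  Elements of \<open>H2 I\<close> are normalised to vanish off the polydisc, so that equality of functions is
  equality on the polydisc and the pointwise operations stay inside \<open>H2 I\<close>.
\<close>

definition H2 :: "nat set \<Rightarrow> func set" where
  "H2 I = {f. (\<forall>z. z \<notin> polydisc I \<longrightarrow> f z = 0) \<and>
              (\<exists>c. has_power_series I c f \<and>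
                   (\<lambda>\<alpha>. (cmod (c \<alpha>))\<^sup>2) summable_on multi_indices I)}"

text \<open>The coefficients are uniquely determined on \<open>multi_indices I\<close>, the only place they are used.\<close>

definition coeffs :: "nat set \<Rightarrow> func \<Rightarrow> (nat \<Rightarrow> nat) \<Rightarrow> complex" where
  "coeffs I f = (SOME c. has_power_series I c f)"

definition H2_norm :: "nat set \<Rightarrow> func \<Rightarrow> real" where
  "H2_norm I f = sqrt (\<Sum>\<^sub>\<infinity>\<alpha>\<in>multi_indices I. (cmod (coeffs I f \<alpha>))\<^sup>2)"

definition H2_inner :: "nat set \<Rightarrow> func \<Rightarrow> func \<Rightarrow> complex" where
  "H2_inner I f g = (\<Sum>\<^sub>\<infinity>\<alpha>\<in>multi_indices I. coeffs I f \<alpha> * cnj (coeffs I g \<alpha>))"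

definition H2_dist :: "nat set \<Rightarrow> func \<Rightarrow> func \<Rightarrow> real" where
  "H2_dist I f g = H2_norm I (\<lambda>z. f z - g z)"

definition invariant_subspace :: "nat set \<Rightarrow> func set \<Rightarrow> bool" where
  "invariant_subspace I M \<longleftrightarrow>
     M \<subseteq> H2 I \<and> (\<lambda>z. 0) \<in> M \<and>
     (\<forall>f\<in>M. \<forall>g\<in>M. (\<lambda>z. f z + g z) \<in> M) \<and>
     (\<forall>a. \<forall>f\<in>M. (\<lambda>z. a * f z) \<in> M) \<and>
     closedin (Metric_space.mtopology (H2 I) (H2_dist I)) M \<and>
     (\<forall>i\<in>I. \<forall>f\<in>M. (\<lambda>z. z i * f z) \<in> M)"

definition invariant_hull :: "nat set \<Rightarrow> func \<Rightarrow> func set" where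
  "invariant_hull I f = \<Inter>{N. invariant_subspace I N \<and> f \<in> N}"

text \<open>The trivial generator \<open>f = 0\<close>, i.e. the subspace \<open>{0}\<close>, is excluded: the generator is meant
  to be nonzero, and the theorem fails otherwise (take \<open>M = z\<^sub>1 H\<^sup>2(\<D>\<^sup>n)\<close>, \<open>P\<^sub>1 = 0\<close>).\<close>

definition singly_generated :: "nat set \<Rightarrow> func set \<Rightarrow> bool" where
  "singly_generated I N \<longleftrightarrow>
     (\<exists>f\<in>H2 I. f \<noteq> (\<lambda>z. 0) \<and>
        invariant_hull I f = {\<lambda>z. f z * h z |h. h \<in> H2 I} \<and>
        N = {\<lambda>z. f z * h z |h. h \<in> H2 I})"


section \<open>Boundary functions and \<open>H\<^sup>\<infinity>\<close>\<close>

definition circle_measure :: "complex measure" where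
  "circle_measure =
     distr (uniform_measure lborel {0..2 * pi}) (restrict_space borel (sphere 0 1)) cis"

definition torus_measure :: "nat set \<Rightarrow> point measure" where
  "torus_measure I = (\<Pi>\<^sub>M i\<in>I. circle_measure)"

definition Linf :: "'a measure \<Rightarrow> ('a \<Rightarrow> complex) set" where
  "Linf M = {g \<in> borel_measurable M. \<exists>C. AE x in M. cmod (g x) \<le> C}"

text \<open>
  Since \<open>1 / 0 = 0\<close> in HOL, membership of \<open>1 / g\<close> in \<open>L\<^sup>\<infinity>\<close> must be accompanied by \<open>g \<noteq> 0\<close> almost
  everywhere.
\<close>

definition inverse_in_Linf :: "'a measure \<Rightarrow> ('a \<Rightarrow> complex) \<Rightarrow> bool" where
  "inverse_in_Linf M g \<longleftrightarrow> (AE x in M. g x \<noteq> 0) \<and> (\<lambda>x. 1 / g x) \<in> Linf M"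

definition radial_disc :: "(complex \<Rightarrow> complex) \<Rightarrow> complex \<Rightarrow> complex" where
  "radial_disc f \<xi> = Lim (at_left 1) (\<lambda>r. f (complex_of_real r * \<xi>))"

definition radial_polydisc :: "nat set \<Rightarrow> func \<Rightarrow> point \<Rightarrow> complex" where
  "radial_polydisc I f \<zeta> = Lim (at_left 1) (\<lambda>r. f (\<lambda>i\<in>I. complex_of_real r * \<zeta> i))"

definition Hinf_disc :: "(complex \<Rightarrow> complex) set" where
  "Hinf_disc = {f. f holomorphic_on ball 0 1 \<and> bounded (f ` ball 0 1)}"

definition Hinf_polydisc :: "nat set \<Rightarrow> func set" where
  "Hinf_polydisc I = {f. holomorphic_polydisc I f \<and> bounded (f ` polydisc I)}"


section \<open>Operators on \<open>H\<^sup>2\<close>\<close>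

definition bounded_ops :: "nat set \<Rightarrow> oper set" where
  "bounded_ops I = {T. (\<forall>f\<in>H2 I. T f \<in> H2 I) \<and>
     (\<forall>f\<in>H2 I. \<forall>g\<in>H2 I. T (\<lambda>z. f z + g z) = (\<lambda>z. T f z + T g z)) \<and>
     (\<forall>a. \<forall>f\<in>H2 I. T (\<lambda>z. a * f z) = (\<lambda>z. a * T f z)) \<and>
     (\<exists>C. \<forall>f\<in>H2 I. H2_norm I (T f) \<le> C * H2_norm I f)}"

definition op_norm :: "nat set \<Rightarrow> oper \<Rightarrow> real" where
  "op_norm I T = (SUP f\<in>{f \<in> H2 I. H2_norm I f \<le> 1}. H2_norm I (T f))"

definition is_adjoint :: "nat set \<Rightarrow> oper \<Rightarrow> oper \<Rightarrow> bool" where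
  "is_adjoint I T S \<longleftrightarrow> (\<forall>f\<in>H2 I. \<forall>g\<in>H2 I. H2_inner I (T f) g = H2_inner I f (S g))"

text \<open>
  Needed because the operator inner function of an invariant subspace is unique only up to a
  constant unitary factor on the right.
\<close>

definition unitary_op :: "nat set \<Rightarrow> oper \<Rightarrow> bool" where
  "unitary_op I U \<longleftrightarrow> U \<in> bounded_ops I \<and>
     (\<exists>S\<in>bounded_ops I. is_adjoint I U S \<and> (\<forall>f\<in>H2 I. S (U f) = f \<and> U (S f) = f))"

definition orth_projection :: "nat set \<Rightarrow> func set \<Rightarrow> oper \<Rightarrow> bool" where
  "orth_projection I N P \<longleftrightarrow>
     (\<forall>f\<in>H2 I. P f \<in> N \<and> (\<forall>g\<in>N. H2_inner I (\<lambda>z. f z - P f z) g = 0))"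

text \<open>\<open>H\<^sup>\<infinity>(B(K))\<close> for \<open>K = H2 I\<close>; analyticity is complex differentiability in the operator norm.\<close>

definition Hinf_op :: "nat set \<Rightarrow> (complex \<Rightarrow> oper) set" where
  "Hinf_op I = {W. (\<forall>z\<in>ball 0 1. W z \<in> bounded_ops I) \<and>
     (\<exists>C. \<forall>z\<in>ball 0 1. op_norm I (W z) \<le> C) \<and>
     (\<forall>z\<in>ball 0 1. \<exists>A\<in>bounded_ops I.
        ((\<lambda>w. op_norm I (\<lambda>f x. (W w f x - W z f x) / (w - z) - A f x)) \<longlongrightarrow> 0) (at z))}"

text \<open>Boundary values of operator-valued functions are radial limits in the strong operator topology.\<close>

definition has_boundary_value :: "nat set \<Rightarrow> (complex \<Rightarrow> oper) \<Rightarrow> complex \<Rightarrow> oper \<Rightarrow> bool" where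
  "has_boundary_value I W \<xi> T \<longleftrightarrow> T \<in> bounded_ops I \<and>
     (\<forall>f\<in>H2 I. ((\<lambda>r. H2_dist I (W (complex_of_real r * \<xi>) f) (T f)) \<longlongrightarrow> 0) (at_left 1))"

definition operator_inner :: "nat set \<Rightarrow> (complex \<Rightarrow> oper) \<Rightarrow> bool" where
  "operator_inner I W \<longleftrightarrow> W \<in> Hinf_op I \<and>
     (AE \<xi> in circle_measure. \<exists>T. has_boundary_value I W \<xi> T \<and>
        (\<exists>S\<in>bounded_ops I. is_adjoint I T S \<and> (\<forall>f\<in>H2 I. S (T f) = f)))"

text \<open>
  The identification of \<open>H\<^sup>2(\<D>\<^sup>n)\<close> with \<open>H\<^sup>2(K)\<close>, \<open>K = H2 {2..n}\<close>, sends \<open>F\<close> to the \<open>K\<close>-valued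
  function \<open>slice n F\<close> of \<open>z\<^sub>1\<close>.  Through it, \<open>op_mult n W\<close> is \<open>(W\<phi>)(z\<^sub>1) = W(z\<^sub>1) \<phi>(z\<^sub>1)\<close>.
\<close>

definition slice :: "nat \<Rightarrow> func \<Rightarrow> complex \<Rightarrow> func" where
  "slice n F w = (\<lambda>x. if x \<in> polydisc {2..n} then F (x(1 := w)) else 0)"

definition op_mult :: "nat \<Rightarrow> (complex \<Rightarrow> oper) \<Rightarrow> oper" where
  "op_mult n W F = (\<lambda>z. if z \<in> polydisc {1..n}
                        then W (z 1) (slice n F (z 1)) (restrict z {2..n}) else 0)"

end

theory Submission
 imports Defs "HOL-Complex_Analysis.Complex_Analysis" "HOL-Probability.Infinite_Product_Measure"
begin

text \<open>
Write \<open>I = {1..n}\<close>, \<open>J = {2..n}\<close>, \<open>K = H2 J\<close>, and view \<open>H2 I\<close> as \<open>H\<^sup>2(K)\<close> through slices in \<open>z\<^sub>1\<close>.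
The theorem compares the isometry \<open>\<Theta>\<close> on \<open>H2 I\<close> with \<open>\<Psi> = q(z\<^sub>1) P\<^sub>0 + P\<^sub>1\<close>. Three facts carry it.

If \<open>f\<^sub>2\<close> is bounded above and below as a multiplier of \<open>K\<close> and \<open>P\<^sub>1\<close> projects onto \<open>f\<^sub>2 K\<close>, then the
range of \<open>f\<^sub>1 P\<^sub>0 + P\<^sub>1\<close> is \<open>f\<^sub>1 H\<^sup>2 + f\<^sub>2 H\<^sup>2\<close> (\<open>proj_mult_range\<close>): \<open>P\<^sub>1 G\<close> is \<open>f\<^sub>2\<close> times a function, and
conversely \<open>f\<^sub>1 g + f\<^sub>2 h\<close> is the image of \<open>P\<^sub>0 g + f\<^sub>1 P\<^sub>1 g + f\<^sub>2 h\<close>.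

For a bounded holomorphic function, invertibility in \<open>L\<^sup>\<infinity>\<close> of the boundary function means exactly that
multiplication by it is bounded below (\<open>mult_lower_of_inverse_in_Linf\<close>, \<open>inverse_in_Linf_of_mult_lower\<close>).
Boundary values exist almost everywhere by Fatou's theorem on the disc and Fubini over rotations of the torus.
If \<open>f H2 J\<close> is the closed subspace generated by \<open>f\<close>, then the closed graph and open mapping principles make
multiplication by \<open>f\<close> bounded above and below (\<open>closed_range_multiplier_bounds\<close>). So singly generated
invariant subspaces with nonzero generator are the subspaces \<open>f\<^sub>2 K\<close> with \<open>f\<^sub>2\<close>, \<open>1 / f\<^sub>2\<close> bounded on the torus.

Two isometries of \<open>H2 I\<close> that commute with multiplication by \<open>z\<^sub>1\<close> and have the same range differ by a
constant unitary of \<open>K\<close> on the right (\<open>same_range_unitary\<close>), because each maps \<open>K\<close> onto the orthogonal complement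
of \<open>z\<^sub>1 R\<close> in the range \<open>R\<close>. Multiplication by \<open>\<Theta>\<close> is such an isometry: on polynomials in \<open>z\<^sub>1\<close> one integrates the
boundary values over the circle, and the rest is density (\<open>op_mult_norm\<close>).

The direction from \<open>\<Theta>\<close> to \<open>M\<close> then reads off the range. In the other direction \<open>f\<^sub>1\<close> need not be inner, so
\<open>f\<^sub>1 P\<^sub>0 + P\<^sub>1\<close> need not be isometric; but \<open>f\<^sub>1\<close> is an inner function \<open>q\<close> times an invertible bounded function
(\<open>inner_factor\<close>), \<open>f\<^sub>1 H\<^sup>2 = q H\<^sup>2\<close>, and \<open>q P\<^sub>0 + P\<^sub>1\<close> is isometric with range \<open>M\<close>.
\<close>

section \<open>Monomials and dilations\<close>

definition mon :: "nat set \<Rightarrow> (nat \<Rightarrow> nat) \<Rightarrow> point \<Rightarrow> complex" where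
 "mon I \<alpha> z = (\<Prod>i\<in>I. z i ^ \<alpha> i)"

definition deg :: "nat set \<Rightarrow> (nat \<Rightarrow> nat) \<Rightarrow> nat" where
 "deg I \<alpha> = (\<Sum>i\<in>I. \<alpha> i)"

definition dil :: "nat set \<Rightarrow> complex \<Rightarrow> point \<Rightarrow> point" where
 "dil I w z = (\<lambda>i\<in>I. w * z i)"

definition torus :: "nat set \<Rightarrow> point set" where
 "torus I = (\<Pi>\<^sub>E i\<in>I. sphere 0 1)"

text \<open>A cofinal sequence of finite sets of multi-indices, so that unordered sums become limits of sequences.\<close>
definition ibox :: "nat set \<Rightarrow> nat \<Rightarrow> (nat \<Rightarrow> nat) set" where
 "ibox I N = (\<Pi>\<^sub>E i\<in>I. {..N})"

lemma mon_dil: "mon I \<alpha> (dil I w z) = w ^ deg I \<alpha> * mon I \<alpha> z"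
 by (simp add: mon_def dil_def deg_def power_mult_distrib prod.distrib power_sum)

lemma norm_mon_torus: "z \<in> torus I ==> cmod (mon I \<alpha> z) = 1"
 by (auto simp: mon_def torus_def prod_norm[symmetric] norm_power PiE_iff intro!: prod.neutral)

lemma dil_in_polydisc:
 assumes "z \<in> torus I" "cmod w < 1" shows "dil I w z \<in> polydisc I"
 using assms by (fastforce simp: dil_def torus_def polydisc_def norm_mult PiE_iff)

lemma dil_in_torus:
 assumes "z \<in> torus I" "cmod w = 1" shows "dil I w z \<in> torus I"
 using assms by (auto simp: dil_def torus_def norm_mult)

lemma finite_box: "finite I ==> finite (ibox I N)"
 by (auto simp: ibox_def intro: finite_PiE)

lemma box_subset: "ibox I N \<subseteq> multi_indices I"
 by (auto simp: ibox_def multi_indices_def)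

lemma filterlim_box:
 assumes "finite I"
 shows "filterlim (ibox I) (finite_subsets_at_top (multi_indices I)) sequentially"
 unfolding filterlim_finite_subsets_at_top
proof safe
 fix X assume X: "finite X" "X \<subseteq> multi_indices I"
 define N where "N = Max (insert 0 ((\<lambda>(\<alpha>,i). \<alpha> i) ` (X \<times> I)))"
 have N: "\<alpha> i \<le> N" if "\<alpha> \<in> X" "i \<in> I" for \<alpha> i
  unfolding N_def using that X assms by (intro Max_ge) auto
 show "\<forall>\<^sub>F y in sequentially. finite (ibox I y) \<and> X \<subseteq> ibox I y \<and> ibox I y \<subseteq> multi_indices I"
  using eventually_ge_at_top[of N]
 proof eventually_elim
  case (elim n)
  have "X \<subseteq> ibox I n"
   using N X elim by (fastforce simp: ibox_def multi_indices_def PiE_iff intro: order_trans)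
  then show ?case using finite_box[OF assms] box_subset by auto
 qed
qed

lemma has_sum_box:
 assumes "finite I" "(f has_sum s) (multi_indices I)"
 shows "(\<lambda>N. sum f (ibox I N)) \<longlonglongrightarrow> s"
 using filterlim_compose[OF assms(2)[unfolded has_sum_def] filterlim_box[OF assms(1)]] .

lemma multi_indices_eqI:
 "\<alpha> \<in> multi_indices I ==> \<beta> \<in> multi_indices I ==> (\<And>i. i \<in> I ==> \<alpha> i = \<beta> i) ==> \<alpha> = \<beta>"
 unfolding multi_indices_def by (rule PiE_ext)

section \<open>The circle measure\<close>

lemma space_circle [simp]: "space circle_measure = sphere 0 1"
 by (simp add: circle_measure_def space_restrict_space)

lemma sets_circle: "sets circle_measure = sets (restrict_space borel (sphere 0 1))"
 by (simp add: circle_measure_def)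

lemma cis_measurable [measurable]:
 "cis \<in> measurable lborel (restrict_space borel (sphere 0 1))"
 by (intro measurable_restrict_space2) (auto intro!: borel_measurable_continuous_onI continuous_intros)

lemma cis_measurable': 
 "cis \<in> measurable (uniform_measure lborel {0..2*pi}) (restrict_space borel (sphere 0 1))"
 using cis_measurable by (simp add: measurable_def)

interpretation circle: prob_space circle_measure
 unfolding circle_measure_def
 by (intro prob_space.prob_space_distr prob_space_uniform_measure cis_measurable') auto

lemma circle_ident_measurable [measurable]: "(\<lambda>\<xi>. \<xi>) \<in> borel_measurable circle_measure"
 unfolding measurable_cong_sets[OF sets_circle refl]
 by (rule measurable_restrict_space1) simp

lemma emeasure_circle:
 assumes "A \<in> sets circle_measure"
 shows "emeasure circle_measure A = emeasure lborel ({0..2*pi} \<inter> {t. cis t \<in> A}) / emeasure lborel {0..2*pi}"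
proof -
 have m: "cis -` A \<inter> space lborel \<in> sets lborel"
  using assms measurable_sets[OF cis_measurable] by (simp add: sets_circle)
 have "emeasure circle_measure A = emeasure (uniform_measure lborel {0..2*pi}) (cis -` A \<inter> space lborel)"
  unfolding circle_measure_def
  using assms by (subst emeasure_distr[OF cis_measurable']) (auto simp: sets_circle)
 also have "\<dots> = emeasure lborel ({0..2*pi} \<inter> (cis -` A \<inter> space lborel)) / emeasure lborel {0..2*pi}"
  using m by (intro emeasure_uniform_measure) auto
 finally show ?thesis by (simp add: vimage_def)
qed

lemma emeasure_lborel_translate:
 fixes B :: "real set"
 assumes "B \<in> sets borel"
 shows "emeasure lborel {t. a + t \<in> B} = emeasure lborel B"
proof -
 have "emeasure lborel B = emeasure (distr lborel borel ((+) a)) B" by (simp add: lborel_distr_plus)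
 also have "\<dots> = emeasure lborel ((+) a -` B \<inter> space lborel)"
  using assms by (intro emeasure_distr) auto
 finally show ?thesis by (simp add: vimage_def)
qed

lemma emeasure_period_translate:
 assumes B: "B \<in> sets borel" and per: "\<And>t. (t + 2*pi \<in> B) = (t \<in> B)" and a: "0 \<le> a" "a < 2*pi"
 shows "emeasure lborel ({0..2*pi} \<inter> {t. a + t \<in> B}) = emeasure lborel ({0..2*pi} \<inter> B)"
proof -
 have [measurable]: "B \<in> sets borel" by fact
 have ends: "emeasure lborel ({0..2*pi} \<inter> C) = emeasure lborel ({0..<2*pi} \<inter> C)" if [measurable]: "C \<in> sets borel" for C
  by (rule emeasure_eq_AE) (use AE_lborel_singleton[of "2*pi"] in \<open>auto\<close>)
 have m: "{t. a + t \<in> B} \<in> sets borel" by measurable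
 have "emeasure lborel ({0..2*pi} \<inter> {t. a + t \<in> B}) = emeasure lborel {t. a + t \<in> {a..<2*pi+a} \<inter> B}"
  unfolding ends[OF m] by (rule arg_cong[of _ _ "emeasure lborel"]) auto
 also have "\<dots> = emeasure lborel ({a..<2*pi+a} \<inter> B)"
  by (rule emeasure_lborel_translate) measurable
 also have "{a..<2*pi+a} \<inter> B = ({a..<2*pi} \<inter> B) \<union> ({2*pi..<2*pi+a} \<inter> B)"
  using a by auto
 also have "emeasure lborel \<dots> = emeasure lborel ({a..<2*pi} \<inter> B) + emeasure lborel ({2*pi..<2*pi+a} \<inter> B)"
  by (rule plus_emeasure[symmetric]) auto
 also have "emeasure lborel ({2*pi..<2*pi+a} \<inter> B) = emeasure lborel {t. 2*pi + t \<in> ({2*pi..<2*pi+a} \<inter> B)}"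
  by (rule emeasure_lborel_translate[symmetric]) measurable
 also have "{t. 2*pi + t \<in> ({2*pi..<2*pi+a} \<inter> B)} = {0..<a} \<inter> B"
  using per by (auto simp: add.commute)
 also have "emeasure lborel ({a..<2*pi} \<inter> B) + emeasure lborel ({0..<a} \<inter> B) = emeasure lborel (({a..<2*pi} \<inter> B) \<union> ({0..<a} \<inter> B))"
  by (rule plus_emeasure) auto
 also have "({a..<2*pi} \<inter> B) \<union> ({0..<a} \<inter> B) = {0..<2*pi} \<inter> B"
  using a by auto
 finally show ?thesis by (simp add: ends[OF B])
qed

lemma circle_rotate_measurable:
 "cmod c = 1 ==> (\<lambda>\<xi>. c * \<xi>) \<in> measurable circle_measure circle_measure"
 unfolding measurable_cong_sets[OF refl sets_circle]
 by (intro measurable_restrict_space2) (auto simp: norm_mult)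

text \<open>Cutting the period interval at the image of its end point reduces rotation to translation invariance of Lebesgue measure.\<close>
lemma distr_circle_rotate:
 assumes "cmod c = 1"
 shows "distr circle_measure circle_measure (\<lambda>\<xi>. c * \<xi>) = circle_measure"
proof (rule measure_eqI)
 obtain a where a: "0 \<le> a" "a < 2*pi" "c = cis a"
  using assms complex_unimodular_polar[of c] by (metis cis.code cis.ctr complex_eq_iff  cis.simps(1) cis.simps(2) complex.sel)
 fix A assume "A \<in> sets (distr circle_measure circle_measure (\<lambda>\<xi>. c * \<xi>))"
 then have A: "A \<in> sets circle_measure" by simp
 have sub: "A \<subseteq> sphere 0 1" using sets.sets_into_space[OF A] by simp
 define A' where "A' = (\<lambda>\<xi>. c * \<xi>) -` A \<inter> space circle_measure"
 have A': "A' \<in> sets circle_measure"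
  unfolding A'_def using A circle_rotate_measurable[OF assms] by (rule measurable_sets[rotated])
 define B where "B = {t. cis t \<in> A}"
 have B: "B \<in> sets borel"
  using measurable_sets[OF cis_measurable, of A] A by (simp add: sets_circle B_def vimage_def)
 have per: "\<And>t. (t + 2*pi \<in> B) = (t \<in> B)" by (simp add: B_def cis_mult[symmetric])
 have "{t. cis t \<in> A'} = {t. a + t \<in> B}"
  by (auto simp: A'_def B_def a cis_mult)
 then have "emeasure circle_measure A' = emeasure circle_measure A"
  unfolding emeasure_circle[OF A] emeasure_circle[OF A'] 
  using emeasure_period_translate[OF B per a(1,2)] by (simp add: B_def)
 then show "emeasure (distr circle_measure circle_measure (\<lambda>\<xi>. c * \<xi>)) A = emeasure circle_measure A"
  using A by (subst emeasure_distr[OF circle_rotate_measurable[OF assms]]) (auto simp: A'_def)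
qed simp

lemma circle_power_integrable:
 "integrable circle_measure (\<lambda>\<xi>. \<xi> ^ k * cnj \<xi> ^ l)"
proof (rule circle.integrable_const_bound[where B=1])
 show "(\<lambda>\<xi>. \<xi> ^ k * cnj \<xi> ^ l) \<in> borel_measurable circle_measure"
 proof -
  have "(\<lambda>\<xi>. cnj \<xi>) \<in> borel_measurable circle_measure"
   by (rule measurable_compose[OF circle_ident_measurable]) (intro borel_measurable_continuous_onI continuous_intros)
  then show ?thesis by measurable
 qed
qed (auto simp: norm_mult norm_power)

text \<open>For distinct exponents, rotation by a suitable angle multiplies the integral by a number different from 1.\<close>
lemma circle_power_integral:
 "(\<integral>\<xi>. \<xi> ^ k * cnj \<xi> ^ l \<partial>circle_measure) = (if k = l then 1 else 0)"
proof (cases "k = l")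
 case True
 have "(\<integral>\<xi>. \<xi> ^ k * cnj \<xi> ^ l \<partial>circle_measure) = (\<integral>\<xi>. 1 \<partial>circle_measure)"
  by (rule Bochner_Integration.integral_cong)
    (auto simp: True power_mult_distrib[symmetric] complex_norm_square[symmetric] simp del: power_mult_distrib)
 then show ?thesis using True by (simp add: circle.prob_space[unfolded space_circle])
next
 case False
 let ?f = "\<lambda>\<xi>. \<xi> ^ k * cnj \<xi> ^ l"
 have eq: "integral\<^sup>L circle_measure ?f = c ^ k * cnj c ^ l * integral\<^sup>L circle_measure ?f" if c: "cmod c = 1" for c
 proof -
  have "integral\<^sup>L circle_measure ?f = integral\<^sup>L (distr circle_measure circle_measure (\<lambda>\<xi>. c * \<xi>)) ?f"
   by (simp add: distr_circle_rotate[OF c])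
  also have "\<dots> = (\<integral>\<xi>. ?f (c * \<xi>) \<partial>circle_measure)"
   by (rule integral_distr[OF circle_rotate_measurable[OF c]])
     (rule borel_measurable_integrable[OF circle_power_integrable])
  also have "\<dots> = (\<integral>\<xi>. (c ^ k * cnj c ^ l) * ?f \<xi> \<partial>circle_measure)"
   by (simp add: power_mult_distrib mult_ac)
  finally show ?thesis by simp
 qed
 define c where "c = cis (pi / (real k - real l))"
 have "c ^ k * cnj c ^ l = cis (real k * (pi / (real k - real l)) + real l * - (pi / (real k - real l)))"
  unfolding c_def cis_cnj Complex.DeMoivre cis_mult ..
 also have "real k * (pi / (real k - real l)) + real l * - (pi / (real k - real l)) = pi"
 proof -
  have "real k * x + real l * - x = (real k - real l) * x" for x by (simp add: left_diff_distrib)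
  moreover have "(real k - real l) * (pi / (real k - real l)) = pi" using False by simp
  ultimately show ?thesis by metis
 qed
 finally have "c ^ k * cnj c ^ l = -1" by simp
 moreover have "cmod c = 1" by (simp add: c_def)
 ultimately show ?thesis using eq[of c] False by simp
qed

section \<open>Parseval's identity on the torus\<close>

interpretation circle_prod: product_sigma_finite "\<lambda>_::nat. circle_measure"
 by unfold_locales

lemma prob_space_torus: "prob_space (torus_measure I)"
 unfolding torus_measure_def by (intro prob_space_PiM) unfold_locales

lemma space_torus [simp]: "space (torus_measure I) = torus I"
 by (simp add: torus_measure_def space_PiM torus_def)

lemma torus_component_measurable [measurable]:
 "i \<in> I ==> (\<lambda>\<zeta>. \<zeta> i) \<in> borel_measurable (torus_measure I)"
 unfolding torus_measure_def
 using measurable_compose[OF measurable_component_singleton[of i I "\<lambda>_. circle_measure"] circle_ident_measurable]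
 by blast

lemma mon_measurable [measurable]: "mon I \<alpha> \<in> borel_measurable (torus_measure I)"
 unfolding mon_def[abs_def] by measurable

lemma torus_integrable_bounded:
 fixes g :: "point \<Rightarrow> 'b::{banach,second_countable_topology}"
 assumes "g \<in> borel_measurable (torus_measure I)" "\<And>\<zeta>. \<zeta> \<in> torus I ==> norm (g \<zeta>) \<le> B"
 shows "integrable (torus_measure I) g"
proof -
 interpret prob_space "torus_measure I" by (rule prob_space_torus)
 show ?thesis using assms by (intro integrable_const_bound[where B=B]) auto
qed

lemma mon_inner_integrable:
 "integrable (torus_measure I) (\<lambda>\<zeta>. mon I \<alpha> \<zeta> * cnj (mon I \<beta> \<zeta>))"
proof (rule torus_integrable_bounded[where B=1])
 have "(\<lambda>\<zeta>. cnj (mon I \<beta> \<zeta>)) \<in> borel_measurable (torus_measure I)"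
  by (rule measurable_compose[OF mon_measurable]) (intro borel_measurable_continuous_onI continuous_intros)
 then show "(\<lambda>\<zeta>. mon I \<alpha> \<zeta> * cnj (mon I \<beta> \<zeta>)) \<in> borel_measurable (torus_measure I)"
  by measurable
qed (simp add: norm_mult norm_mon_torus)

lemma mon_orthonormal:
 assumes "finite I" "\<alpha> \<in> multi_indices I" "\<beta> \<in> multi_indices I"
 shows "(\<integral>\<zeta>. mon I \<alpha> \<zeta> * cnj (mon I \<beta> \<zeta>) \<partial>torus_measure I) = (if \<alpha> = \<beta> then 1 else 0)"
proof -
 have "(\<integral>\<zeta>. mon I \<alpha> \<zeta> * cnj (mon I \<beta> \<zeta>) \<partial>torus_measure I)
   = (\<integral>\<zeta>. (\<Prod>i\<in>I. \<zeta> i ^ \<alpha> i * cnj (\<zeta> i) ^ \<beta> i) \<partial>PiM I (\<lambda>_. circle_measure))"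
  by (simp add: mon_def torus_measure_def prod.distrib)
 also have "\<dots> = (\<Prod>i\<in>I. \<integral>\<xi>. \<xi> ^ \<alpha> i * cnj \<xi> ^ \<beta> i \<partial>circle_measure)"
  by (rule circle_prod.product_integral_prod[OF assms(1) circle_power_integrable])
 also have "\<dots> = (if \<forall>i\<in>I. \<alpha> i = \<beta> i then 1 else 0)"
  using assms(1) by (auto simp: circle_power_integral)
 also have "(\<forall>i\<in>I. \<alpha> i = \<beta> i) = (\<alpha> = \<beta>)"
  using multi_indices_eqI assms(2,3) by blast
 finally show ?thesis .
qed

lemma torus_parseval_finite:
 assumes "finite I" "finite F" "F \<subseteq> multi_indices I"
 shows "(\<integral>\<zeta>. (cmod (\<Sum>\<alpha>\<in>F. c \<alpha> * mon I \<alpha> \<zeta>))^2 \<partial>torus_measure I) = (\<Sum>\<alpha>\<in>F. (cmod (c \<alpha>))^2)"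
proof -
 have eq: "complex_of_real ((cmod (\<Sum>\<alpha>\<in>F. c \<alpha> * mon I \<alpha> \<zeta>))^2)
   = (\<Sum>\<alpha>\<in>F. \<Sum>\<beta>\<in>F. (c \<alpha> * cnj (c \<beta>)) * (mon I \<alpha> \<zeta> * cnj (mon I \<beta> \<zeta>)))" for \<zeta>
  by (simp add: complex_norm_square sum_product mult_ac flip: of_real_power)
 have "complex_of_real (\<integral>\<zeta>. (cmod (\<Sum>\<alpha>\<in>F. c \<alpha> * mon I \<alpha> \<zeta>))^2 \<partial>torus_measure I)
   = (\<integral>\<zeta>. (\<Sum>\<alpha>\<in>F. \<Sum>\<beta>\<in>F. (c \<alpha> * cnj (c \<beta>)) * (mon I \<alpha> \<zeta> * cnj (mon I \<beta> \<zeta>))) \<partial>torus_measure I)"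
  unfolding eq[symmetric] by (rule integral_complex_of_real[symmetric])
 also have "\<dots> = (\<Sum>\<alpha>\<in>F. \<Sum>\<beta>\<in>F. (c \<alpha> * cnj (c \<beta>)) * (if \<alpha> = \<beta> then 1 else 0))"
  using assms by (subst Bochner_Integration.integral_sum, (intro Bochner_Integration.integrable_sum integrable_mult_right mon_inner_integrable))
   (intro sum.cong refl, subst Bochner_Integration.integral_sum, auto intro!: sum.cong integrable_mult_right mon_inner_integrable simp: mon_orthonormal subset_iff)
 also have "\<dots> = complex_of_real (\<Sum>\<alpha>\<in>F. (cmod (c \<alpha>))^2)"
  using assms(2) by (simp add: complex_norm_square[symmetric] if_distrib[of "(*) _"] cong: if_cong)
 finally show ?thesis using of_real_eq_iff by blast
qed

lemma box_sum_bound: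
 fixes a :: "_ \<Rightarrow> real"
 assumes "finite I" "a summable_on multi_indices I" "\<And>\<alpha>. 0 \<le> a \<alpha>"
 shows "sum a (ibox I N) \<le> infsum a (multi_indices I)"
 using assms finite_box box_subset by (intro finite_sum_le_infsum) auto

lemma torus_parseval:
 assumes I: "finite I" and c: "(\<lambda>\<alpha>. cmod (c \<alpha>)) summable_on multi_indices I"
  and g: "\<And>\<zeta>. \<zeta> \<in> torus I ==> ((\<lambda>\<alpha>. c \<alpha> * mon I \<alpha> \<zeta>) has_sum g \<zeta>) (multi_indices I)"
 shows "g \<in> borel_measurable (torus_measure I)"
  and "((\<lambda>\<alpha>. (cmod (c \<alpha>))^2) has_sum (\<integral>\<zeta>. (cmod (g \<zeta>))^2 \<partial>torus_measure I)) (multi_indices I)"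
  and "integrable (torus_measure I) (\<lambda>\<zeta>. (cmod (g \<zeta>))^2)"
proof -
 interpret prob_space "torus_measure I" by (rule prob_space_torus)
 define s where "s N \<zeta> = (\<Sum>\<alpha>\<in>ibox I N. c \<alpha> * mon I \<alpha> \<zeta>)" for N \<zeta>
 define B where "B = (\<Sum>\<^sub>\<infinity>\<alpha>\<in>multi_indices I. cmod (c \<alpha>))"
 have lim: "(\<lambda>N. s N \<zeta>) \<longlonglongrightarrow> g \<zeta>" if "\<zeta> \<in> torus I" for \<zeta>
  unfolding s_def by (rule has_sum_box[OF I g[OF that]])
 have sm [measurable]: "s N \<in> borel_measurable (torus_measure I)" for N
  unfolding s_def[abs_def] by measurable
 show m [measurable]: "g \<in> borel_measurable (torus_measure I)"
  by (rule borel_measurable_LIMSEQ_metric[where f=s, OF sm]) (simp add: lim)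
 have sB: "cmod (s N \<zeta>) \<le> B" if "\<zeta> \<in> torus I" for N \<zeta>
 proof -
  have "cmod (s N \<zeta>) \<le> (\<Sum>\<alpha>\<in>ibox I N. cmod (c \<alpha>))"
   unfolding s_def using that by (intro sum_norm_le) (simp add: norm_mult norm_mon_torus)
  also have "\<dots> \<le> B" unfolding B_def by (rule box_sum_bound[OF I c]) simp
  finally show ?thesis .
 qed
 have gB: "cmod (g \<zeta>) \<le> B" if "\<zeta> \<in> torus I" for \<zeta>
  by (rule LIMSEQ_le_const2[OF tendsto_norm[OF lim[OF that]]]) (use sB that in auto)
 show "integrable (torus_measure I) (\<lambda>\<zeta>. (cmod (g \<zeta>))^2)"
  by (rule torus_integrable_bounded[where B="B^2"]) (auto intro!: power_mono gB)
 have 1: "(\<lambda>N. \<integral>\<zeta>. (cmod (s N \<zeta>))^2 \<partial>torus_measure I) \<longlonglongrightarrow> (\<integral>\<zeta>. (cmod (g \<zeta>))^2 \<partial>torus_measure I)"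
 proof (rule integral_dominated_convergence[where w="\<lambda>_. B^2"])
  show "AE \<zeta> in torus_measure I. (\<lambda>N. (cmod (s N \<zeta>))^2) \<longlonglongrightarrow> (cmod (g \<zeta>))^2"
   by (rule AE_I2) (rule tendsto_power[OF tendsto_norm[OF lim]], simp)
  show "AE \<zeta> in torus_measure I. norm ((cmod (s N \<zeta>))^2) \<le> B^2" for N
   by (rule AE_I2) (auto intro!: power_mono sB)
 qed auto
 have sq: "(\<lambda>\<alpha>. (cmod (c \<alpha>))^2) summable_on multi_indices I"
 proof (rule summable_on_comparison_test[where f="\<lambda>\<alpha>. B * cmod (c \<alpha>)"])
  show "(\<lambda>\<alpha>. B * cmod (c \<alpha>)) summable_on multi_indices I"
   using c by (rule summable_on_cmult_right)
  fix \<alpha> assume \<alpha>: "\<alpha> \<in> multi_indices I"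
  have "cmod (c \<alpha>) \<le> B"
   using finite_sum_le_infsum[OF c, of "{\<alpha>}"] \<alpha> by (simp add: B_def)
  then show "(cmod (c \<alpha>))^2 \<le> B * cmod (c \<alpha>)" by (simp add: power2_eq_square mult_right_mono)
 qed simp
 have 2: "(\<lambda>N. \<Sum>\<alpha>\<in>ibox I N. (cmod (c \<alpha>))^2) \<longlonglongrightarrow> (\<Sum>\<^sub>\<infinity>\<alpha>\<in>multi_indices I. (cmod (c \<alpha>))^2)"
  by (rule has_sum_box[OF I has_sum_infsum[OF sq]])
 have "(\<integral>\<zeta>. (cmod (s N \<zeta>))^2 \<partial>torus_measure I) = (\<Sum>\<alpha>\<in>ibox I N. (cmod (c \<alpha>))^2)" for N
  unfolding s_def by (rule torus_parseval_finite[OF I finite_box[OF I] box_subset])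
 with 1 2 have "(\<integral>\<zeta>. (cmod (g \<zeta>))^2 \<partial>torus_measure I) = (\<Sum>\<^sub>\<infinity>\<alpha>\<in>multi_indices I. (cmod (c \<alpha>))^2)"
  by (simp add: LIMSEQ_unique)
 then show "((\<lambda>\<alpha>. (cmod (c \<alpha>))^2) has_sum (\<integral>\<zeta>. (cmod (g \<zeta>))^2 \<partial>torus_measure I)) (multi_indices I)"
  using has_sum_infsum[OF sq] by simp
qed

lemma dil_measurable:
 assumes "cmod c = 1"
 shows "dil I c \<in> measurable (torus_measure I) (torus_measure I)"
 unfolding torus_measure_def dil_def[abs_def] using circle_rotate_measurable[OF assms]
 by measurable

lemma distr_torus_rotate:
 assumes "finite I" "cmod c = 1"
 shows "distr (torus_measure I) (torus_measure I) (dil I c) = torus_measure I"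
proof -
 have "dil I c = compose I (\<lambda>\<xi>. c * \<xi>)" by (auto simp: dil_def compose_def fun_eq_iff)
 then show ?thesis unfolding torus_measure_def
  using distr_PiM_finite_prob_space'[OF assms(1), of "\<lambda>_. circle_measure" "\<lambda>_. circle_measure" "\<lambda>\<xi>. c * \<xi>"]
   circle.prob_space_axioms circle_rotate_measurable[OF assms(2)] distr_circle_rotate[OF assms(2)]
  by simp
qed

section \<open>Normed spaces of functions and comparable norms\<close>

locale fun_normed =
 fixes X :: "('x \<Rightarrow> complex) set" and nm :: "('x \<Rightarrow> complex) \<Rightarrow> real"
 assumes zero_mem [simp]: "(\<lambda>x. 0) \<in> X"
  and add_mem: "f \<in> X ==> g \<in> X ==> (\<lambda>x. f x + g x) \<in> X"
  and scale_mem: "f \<in> X ==> (\<lambda>x. a * f x) \<in> X"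
  and nm_triangle: "f \<in> X ==> g \<in> X ==> nm (\<lambda>x. f x + g x) \<le> nm f + nm g"
  and nm_scale: "f \<in> X ==> nm (\<lambda>x. a * f x) = cmod a * nm f"
  and nm_definite: "f \<in> X ==> nm f = 0 ==> f = (\<lambda>x. 0)"
begin

lemma uminus_mem: "f \<in> X ==> (\<lambda>x. - f x) \<in> X"
 using scale_mem[of f "-1"] by simp

lemma diff_mem: "f \<in> X ==> g \<in> X ==> (\<lambda>x. f x - g x) \<in> X"
 using add_mem[OF _ uminus_mem, of f g] by simp

lemma sum_mem: "(\<And>i. i \<in> A ==> f i \<in> X) ==> (\<lambda>x. \<Sum>i\<in>A. f i x) \<in> X"
 by (induction A rule: infinite_finite_induct) (auto intro: add_mem)

lemma nm_zero [simp]: "nm (\<lambda>x. 0) = 0"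
 using nm_scale[OF zero_mem, of 0] by simp

lemma nm_uminus: "f \<in> X ==> nm (\<lambda>x. - f x) = nm f"
 using nm_scale[of f "-1"] by simp

lemma nm_ge0: "f \<in> X ==> 0 \<le> nm f"
 using nm_triangle[OF _ uminus_mem, of f f] by (simp add: nm_uminus)

lemma nm_commute: "f \<in> X ==> g \<in> X ==> nm (\<lambda>x. f x - g x) = nm (\<lambda>x. g x - f x)"
 using nm_uminus[OF diff_mem, of f g] by simp

lemma nm_triangle_diff:
 assumes "f \<in> X" "g \<in> X" "h \<in> X"
 shows "nm (\<lambda>x. f x - h x) \<le> nm (\<lambda>x. f x - g x) + nm (\<lambda>x. g x - h x)"
 using nm_triangle[OF diff_mem[OF assms(1,2)] diff_mem[OF assms(2,3)]] by simp

lemma nm_le_diff: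
 assumes "f \<in> X" "g \<in> X" shows "nm f \<le> nm g + nm (\<lambda>x. f x - g x)"
 using nm_triangle[OF assms(2) diff_mem[OF assms]] by simp

lemma nm_abs_diff:
 assumes "f \<in> X" "g \<in> X" shows "\<bar>nm f - nm g\<bar> \<le> nm (\<lambda>x. f x - g x)"
 using nm_le_diff[OF assms] nm_le_diff[OF assms(2,1)] nm_commute[OF assms] by linarith

lemma nm_sum: "(\<And>i. i \<in> A ==> f i \<in> X) ==> nm (\<lambda>x. \<Sum>i\<in>A. f i x) \<le> (\<Sum>i\<in>A. nm (f i))"
proof (induction A rule: infinite_finite_induct)
 case (insert a A)
 then show ?case
  using nm_triangle[of "f a" "\<lambda>x. \<Sum>i\<in>A. f i x"] sum_mem[of A f] by force
qed auto

definition tends :: "(nat \<Rightarrow> 'x \<Rightarrow> complex) \<Rightarrow> ('x \<Rightarrow> complex) \<Rightarrow> bool" where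
 "tends u l \<longleftrightarrow> (\<lambda>k. nm (\<lambda>x. u k x - l x)) \<longlonglongrightarrow> 0"

definition cauchy :: "(nat \<Rightarrow> 'x \<Rightarrow> complex) \<Rightarrow> bool" where
 "cauchy u \<longleftrightarrow> (\<forall>e>0. \<exists>N. \<forall>m\<ge>N. \<forall>n\<ge>N. nm (\<lambda>x. u m x - u n x) < e)"

definition closed_in :: "('x \<Rightarrow> complex) set \<Rightarrow> bool" where
 "closed_in S \<longleftrightarrow> S \<subseteq> X \<and> (\<forall>u l. (\<forall>k. u k \<in> S) \<longrightarrow> l \<in> X \<longrightarrow> tends u l \<longrightarrow> l \<in> S)"

lemma tends_nm: 
 assumes "tends u l" "\<And>k. u k \<in> X" "l \<in> X" shows "(\<lambda>k. nm (u k)) \<longlonglongrightarrow> nm l"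
proof -
 have "(\<lambda>k. nm (u k) - nm l) \<longlonglongrightarrow> 0"
  by (rule Lim_null_comparison[OF _ assms(1)[unfolded tends_def]])
    (use nm_abs_diff assms in \<open>auto\<close>)
 then show ?thesis by (simp add: LIM_zero_iff)
qed

lemma tends_cauchy:
 assumes "tends u l" "\<And>k. u k \<in> X" "l \<in> X" shows "cauchy u"
 unfolding cauchy_def
proof safe
 fix e :: real assume "0 < e"
 then have "\<forall>\<^sub>F k in sequentially. nm (\<lambda>x. u k x - l x) < e/2"
  using order_tendstoD(2)[OF assms(1)[unfolded tends_def], of "e/2"] by simp
 then obtain N where N: "\<And>k. k \<ge> N ==> nm (\<lambda>x. u k x - l x) < e/2"
  by (auto simp: eventually_sequentially)
 have "nm (\<lambda>x. u m x - u n x) < e" if "m \<ge> N" "n \<ge> N" for m n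
  using nm_triangle_diff[OF assms(2,3,2), of m n] N[OF that(1)] N[OF that(2)] nm_commute[OF assms(2,3), of n]
  by linarith
 then show "\<exists>N. \<forall>m\<ge>N. \<forall>n\<ge>N. nm (\<lambda>x. u m x - u n x) < e" by blast
qed

lemma tends_bounded_map:
 assumes "tends u l" "\<And>k. nm (\<lambda>x. v k x - m x) \<le> C * nm (\<lambda>x. u k x - l x)" "\<And>k. v k \<in> X" "m \<in> X"
 shows "tends v m"
 unfolding tends_def
 by (rule Lim_null_comparison[OF _ tendsto_mult_right_zero[OF assms(1)[unfolded tends_def], of C]])
   (use assms nm_ge0[OF diff_mem] in auto)

lemma cauchy_bounded_map:
 assumes "cauchy u" "\<And>i j. nm (\<lambda>x. v i x - v j x) \<le> C * nm (\<lambda>x. u i x - u j x)"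
  and "\<And>k. u k \<in> X"
 shows "cauchy v"
 unfolding cauchy_def
proof safe
 fix e :: real assume "0 < e"
 define D where "D = max C 1"
 have "D > 0" by (simp add: D_def)
 then obtain N where N: "\<And>m n. m\<ge>N ==> n\<ge>N ==> nm (\<lambda>x. u m x - u n x) < e / D"
  using assms(1) \<open>0 < e\<close> unfolding cauchy_def by (metis divide_pos_pos)
 have "nm (\<lambda>x. v m x - v n x) < e" if "m \<ge> N" "n \<ge> N" for m n
 proof -
  have "nm (\<lambda>x. v m x - v n x) \<le> C * nm (\<lambda>x. u m x - u n x)" by (rule assms(2))
  also have "\<dots> \<le> D * nm (\<lambda>x. u m x - u n x)"
   by (intro mult_right_mono nm_ge0 diff_mem assms) (simp add: D_def)
  also have "\<dots> < e" using N[OF that] \<open>D > 0\<close> by (simp add: field_simps)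
  finally show ?thesis .
 qed
 then show "\<exists>N. \<forall>m\<ge>N. \<forall>n\<ge>N. nm (\<lambda>x. v m x - v n x) < e" by blast
qed

end

locale fun_banach = fun_normed X nm for X :: "('x \<Rightarrow> complex) set" and nm +
 assumes complete: "(\<And>k. u k \<in> X) ==> cauchy u ==> \<exists>l\<in>X. tends u l"
begin

text \<open>Successive approximation: correcting the error with halved tolerances sums to a geometric series in the stronger norm.\<close>
lemma approx_dominated:
 assumes q: "fun_banach X q" and le: "\<And>f. f \<in> X ==> nm f \<le> q f"
  and K: "0 \<le> K" and approx: "\<And>h e. h \<in> X ==> e > 0 ==> \<exists>g\<in>X. q g \<le> K * nm h \<and> nm (\<lambda>x. h x - g x) < e"
  and h: "h \<in> X"
 shows "q h \<le> 2 * K * nm h"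
proof (cases "nm h = 0")
 case True
 interpret q: fun_banach X q by (rule q)
 show ?thesis using nm_definite[OF h True] by simp
next
 case False
 interpret q: fun_banach X q by (rule q)
 have pos: "nm h > 0" using False nm_ge0[OF h] by simp
 define pick where "pick r k = (SOME g. g \<in> X \<and> q g \<le> K * nm r \<and> nm (\<lambda>x. r x - g x) < nm h / 2 ^ Suc k)" for r k
 have pick: "pick r k \<in> X \<and> q (pick r k) \<le> K * nm r \<and> nm (\<lambda>x. r x - pick r k x) < nm h / 2 ^ Suc k" if "r \<in> X" for r k
 proof -
  have "\<exists>g. g \<in> X \<and> q g \<le> K * nm r \<and> nm (\<lambda>x. r x - g x) < nm h / 2 ^ Suc k"
   using approx[OF that, of "nm h / 2 ^ Suc k"] pos by auto
  from someI_ex[OF this] show ?thesis unfolding pick_def .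
 qed
 define rem where "rem = rec_nat h (\<lambda>k r x. r x - pick r k x)"
 have rem0: "rem 0 = h" and remS: "rem (Suc k) = (\<lambda>x. rem k x - pick (rem k) k x)" for k
  by (simp_all add: rem_def)
 have remX: "rem k \<in> X" for k
  by (induction k) (auto simp: rem0 remS h intro: diff_mem pick[THEN conjunct1])
 define g where "g k = pick (rem k) k" for k
 have gX: "g k \<in> X" for k unfolding g_def using pick[OF remX] by blast
 have rem_small: "nm (rem k) \<le> nm h / 2 ^ k" for k
 proof (cases k)
  case (Suc j) then show ?thesis using pick[OF remX, of j j] by (simp add: remS)
 qed (simp add: rem0)
 have gq: "q (g k) \<le> K * nm h / 2 ^ k" for k
 proof -
  have "q (g k) \<le> K * nm (rem k)" unfolding g_def using pick[OF remX] by blast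
  also have "\<dots> \<le> K * (nm h / 2 ^ k)" using rem_small K by (intro mult_left_mono) auto
  finally show ?thesis by simp
 qed
 define S where "S m x = (\<Sum>k<m. g k x)" for m x
 have SX: "S m \<in> X" for m unfolding S_def[abs_def] by (rule sum_mem) (rule gX)
 have Srem: "h x - S m x = rem m x" for m x
  by (induction m) (auto simp: S_def rem0 remS g_def)
 have geom: "(\<Sum>k\<in>{m..<n}. q (g k)) \<le> 2 * K * nm h / 2 ^ m" for m n
 proof (cases "m \<le> n")
  case True
  have "(\<Sum>k\<in>{m..<n}. q (g k)) \<le> (\<Sum>k\<in>{m..<n}. K * nm h / 2 ^ k)" by (intro sum_mono gq)
  also have "\<dots> = 2 * K * nm h / 2 ^ m - 2 * K * nm h / 2 ^ n"
  proof -
   have "(\<Sum>k\<in>{m..<n}. A / 2 ^ k) = 2 * A / 2 ^ m - 2 * A / 2 ^ n" for A :: real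
    using True by (induction n rule: dec_induct) simp_all
   from this[of "K * nm h"] show ?thesis by (simp add: mult.assoc)
  qed
  also have "\<dots> \<le> 2 * K * nm h / 2 ^ m" using K pos by simp
  finally show ?thesis .
 qed (use K pos in simp)
 have Sdiff: "q (\<lambda>x. S n x - S m x) \<le> 2 * K * nm h / 2 ^ m" if "m \<le> n" for m n
 proof -
  have "(\<lambda>x. S n x - S m x) = (\<lambda>x. \<Sum>k\<in>{m..<n}. g k x)"
  proof
   fix x show "S n x - S m x = (\<Sum>k\<in>{m..<n}. g k x)"
    using sum.atLeastLessThan_concat[of 0 m n "\<lambda>k. g k x"] that
    by (simp add: S_def atLeast0LessThan[symmetric] algebra_simps)
  qed
  then show ?thesis using q.nm_sum[of "{m..<n}" g] gX geom[of m n] by simp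
 qed
 have "q.cauchy S"
  unfolding q.cauchy_def
 proof safe
  fix e :: real assume "0 < e"
  obtain N where "2 * K * nm h / e < 2 ^ N" using real_arch_pow[of 2 "2 * K * nm h / e"] by auto
  with \<open>0 < e\<close> have N: "2 * K * nm h / 2 ^ N < e" by (simp add: field_simps)
  have *: "q (\<lambda>x. S n x - S m x) < e" if "N \<le> m" "m \<le> n" for m n
  proof -
   have "2 * K * nm h / 2 ^ m \<le> 2 * K * nm h / 2 ^ N"
    using K pos that by (intro divide_left_mono) auto
   then show ?thesis using Sdiff[OF that(2)] N by linarith
  qed
  have "q (\<lambda>x. S m x - S n x) < e" if "N \<le> m" "N \<le> n" for m n
   using *[of m n] *[of n m] that q.nm_commute[OF SX SX, of m n] by (cases "m \<le> n") auto
  then show "\<exists>N. \<forall>m\<ge>N. \<forall>n\<ge>N. q (\<lambda>x. S m x - S n x) < e" by blast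
 qed
 then obtain l where l: "l \<in> X" "q.tends S l" using q.complete[of S] SX by blast
 have "(\<lambda>m. nm h / 2 ^ m + q (\<lambda>x. S m x - l x)) \<longlonglongrightarrow> 0 + 0"
  using l(2) unfolding q.tends_def
  by (intro tendsto_add) (auto intro: LIMSEQ_divide_realpow_zero)
 moreover have "nm (\<lambda>x. h x - l x) \<le> nm h / 2 ^ m + q (\<lambda>x. S m x - l x)" for m
 proof -
  have "nm (\<lambda>x. h x - l x) \<le> nm (\<lambda>x. h x - S m x) + nm (\<lambda>x. S m x - l x)"
   by (rule nm_triangle_diff[OF h SX l(1)])
  also have "nm (\<lambda>x. S m x - l x) \<le> q (\<lambda>x. S m x - l x)" by (intro le diff_mem SX l)
  also have "nm (\<lambda>x. h x - S m x) \<le> nm h / 2 ^ m" using rem_small by (simp add: Srem)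
  finally show ?thesis by simp
 qed
 ultimately have "nm (\<lambda>x. h x - l x) \<le> 0"
  by (intro LIMSEQ_le_const[where x=0]) auto
 then have "nm (\<lambda>x. h x - l x) = 0" using nm_ge0[OF diff_mem[OF h l(1)]] by simp
 then have "(\<lambda>x. h x - l x) = (\<lambda>x. 0)" using nm_definite[OF diff_mem[OF h l(1)]] by simp
 then have hl: "h = l" by (metis eq_iff_diff_eq_0 ext)
 have "q (S m) \<le> 2 * K * nm h" for m using Sdiff[of 0 m] by (simp add: S_def[of 0])
 then show ?thesis
  using LIMSEQ_le_const2[OF q.tends_nm[OF l(2) SX l(1)]] hl by blast
qed

text \<open>The bounded inverse theorem for the identity map. By the Baire category theorem some ball of the stronger norm is dense in a ball of the weaker one, and \<open>approx_dominated\<close> removes the closure.\<close>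
theorem comparable_norms_equivalent:
 assumes q: "fun_banach X q" and le: "\<And>f. f \<in> X ==> nm f \<le> q f"
 shows "\<exists>C\<ge>0. \<forall>f\<in>X. q f \<le> C * nm f"
proof -
 interpret q: fun_banach X q by (rule q)
 define d where "d f g = (if f \<in> X \<and> g \<in> X then nm (\<lambda>x. f x - g x) else 0)" for f g
 interpret M: Metric_space X d
 proof
  show "0 \<le> d x y" for x y by (auto simp: d_def intro: nm_ge0 diff_mem)
  show "d x y = d y x" for x y by (auto simp: d_def intro: nm_commute)
  show "(d x y = 0) = (x = y)" if "x \<in> X" "y \<in> X" for x y
   using that nm_definite[OF diff_mem[OF that]] by (auto simp: d_def fun_eq_iff)
  show "d x z \<le> d x y + d y z" if "x \<in> X" "y \<in> X" "z \<in> X" for x y z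
   using that by (simp add: d_def nm_triangle_diff)
 qed
 have mc: M.mcomplete
  unfolding M.mcomplete_def
 proof safe
  fix u assume u: "M.MCauchy u"
  then have uX: "u k \<in> X" for k by (auto simp: M.MCauchy_def)
  have "cauchy u" using u uX unfolding M.MCauchy_def cauchy_def d_def by auto
  then obtain l where l: "l \<in> X" "tends u l" using complete uX by blast
  have "limitin M.mtopology u l sequentially"
   unfolding M.limit_metric_sequentially
  proof safe
   fix e :: real assume "0 < e"
   then have "\<forall>\<^sub>F k in sequentially. nm (\<lambda>x. u k x - l x) < e"
    using order_tendstoD(2)[OF l(2)[unfolded tends_def]] by simp
   then show "\<exists>N. \<forall>n\<ge>N. u n \<in> X \<and> d (u n) l < e"
    using uX l by (auto simp: eventually_sequentially d_def)
  qed (rule l)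
  then show "\<exists>l. limitin M.mtopology u l sequentially" by blast
 qed
 define A where "A n = M.mtopology closure_of {f \<in> X. q f \<le> real n}" for n
 have "X \<subseteq> \<Union>(range A)"
 proof
  fix f assume f: "f \<in> X"
  obtain n where "q f \<le> real n" using real_arch_simple by blast
  then have "f \<in> A n" unfolding A_def using f by (intro subsetD[OF closure_of_subset]) auto
  then show "f \<in> \<Union>(range A)" by blast
 qed
 moreover have "A n \<subseteq> X" for n unfolding A_def using closure_of_subset_topspace[of M.mtopology] by auto
 ultimately have UA: "\<Union>(range A) = X" by auto
 have "\<exists>n. M.mtopology interior_of A n \<noteq> {}"
 proof (rule ccontr)
  assume "\<nexists>n. M.mtopology interior_of A n \<noteq> {}"
  then have "M.mtopology interior_of \<Union>(range A) = {}"
   by (intro M.metric_Baire_category_alt[OF mc]) (auto simp: A_def)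
  moreover have "M.mtopology interior_of X = X"
   by (metis M.topspace_mtopology interior_of_topspace)
  ultimately show False using UA zero_mem by auto
 qed
 then obtain n f0 where "f0 \<in> M.mtopology interior_of A n" by blast
 then obtain U where U: "openin M.mtopology U" "f0 \<in> U" "U \<subseteq> A n" by (auto simp: interior_of_def)
 then obtain r where r: "r > 0" "M.mball f0 r \<subseteq> A n" and f0: "f0 \<in> X"
  unfolding M.openin_mtopology by blast
 have clo: "\<exists>a\<in>X. q a \<le> real n \<and> nm (\<lambda>x. f x - a x) < e" if "f \<in> X" "nm (\<lambda>x. f0 x - f x) < r" "e > 0" for f e
 proof -
  have "f \<in> A n" using r f0 that by (auto simp: d_def)
  then show ?thesis using that unfolding A_def M.metric_closure_of by (fastforce simp: d_def)
 qed
 have small: "\<exists>g\<in>X. q g \<le> 2 * real n \<and> nm (\<lambda>x. h x - g x) < e" if h: "h \<in> X" "nm h < r" and e: "e > 0" for h e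
 proof -
  have fh: "(\<lambda>x. f0 x + h x) \<in> X" using f0 h add_mem by blast
  have "nm (\<lambda>x. f0 x - (f0 x + h x)) < r" using nm_uminus[OF h(1)] h(2) by simp
  then obtain a where a: "a \<in> X" "q a \<le> real n" "nm (\<lambda>x. (f0 x + h x) - a x) < e/2"
   using clo[OF fh, of "e/2"] e by auto
  obtain b where b: "b \<in> X" "q b \<le> real n" "nm (\<lambda>x. f0 x - b x) < e/2"
   using clo[OF f0, of "e/2"] e r(1) by auto
  have "q (\<lambda>x. a x - b x) \<le> 2 * real n"
   using q.nm_triangle[OF a(1) q.uminus_mem[OF b(1)]] q.nm_uminus[OF b(1)] a b by simp
  moreover have "nm (\<lambda>x. h x - (a x - b x)) < e"
  proof -
   have "(\<lambda>x. h x - (a x - b x)) = (\<lambda>x. ((f0 x + h x) - a x) + - (f0 x - b x))" by auto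
   then show ?thesis
    using nm_triangle[OF diff_mem[OF fh a(1)] uminus_mem[OF diff_mem[OF f0 b(1)]]] 
     nm_uminus[OF diff_mem[OF f0 b(1)]] a(3) b(3) by simp
  qed
  ultimately show ?thesis using diff_mem[OF a(1) b(1)] by blast
 qed
 define K where "K = 4 * real n / r"
 have K0: "K \<ge> 0" using r by (simp add: K_def)
 have approx: "\<exists>g\<in>X. q g \<le> K * nm h \<and> nm (\<lambda>x. h x - g x) < e" if h: "h \<in> X" and e: "e > 0" for h e
 proof (cases "nm h = 0")
  case True
  then have "h = (\<lambda>x. 0)" by (rule nm_definite[OF h])
  then show ?thesis using e by (intro bexI[of _ "\<lambda>x. 0"]) auto
 next
  case False
  then have pos: "nm h > 0" using nm_ge0[OF h] by simp
  define t where "t = r / (2 * nm h)"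
  have t: "t > 0" using r pos by (simp add: t_def)
  have ht: "(\<lambda>x. of_real t * h x) \<in> X" by (rule scale_mem[OF h])
  have "nm (\<lambda>x. of_real t * h x) = t * nm h" using nm_scale[OF h, of "of_real t"] t by simp
  also have "\<dots> < r" using pos r by (simp add: t_def)
  finally have "nm (\<lambda>x. of_real t * h x) < r" .
  then obtain g where g: "g \<in> X" "q g \<le> 2 * real n" "nm (\<lambda>x. of_real t * h x - g x) < t * e"
   using small[OF ht, of "t * e"] t e by auto
  let ?g = "\<lambda>x. of_real (1/t) * g x"
  have "q ?g = q g / t" using q.nm_scale[OF g(1), of "of_real (1/t)"] t by (simp add: norm_divide)
  also have "\<dots> \<le> 2 * real n / t" using g(2) t by (intro divide_right_mono) auto
  also have "\<dots> = K * nm h" using r pos by (simp add: t_def K_def)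
  finally have 1: "q ?g \<le> K * nm h" .
  have eq: "(\<lambda>x. h x - ?g x) = (\<lambda>x. of_real (1/t) * (of_real t * h x - g x))"
   using t by (auto simp: field_simps)
  have "nm (\<lambda>x. h x - ?g x) < e"
   unfolding eq nm_scale[OF diff_mem[OF ht g(1)]] using g(3) t by (simp add: field_simps norm_divide)
  with 1 show ?thesis using scale_mem[OF g(1)] by blast
 qed
 have "q h \<le> 2 * K * nm h" if "h \<in> X" for h
 proof (rule approx_dominated[OF q _ K0 _ that])
  show "nm f \<le> q f" if "f \<in> X" for f using that by (rule le)
  show "\<exists>g\<in>X. q g \<le> K * nm h \<and> nm (\<lambda>x. h x - g x) < e" if "h \<in> X" "e > 0" for h e
   using that by (rule approx)
 qed
 then have "\<forall>f\<in>X. q f \<le> 2 * K * nm f" by blast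
 moreover have "0 \<le> 2 * K" using K0 by simp
 ultimately show ?thesis by blast
qed

end

section \<open>Hilbert spaces of functions and orthogonal projections\<close>

locale fun_prehilbert =
 fixes X :: "('x \<Rightarrow> complex) set" and ip :: "('x \<Rightarrow> complex) \<Rightarrow> ('x \<Rightarrow> complex) \<Rightarrow> complex"
  and nm :: "('x \<Rightarrow> complex) \<Rightarrow> real"
 assumes zero_mem' : "(\<lambda>x. 0) \<in> X"
  and add_mem': "f \<in> X ==> g \<in> X ==> (\<lambda>x. f x + g x) \<in> X"
  and scale_mem': "f \<in> X ==> (\<lambda>x. a * f x) \<in> X"
  and ip_add: "f \<in> X ==> g \<in> X ==> h \<in> X ==> ip (\<lambda>x. f x + g x) h = ip f h + ip g h"
  and ip_scale: "f \<in> X ==> h \<in> X ==> ip (\<lambda>x. a * f x) h = a * ip f h"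
  and ip_cnj: "f \<in> X ==> g \<in> X ==> cnj (ip f g) = ip g f"
  and ip_nm: "f \<in> X ==> ip f f = of_real ((nm f)^2)"
  and nm_ge0': "f \<in> X ==> 0 \<le> nm f"
  and nm_definite': "f \<in> X ==> nm f = 0 ==> f = (\<lambda>x. 0)"
begin

lemma ip_add_right: "f \<in> X ==> g \<in> X ==> h \<in> X ==> ip h (\<lambda>x. f x + g x) = ip h f + ip h g"
 using ip_cnj[OF add_mem', of f g h] ip_add[of f g h] ip_cnj[of f h] ip_cnj[of g h] by simp

lemma ip_scale_right: "f \<in> X ==> h \<in> X ==> ip h (\<lambda>x. a * f x) = cnj a * ip h f"
 using ip_cnj[OF scale_mem', of f h a] ip_scale[of f h a] ip_cnj[of f h] by simp

lemma uminus_mem': "f \<in> X ==> (\<lambda>x. - f x) \<in> X"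
 using scale_mem'[of f "-1"] by simp

lemma diff_mem': "f \<in> X ==> g \<in> X ==> (\<lambda>x. f x - g x) \<in> X"
 using add_mem'[OF _ uminus_mem', of f g] by simp

lemma ip_uminus: "f \<in> X ==> h \<in> X ==> ip (\<lambda>x. - f x) h = - ip f h"
 using ip_scale[of f h "-1"] by simp

lemma ip_uminus_right: "f \<in> X ==> h \<in> X ==> ip h (\<lambda>x. - f x) = - ip h f"
 using ip_scale_right[of f h "-1"] by simp

lemma ip_diff: "f \<in> X ==> g \<in> X ==> h \<in> X ==> ip (\<lambda>x. f x - g x) h = ip f h - ip g h"
 using ip_add[of f "\<lambda>x. - g x" h] uminus_mem' by (simp add: ip_uminus)

lemma ip_diff_right: "f \<in> X ==> g \<in> X ==> h \<in> X ==> ip h (\<lambda>x. f x - g x) = ip h f - ip h g"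
 using ip_add_right[of f "\<lambda>x. - g x" h] uminus_mem' by (simp add: ip_uminus_right)

lemma nm_scale': "f \<in> X ==> nm (\<lambda>x. a * f x) = cmod a * nm f"
proof -
 assume f: "f \<in> X"
 have "complex_of_real ((nm (\<lambda>x. a * f x))^2) = ip (\<lambda>x. a * f x) (\<lambda>x. a * f x)"
  by (rule ip_nm[symmetric]) (rule scale_mem'[OF f])
 also have "\<dots> = a * (cnj a * of_real ((nm f)^2))"
  using f scale_mem'[OF f] by (simp add: ip_scale ip_scale_right ip_nm)
 also have "\<dots> = of_real ((cmod a * nm f)^2)"
  unfolding power_mult_distrib of_real_mult complex_norm_square[of a] by (simp add: mult_ac)
 finally have "complex_of_real ((nm (\<lambda>x. a * f x))^2) = of_real ((cmod a * nm f)^2)" .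
 then have "(nm (\<lambda>x. a * f x))^2 = (cmod a * nm f)^2" using of_real_eq_iff by blast
 then show ?thesis by (rule power2_eq_imp_eq) (simp_all add: nm_ge0' f scale_mem')
qed

lemma nm_diff_sq:
 assumes "f \<in> X" "g \<in> X"
 shows "(nm (\<lambda>x. f x - g x))^2 = (nm f)^2 - 2 * Re (ip f g) + (nm g)^2"
proof -
 note D = diff_mem'[OF assms]
 have "complex_of_real ((nm (\<lambda>x. f x - g x))^2) = ip f f - ip f g - (ip g f - ip g g)"
  unfolding ip_nm[OF D, symmetric] ip_diff[OF assms D] ip_diff_right[OF assms assms(1)] ip_diff_right[OF assms assms(2)] ..
 also have "\<dots> = of_real ((nm f)^2) - (ip f g + cnj (ip f g)) + of_real ((nm g)^2)"
  unfolding ip_cnj[OF assms] ip_nm[OF assms(1)] ip_nm[OF assms(2)] by (simp only: algebra_simps)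
 also have "\<dots> = of_real ((nm f)^2 - 2 * Re (ip f g) + (nm g)^2)"
  unfolding complex_add_cnj by simp
 finally show ?thesis using of_real_eq_iff by blast
qed

lemma nm_add_sq:
 assumes "f \<in> X" "g \<in> X"
 shows "(nm (\<lambda>x. f x + g x))^2 = (nm f)^2 + 2 * Re (ip f g) + (nm g)^2"
proof -
 have "nm (\<lambda>x. - g x) = nm g" using nm_scale'[OF assms(2), of "-1"] by simp
 then show ?thesis
  using nm_diff_sq[OF assms(1) uminus_mem'[OF assms(2)]] unfolding ip_uminus_right[OF assms(2,1)] by simp
qed

lemma cauchy_schwarz:
 assumes "f \<in> X" "g \<in> X" shows "cmod (ip f g) \<le> nm f * nm g"
proof (cases "nm g = 0")
 case True
 then have "g = (\<lambda>x. 0)" by (rule nm_definite'[OF assms(2)])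
 then have "ip f g = 0" using ip_scale_right[OF zero_mem' assms(1), of 0] by simp
 then show ?thesis using True by simp
next
 case False
 define a where "a = ip f g / of_real ((nm g)^2)"
 have "0 \<le> (nm (\<lambda>x. f x - a * g x))^2" by simp
 also have "\<dots> = (nm f)^2 - 2 * Re (cnj a * ip f g) + (cmod a * nm g)^2"
  unfolding nm_diff_sq[OF assms(1) scale_mem'[OF assms(2)], of a] ip_scale_right[OF assms(2,1)] nm_scale'[OF assms(2)] ..
 also have "cnj a * ip f g = of_real ((cmod (ip f g))^2 / (nm g)^2)"
  unfolding of_real_divide complex_norm_square by (simp add: a_def)
 also have "(cmod a * nm g)^2 = (cmod (ip f g))^2 / (nm g)^2"
 proof -
  have "cmod a = cmod (ip f g) / (nm g)^2" by (simp add: a_def norm_divide norm_power)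
  then show ?thesis using False by (simp add: power2_eq_square)
 qed
 finally have "(cmod (ip f g))^2 / (nm g)^2 \<le> (nm f)^2" by simp
 then have "(cmod (ip f g))^2 \<le> (nm f * nm g)^2"
  using False by (simp add: divide_le_eq power_mult_distrib)
 then show ?thesis by (rule power2_le_imp_le) (simp add: nm_ge0' assms)
qed

sublocale fun_normed X nm
proof
 fix f g assume fg: "f \<in> X" "g \<in> X"
 have "(nm (\<lambda>x. f x + g x))^2 \<le> (nm f + nm g)^2"
 proof -
  have "Re (ip f g) \<le> nm f * nm g"
   using cauchy_schwarz[OF fg] complex_Re_le_cmod[of "ip f g"] by linarith
  then show ?thesis unfolding nm_add_sq[OF fg] power2_sum by linarith
 qed
 then show "nm (\<lambda>x. f x + g x) \<le> nm f + nm g"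
  by (rule power2_le_imp_le) (intro add_nonneg_nonneg nm_ge0' fg)
next
 show "(\<lambda>x. 0) \<in> X" by (rule zero_mem')
next
 fix f g assume "f \<in> X" "g \<in> X" then show "(\<lambda>x. f x + g x) \<in> X" by (rule add_mem')
next
 fix f a assume "f \<in> X" then show "(\<lambda>x. a * f x) \<in> X" by (rule scale_mem')
next
 fix f a assume "f \<in> X" then show "nm (\<lambda>x. a * f x) = cmod a * nm f" by (rule nm_scale')
next
 fix f assume "f \<in> X" "nm f = 0" then show "f = (\<lambda>x. 0)" by (rule nm_definite')
qed

lemma ip_zero [simp]: "f \<in> X ==> ip (\<lambda>x. 0) f = 0" "f \<in> X ==> ip f (\<lambda>x. 0) = 0"
 using ip_scale[OF zero_mem, of f 0] ip_scale_right[OF zero_mem, of f 0] by simp_all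

lemma ip_eq_0_sym: "f \<in> X ==> g \<in> X ==> ip f g = 0 ==> ip g f = 0"
 using ip_cnj[of f g] by simp

lemma pythagoras:
 assumes "f \<in> X" "g \<in> X" "ip f g = 0"
 shows "(nm (\<lambda>x. f x + g x))^2 = (nm f)^2 + (nm g)^2"
 unfolding nm_add_sq[OF assms(1,2)] assms(3) by simp

text \<open>By polarisation.\<close>
lemma isometry_ip:
 assumes T: "\<And>f. f \<in> X ==> T f \<in> X" "\<And>f. f \<in> X ==> nm (T f) = nm f"
  and add: "\<And>f g. f \<in> X ==> g \<in> X ==> T (\<lambda>x. f x + g x) = (\<lambda>x. T f x + T g x)"
  and scale: "\<And>a f. f \<in> X ==> T (\<lambda>x. a * f x) = (\<lambda>x. a * T f x)"
  and fg: "f \<in> X" "g \<in> X"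
 shows "ip (T f) (T g) = ip f g"
proof -
 have Re: "Re (ip (T f) (T g)) = Re (ip f g)" if "f \<in> X" "g \<in> X" for f g
 proof -
  have "nm (\<lambda>x. T f x + T g x) = nm (\<lambda>x. f x + g x)"
   using T(2)[OF add_mem[OF that]] unfolding add[OF that] .
  then have "(nm f)^2 + 2 * Re (ip (T f) (T g)) + (nm g)^2 = (nm f)^2 + 2 * Re (ip f g) + (nm g)^2"
   using nm_add_sq[OF that] nm_add_sq[OF T(1)[OF that(1)] T(1)[OF that(2)]]
   unfolding T(2)[OF that(1)] T(2)[OF that(2)] by simp
  then show ?thesis by linarith
 qed
 have "Re (ip (T (\<lambda>x. \<i> * f x)) (T g)) = Re (ip (\<lambda>x. \<i> * f x) g)"
  by (rule Re[OF scale_mem[OF fg(1)] fg(2)])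
 then have "Im (ip (T f) (T g)) = Im (ip f g)"
  unfolding scale[OF fg(1)] ip_scale[OF fg] ip_scale[OF T(1)[OF fg(1)] T(1)[OF fg(2)]] by simp
 with Re[OF fg] show ?thesis by (simp add: complex_eq_iff)
qed

end

locale fun_hilbert = fun_prehilbert X ip nm for X :: "('x \<Rightarrow> complex) set" and ip and nm +
 assumes complete': "(\<And>k. u k \<in> X) ==> cauchy u ==> \<exists>l\<in>X. tends u l"
begin

sublocale fun_banach X nm by unfold_locales (rule complete')

definition subspace :: "('x \<Rightarrow> complex) set \<Rightarrow> bool" where
 "subspace N \<longleftrightarrow> closed_in N \<and> (\<lambda>x. 0) \<in> N \<and> (\<forall>f\<in>N. \<forall>g\<in>N. (\<lambda>x. f x + g x) \<in> N) \<and> (\<forall>a. \<forall>f\<in>N. (\<lambda>x. a * f x) \<in> N)"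

lemma subspaceD:
 assumes "subspace N"
 shows "closed_in N" "(\<lambda>x. 0) \<in> N" "f \<in> N ==> g \<in> N ==> (\<lambda>x. f x + g x) \<in> N" "f \<in> N ==> (\<lambda>x. a * f x) \<in> N"
 using assms by (auto simp: subspace_def)

text \<open>A minimising sequence for the distance to the subspace is Cauchy by the parallelogram law.\<close>
theorem projection_exists:
 assumes N: "subspace N" and f: "f \<in> X"
 shows "\<exists>p\<in>N. \<forall>g\<in>N. ip (\<lambda>x. f x - p x) g = 0"
proof -
 have NX: "g \<in> X" if "g \<in> N" for g using N that by (auto simp: subspace_def closed_in_def)
 define D where "D = (\<lambda>g. nm (\<lambda>x. f x - g x)) ` N"
 define d where "d = Inf D"
 have Dne: "D \<noteq> {}" using N by (auto simp: D_def subspace_def)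
 have Dbd: "bdd_below D" unfolding D_def by (intro bdd_belowI[of _ 0]) (auto intro: nm_ge0 diff_mem f NX)
 have dle: "d \<le> nm (\<lambda>x. f x - g x)" if "g \<in> N" for g
  unfolding d_def by (rule cInf_lower[OF _ Dbd]) (use that in \<open>auto simp: D_def\<close>)
 have d0: "0 \<le> d" unfolding d_def by (rule cInf_greatest[OF Dne]) (auto simp: D_def intro: nm_ge0 diff_mem f NX)
 have "\<exists>g\<in>N. nm (\<lambda>x. f x - g x) < d + 1 / real (Suc k)" for k
 proof -
  have "Inf D < d + 1 / real (Suc k)" by (simp add: d_def)
  then obtain y where "y \<in> D" "y < d + 1 / real (Suc k)" using cInf_lessD[OF Dne] by blast
  then show ?thesis by (auto simp: D_def)
 qed
 then have "\<forall>k. \<exists>g. g \<in> N \<and> nm (\<lambda>x. f x - g x) < d + 1 / real (Suc k)" by blast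
 from choice[OF this] obtain u where u: "\<And>k. u k \<in> N" "\<And>k. nm (\<lambda>x. f x - u k x) < d + 1 / real (Suc k)" by auto
 have uX: "u k \<in> X" for k using u NX by blast
 have half: "(\<lambda>x. (1/2) * (g x + h x)) \<in> N" if "g \<in> N" "h \<in> N" for g h
  using subspaceD(4)[OF N subspaceD(3)[OF N that], of "1/2"] .
 have par: "(nm (\<lambda>x. u m x - u n x))^2 \<le> 2 * (nm (\<lambda>x. f x - u m x))^2 + 2 * (nm (\<lambda>x. f x - u n x))^2 - 4 * d^2" for m n
 proof -
  have fm: "(\<lambda>x. f x - u m x) \<in> X" "(\<lambda>x. f x - u n x) \<in> X" by (auto intro: diff_mem f uX)
  have mid: "(\<lambda>x. f x - (1/2) * (u m x + u n x)) \<in> X" by (intro diff_mem f NX half u)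
  have "(nm (\<lambda>x. (f x - u m x) + (f x - u n x)))^2 + (nm (\<lambda>x. (f x - u m x) - (f x - u n x)))^2
   = 2 * (nm (\<lambda>x. f x - u m x))^2 + 2 * (nm (\<lambda>x. f x - u n x))^2"
   using nm_add_sq[OF fm] nm_diff_sq[OF fm] by simp
  moreover have "(nm (\<lambda>x. (f x - u m x) + (f x - u n x)))^2 = 4 * (nm (\<lambda>x. f x - (1/2) * (u m x + u n x)))^2"
  proof -
   have "(\<lambda>x. (f x - u m x) + (f x - u n x)) = (\<lambda>x. 2 * (f x - (1/2) * (u m x + u n x)))" by (auto simp: algebra_simps)
   then show ?thesis using nm_scale[OF mid, of 2] by (simp add: power_mult_distrib)
  qed
  moreover have "(\<lambda>x. (f x - u m x) - (f x - u n x)) = (\<lambda>x. u n x - u m x)" by auto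
  moreover have "d^2 \<le> (nm (\<lambda>x. f x - (1/2) * (u m x + u n x)))^2"
   by (intro power_mono d0 dle half u)
  ultimately show ?thesis using nm_commute[OF uX uX, of m n] by simp
 qed
 have inv0: "(\<lambda>k. 1 / real (Suc k)) \<longlonglongrightarrow> 0"
  using LIMSEQ_inverse_real_of_nat by (simp add: inverse_eq_divide)
 have "cauchy u"
  unfolding cauchy_def
 proof safe
  fix e :: real assume e: "0 < e"
  have "(\<lambda>k. 4 * (d + 1 / real (Suc k))^2 - 4 * d^2) \<longlonglongrightarrow> 4 * (d + 0)^2 - 4 * d^2"
   by (rule tendsto_diff[OF tendsto_mult[OF tendsto_const tendsto_power[OF tendsto_add[OF tendsto_const inv0]]] tendsto_const])
  then have "\<forall>\<^sub>F k in sequentially. 4 * (d + 1 / real (Suc k))^2 - 4 * d^2 < e^2"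
   by (rule order_tendstoD(2)) (use e in simp)
  then obtain K where K: "4 * (d + 1 / real (Suc K))^2 - 4 * d^2 < e^2" by (auto simp: eventually_sequentially)
  have "nm (\<lambda>x. u m x - u n x) < e" if "m \<ge> K" "n \<ge> K" for m n
  proof -
   have b: "(nm (\<lambda>x. f x - u k x))^2 \<le> (d + 1 / real (Suc K))^2" if "k \<ge> K" for k
   proof (rule power_mono)
    have "1 / real (Suc k) \<le> 1 / real (Suc K)" using that by (simp add: frac_le)
    then show "nm (\<lambda>x. f x - u k x) \<le> d + 1 / real (Suc K)" using u(2)[of k] by linarith
   qed (intro nm_ge0 diff_mem f uX)
   have "(nm (\<lambda>x. u m x - u n x))^2 < e^2" using par[of m n] b[OF that(1)] b[OF that(2)] K by linarith
   then show ?thesis by (rule power2_less_imp_less) (use e in simp)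
  qed
  then show "\<exists>N. \<forall>m\<ge>N. \<forall>n\<ge>N. nm (\<lambda>x. u m x - u n x) < e" by blast
 qed
 then obtain p where p: "p \<in> X" "tends u p" using complete uX by blast
 have pN: "p \<in> N" using subspaceD(1)[OF N] u(1) p unfolding closed_in_def by blast
 have "nm (\<lambda>x. f x - p x) \<le> d"
 proof (rule LIMSEQ_le_const)
  show "(\<lambda>k. (d + 1 / real (Suc k)) + nm (\<lambda>x. u k x - p x)) \<longlonglongrightarrow> d"
   using tendsto_add[OF tendsto_add[OF tendsto_const[of d] inv0] p(2)[unfolded tends_def]]
   by simp
  have "nm (\<lambda>x. f x - p x) \<le> (d + 1 / real (Suc k)) + nm (\<lambda>x. u k x - p x)" for k
   using nm_triangle_diff[OF f uX p(1), of k] u(2)[of k] by linarith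
  then show "\<exists>N. \<forall>n\<ge>N. nm (\<lambda>x. f x - p x) \<le> (d + 1 / real (Suc n)) + nm (\<lambda>x. u n x - p x)" by blast
 qed
 then have pd: "nm (\<lambda>x. f x - p x) = d" using dle[OF pN] by simp
 have "ip (\<lambda>x. f x - p x) g = 0" if g: "g \<in> N" for g
 proof (cases "nm g = 0")
  case True
  then show ?thesis using nm_definite[OF NX[OF g] True] ip_zero(2)[OF diff_mem[OF f p(1)]] by metis
 next
  case False
  let ?e = "\<lambda>x. f x - p x"
  have eX: "?e \<in> X" and gX: "g \<in> X" using f p g NX by (auto intro: diff_mem)
  define a where "a = ip ?e g / of_real ((nm g)^2)"
  have "(\<lambda>x. p x + a * g x) \<in> N" using subspaceD(3)[OF N pN subspaceD(4)[OF N g, of a]] .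
  then have "d \<le> nm (\<lambda>x. f x - (p x + a * g x))" by (rule dle)
  also have "(\<lambda>x. f x - (p x + a * g x)) = (\<lambda>x. ?e x - a * g x)" by auto
  finally have "d^2 \<le> (nm (\<lambda>x. ?e x - a * g x))^2" using d0 by (intro power_mono) auto
  also have "\<dots> = (nm ?e)^2 - 2 * Re (cnj a * ip ?e g) + (cmod a * nm g)^2"
   unfolding nm_diff_sq[OF eX scale_mem[OF gX], of a] ip_scale_right[OF gX eX] nm_scale[OF gX] ..
  also have "cnj a * ip ?e g = of_real ((cmod (ip ?e g))^2 / (nm g)^2)"
   unfolding of_real_divide complex_norm_square by (simp add: a_def)
  also have "(cmod a * nm g)^2 = (cmod (ip ?e g))^2 / (nm g)^2"
  proof -
  have "cmod a = cmod (ip ?e g) / (nm g)^2" by (simp add: a_def norm_divide norm_power)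
  then show ?thesis using False by (simp add: power2_eq_square)
 qed
  finally have "(cmod (ip ?e g))^2 / (nm g)^2 \<le> 0" using pd by simp
  then show ?thesis using False by (simp add: divide_le_0_iff)
 qed
 then show ?thesis using pN by blast
qed

end

section \<open>The Hardy space as a Hilbert space\<close>

lemma has_power_series_mon:
 "has_power_series I c f \<longleftrightarrow> (\<forall>z\<in>polydisc I. ((\<lambda>\<alpha>. c \<alpha> * mon I \<alpha> z) has_sum f z) (multi_indices I))"
 by (simp add: has_power_series_def mon_def)

lemma power_series_abs_summable:
 assumes "has_power_series I c f" "0 \<le> r" "r < 1"
 shows "(\<lambda>\<alpha>. cmod (c \<alpha> * of_real r ^ deg I \<alpha>)) summable_on multi_indices I"
proof -
 define z :: point where "z = (\<lambda>i\<in>I. of_real r)"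
 have "z \<in> polydisc I" using assms(2,3) by (auto simp: z_def polydisc_def)
 then have "(\<lambda>\<alpha>. c \<alpha> * mon I \<alpha> z) summable_on multi_indices I"
  using assms(1) by (auto simp: has_power_series_mon summable_on_def)
 moreover have "mon I \<alpha> z = of_real r ^ deg I \<alpha>" for \<alpha>
  by (simp add: mon_def z_def deg_def power_sum)
 ultimately show ?thesis
  unfolding summable_on_iff_abs_summable_on_complex by simp
qed

lemma power_series_dil:
 assumes "has_power_series I c f" "cmod w < 1" "\<zeta> \<in> torus I"
 shows "((\<lambda>\<alpha>. (c \<alpha> * w ^ deg I \<alpha>) * mon I \<alpha> \<zeta>) has_sum f (dil I w \<zeta>)) (multi_indices I)"
 using assms(1)[unfolded has_power_series_mon, rule_format, OF dil_in_polydisc[OF assms(3,2)]]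
 by (simp add: mon_dil mult_ac)

lemma dil_parseval:
 assumes "finite I" "has_power_series I c f" "0 \<le> r" "r < 1"
 shows "(\<lambda>\<zeta>. f (dil I (of_real r) \<zeta>)) \<in> borel_measurable (torus_measure I)"
  and "((\<lambda>\<alpha>. (cmod (c \<alpha>))^2 * (r^2) ^ deg I \<alpha>) has_sum (\<integral>\<zeta>. (cmod (f (dil I (of_real r) \<zeta>)))^2 \<partial>torus_measure I)) (multi_indices I)"
  and "integrable (torus_measure I) (\<lambda>\<zeta>. (cmod (f (dil I (of_real r) \<zeta>)))^2)"
proof -
 have s: "((\<lambda>\<alpha>. (c \<alpha> * of_real r ^ deg I \<alpha>) * mon I \<alpha> \<zeta>) has_sum f (dil I (of_real r) \<zeta>)) (multi_indices I)"
  if "\<zeta> \<in> torus I" for \<zeta> using assms that by (intro power_series_dil) auto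
 note P = torus_parseval[OF assms(1) power_series_abs_summable[OF assms(2-4)] s]
 show "(\<lambda>\<zeta>. f (dil I (of_real r) \<zeta>)) \<in> borel_measurable (torus_measure I)" using P(1) by simp
 have "(cmod (c \<alpha> * of_real r ^ deg I \<alpha>))^2 = (cmod (c \<alpha>))^2 * (r^2) ^ deg I \<alpha>" for \<alpha>
  using assms(3) by (simp add: norm_mult norm_power power_mult_distrib power_mult[symmetric] mult.commute)
 then show "((\<lambda>\<alpha>. (cmod (c \<alpha>))^2 * (r^2) ^ deg I \<alpha>) has_sum (\<integral>\<zeta>. (cmod (f (dil I (of_real r) \<zeta>)))^2 \<partial>torus_measure I)) (multi_indices I)"
  using P(2) by simp
 show "integrable (torus_measure I) (\<lambda>\<zeta>. (cmod (f (dil I (of_real r) \<zeta>)))^2)" using P(3) by simp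
qed

lemma power_series_add:
 "has_power_series I c f ==> has_power_series I d g ==> has_power_series I (\<lambda>\<alpha>. c \<alpha> + d \<alpha>) (\<lambda>z. f z + g z)"
 unfolding has_power_series_def by (auto simp: distrib_right intro: has_sum_add)

lemma power_series_scale:
 "has_power_series I c f ==> has_power_series I (\<lambda>\<alpha>. a * c \<alpha>) (\<lambda>z. a * f z)"
 unfolding has_power_series_def by (auto simp: mult.assoc intro: has_sum_cmult_right)

lemma power_series_diff:
 "has_power_series I c f ==> has_power_series I d g ==> has_power_series I (\<lambda>\<alpha>. c \<alpha> - d \<alpha>) (\<lambda>z. f z - g z)"
 using power_series_add[OF _ power_series_scale, of I c f d g "-1"] by simp

text \<open>Parseval for dilations recovers the moduli of the coefficients of the difference of two expansions.\<close>
lemma power_series_unique: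
 assumes I: "finite I" and "has_power_series I c f" "has_power_series I d f" "\<alpha> \<in> multi_indices I"
 shows "c \<alpha> = d \<alpha>"
proof -
 have "has_power_series I (\<lambda>\<alpha>. c \<alpha> - d \<alpha>) (\<lambda>z. 0)"
  using power_series_diff[OF assms(2,3)] by simp
 from dil_parseval(2)[OF I this, of "1/2"]
 have "((\<lambda>\<alpha>. (cmod (c \<alpha> - d \<alpha>))^2 * ((1/2)^2) ^ deg I \<alpha>) has_sum 0) (multi_indices I)" by simp
 then have "(cmod (c \<alpha> - d \<alpha>))^2 * ((1/2)^2) ^ deg I \<alpha> = 0"
  by (rule nonneg_has_sum_le_0D) (use assms in auto)
 then show ?thesis by simp
qed

lemma coeffs_power_series:
 "has_power_series I c f ==> has_power_series I (coeffs I f) f"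
 unfolding coeffs_def by (rule someI[of "\<lambda>c. has_power_series I c f"])

lemma coeffs_eq:
 "finite I ==> has_power_series I c f ==> \<alpha> \<in> multi_indices I ==> coeffs I f \<alpha> = c \<alpha>"
 by (rule power_series_unique[OF _ coeffs_power_series])

definition of_coeffs :: "nat set \<Rightarrow> ((nat \<Rightarrow> nat) \<Rightarrow> complex) \<Rightarrow> func" where
 "of_coeffs I c = (\<lambda>z. if z \<in> polydisc I then \<Sum>\<^sub>\<infinity>\<alpha>\<in>multi_indices I. c \<alpha> * mon I \<alpha> z else 0)"

definition sq_summable :: "nat set \<Rightarrow> ((nat \<Rightarrow> nat) \<Rightarrow> complex) \<Rightarrow> bool" where
 "sq_summable I c \<longleftrightarrow> (\<lambda>\<alpha>. (cmod (c \<alpha>))^2) summable_on multi_indices I"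

lemma multi_index_finite_subset_box:
 assumes "finite I" "finite X" "X \<subseteq> multi_indices I"
 shows "\<exists>N. X \<subseteq> ibox I N"
proof -
 have "\<forall>\<^sub>F N in sequentially. finite (ibox I N) \<and> X \<subseteq> ibox I N \<and> ibox I N \<subseteq> multi_indices I"
  using filterlim_box[OF assms(1)] assms(2,3) unfolding filterlim_finite_subsets_at_top by blast
 then show ?thesis unfolding eventually_sequentially by blast
qed

text \<open>The square sum is a product of geometric series; this makes point evaluations bounded.\<close>
lemma mon_sq_summable:
 assumes I: "finite I" and z: "z \<in> polydisc I"
 shows "sq_summable I (\<lambda>\<alpha>. mon I \<alpha> z)"
 unfolding sq_summable_def
proof (rule nonneg_bdd_above_summable_on)
 define x where "x i = (cmod (z i))^2" for i
 have x: "0 \<le> x i" "x i < 1" if "i \<in> I" for i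
  using z that by (auto simp: x_def polydisc_def PiE_iff power_less_one_iff abs_square_less_1)
 have mon: "(cmod (mon I \<alpha> z))^2 = (\<Prod>i\<in>I. x i ^ \<alpha> i)" for \<alpha>
  by (simp add: mon_def x_def prod_norm[symmetric] norm_power prod_power_distrib power_mult[symmetric] mult.commute)
 show "bdd_above (sum (\<lambda>\<alpha>. (cmod (mon I \<alpha> z))^2) ` {F. F \<subseteq> multi_indices I \<and> finite F})"
 proof (rule bdd_aboveI2)
  fix F assume "F \<in> {F. F \<subseteq> multi_indices I \<and> finite F}"
  then obtain N where N: "F \<subseteq> ibox I N" using multi_index_finite_subset_box[OF I] by blast
  have "(\<Sum>\<alpha>\<in>F. (cmod (mon I \<alpha> z))^2) \<le> (\<Sum>\<alpha>\<in>ibox I N. (cmod (mon I \<alpha> z))^2)"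
   by (rule sum_mono2[OF finite_box[OF I] N]) simp
  also have "\<dots> = (\<Prod>i\<in>I. \<Sum>k\<le>N. x i ^ k)"
   unfolding mon ibox_def by (rule prod_sum_PiE[symmetric]) (use I in auto)
  also have "\<dots> \<le> (\<Prod>i\<in>I. 1 / (1 - x i))"
  proof (rule prod_mono)
   fix i assume i: "i \<in> I"
   have "(\<Sum>k\<le>N. x i ^ k) \<le> (\<Sum>k. x i ^ k)"
    using x[OF i] by (intro sum_le_suminf summable_geometric) auto
   then show "0 \<le> (\<Sum>k\<le>N. x i ^ k) \<and> (\<Sum>k\<le>N. x i ^ k) \<le> 1 / (1 - x i)"
    using x[OF i] by (auto simp: suminf_geometric intro!: sum_nonneg)
  qed
  finally show "(\<Sum>\<alpha>\<in>F. (cmod (mon I \<alpha> z))^2) \<le> (\<Prod>i\<in>I. 1 / (1 - x i))" .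
 qed
qed simp

lemma sq_summable_mult:
 assumes "sq_summable I c" "sq_summable I d"
 shows "(\<lambda>\<alpha>. c \<alpha> * d \<alpha>) summable_on multi_indices I"
proof -
 have "(\<lambda>\<alpha>. cmod (c \<alpha> * d \<alpha>)) summable_on multi_indices I"
  by (rule abs_summable_product)
    (use assms in \<open>simp_all add: sq_summable_def norm_mult power2_eq_square\<close>)
 then show ?thesis by (rule abs_summable_summable)
qed

lemma sq_summable_cnj: "sq_summable I c ==> sq_summable I (\<lambda>\<alpha>. cnj (c \<alpha>))"
 by (simp add: sq_summable_def)

lemma sq_summable_scale: "sq_summable I c ==> sq_summable I (\<lambda>\<alpha>. a * c \<alpha>)"
 by (simp add: sq_summable_def norm_mult power_mult_distrib summable_on_cmult_right)

lemma sq_summable_cong: "(\<And>\<alpha>. \<alpha> \<in> multi_indices I ==> c \<alpha> = d \<alpha>) ==> sq_summable I c = sq_summable I d"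
 unfolding sq_summable_def by (rule summable_on_cong) simp

lemma sq_summable_add:
 assumes "sq_summable I c" "sq_summable I d"
 shows "sq_summable I (\<lambda>\<alpha>. c \<alpha> + d \<alpha>)"
 unfolding sq_summable_def
proof (rule summable_on_comparison_test[where f="\<lambda>\<alpha>. 2 * (cmod (c \<alpha>))^2 + 2 * (cmod (d \<alpha>))^2"])
 show "(\<lambda>\<alpha>. 2 * (cmod (c \<alpha>))^2 + 2 * (cmod (d \<alpha>))^2) summable_on multi_indices I"
  using assms by (intro summable_on_add summable_on_cmult_right) (auto simp: sq_summable_def)
 fix \<alpha>
 have "(cmod (c \<alpha> + d \<alpha>))^2 \<le> (cmod (c \<alpha>) + cmod (d \<alpha>))^2"
  by (rule power_mono[OF norm_triangle_ineq]) simp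
 also have "\<dots> \<le> 2 * (cmod (c \<alpha>))^2 + 2 * (cmod (d \<alpha>))^2"
  using sum_squares_bound[of "cmod (c \<alpha>)" "cmod (d \<alpha>)"] unfolding power2_sum by linarith
 finally show "(cmod (c \<alpha> + d \<alpha>))^2 \<le> 2 * (cmod (c \<alpha>))^2 + 2 * (cmod (d \<alpha>))^2" .
qed simp

lemma of_coeffs_power_series:
 assumes "finite I" "sq_summable I c"
 shows "has_power_series I c (of_coeffs I c)"
 unfolding has_power_series_mon of_coeffs_def
 using sq_summable_mult[OF assms(2) mon_sq_summable[OF assms(1)]] by (auto intro: has_sum_infsum)

lemma of_coeffs_H2: "finite I ==> sq_summable I c ==> of_coeffs I c \<in> H2 I"
 unfolding H2_def using of_coeffs_power_series[of I c]
 by (auto simp: of_coeffs_def sq_summable_def)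

lemma coeffs_of_coeffs:
 "finite I ==> sq_summable I c ==> \<alpha> \<in> multi_indices I ==> coeffs I (of_coeffs I c) \<alpha> = c \<alpha>"
 by (rule coeffs_eq[OF _ of_coeffs_power_series])

lemma H2_power_series: "f \<in> H2 I ==> has_power_series I (coeffs I f) f"
 unfolding H2_def using coeffs_power_series by blast

lemma H2_sq_summable: "finite I ==> f \<in> H2 I ==> sq_summable I (coeffs I f)"
proof -
 assume I: "finite I" and "f \<in> H2 I"
 then obtain c where c: "has_power_series I c f" "sq_summable I c"
  unfolding H2_def sq_summable_def by blast
 show "sq_summable I (coeffs I f)"
  by (rule iffD2[OF sq_summable_cong c(2)]) (rule coeffs_eq[OF I c(1)])
qed

lemma H2_off: "f \<in> H2 I ==> z \<notin> polydisc I ==> f z = 0"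
 by (simp add: H2_def)

lemma H2_I:
 assumes "has_power_series I c f" "sq_summable I c" "\<And>z. z \<notin> polydisc I ==> f z = 0"
 shows "f \<in> H2 I"
 using assms by (auto simp: H2_def sq_summable_def)

lemma H2_eval: "f \<in> H2 I ==> z \<in> polydisc I ==> ((\<lambda>\<alpha>. coeffs I f \<alpha> * mon I \<alpha> z) has_sum f z) (multi_indices I)"
 using H2_power_series unfolding has_power_series_mon by blast

lemma H2_eqI:
 assumes "finite I" "f \<in> H2 I" "g \<in> H2 I" "\<And>\<alpha>. \<alpha> \<in> multi_indices I ==> coeffs I f \<alpha> = coeffs I g \<alpha>"
 shows "f = g"
proof
 fix z show "f z = g z"
 proof (cases "z \<in> polydisc I")
  case True
  have "((\<lambda>\<alpha>. coeffs I f \<alpha> * mon I \<alpha> z) has_sum g z) (multi_indices I)"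
   using H2_eval[OF assms(3) True] assms(4) by (simp cong: has_sum_cong)
  then show ?thesis using H2_eval[OF assms(2) True] has_sum_unique by blast
 qed (simp add: H2_off[OF assms(2)] H2_off[OF assms(3)])
qed

lemma H2_zero: "(\<lambda>z. 0) \<in> H2 I"
 by (rule H2_I[where c="\<lambda>_. 0"]) (auto simp: has_power_series_def sq_summable_def)

lemma
 assumes I: "finite I" and "f \<in> H2 I" "g \<in> H2 I"
 shows H2_add: "(\<lambda>z. f z + g z) \<in> H2 I"
  and coeffs_add: "\<alpha> \<in> multi_indices I ==> coeffs I (\<lambda>z. f z + g z) \<alpha> = coeffs I f \<alpha> + coeffs I g \<alpha>"
proof -
 note ps = power_series_add[OF assms(2,3)[THEN H2_power_series]]
 show "(\<lambda>z. f z + g z) \<in> H2 I"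
  by (rule H2_I[OF ps sq_summable_add[OF assms(2,3)[THEN H2_sq_summable[OF I]]]]) (simp add: H2_off[OF assms(2)] H2_off[OF assms(3)])
 show "\<alpha> \<in> multi_indices I ==> coeffs I (\<lambda>z. f z + g z) \<alpha> = coeffs I f \<alpha> + coeffs I g \<alpha>"
  by (rule coeffs_eq[OF I ps])
qed

lemma
 assumes I: "finite I" and "f \<in> H2 I"
 shows H2_scale: "(\<lambda>z. a * f z) \<in> H2 I"
  and coeffs_scale: "\<alpha> \<in> multi_indices I ==> coeffs I (\<lambda>z. a * f z) \<alpha> = a * coeffs I f \<alpha>"
proof -
 note ps = power_series_scale[OF assms(2)[THEN H2_power_series], of a]
 show "(\<lambda>z. a * f z) \<in> H2 I"
  by (rule H2_I[OF ps sq_summable_scale[OF assms(2)[THEN H2_sq_summable[OF I]]]]) (simp add: H2_off[OF assms(2)])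
 show "\<alpha> \<in> multi_indices I ==> coeffs I (\<lambda>z. a * f z) \<alpha> = a * coeffs I f \<alpha>"
  by (rule coeffs_eq[OF I ps])
qed

lemma coeffs_diff:
 assumes I: "finite I" and "f \<in> H2 I" "g \<in> H2 I" "\<alpha> \<in> multi_indices I"
 shows "coeffs I (\<lambda>z. f z - g z) \<alpha> = coeffs I f \<alpha> - coeffs I g \<alpha>"
 using coeffs_add[OF I assms(2) H2_scale[OF I assms(3), of "-1"] assms(4)] coeffs_scale[OF I assms(3,4), of "-1"] by simp

lemma coeffs_zero: "finite I ==> \<alpha> \<in> multi_indices I ==> coeffs I (\<lambda>z. 0) \<alpha> = 0"
 by (rule coeffs_eq[where c="\<lambda>_. 0"]) (auto simp: has_power_series_def)

lemma H2_norm_has_sum: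
 assumes "finite I" "f \<in> H2 I"
 shows "((\<lambda>\<alpha>. (cmod (coeffs I f \<alpha>))^2) has_sum (H2_norm I f)^2) (multi_indices I)"
 using H2_sq_summable[OF assms] unfolding H2_norm_def sq_summable_def
 by (simp add: infsum_nonneg)

lemma H2_norm_sq_eqI:
 assumes "finite I" "f \<in> H2 I" "((\<lambda>\<alpha>. (cmod (coeffs I f \<alpha>))^2) has_sum s) (multi_indices I)"
 shows "(H2_norm I f)^2 = s"
 using has_sum_unique[OF H2_norm_has_sum[OF assms(1,2)] assms(3)] .

lemma H2_norm_ge0: "0 \<le> H2_norm I f"
 by (simp add: H2_norm_def infsum_nonneg)

lemma H2_norm_partial:
 assumes "finite I" "f \<in> H2 I" "finite F" "F \<subseteq> multi_indices I"
 shows "(\<Sum>\<alpha>\<in>F. (cmod (coeffs I f \<alpha>))^2) \<le> (H2_norm I f)^2"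
 by (rule finite_sum_le_has_sum[OF H2_norm_has_sum[OF assms(1,2)]]) (use assms in auto)

lemma H2_norm_leI:
 assumes "finite I" "f \<in> H2 I" "0 \<le> B" "\<And>F. finite F ==> F \<subseteq> multi_indices I ==> (\<Sum>\<alpha>\<in>F. (cmod (coeffs I f \<alpha>))^2) \<le> B^2"
 shows "H2_norm I f \<le> B"
proof -
 have "(H2_norm I f)^2 \<le> B^2"
  by (rule has_sum_le_finite_sums[OF H2_norm_has_sum[OF assms(1,2)]]) (use assms(4) in auto)
 then show ?thesis using assms(3) by (rule power2_le_imp_le)
qed

lemma sq_summable_bdd:
 assumes "\<And>F. finite F ==> F \<subseteq> multi_indices I ==> (\<Sum>\<alpha>\<in>F. (cmod (c \<alpha>))^2) \<le> B"
 shows "sq_summable I c"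
 unfolding sq_summable_def
 by (rule nonneg_bdd_above_summable_on) (auto intro!: bdd_aboveI2[where M=B] assms)

lemma coeff_le_norm:
 assumes "finite I" "f \<in> H2 I" "\<alpha> \<in> multi_indices I"
 shows "cmod (coeffs I f \<alpha>) \<le> H2_norm I f"
 by (rule power2_le_imp_le[OF _ H2_norm_ge0]) (use H2_norm_partial[OF assms(1,2), of "{\<alpha>}"] assms(3) in simp)

lemma H2_inner_has_sum:
 assumes "finite I" "f \<in> H2 I" "g \<in> H2 I"
 shows "((\<lambda>\<alpha>. coeffs I f \<alpha> * cnj (coeffs I g \<alpha>)) has_sum H2_inner I f g) (multi_indices I)"
 unfolding H2_inner_def
 by (rule has_sum_infsum) (intro sq_summable_mult sq_summable_cnj H2_sq_summable assms)

lemma H2_prehilbert: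
 assumes I: "finite I" shows "fun_prehilbert (H2 I) (H2_inner I) (H2_norm I)"
proof
 show "(\<lambda>x. 0) \<in> H2 I" by (rule H2_zero)
 show "(\<lambda>x. f x + g x) \<in> H2 I" if "f \<in> H2 I" "g \<in> H2 I" for f g using I that by (rule H2_add)
 show "(\<lambda>x. a * f x) \<in> H2 I" if "f \<in> H2 I" for f a using I that by (rule H2_scale)
 show "H2_inner I (\<lambda>x. f x + g x) h = H2_inner I f h + H2_inner I g h" if "f \<in> H2 I" "g \<in> H2 I" "h \<in> H2 I" for f g h
 proof -
  have "((\<lambda>\<alpha>. coeffs I (\<lambda>x. f x + g x) \<alpha> * cnj (coeffs I h \<alpha>)) has_sum (H2_inner I f h + H2_inner I g h)) (multi_indices I)"
   using has_sum_add[OF H2_inner_has_sum[OF I that(1,3)] H2_inner_has_sum[OF I that(2,3)]]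
   by (simp add: coeffs_add[OF I that(1,2)] distrib_right cong: has_sum_cong)
  then show ?thesis using has_sum_unique[OF H2_inner_has_sum[OF I H2_add[OF I that(1,2)] that(3)]] by blast
 qed
 show "H2_inner I (\<lambda>x. a * f x) h = a * H2_inner I f h" if "f \<in> H2 I" "h \<in> H2 I" for f h a
 proof -
  have "((\<lambda>\<alpha>. coeffs I (\<lambda>x. a * f x) \<alpha> * cnj (coeffs I h \<alpha>)) has_sum (a * H2_inner I f h)) (multi_indices I)"
   using has_sum_cmult_right[OF H2_inner_has_sum[OF I that], of a]
   by (simp add: coeffs_scale[OF I that(1)] mult.assoc cong: has_sum_cong)
  then show ?thesis using has_sum_unique[OF H2_inner_has_sum[OF I H2_scale[OF I that(1)] that(2)]] by blast
 qed
 show "cnj (H2_inner I f g) = H2_inner I g f" for f g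
  by (simp add: H2_inner_def mult.commute flip: infsum_cnj)
 show "H2_inner I f f = complex_of_real ((H2_norm I f)^2)" if "f \<in> H2 I" for f
 proof -
  have "((\<lambda>\<alpha>. complex_of_real ((cmod (coeffs I f \<alpha>))^2)) has_sum complex_of_real ((H2_norm I f)^2)) (multi_indices I)"
   by (rule has_sum_of_real[OF H2_norm_has_sum[OF I that]])
  then show ?thesis
   unfolding complex_norm_square using has_sum_unique[OF H2_inner_has_sum[OF I that that]] by blast
 qed
 show "0 \<le> H2_norm I f" for f by (rule H2_norm_ge0)
 show "f = (\<lambda>x. 0)" if "f \<in> H2 I" "H2_norm I f = 0" for f
  using coeff_le_norm[OF I that(1)] that by (intro H2_eqI[OF I _ H2_zero]) (auto simp: coeffs_zero[OF I])
qed

theorem H2_hilbert: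
 assumes I: "finite I" shows "fun_hilbert (H2 I) (H2_inner I) (H2_norm I)"
proof -
 interpret fun_prehilbert "H2 I" "H2_inner I" "H2_norm I" by (rule H2_prehilbert[OF I])
 show ?thesis
 proof
  fix u assume uX: "\<And>k. u k \<in> H2 I" and u: "cauchy u"
  define c where "c k \<alpha> = coeffs I (u k) \<alpha>" for k \<alpha>
  have N: "\<exists>N. \<forall>m\<ge>N. \<forall>n\<ge>N. H2_norm I (\<lambda>x. u m x - u n x) < e" if "e > 0" for e
   using u that unfolding cauchy_def by blast
  have cd: "c m \<alpha> - c n \<alpha> = coeffs I (\<lambda>x. u m x - u n x) \<alpha>" if "\<alpha> \<in> multi_indices I" for m n \<alpha>
   unfolding c_def by (rule coeffs_diff[symmetric, OF I uX uX that])
  have "\<exists>l. (\<lambda>k. c k \<alpha>) \<longlonglongrightarrow> l" if a: "\<alpha> \<in> multi_indices I" for \<alpha>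
  proof -
   have "Cauchy (\<lambda>k. c k \<alpha>)"
   proof (rule metric_CauchyI)
    fix e :: real assume "e > 0"
    from N[OF this] obtain M where M: "\<And>m n. m \<ge> M ==> n \<ge> M ==> H2_norm I (\<lambda>x. u m x - u n x) < e" by blast
    have "dist (c m \<alpha>) (c n \<alpha>) < e" if "m \<ge> M" "n \<ge> M" for m n
     using coeff_le_norm[OF I diff_mem[OF uX uX] a, of m n] M[OF that] by (simp add: dist_norm cd[OF a])
    then show "\<exists>M. \<forall>m\<ge>M. \<forall>n\<ge>M. dist (c m \<alpha>) (c n \<alpha>) < e" by blast
   qed
   then show ?thesis using Cauchy_convergent unfolding convergent_def by blast
  qed
  then obtain l where l: "\<And>\<alpha>. \<alpha> \<in> multi_indices I ==> (\<lambda>k. c k \<alpha>) \<longlonglongrightarrow> l \<alpha>" by metis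
  have small: "(\<Sum>\<alpha>\<in>F. (cmod (c m \<alpha> - l \<alpha>))^2) \<le> e^2"
   if F: "finite F" "F \<subseteq> multi_indices I" and m: "\<And>n. n \<ge> m ==> H2_norm I (\<lambda>x. u m x - u n x) \<le> e" for F m e
  proof (rule LIMSEQ_le_const2)
   show "(\<lambda>n. \<Sum>\<alpha>\<in>F. (cmod (c m \<alpha> - c n \<alpha>))^2) \<longlonglongrightarrow> (\<Sum>\<alpha>\<in>F. (cmod (c m \<alpha> - l \<alpha>))^2)"
    by (rule tendsto_sum, rule tendsto_power, rule tendsto_norm, rule tendsto_diff[OF tendsto_const l]) (use F in auto)
   have "(\<Sum>\<alpha>\<in>F. (cmod (c m \<alpha> - c n \<alpha>))^2) \<le> e^2" if "n \<ge> m" for n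
   proof -
    have "(\<Sum>\<alpha>\<in>F. (cmod (c m \<alpha> - c n \<alpha>))^2) = (\<Sum>\<alpha>\<in>F. (cmod (coeffs I (\<lambda>x. u m x - u n x) \<alpha>))^2)"
     using F by (intro sum.cong refl) (simp add: cd subset_iff)
    also have "\<dots> \<le> (H2_norm I (\<lambda>x. u m x - u n x))^2" by (rule H2_norm_partial[OF I diff_mem[OF uX uX] F])
    also have "\<dots> \<le> e^2" by (rule power_mono[OF m[OF that] H2_norm_ge0])
    finally show ?thesis .
   qed
   then show "\<exists>N. \<forall>n\<ge>N. (\<Sum>\<alpha>\<in>F. (cmod (c m \<alpha> - c n \<alpha>))^2) \<le> e^2" by blast
  qed
  have sqd: "sq_summable I (\<lambda>\<alpha>. c m \<alpha> - l \<alpha>)" if "\<And>n. n \<ge> m ==> H2_norm I (\<lambda>x. u m x - u n x) \<le> e" for m e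
   by (rule sq_summable_bdd[where B="e^2"]) (rule small[OF _ _ that])
  obtain M where M: "\<And>n. n \<ge> M ==> H2_norm I (\<lambda>x. u M x - u n x) \<le> 1" using N[of 1] by force
  have "sq_summable I (\<lambda>\<alpha>. c M \<alpha> + (-1) * (c M \<alpha> - l \<alpha>))"
   unfolding c_def by (intro sq_summable_add sq_summable_scale H2_sq_summable[OF I uX] sqd[OF M, unfolded c_def])
  then have sql: "sq_summable I l" by simp
  define L where "L = of_coeffs I l"
  have LX: "L \<in> H2 I" unfolding L_def by (rule of_coeffs_H2[OF I sql])
  have cL: "coeffs I L \<alpha> = l \<alpha>" if "\<alpha> \<in> multi_indices I" for \<alpha>
   unfolding L_def by (rule coeffs_of_coeffs[OF I sql that])
  have "tends u L"
   unfolding tends_def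
  proof (rule LIMSEQ_I)
   fix e :: real assume "0 < e"
   then obtain M where M: "\<And>m n. m \<ge> M ==> n \<ge> M ==> H2_norm I (\<lambda>x. u m x - u n x) < e/2" using N[of "e/2"] by auto
   have "H2_norm I (\<lambda>x. u m x - L x) \<le> e/2" if m: "m \<ge> M" for m
   proof (rule H2_norm_leI[OF I diff_mem[OF uX LX]])
    fix F assume F: "finite F" "F \<subseteq> multi_indices I"
    have "(\<Sum>\<alpha>\<in>F. (cmod (coeffs I (\<lambda>x. u m x - L x) \<alpha>))^2) = (\<Sum>\<alpha>\<in>F. (cmod (c m \<alpha> - l \<alpha>))^2)"
     using F by (intro sum.cong refl) (simp add: coeffs_diff[OF I uX LX] cL c_def subset_iff)
    also have "\<dots> \<le> (e/2)^2"
     by (rule small[OF F]) (use M m in \<open>force intro: less_imp_le\<close>)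
    finally show "(\<Sum>\<alpha>\<in>F. (cmod (coeffs I (\<lambda>x. u m x - L x) \<alpha>))^2) \<le> (e/2)^2" .
   qed (use \<open>0 < e\<close> in simp)
   then show "\<exists>no. \<forall>n\<ge>no. norm (H2_norm I (\<lambda>x. u n x - L x) - 0) < e"
    using \<open>0 < e\<close> H2_norm_ge0 by (intro exI[of _ M]) (force simp: abs_of_nonneg)
  qed
  then show "\<exists>l\<in>H2 I. tends u l" using LX by blast
 qed
qed

abbreviation "H2_tends I \<equiv> fun_normed.tends (H2_norm I)"
abbreviation "H2_closed I \<equiv> fun_normed.closed_in (H2 I) (H2_norm I)"

text \<open>Connects the topological formulation with sequences, which are used everywhere else.\<close>
lemma closedin_H2_iff:
 assumes I: "finite I"
 shows "closedin (Metric_space.mtopology (H2 I) (H2_dist I)) S \<longleftrightarrow> H2_closed I S"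
proof -
 interpret fun_hilbert "H2 I" "H2_inner I" "H2_norm I" by (rule H2_hilbert[OF I])
 interpret M: Metric_space "H2 I" "H2_dist I"
 proof
  show "0 \<le> H2_dist I x y" for x y by (simp add: H2_dist_def H2_norm_ge0)
  show "H2_dist I x y = H2_dist I y x" for x y
  proof (cases "\<exists>c. has_power_series I c (\<lambda>z. x z - y z)")
   case True
   then obtain c where c: "has_power_series I c (\<lambda>z. x z - y z)" by blast
   have c': "has_power_series I (\<lambda>\<alpha>. - c \<alpha>) (\<lambda>z. y z - x z)"
    using power_series_scale[OF c, of "-1"] by simp
   have "cmod (coeffs I (\<lambda>z. x z - y z) \<alpha>) = cmod (coeffs I (\<lambda>z. y z - x z) \<alpha>)" if "\<alpha> \<in> multi_indices I" for \<alpha>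
    using coeffs_eq[OF I c that] coeffs_eq[OF I c' that] by simp
   then show ?thesis unfolding H2_dist_def H2_norm_def by (simp cong: infsum_cong)
  next
   case False
   have "has_power_series I (\<lambda>\<alpha>. - c \<alpha>) (\<lambda>z. x z - y z)" if "has_power_series I c (\<lambda>z. y z - x z)" for c
    using power_series_scale[OF that, of "-1"] by simp
   with False have "\<And>c. \<not> has_power_series I c (\<lambda>z. y z - x z)" by blast
   with False show ?thesis by (simp add: H2_dist_def H2_norm_def coeffs_def)
  qed
  show "(H2_dist I x y = 0) = (x = y)" if "x \<in> H2 I" "y \<in> H2 I" for x y
   using nm_definite[OF diff_mem[OF that]] nm_zero by (auto simp: H2_dist_def fun_eq_iff)
  show "H2_dist I x z \<le> H2_dist I x y + H2_dist I y z" if "x \<in> H2 I" "y \<in> H2 I" "z \<in> H2 I" for x y z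
   unfolding H2_dist_def by (rule nm_triangle_diff[OF that])
 qed
 have lim: "limitin M.mtopology u l sequentially \<longleftrightarrow> tends u l" if "\<And>k. u k \<in> H2 I" "l \<in> H2 I" for u l
  unfolding M.limit_metric_sequentially tends_def LIMSEQ_iff H2_dist_def
  using that H2_norm_ge0 by (simp add: abs_of_nonneg)
 show ?thesis
  unfolding M.metric_closedin_iff_sequentially_closed closed_in_def
 proof (intro conj_cong refl, standard)
  assume S: "S \<subseteq> H2 I" and h: "\<forall>\<sigma> l. range \<sigma> \<subseteq> S \<and> limitin M.mtopology \<sigma> l sequentially \<longrightarrow> l \<in> S"
  show "\<forall>u l. (\<forall>k. u k \<in> S) \<longrightarrow> l \<in> H2 I \<longrightarrow> tends u l \<longrightarrow> l \<in> S"
  proof safe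
   fix u l assume s: "\<forall>k. u k \<in> S" "l \<in> H2 I" "tends u l"
   have "limitin M.mtopology u l sequentially" using lim[of u l] S s by blast
   moreover have "range u \<subseteq> S" using s(1) by blast
   ultimately show "l \<in> S" using h by blast
  qed
 next
  assume S: "S \<subseteq> H2 I" and h: "\<forall>u l. (\<forall>k. u k \<in> S) \<longrightarrow> l \<in> H2 I \<longrightarrow> tends u l \<longrightarrow> l \<in> S"
  show "\<forall>\<sigma> l. range \<sigma> \<subseteq> S \<and> limitin M.mtopology \<sigma> l sequentially \<longrightarrow> l \<in> S"
  proof safe
   fix \<sigma> l assume s: "range \<sigma> \<subseteq> S" "limitin M.mtopology \<sigma> l sequentially"
   have l: "l \<in> H2 I" using limitin_topspace[OF s(2)] by simp
   have sk: "\<And>k. \<sigma> k \<in> S" using s(1) by blast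
   then have "tends \<sigma> l" using lim[of \<sigma> l] S l s(2) by blast
   then show "l \<in> S" using h sk l by blast
  qed
 qed
qed

subsection \<open>Point evaluations\<close>

lemma eval_bound:
 assumes I: "finite I" and z: "z \<in> polydisc I"
 shows "\<exists>C\<ge>0. \<forall>f\<in>H2 I. cmod (f z) \<le> C * H2_norm I f"
proof -
 interpret fun_hilbert "H2 I" "H2_inner I" "H2_norm I" by (rule H2_hilbert[OF I])
 define k where "k = of_coeffs I (\<lambda>\<alpha>. cnj (mon I \<alpha> z))"
 have sq: "sq_summable I (\<lambda>\<alpha>. cnj (mon I \<alpha> z))" by (rule sq_summable_cnj[OF mon_sq_summable[OF I z]])
 have kX: "k \<in> H2 I" unfolding k_def by (rule of_coeffs_H2[OF I sq])
 have "f z = H2_inner I f k" if f: "f \<in> H2 I" for f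
 proof -
  have "((\<lambda>\<alpha>. coeffs I f \<alpha> * cnj (coeffs I k \<alpha>)) has_sum f z) (multi_indices I)"
   using H2_eval[OF f z] by (simp add: k_def coeffs_of_coeffs[OF I sq] cong: has_sum_cong)
  from has_sum_unique[OF this H2_inner_has_sum[OF I f kX]] show ?thesis .
 qed
 then have "\<forall>f\<in>H2 I. cmod (f z) \<le> H2_norm I k * H2_norm I f"
  using cauchy_schwarz[OF _ kX] by (simp add: mult.commute)
 then show ?thesis using H2_norm_ge0 by blast
qed

lemma tends_pointwise:
 assumes I: "finite I" and t: "H2_tends I u l" and u: "\<And>k. u k \<in> H2 I" and l: "l \<in> H2 I"
 shows "(\<lambda>k. u k z) \<longlonglongrightarrow> l z"
proof (cases "z \<in> polydisc I")
 case True
 interpret fun_hilbert "H2 I" "H2_inner I" "H2_norm I" by (rule H2_hilbert[OF I])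
 obtain C where C: "\<And>f. f \<in> H2 I ==> cmod (f z) \<le> C * H2_norm I f" using eval_bound[OF I True] by blast
 have "(\<lambda>k. u k z - l z) \<longlonglongrightarrow> 0"
  by (rule Lim_null_comparison[OF _ tendsto_mult_right_zero[OF t[unfolded tends_def], of C]])
    (rule always_eventually, rule allI, rule C[OF diff_mem[OF u l]])
 then show ?thesis by (rule LIM_zero_cancel)
qed (simp add: H2_off[OF u] H2_off[OF l])

subsection \<open>Density of the polynomials\<close>

definition poly_on :: "nat set \<Rightarrow> (nat \<Rightarrow> nat) set \<Rightarrow> ((nat \<Rightarrow> nat) \<Rightarrow> complex) \<Rightarrow> func" where
 "poly_on I F c = (\<lambda>z. if z \<in> polydisc I then \<Sum>\<alpha>\<in>F. c \<alpha> * mon I \<alpha> z else 0)"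

lemma
 assumes I: "finite I" and F: "finite F" "F \<subseteq> multi_indices I"
 shows poly_on_H2: "poly_on I F c \<in> H2 I"
  and poly_on_power_series: "has_power_series I (\<lambda>\<alpha>. if \<alpha> \<in> F then c \<alpha> else 0) (poly_on I F c)"
  and coeffs_poly_on: "\<alpha> \<in> multi_indices I ==> coeffs I (poly_on I F c) \<alpha> = (if \<alpha> \<in> F then c \<alpha> else 0)"
  and poly_on_norm: "(H2_norm I (poly_on I F c))^2 = (\<Sum>\<alpha>\<in>F. (cmod (c \<alpha>))^2)"
proof -
 show ps: "has_power_series I (\<lambda>\<alpha>. if \<alpha> \<in> F then c \<alpha> else 0) (poly_on I F c)"
  unfolding has_power_series_mon poly_on_def
 proof
  fix z assume "z \<in> polydisc I"
  have "((\<lambda>\<alpha>. (if \<alpha> \<in> F then c \<alpha> else 0) * mon I \<alpha> z) has_sum (\<Sum>\<alpha>\<in>F. c \<alpha> * mon I \<alpha> z)) (multi_indices I)"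
   by (rule has_sum_finite_neutralI[where B=F]) (use F in auto)
  then show "((\<lambda>\<alpha>. (if \<alpha> \<in> F then c \<alpha> else 0) * mon I \<alpha> z) has_sum (if z \<in> polydisc I then \<Sum>\<alpha>\<in>F. c \<alpha> * mon I \<alpha> z else 0)) (multi_indices I)"
   using \<open>z \<in> polydisc I\<close> by simp
 qed
 have hs: "((\<lambda>\<alpha>. (cmod (if \<alpha> \<in> F then c \<alpha> else 0))^2) has_sum (\<Sum>\<alpha>\<in>F. (cmod (c \<alpha>))^2)) (multi_indices I)"
  by (rule has_sum_finite_neutralI[where B=F]) (use F in auto)
 then have sq: "sq_summable I (\<lambda>\<alpha>. if \<alpha> \<in> F then c \<alpha> else 0)"
  unfolding sq_summable_def summable_on_def by blast
 show X: "poly_on I F c \<in> H2 I" by (rule H2_I[OF ps sq]) (simp add: poly_on_def)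
 show co: "\<alpha> \<in> multi_indices I ==> coeffs I (poly_on I F c) \<alpha> = (if \<alpha> \<in> F then c \<alpha> else 0)" for \<alpha>
  by (rule coeffs_eq[OF I ps])
 show "(H2_norm I (poly_on I F c))^2 = (\<Sum>\<alpha>\<in>F. (cmod (c \<alpha>))^2)"
  by (rule H2_norm_sq_eqI[OF I X]) (use hs in \<open>simp add: co cong: has_sum_cong\<close>)
qed

lemma poly_tends:
 assumes I: "finite I" and f: "f \<in> H2 I"
 shows "H2_tends I (\<lambda>N. poly_on I (ibox I N) (coeffs I f)) f"
proof -
 interpret fun_hilbert "H2 I" "H2_inner I" "H2_norm I" by (rule H2_hilbert[OF I])
 define S where "S = (H2_norm I f)^2"
 define p where "p N = poly_on I (ibox I N) (coeffs I f)" for N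
 have pX: "p N \<in> H2 I" for N unfolding p_def by (rule poly_on_H2[OF I finite_box[OF I] box_subset])
 have pn: "(H2_norm I (p N))^2 = (\<Sum>\<alpha>\<in>ibox I N. (cmod (coeffs I f \<alpha>))^2)" for N
  unfolding p_def by (rule poly_on_norm[OF I finite_box[OF I] box_subset])
 have ip: "H2_inner I f (p N) = of_real ((H2_norm I (p N))^2)" for N
 proof -
  have "((\<lambda>\<alpha>. coeffs I f \<alpha> * cnj (coeffs I (p N) \<alpha>)) has_sum (\<Sum>\<alpha>\<in>ibox I N. coeffs I f \<alpha> * cnj (coeffs I f \<alpha>))) (multi_indices I)"
   by (rule has_sum_finite_neutralI[where B="ibox I N"])
    (use finite_box[OF I] box_subset in \<open>auto simp: p_def coeffs_poly_on[OF I finite_box[OF I] box_subset] subset_iff\<close>)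
  from has_sum_unique[OF H2_inner_has_sum[OF I f pX] this]
  show ?thesis unfolding pn of_real_sum complex_norm_square .
 qed
 have d: "(H2_norm I (\<lambda>x. p N x - f x))^2 = S - (\<Sum>\<alpha>\<in>ibox I N. (cmod (coeffs I f \<alpha>))^2)" for N
 proof -
  have "Re (H2_inner I f (p N)) = (H2_norm I (p N))^2" unfolding ip by simp
  then show ?thesis
   using nm_diff_sq[OF f pX, of N] unfolding nm_commute[OF pX f] S_def pn by linarith
 qed
 have "(\<lambda>N. S - (\<Sum>\<alpha>\<in>ibox I N. (cmod (coeffs I f \<alpha>))^2)) \<longlonglongrightarrow> S - S"
  unfolding S_def by (rule tendsto_diff[OF tendsto_const has_sum_box[OF I H2_norm_has_sum[OF I f]]])
 then have "(\<lambda>N. sqrt ((H2_norm I (\<lambda>x. p N x - f x))^2)) \<longlonglongrightarrow> sqrt 0"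
  unfolding d by (intro tendsto_real_sqrt) simp
 then show ?thesis unfolding tends_def p_def by (simp add: H2_norm_ge0)
qed

section \<open>Products and multipliers\<close>

text \<open>The finite partial sums are holomorphic and converge locally uniformly.\<close>
lemma power_series_holomorphic_comp:
 assumes I: "finite I" and f: "has_power_series I c f" and \<Omega>: "open \<Omega>"
  and hol: "\<And>i. i \<in> I ==> g i holomorphic_on \<Omega>"
  and ball: "\<And>i w. i \<in> I ==> w \<in> \<Omega> ==> cmod (g i w) < 1"
 shows "(\<lambda>w. f (\<lambda>i\<in>I. g i w)) holomorphic_on \<Omega>"
 unfolding holomorphic_on_def
proof
 fix w0 assume "w0 \<in> \<Omega>"
 then obtain e where e: "e > 0" "cball w0 e \<subseteq> \<Omega>" using \<Omega> open_contains_cball by blast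
 have "\<exists>r. 0 \<le> r \<and> r < 1 \<and> (\<forall>w\<in>cball w0 e. cmod (g i w) \<le> r)" if i: "i \<in> I" for i
 proof -
  have "continuous_on (cball w0 e) (\<lambda>w. cmod (g i w))"
   using holomorphic_on_subset[OF hol[OF i] e(2)] by (intro continuous_on_norm holomorphic_on_imp_continuous_on)
  from continuous_attains_sup[OF compact_cball _ this] e(1)
  obtain x where x: "x \<in> cball w0 e" "\<forall>y\<in>cball w0 e. cmod (g i y) \<le> cmod (g i x)" by auto
  then show ?thesis using ball[OF i, of x] e(2) by (intro exI[of _ "cmod (g i x)"]) auto
 qed
 then obtain r where r: "\<And>i. i \<in> I ==> 0 \<le> r i \<and> r i < 1 \<and> (\<forall>w\<in>cball w0 e. cmod (g i w) \<le> r i)" by metis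
 define R where "R = Max (insert 0 (r ` I))"
 have R: "0 \<le> R" "R < 1" using r I by (auto simp: R_def)
 have rR: "cmod (g i w) \<le> R" if "i \<in> I" "w \<in> cball w0 e" for i w
 proof -
  have "r i \<le> R" unfolding R_def using that I by (intro Max_ge) auto
  then show ?thesis using r[OF that(1)] that(2) by force
 qed
 define P where "P F w = (\<Sum>\<alpha>\<in>F. c \<alpha> * mon I \<alpha> (\<lambda>i\<in>I. g i w))" for F w
 have ulim: "uniform_limit (cball w0 e) P (\<lambda>w. f (\<lambda>i\<in>I. g i w)) (finite_subsets_at_top (multi_indices I))"
  unfolding P_def
 proof (rule Weierstrass_m_test_general'[where M="\<lambda>\<alpha>. cmod (c \<alpha> * of_real R ^ deg I \<alpha>)"])
  show "(\<lambda>\<alpha>. cmod (c \<alpha> * of_real R ^ deg I \<alpha>)) summable_on multi_indices I"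
   by (rule power_series_abs_summable[OF f R])
  show "((\<lambda>\<alpha>. c \<alpha> * mon I \<alpha> (\<lambda>i\<in>I. g i w)) has_sum f (\<lambda>i\<in>I. g i w)) (multi_indices I)" if "w \<in> cball w0 e" for w
  proof -
   have "(\<lambda>i\<in>I. g i w) \<in> polydisc I" using ball e(2) that by (auto simp: polydisc_def)
   then show ?thesis using f unfolding has_power_series_mon by blast
  qed
  fix \<alpha> w assume w: "w \<in> cball w0 e"
  have "cmod (mon I \<alpha> (\<lambda>i\<in>I. g i w)) = (\<Prod>i\<in>I. cmod (g i w) ^ \<alpha> i)"
   by (simp add: mon_def prod_norm[symmetric] norm_power)
  also have "\<dots> \<le> (\<Prod>i\<in>I. R ^ \<alpha> i)"
   by (rule prod_mono) (use rR w in \<open>auto intro!: power_mono\<close>)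
  also have "\<dots> = R ^ deg I \<alpha>" by (simp add: deg_def power_sum)
  finally show "cmod (c \<alpha> * mon I \<alpha> (\<lambda>i\<in>I. g i w)) \<le> cmod (c \<alpha> * of_real R ^ deg I \<alpha>)"
   using R by (simp add: norm_mult norm_power mult_left_mono)
 qed
 have Phol: "P F holomorphic_on cball w0 e" for F
  unfolding P_def[abs_def] mon_def
  using holomorphic_on_subset[OF hol e(2)] by (auto intro!: holomorphic_intros)
 have "\<forall>\<^sub>F F in finite_subsets_at_top (multi_indices I). continuous_on (cball w0 e) (P F) \<and> P F holomorphic_on ball w0 e"
 proof (intro always_eventually allI conjI)
  fix F show "continuous_on (cball w0 e) (P F)" by (rule holomorphic_on_imp_continuous_on[OF Phol])
  show "P F holomorphic_on ball w0 e" by (rule holomorphic_on_subset[OF Phol]) auto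
 qed
 from holomorphic_uniform_limit[OF this ulim]
 have "(\<lambda>w. f (\<lambda>i\<in>I. g i w)) holomorphic_on ball w0 e" by auto
 then have "(\<lambda>w. f (\<lambda>i\<in>I. g i w)) field_differentiable at w0"
  by (rule holomorphic_on_imp_differentiable_at) (use e(1) in auto)
 then show "(\<lambda>w. f (\<lambda>i\<in>I. g i w)) field_differentiable at w0 within \<Omega>"
  by (rule field_differentiable_at_within)
qed

lemma mon_add: "mon I (\<lambda>i\<in>I. \<alpha> i + \<beta> i) z = mon I \<alpha> z * mon I \<beta> z"
 by (simp add: mon_def power_add prod.distrib)

lemma power_series_mult:
 assumes I: "finite I" and f: "has_power_series I c f" and g: "has_power_series I d g"
 shows "\<exists>e. has_power_series I e (\<lambda>z. f z * g z)"
proof -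
 let ?mi = "multi_indices I"
 define s where "s = (\<lambda>(\<alpha>, \<beta>). \<lambda>i\<in>I. \<alpha> i + \<beta> i :: nat)"
 define P where "P \<gamma> = {p \<in> ?mi \<times> ?mi. s p = \<gamma>}" for \<gamma>
 define e where "e \<gamma> = (\<Sum>(\<alpha>,\<beta>)\<in>P \<gamma>. c \<alpha> * d \<beta>)" for \<gamma>
 have s_mi: "s p \<in> ?mi" for p by (auto simp: s_def multi_indices_def split: prod.split)
 have finP: "finite (P \<gamma>)" for \<gamma>
 proof (rule finite_subset)
  show "P \<gamma> \<subseteq> (\<Pi>\<^sub>E i\<in>I. {..\<gamma> i}) \<times> (\<Pi>\<^sub>E i\<in>I. {..\<gamma> i})"
   by (auto simp: P_def s_def multi_indices_def PiE_iff)
  show "finite ((\<Pi>\<^sub>E i\<in>I. {..\<gamma> i}) \<times> (\<Pi>\<^sub>E i\<in>I. {..\<gamma> i}))" using I by (auto intro: finite_PiE)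
 qed
 have "((\<lambda>\<gamma>. e \<gamma> * mon I \<gamma> z) has_sum f z * g z) ?mi" if z: "z \<in> polydisc I" for z
 proof -
  define a where "a \<alpha> = c \<alpha> * mon I \<alpha> z" for \<alpha>
  define b where "b \<beta> = d \<beta> * mon I \<beta> z" for \<beta>
  have a: "(a has_sum f z) ?mi" and b: "(b has_sum g z) ?mi"
   using f g z unfolding has_power_series_mon a_def[abs_def] b_def[abs_def] by blast+
  have aa: "(\<lambda>\<alpha>. cmod (a \<alpha>)) summable_on ?mi" and bb: "(\<lambda>\<alpha>. cmod (b \<alpha>)) summable_on ?mi"
   using a b summable_on_iff_abs_summable_on_complex has_sum_imp_summable by blast+
  have "(\<lambda>p. norm (case p of (x, y) \<Rightarrow> a x * b y)) summable_on (?mi \<times> ?mi)"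
  proof (rule iffD2[OF Infinite_Sum.abs_summable_on_Sigma_iff], intro conjI ballI)
   show "(\<lambda>y. norm (case (x, y) of (x, y) \<Rightarrow> a x * b y)) summable_on ?mi" for x
    using summable_on_cmult_right[OF bb, of "cmod (a x)"] by (simp add: norm_mult)
   show "(\<lambda>x. norm (\<Sum>\<^sub>\<infinity>y\<in>?mi. cmod (case (x, y) of (x, y) \<Rightarrow> a x * b y))) summable_on ?mi"
    using summable_on_cmult_left[OF aa, of "infsum (\<lambda>y. cmod (b y)) ?mi"]
    by (simp add: norm_mult infsum_cmult_right' infsum_nonneg)
  qed
  then have sm: "(\<lambda>(x,y). a x * b y) summable_on (?mi \<times> ?mi)" by (rule abs_summable_summable)
  have "((\<lambda>(x,y). a x * b y) has_sum (f z * g z)) (?mi \<times> ?mi)"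
  proof (rule has_sum_SigmaI[where g="\<lambda>x. a x * g z"])
   show "((\<lambda>y. case (x, y) of (x, y) \<Rightarrow> a x * b y) has_sum a x * g z) ?mi" for x
    using has_sum_cmult_right[OF b] by simp
   show "((\<lambda>x. a x * g z) has_sum f z * g z) ?mi" by (rule has_sum_cmult_left[OF a])
  qed (rule sm)
  then have "((\<lambda>(\<gamma>, p). (case p of (x,y) \<Rightarrow> a x * b y)) has_sum (f z * g z)) (Sigma ?mi P)"
   by (subst has_sum_reindex_bij_witness[where i="\<lambda>p. (s p, p)" and j="\<lambda>(\<gamma>, p). p" and T="?mi \<times> ?mi"])
    (auto simp: P_def s_mi)
  then have "((\<lambda>\<gamma>. \<Sum>(x,y)\<in>P \<gamma>. a x * b y) has_sum (f z * g z)) ?mi"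
   by (rule has_sum_SigmaD) (use finP in \<open>auto intro: has_sum_finite\<close>)
  moreover have "(\<Sum>(x,y)\<in>P \<gamma>. a x * b y) = e \<gamma> * mon I \<gamma> z" for \<gamma>
   unfolding e_def sum_distrib_right
   by (rule sum.cong[OF refl]) (auto simp: P_def s_def a_def b_def mon_add)
  ultimately show ?thesis by simp
 qed
 then show ?thesis unfolding has_power_series_mon by blast
qed

definition rad :: "nat \<Rightarrow> real" where "rad k = 1 - 1 / real (Suc k)"

lemma rad_bounds: "0 \<le> rad k" "rad k < 1" by (auto simp: rad_def field_simps)

lemma rad_tendsto: "rad \<longlonglongrightarrow> 1"
 unfolding rad_def[abs_def]
 using tendsto_diff[OF tendsto_const[of 1] LIMSEQ_inverse_real_of_nat] by (simp add: inverse_eq_divide)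

lemma rad_at_left: "filterlim rad (at_left 1) sequentially"
 unfolding filterlim_at using rad_tendsto rad_bounds(2) by (auto intro: always_eventually simp: less_le)

text \<open>Membership in \<open>H2\<close> is detected by square means over dilated tori, where a bounded factor can be estimated pointwise.\<close>
lemma partial_sum_from_dilations:
 assumes I: "finite I" and e: "has_power_series I e g" and F: "finite F" "F \<subseteq> multi_indices I"
  and B: "\<And>r. 0 \<le> r ==> r < 1 ==> (\<integral>\<zeta>. (cmod (g (dil I (of_real r) \<zeta>)))^2 \<partial>torus_measure I) \<le> B"
 shows "(\<Sum>\<alpha>\<in>F. (cmod (e \<alpha>))^2) \<le> B"
proof (rule LIMSEQ_le_const2)
 have "(\<lambda>k. \<Sum>\<alpha>\<in>F. (cmod (e \<alpha>))^2 * ((rad k)^2) ^ deg I \<alpha>) \<longlonglongrightarrow> (\<Sum>\<alpha>\<in>F. (cmod (e \<alpha>))^2 * (1^2) ^ deg I \<alpha>)"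
  by (rule tendsto_sum, rule tendsto_mult[OF tendsto_const], rule tendsto_power, rule tendsto_power, rule rad_tendsto)
 then show "(\<lambda>k. \<Sum>\<alpha>\<in>F. (cmod (e \<alpha>))^2 * ((rad k)^2) ^ deg I \<alpha>) \<longlonglongrightarrow> (\<Sum>\<alpha>\<in>F. (cmod (e \<alpha>))^2)" by simp
 have "(\<Sum>\<alpha>\<in>F. (cmod (e \<alpha>))^2 * ((rad k)^2) ^ deg I \<alpha>) \<le> B" for k
  using finite_sum_le_has_sum[OF dil_parseval(2)[OF I e rad_bounds, of k] F(1,2)] B[OF rad_bounds, of k] by simp
 then show "\<exists>N. \<forall>k\<ge>N. (\<Sum>\<alpha>\<in>F. (cmod (e \<alpha>))^2 * ((rad k)^2) ^ deg I \<alpha>) \<le> B" by blast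
qed

lemma dil_norm_le:
 assumes I: "finite I" and h: "h \<in> H2 I" and r: "0 \<le> r" "r < 1"
 shows "(\<integral>\<zeta>. (cmod (h (dil I (of_real r) \<zeta>)))^2 \<partial>torus_measure I) \<le> (H2_norm I h)^2"
proof (rule has_sum_mono[OF dil_parseval(2)[OF I H2_power_series[OF h] r] H2_norm_has_sum[OF I h]])
 fix \<alpha>
 have "(r^2) ^ deg I \<alpha> \<le> 1" using r by (intro power_le_one) auto
 then show "(cmod (coeffs I h \<alpha>))^2 * (r^2) ^ deg I \<alpha> \<le> (cmod (coeffs I h \<alpha>))^2"
  by (intro mult_left_le) auto
qed

lemma
 assumes I: "finite I" and f: "holomorphic_polydisc I f" and B: "\<And>z. z \<in> polydisc I ==> cmod (f z) \<le> B" "0 \<le> B" and h: "h \<in> H2 I"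
 shows bounded_mult_H2: "(\<lambda>z. f z * h z) \<in> H2 I"
  and bounded_mult_norm: "H2_norm I (\<lambda>z. f z * h z) \<le> B * H2_norm I h"
proof -
 obtain c where c: "has_power_series I c f" using f by (auto simp: holomorphic_polydisc_def)
 obtain e where e: "has_power_series I e (\<lambda>z. f z * h z)"
  using power_series_mult[OF I c H2_power_series[OF h]] by blast
 have int: "(\<integral>\<zeta>. (cmod (f (dil I (of_real r) \<zeta>) * h (dil I (of_real r) \<zeta>)))^2 \<partial>torus_measure I) \<le> (B * H2_norm I h)^2"
  if r: "0 \<le> r" "r < 1" for r
 proof -
  have "(\<integral>\<zeta>. (cmod (f (dil I (of_real r) \<zeta>) * h (dil I (of_real r) \<zeta>)))^2 \<partial>torus_measure I)
   \<le> (\<integral>\<zeta>. B^2 * (cmod (h (dil I (of_real r) \<zeta>)))^2 \<partial>torus_measure I)"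
  proof (rule integral_mono[OF dil_parseval(3)[OF I e r]])
   show "integrable (torus_measure I) (\<lambda>\<zeta>. B^2 * (cmod (h (dil I (of_real r) \<zeta>)))^2)"
    by (rule integrable_mult_right[OF dil_parseval(3)[OF I H2_power_series[OF h] r]])
   fix \<zeta> assume "\<zeta> \<in> space (torus_measure I)"
   then have "dil I (of_real r) \<zeta> \<in> polydisc I" using r by (intro dil_in_polydisc) auto
   then have "(cmod (f (dil I (of_real r) \<zeta>)))^2 \<le> B^2" by (intro power_mono B) auto
   then show "(cmod (f (dil I (of_real r) \<zeta>) * h (dil I (of_real r) \<zeta>)))^2 \<le> B^2 * (cmod (h (dil I (of_real r) \<zeta>)))^2"
    unfolding norm_mult power_mult_distrib by (rule mult_right_mono) simp
  qed
  also have "\<dots> = B^2 * (\<integral>\<zeta>. (cmod (h (dil I (of_real r) \<zeta>)))^2 \<partial>torus_measure I)" by simp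
  also have "\<dots> \<le> B^2 * (H2_norm I h)^2" by (rule mult_left_mono[OF dil_norm_le[OF I h r]]) simp
  finally show ?thesis by (simp add: power_mult_distrib)
 qed
 have part: "(\<Sum>\<alpha>\<in>F. (cmod (e \<alpha>))^2) \<le> (B * H2_norm I h)^2" if "finite F" "F \<subseteq> multi_indices I" for F
  by (rule partial_sum_from_dilations[OF I e that int])
 show X: "(\<lambda>z. f z * h z) \<in> H2 I"
  by (rule H2_I[OF e sq_summable_bdd[OF part]]) (simp_all add: H2_off[OF h])
 have co: "coeffs I (\<lambda>z. f z * h z) \<alpha> = e \<alpha>" if "\<alpha> \<in> multi_indices I" for \<alpha> by (rule coeffs_eq[OF I e that])
 show "H2_norm I (\<lambda>z. f z * h z) \<le> B * H2_norm I h"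
 proof (rule H2_norm_leI[OF I X])
  show "0 \<le> B * H2_norm I h" by (intro mult_nonneg_nonneg B H2_norm_ge0)
  fix F assume F: "finite F" "F \<subseteq> multi_indices I"
  have "(\<Sum>\<alpha>\<in>F. (cmod (coeffs I (\<lambda>z. f z * h z) \<alpha>))^2) = (\<Sum>\<alpha>\<in>F. (cmod (e \<alpha>))^2)"
   using F by (intro sum.cong refl) (simp add: co subset_iff)
  then show "(\<Sum>\<alpha>\<in>F. (cmod (coeffs I (\<lambda>z. f z * h z) \<alpha>))^2) \<le> (B * H2_norm I h)^2" using part[OF F] by simp
 qed
qed

definition one_on :: "nat set \<Rightarrow> func" where "one_on I = (\<lambda>z. if z \<in> polydisc I then 1 else 0)"

lemma one_on_poly: "one_on I = poly_on I {\<lambda>i\<in>I. 0} (\<lambda>_. 1)"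
 by (auto simp: one_on_def poly_on_def mon_def fun_eq_iff)

lemma zero_index: "(\<lambda>i\<in>I. 0) \<in> multi_indices I" by (simp add: multi_indices_def)

lemma one_on_H2: "finite I ==> one_on I \<in> H2 I"
 unfolding one_on_poly using zero_index by (intro poly_on_H2) auto

lemma one_on_norm: "finite I ==> H2_norm I (one_on I) = 1"
 using poly_on_norm[of I "{\<lambda>i\<in>I. 0}" "\<lambda>_. 1"] zero_index H2_norm_ge0[of I "one_on I"]
 unfolding one_on_poly by (simp add: power2_eq_1_iff)

lemma bounded_H2:
 assumes "finite I" "holomorphic_polydisc I f" "bounded (f ` polydisc I)"
 shows "(\<lambda>z. if z \<in> polydisc I then f z else 0) \<in> H2 I"
proof -
 obtain B where B: "\<And>z. z \<in> polydisc I ==> cmod (f z) \<le> B" "B > 0"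
  using assms(3) unfolding bounded_pos by auto
 have "(\<lambda>z. f z * one_on I z) \<in> H2 I"
  by (rule bounded_mult_H2[OF assms(1,2) B(1) _ one_on_H2[OF assms(1)]]) (use B in auto)
 moreover have "(\<lambda>z. f z * one_on I z) = (\<lambda>z. if z \<in> polydisc I then f z else 0)" by (auto simp: one_on_def)
 ultimately show ?thesis by simp
qed

definition is_poly :: "nat set \<Rightarrow> func \<Rightarrow> bool" where
 "is_poly I h \<longleftrightarrow> (\<exists>F c. finite F \<and> F \<subseteq> multi_indices I \<and> h = poly_on I F c)"

lemma is_poly_diff:
 assumes "is_poly I g" "is_poly I h" shows "is_poly I (\<lambda>z. g z - h z)"
proof -
 obtain F c G d where *: "finite F" "F \<subseteq> multi_indices I" "g = poly_on I F c" "finite G" "G \<subseteq> multi_indices I" "h = poly_on I G d"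
  using assms by (auto simp: is_poly_def)
 have "(\<Sum>\<alpha>\<in>F. c \<alpha> * mon I \<alpha> z) = (\<Sum>\<alpha>\<in>F \<union> G. (if \<alpha> \<in> F then c \<alpha> else 0) * mon I \<alpha> z)"
  "(\<Sum>\<alpha>\<in>G. d \<alpha> * mon I \<alpha> z) = (\<Sum>\<alpha>\<in>F \<union> G. (if \<alpha> \<in> G then d \<alpha> else 0) * mon I \<alpha> z)" for z
  using * by (auto intro!: sum.mono_neutral_cong_left)
 then have "(\<lambda>z. g z - h z) = poly_on I (F \<union> G) (\<lambda>\<alpha>. (if \<alpha> \<in> F then c \<alpha> else 0) - (if \<alpha> \<in> G then d \<alpha> else 0))"
  unfolding *(3,6) poly_on_def by (auto simp: fun_eq_iff left_diff_distrib sum_subtractf)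
 then show ?thesis unfolding is_poly_def using * by (intro exI[of _ "F \<union> G"]) auto
qed

lemma is_poly_H2: "finite I ==> is_poly I h ==> h \<in> H2 I"
 by (auto simp: is_poly_def intro: poly_on_H2)

lemma is_poly_trunc: "finite I ==> is_poly I (poly_on I (ibox I N) c)"
 unfolding is_poly_def by (intro exI[of _ "ibox I N"] exI[of _ c] conjI finite_box box_subset refl)

lemma is_poly_bounded:
 assumes I: "finite I" and h: "is_poly I h"
 shows "holomorphic_polydisc I h" "\<exists>B\<ge>0. \<forall>z\<in>polydisc I. cmod (h z) \<le> B"
proof -
 obtain F c where *: "finite F" "F \<subseteq> multi_indices I" "h = poly_on I F c" using h by (auto simp: is_poly_def)
 show "holomorphic_polydisc I h" unfolding holomorphic_polydisc_def *(3)
  using poly_on_power_series[OF I *(1,2)] by blast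
 have "cmod (h z) \<le> (\<Sum>\<alpha>\<in>F. cmod (c \<alpha>))" if z: "z \<in> polydisc I" for z
 proof -
  have "cmod (mon I \<alpha> z) \<le> 1" for \<alpha>
   unfolding mon_def prod_norm[symmetric] norm_power
   by (rule prod_le_1) (use z in \<open>auto simp: polydisc_def PiE_iff intro!: power_le_one intro: less_imp_le\<close>)
  then have "cmod (\<Sum>\<alpha>\<in>F. c \<alpha> * mon I \<alpha> z) \<le> (\<Sum>\<alpha>\<in>F. cmod (c \<alpha>))"
   by (intro sum_norm_le) (simp add: norm_mult mult_left_le)
  then show ?thesis using z by (simp add: *(3) poly_on_def)
 qed
 then show "\<exists>B\<ge>0. \<forall>z\<in>polydisc I. cmod (h z) \<le> B" by (intro exI[of _ "\<Sum>\<alpha>\<in>F. cmod (c \<alpha>)"]) (auto intro: sum_nonneg)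
qed

lemma poly_mult_H2:
 assumes I: "finite I" and h: "is_poly I h" and g: "g \<in> H2 I"
 shows "(\<lambda>z. g z * h z) \<in> H2 I"
proof -
 obtain B where B: "0 \<le> B" "\<And>z. z \<in> polydisc I ==> cmod (h z) \<le> B" using is_poly_bounded(2)[OF I h] by blast
 show ?thesis using bounded_mult_H2[OF I is_poly_bounded(1)[OF I h] B(2,1) g] by (simp add: mult.commute)
qed

text \<open>A bound on polynomials suffices: the products with Taylor polynomials form a Cauchy sequence, and its limit is identified pointwise.\<close>
lemma multiplier_extend:
 assumes I: "finite I" and g: "g \<in> H2 I" and C: "\<And>p. is_poly I p ==> H2_norm I (\<lambda>z. g z * p z) \<le> C * H2_norm I p" and h: "h \<in> H2 I"
 shows "(\<lambda>z. g z * h z) \<in> H2 I \<and> H2_tends I (\<lambda>N z. g z * poly_on I (ibox I N) (coeffs I h) z) (\<lambda>z. g z * h z)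
   \<and> H2_norm I (\<lambda>z. g z * h z) \<le> C * H2_norm I h"
proof -
 interpret fun_hilbert "H2 I" "H2_inner I" "H2_norm I" by (rule H2_hilbert[OF I])
 define p where "p N = poly_on I (ibox I N) (coeffs I h)" for N
 have pp: "is_poly I (p N)" for N unfolding p_def by (rule is_poly_trunc[OF I])
 have pX: "p N \<in> H2 I" for N by (rule is_poly_H2[OF I pp])
 have pt: "tends p h" unfolding p_def by (rule poly_tends[OF I h])
 have gpX: "(\<lambda>z. g z * p N z) \<in> H2 I" for N by (rule poly_mult_H2[OF I pp g])
 have "cauchy (\<lambda>N z. g z * p N z)"
 proof (rule cauchy_bounded_map[OF tends_cauchy[OF pt pX h] _ pX])
  fix i j
  show "H2_norm I (\<lambda>x. g x * p i x - g x * p j x) \<le> C * H2_norm I (\<lambda>x. p i x - p j x)"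
   using C[OF is_poly_diff[OF pp pp], of i j] by (simp add: right_diff_distrib)
 qed
 then obtain l where l: "l \<in> H2 I" "tends (\<lambda>N z. g z * p N z) l" using complete[of "\<lambda>N z. g z * p N z"] gpX by blast
 have "l z = g z * h z" for z
  using LIMSEQ_unique[OF tends_pointwise[OF I l(2) gpX l(1), of z] tendsto_mult[OF tendsto_const tends_pointwise[OF I pt pX h, of z]]] .
 then have leq: "l = (\<lambda>z. g z * h z)" by auto
 have "H2_norm I l \<le> C * H2_norm I h"
 proof (rule LIMSEQ_le[OF tends_nm[OF l(2) gpX l(1)] tendsto_mult[OF tendsto_const tends_nm[OF pt pX h]]])
  show "\<exists>N. \<forall>n\<ge>N. H2_norm I (\<lambda>z. g z * p n z) \<le> C * H2_norm I (p n)" using C[OF pp] by blast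
 qed
 then show ?thesis using l unfolding leq p_def by blast
qed

text \<open>Iterating the multiplier on the constant 1 and evaluating at \<open>z\<close> gives \<open>(cmod (g z)) ^ k \<le> K * C ^ k\<close> for all \<open>k\<close>.\<close>
lemma multiplier_bounded:
 assumes I: "finite I" and C0: "0 \<le> C"
  and C: "\<And>h. h \<in> H2 I ==> (\<lambda>z. g z * h z) \<in> H2 I \<and> H2_norm I (\<lambda>z. g z * h z) \<le> C * H2_norm I h"
  and z: "z \<in> polydisc I"
 shows "cmod (g z) \<le> C"
proof (rule ccontr)
 assume "\<not> cmod (g z) \<le> C"
 then have gt: "C < cmod (g z)" by simp
 obtain K where K: "K \<ge> 0" "\<And>f. f \<in> H2 I ==> cmod (f z) \<le> K * H2_norm I f" using eval_bound[OF I z] by blast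
 have pw: "(\<lambda>x. g x ^ k * one_on I x) \<in> H2 I \<and> H2_norm I (\<lambda>x. g x ^ k * one_on I x) \<le> C ^ k" for k
 proof (induction k)
  case 0 then show ?case using one_on_H2[OF I] one_on_norm[OF I] by simp
 next
  case (Suc k)
  have eq: "(\<lambda>x. g x ^ Suc k * one_on I x) = (\<lambda>x. g x * (g x ^ k * one_on I x))" by (simp add: mult.assoc)
  have "C * H2_norm I (\<lambda>x. g x ^ k * one_on I x) \<le> C * C ^ k" using Suc C0 by (intro mult_left_mono) auto
  then show ?case unfolding eq using C[of "\<lambda>x. g x ^ k * one_on I x"] Suc by auto
 qed
 have le: "cmod (g z) ^ k \<le> K * C ^ k" for k
 proof -
  have "cmod (g z) ^ k = cmod (g z ^ k * one_on I z)" using z by (simp add: one_on_def norm_power)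
  also have "\<dots> \<le> K * H2_norm I (\<lambda>x. g x ^ k * one_on I x)" using K(2)[of "\<lambda>x. g x ^ k * one_on I x"] pw by blast
  also have "\<dots> \<le> K * C ^ k" using pw K(1) by (intro mult_left_mono) auto
  finally show ?thesis .
 qed
 show False
 proof (cases "C = 0")
  case True then show False using le[of 1] gt by simp
 next
  case False
  then have Cp: "C > 0" using C0 by simp
  obtain k where k: "K < (cmod (g z) / C) ^ k" using real_arch_pow[of "cmod (g z) / C" K] gt Cp by auto
  then show False using le[of k] Cp by (simp add: power_divide field_simps)
 qed
qed

subsection \<open>The coordinate shifts\<close>

definition up :: "nat \<Rightarrow> (nat \<Rightarrow> nat) \<Rightarrow> (nat \<Rightarrow> nat)" where "up i \<alpha> = \<alpha>(i := Suc (\<alpha> i))"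

lemma up_in: "i \<in> I ==> \<alpha> \<in> multi_indices I ==> up i \<alpha> \<in> multi_indices I"
 by (auto simp: up_def multi_indices_def PiE_iff extensional_def)

lemma mon_up: "finite I ==> i \<in> I ==> mon I (up i \<alpha>) z = z i * mon I \<alpha> z"
 unfolding mon_def up_def by (subst (1 2) prod.remove[of I i]) (auto intro!: prod.cong)

text \<open>Multiplication by a coordinate only moves coefficients along \<open>up i\<close>.\<close>
lemma has_sum_up:
 assumes "i \<in> I" "\<And>\<alpha>. \<alpha> \<in> multi_indices I ==> \<alpha> i = 0 ==> f \<alpha> = 0"
 shows "(f has_sum s) (multi_indices I) \<longleftrightarrow> ((\<lambda>\<alpha>. f (up i \<alpha>)) has_sum s) (multi_indices I)"
proof -
 have inj: "inj_on (up i) (multi_indices I)"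
 proof (rule inj_onI)
  fix \<alpha> \<beta> assume "up i \<alpha> = up i \<beta>"
  then have "\<alpha> j = \<beta> j" for j unfolding up_def fun_eq_iff by (cases "j = i") (auto dest: spec[of _ j] spec[of _ i])
  then show "\<alpha> = \<beta>" by auto
 qed
 have img: "\<alpha> \<in> up i ` multi_indices I" if "\<alpha> \<in> multi_indices I" "\<alpha> i \<noteq> 0" for \<alpha>
 proof (rule image_eqI)
  show "\<alpha> = up i (\<alpha>(i := \<alpha> i - 1))" using that by (auto simp: up_def)
  show "\<alpha>(i := \<alpha> i - 1) \<in> multi_indices I" using that assms(1) by (auto simp: multi_indices_def PiE_iff extensional_def)
 qed
 have "(f has_sum s) (multi_indices I) \<longleftrightarrow> (f has_sum s) (up i ` multi_indices I)"
  by (rule has_sum_cong_neutral) (use assms img up_in in \<open>auto\<close>)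
 also have "\<dots> \<longleftrightarrow> ((\<lambda>\<alpha>. f (up i \<alpha>)) has_sum s) (multi_indices I)"
  using has_sum_reindex[OF inj, of f s] by (simp add: o_def)
 finally show ?thesis .
qed

lemma
 assumes I: "finite I" and i: "i \<in> I" and f: "f \<in> H2 I"
 shows shift_H2: "(\<lambda>z. z i * f z) \<in> H2 I"
  and coeffs_shift_up: "\<alpha> \<in> multi_indices I ==> coeffs I (\<lambda>z. z i * f z) (up i \<alpha>) = coeffs I f \<alpha>"
  and coeffs_shift_0: "\<alpha> \<in> multi_indices I ==> \<alpha> i = 0 ==> coeffs I (\<lambda>z. z i * f z) \<alpha> = 0"
  and shift_norm: "H2_norm I (\<lambda>z. z i * f z) = H2_norm I f"
proof -
 define d where "d \<alpha> = (if \<alpha> i = 0 then 0 else coeffs I f (\<alpha>(i := \<alpha> i - 1)))" for \<alpha>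
 have dup: "d (up i \<alpha>) = coeffs I f \<alpha>" for \<alpha> by (simp add: d_def up_def)
 have ps: "has_power_series I d (\<lambda>z. z i * f z)"
  unfolding has_power_series_mon
 proof
  fix z assume z: "z \<in> polydisc I"
  show "((\<lambda>\<alpha>. d \<alpha> * mon I \<alpha> z) has_sum z i * f z) (multi_indices I)"
  proof (rule iffD2[OF has_sum_up[OF i]])
   show "((\<lambda>\<alpha>. d (up i \<alpha>) * mon I (up i \<alpha>) z) has_sum z i * f z) (multi_indices I)"
    using has_sum_cmult_right[OF H2_eval[OF f z], of "z i"]
    by (simp add: dup mon_up[OF I i] mult.left_commute)
  qed (simp add: d_def)
 qed
 have hs: "((\<lambda>\<alpha>. (cmod (d \<alpha>))^2) has_sum (H2_norm I f)^2) (multi_indices I)"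
  by (rule iffD2[OF has_sum_up[OF i]]) (simp add: d_def, simp add: dup H2_norm_has_sum[OF I f])
 show X: "(\<lambda>z. z i * f z) \<in> H2 I"
  by (rule H2_I[OF ps]) (use hs in \<open>auto simp: sq_summable_def summable_on_def H2_off[OF f]\<close>)
 have co: "coeffs I (\<lambda>z. z i * f z) \<alpha> = d \<alpha>" if "\<alpha> \<in> multi_indices I" for \<alpha> by (rule coeffs_eq[OF I ps that])
 show "\<alpha> \<in> multi_indices I ==> coeffs I (\<lambda>z. z i * f z) (up i \<alpha>) = coeffs I f \<alpha>"
  by (simp add: co up_in[OF i] dup)
 show "\<alpha> \<in> multi_indices I ==> \<alpha> i = 0 ==> coeffs I (\<lambda>z. z i * f z) \<alpha> = 0"
  by (simp add: co d_def)
 have "(H2_norm I (\<lambda>z. z i * f z))^2 = (H2_norm I f)^2"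
  by (rule H2_norm_sq_eqI[OF I X]) (use hs in \<open>simp add: co cong: has_sum_cong\<close>)
 then show "H2_norm I (\<lambda>z. z i * f z) = H2_norm I f"
  by (rule power2_eq_imp_eq) (rule H2_norm_ge0)+
qed

lemma shift_inner:
 assumes I: "finite I" and i: "i \<in> I" and f: "f \<in> H2 I" and g: "g \<in> H2 I"
 shows "H2_inner I (\<lambda>z. z i * f z) (\<lambda>z. z i * g z) = H2_inner I f g"
proof -
 interpret fun_hilbert "H2 I" "H2_inner I" "H2_norm I" by (rule H2_hilbert[OF I])
 show ?thesis
  by (rule isometry_ip[of "\<lambda>f z. z i * f z"])
    (simp_all add: shift_H2[OF I i] shift_norm[OF I i] distrib_left mult.left_commute f g)
qed

section \<open>Fatou's theorem\<close>

lemma reflected_kernel_bound: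
 fixes u :: complex
 assumes u: "cmod u = 1" and r: "0 < r" "r < 1"
 shows "cmod (1 / (u - of_real r)^2 - 1 / (u - of_real (1/r))^2) \<le> 4 * (1 - r) / cmod (u - of_real r) ^ 3"
  and "1 - r \<le> cmod (u - of_real r)"
  and "u \<noteq> of_real (1/r)"
proof -
 define a where "a = u - of_real r"
 define b where "b = u - of_real (1/r)"
 have a0: "1 - r \<le> cmod a" using norm_triangle_ineq2[of u "of_real r"] u r by (simp add: a_def)
 then show "1 - r \<le> cmod (u - of_real r)" by (simp add: a_def)
 have an: "cmod a > 0" using a0 r by linarith
 have "cmod (of_real r * b) = cmod (cnj u * (of_real r * b))" using u by (simp add: norm_mult)
 also have "cnj u * (of_real r * b) = of_real r * (u * cnj u) - cnj u * of_real (r * (1/r))"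
  unfolding b_def by (simp add: algebra_simps)
 also have "\<dots> = - cnj a" using r u by (simp add: a_def complex_norm_square[symmetric])
 finally have rb: "r * cmod b = cmod a" using r by (simp add: norm_mult)
 then have bn: "cmod b > 0" using an r by (metis less_irrefl mult_zero_right norm_ge_zero order_le_less)
 then show "u \<noteq> of_real (1/r)" by (auto simp: b_def)
 have bma: "b - a = of_real (r - 1/r)" by (simp add: a_def b_def)
 have nb: "cmod b = cmod a / r" using rb r by (simp add: field_simps)
 have "1 / a^2 - 1 / b^2 = (b - a) * (b + a) / (a^2 * b^2)"
  using an bn by (simp add: field_simps power2_eq_square)
 then have "cmod (1 / a^2 - 1 / b^2) = \<bar>r - 1/r\<bar> * cmod (b + a) / ((cmod a)^2 * (cmod b)^2)"
  unfolding bma by (simp only: norm_mult norm_divide norm_power norm_of_real)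
 also have "\<bar>r - 1/r\<bar> = (1 - r^2) / r"
 proof -
  have "r - 1/r = - ((1 - r\<^sup>2) / r)" using r by (simp add: field_simps power2_eq_square)
  moreover have "0 \<le> (1 - r^2) / r" using r by (simp add: power_le_one)
  ultimately show ?thesis by linarith
 qed
 also have "(1 - r^2) / r * cmod (b + a) / ((cmod a)^2 * (cmod b)^2)
   \<le> (1 - r^2) / r * (cmod a * (1 + r) / r) / ((cmod a)^2 * (cmod b)^2)"
 proof (intro divide_right_mono mult_left_mono)
  show "cmod (b + a) \<le> cmod a * (1 + r) / r"
   using norm_triangle_ineq[of b a] r unfolding nb by (simp add: field_simps)
  show "0 \<le> (1 - r^2) / r" using r by (simp add: power_le_one)
 qed simp
 also have "\<dots> = (1 - r) * (1 + r) * (1 + r) / cmod a ^ 3"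
  unfolding nb using an r by (simp add: field_simps power2_eq_square power3_eq_cube)
 also have "\<dots> \<le> 4 * (1 - r) / cmod a ^ 3"
 proof (rule divide_right_mono)
  have "(1 + r) * (1 + r) \<le> 2 * 2" using r by (intro mult_mono) auto
  then have "(1 - r) * ((1 + r) * (1 + r)) \<le> (1 - r) * 4" using r by (intro mult_left_mono) auto
  then show "(1 - r) * (1 + r) * (1 + r) \<le> 4 * (1 - r)" by (simp add: mult.assoc)
 qed simp
 finally show "cmod (1 / (u - of_real r)^2 - 1 / (u - of_real (1/r))^2) \<le> 4 * (1 - r) / cmod (u - of_real r) ^ 3"
  by (simp add: a_def b_def)
qed

lemma poisson_integral:
 assumes r: "0 < r" "r < 1"
 shows "((\<lambda>x. 1 / (cmod (circlepath 0 1 x - of_real r))^2) has_integral 1 / (1 - r^2)) {0..1}"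
proof -
 have "((\<lambda>u. (1 / (1 - of_real r * u)) / (u - of_real r)) has_contour_integral (2 * of_real pi * \<i> * (1 / (1 - of_real r * of_real r)))) (circlepath 0 1)"
 proof (rule Cauchy_integral_circlepath)
  have ne: "1 - of_real r * u \<noteq> 0" if "cmod u \<le> 1" for u :: complex
  proof
   assume "1 - of_real r * u = 0"
   then have "cmod (of_real r * u) = 1" by (metis eq_iff_diff_eq_0 norm_one)
   moreover have "cmod (of_real r * u) \<le> r" using that r by (simp add: norm_mult mult_left_le)
   ultimately show False using r by linarith
  qed
  show "continuous_on (cball 0 1) (\<lambda>u::complex. 1 / (1 - of_real r * u))"
   by (intro continuous_intros) (use ne in auto)
  show "(\<lambda>u::complex. 1 / (1 - of_real r * u)) holomorphic_on ball 0 1"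
   by (intro holomorphic_intros) (use ne in \<open>auto simp: less_imp_le\<close>)
 qed (use r in simp)
 then have "((\<lambda>x. (1 / (1 - of_real r * circlepath 0 1 x)) / (circlepath 0 1 x - of_real r) * vector_derivative (circlepath 0 1) (at x within {0..1}))
   has_integral (2 * of_real pi * \<i> * (1 / (1 - of_real r * of_real r)))) {0..1}"
  by (simp add: has_contour_integral_def)
 then have "((\<lambda>x. (2 * of_real pi * \<i>) * of_real (1 / (cmod (circlepath 0 1 x - of_real r))^2))
   has_integral (2 * of_real pi * \<i> * (1 / (1 - of_real r * of_real r)))) {0..1}"
 proof (rule has_integral_eq[rotated])
  fix x :: real assume x: "x \<in> {0..1}"
  define u where "u = circlepath 0 1 x"
  have u1: "cmod u = 1" by (simp add: u_def circlepath)
  have vd: "vector_derivative (circlepath 0 1) (at x within {0..1}) = 2 * pi * \<i> * u"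
   using x vector_derivative_circlepath01[of x 0 1] by (simp add: u_def circlepath)
  have uu: "u * cnj u = 1" using complex_norm_square[of u] u1 by simp
  have "1 - of_real r * u = u * cnj (u - of_real r)" by (simp add: right_diff_distrib uu mult.commute)
  then have "(1 / (1 - of_real r * u)) / (u - of_real r) * (2 * pi * \<i> * u) = (2 * of_real pi * \<i>) * (1 / (cnj (u - of_real r) * (u - of_real r)))"
   using u1 by auto
  also have "cnj (u - of_real r) * (u - of_real r) = of_real ((cmod (u - of_real r))^2)"
   unfolding complex_norm_square by (simp add: mult.commute)
  finally show "1 / (1 - of_real r * circlepath 0 1 x) / (circlepath 0 1 x - of_real r) * vector_derivative (circlepath 0 1) (at x within {0..1})
   = 2 * of_real pi * \<i> * of_real (1 / (cmod (circlepath 0 1 x - of_real r))^2)"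
   unfolding vd u_def[symmetric] by simp
 qed
 from has_integral_mult_right[OF this, of "1 / (2 * of_real pi * \<i>)"]
 have "((\<lambda>x. complex_of_real (1 / (cmod (circlepath 0 1 x - of_real r))^2)) has_integral (1 / (1 - of_real r * of_real r))) {0..1}"
  by simp
 moreover have "1 / (1 - of_real r * of_real r) = complex_of_real (1 / (1 - r^2))" by (simp add: power2_eq_square)
 ultimately have "((\<lambda>x. complex_of_real (1 / (cmod (circlepath 0 1 x - of_real r))^2)) has_integral complex_of_real (1 / (1 - r^2))) {0..1}"
  by (simp only:)
 from has_integral_Re[OF this] show ?thesis by (simp only: Re_complex_of_real)
qed

text \<open>Cauchy's formula for the derivative. The pole \<open>1/r\<close> lies outside the disc, so its kernel contributes nothing to the integral, and subtracting it gains a factor of order \<open>1 - r\<close>.\<close>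
lemma deriv_reflected_formula:
 assumes cont: "continuous_on (cball 0 1) R" and hol: "R holomorphic_on ball 0 1" and r: "0 < r" "r < 1"
 shows "((\<lambda>u. R u * (1 / (u - of_real r)^2 - 1 / (u - of_real (1/r))^2)) has_contour_integral (2 * of_real pi * \<i> * deriv R (of_real r))) (circlepath 0 1)"
proof -
 note C = Cauchy_derivative_integral_circlepath[OF cont hol, of "of_real r"]
 have "deriv R (of_real r) = 1 / (2 * of_real pi * \<i>) * contour_integral (circlepath 0 1) (\<lambda>u. R u / (u - of_real r)^2)"
  using C(2) r by (intro DERIV_imp_deriv) auto
 then have 1: "((\<lambda>u. R u / (u - of_real r)^2) has_contour_integral (2 * of_real pi * \<i> * deriv R (of_real r))) (circlepath 0 1)"
  using has_contour_integral_integral[OF C(1)] r by simp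
 have ne: "u - of_real (1/r) \<noteq> 0" if "cmod u \<le> 1" for u :: complex
 proof
  assume "u - of_real (1/r) = 0"
  then have "cmod u = 1 / r" using r by (simp add: norm_divide)
  moreover have "1 / r > 1" using r by simp
  ultimately show False using that by linarith
 qed
 have "((\<lambda>u. (u * R u / (u - of_real (1/r))^2) / (u - 0)) has_contour_integral (2 * of_real pi * \<i> * (0 * R 0 / (0 - of_real (1/r))^2))) (circlepath 0 1)"
 proof (rule Cauchy_integral_circlepath)
  show "continuous_on (cball 0 1) (\<lambda>u. u * R u / (u - of_real (1/r))^2)"
   by (intro continuous_intros cont) (use ne in auto)
  show "(\<lambda>u. u * R u / (u - of_real (1/r))^2) holomorphic_on ball 0 1"
   by (intro holomorphic_intros hol) (use ne in \<open>auto simp: less_imp_le\<close>)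
 qed simp
 then have "((\<lambda>u. (u * R u / (u - of_real (1/r))^2) / u) has_contour_integral 0) (circlepath 0 1)" by simp
 then have 2: "((\<lambda>u. R u / (u - of_real (1/r))^2) has_contour_integral 0) (circlepath 0 1)"
  by (rule has_contour_integral_eq) auto
 show ?thesis
  using has_contour_integral_diff[OF 1 2] by (simp add: right_diff_distrib)
qed

text \<open>Near 1 the difference kernel times \<open>cmod (u - 1)\<close> is controlled by the Poisson kernel, and away from 1 it tends to 0 uniformly.\<close>
lemma deriv_radial_limit_0:
 assumes cont: "continuous_on (cball 0 1) R" and hol: "R holomorphic_on ball 0 1"
  and small: "\<And>e. e > 0 ==> \<exists>d>0. \<forall>u. cmod u = 1 \<longrightarrow> cmod (u - 1) < d \<longrightarrow> cmod (R u) \<le> e * cmod (u - 1)"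
 shows "((\<lambda>r. deriv R (of_real r)) \<longlongrightarrow> 0) (at_left 1)"
proof (rule tendstoI)
 fix e :: real assume e: "0 < e"
 have "bounded (R ` cball 0 1)" by (intro compact_imp_bounded compact_continuous_image cont compact_cball)
 then obtain M where M: "M > 0" "\<And>u. cmod u \<le> 1 ==> cmod (R u) \<le> M" unfolding bounded_pos by auto
 define \<epsilon> where "\<epsilon> = e / 16"
 have \<epsilon>: "\<epsilon> > 0" using e by (simp add: \<epsilon>_def)
 obtain d where d: "d > 0" "\<And>u. cmod u = 1 ==> cmod (u - 1) < d ==> cmod (R u) \<le> \<epsilon> * cmod (u - 1)"
  using small[OF \<epsilon>] by blast
 define D where "D r = M * (32 * (1 - r) / d ^ 3)" for r
 have "((\<lambda>r. D r) \<longlongrightarrow> M * (32 * (1 - 1) / d ^ 3)) (at_left 1)"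
  unfolding D_def by (intro tendsto_intros) (use d in auto)
 then have ev1: "\<forall>\<^sub>F r in at_left 1. D r < e / 2" by (rule order_tendstoD(2)) (use e in simp)
 have ev2: "\<forall>\<^sub>F r::real in at_left 1. max 0 (1 - d/2) < r" 
  by (rule eventually_at_left_real[of "max 0 (1 - d/2)" 1, THEN eventually_mono]) (use d in auto)
 have ev3: "\<forall>\<^sub>F r::real in at_left 1. r < 1" by (simp add: eventually_at_filter)
 show "\<forall>\<^sub>F r in at_left 1. dist (deriv R (of_real r)) 0 < e"
  using ev1 ev2 ev3
 proof eventually_elim
  case (elim r)
  then have r: "0 < r" "r < 1" and rd: "1 - r < d/2" by auto
  define A where "A = 8 * \<epsilon> * (1 - r)"
  define K where "K u = 1 / (u - of_real r)^2 - 1 / (u - of_real (1/r))^2" for u :: complex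
  have bound: "cmod (R u * K u) \<le> A * (1 / (cmod (u - of_real r))^2) + D r" if u: "cmod u = 1" for u
  proof -
   define a where "a = cmod (u - of_real r)"
   have a: "1 - r \<le> a" "a > 0" using reflected_kernel_bound(2)[OF u r] r by (auto simp: a_def)
   have K: "cmod (K u) \<le> 4 * (1 - r) / a ^ 3"
    unfolding K_def a_def by (rule reflected_kernel_bound(1)[OF u r])
   have u1: "cmod (u - 1) \<le> a + (1 - r)"
   proof -
    have "cmod (complex_of_real r - 1) = \<bar>r - 1\<bar>"
     using norm_of_real[of "r - 1", where 'a=complex] by simp
    moreover have "cmod (u - 1) \<le> cmod (u - of_real r) + cmod (complex_of_real r - 1)"
     using norm_triangle_ineq[of "u - of_real r" "of_real r - 1"] by simp
    ultimately show ?thesis using r by (simp add: a_def)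
   qed
   have pos: "0 \<le> A * (1 / a^2)" "0 \<le> D r" using \<epsilon> r M d by (auto simp: A_def D_def)
   show ?thesis
   proof (cases "cmod (u - 1) < d")
    case True
    have "cmod (R u) \<le> \<epsilon> * (2 * a)"
     using d(2)[OF u True] mult_left_mono[of "cmod (u - 1)" "2 * a" \<epsilon>] u1 a \<epsilon> by linarith
    then have "cmod (R u * K u) \<le> \<epsilon> * (2 * a) * (4 * (1 - r) / a ^ 3)"
     unfolding norm_mult using K \<epsilon> a by (intro mult_mono) auto
    also have "\<dots> = A * (1 / a^2)" using a by (simp add: A_def field_simps power2_eq_square power3_eq_cube)
    finally show ?thesis using pos by (simp add: a_def)
   next
    case False
    then have ad: "d / 2 \<le> a" using u1 rd by linarith
    have "(d/2) ^ 3 \<le> a ^ 3" using ad d by (intro power_mono) auto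
    then have "4 * (1 - r) / a ^ 3 \<le> 4 * (1 - r) / (d/2) ^ 3"
     using d r a by (intro divide_left_mono) auto
    also have "\<dots> = 32 * (1 - r) / d ^ 3" by (simp add: power_divide)
    finally have "cmod (K u) \<le> 32 * (1 - r) / d ^ 3" using K by linarith
    then have "cmod (R u * K u) \<le> D r"
     unfolding norm_mult D_def using M u by (intro mult_mono) auto
    then show ?thesis using pos by (simp add: a_def)
   qed
  qed
  have hi: "((\<lambda>x. R (circlepath 0 1 x) * K (circlepath 0 1 x) * vector_derivative (circlepath 0 1) (at x within {0..1})) has_integral (2 * of_real pi * \<i> * deriv R (of_real r))) {0..1}"
   using deriv_reflected_formula[OF cont hol r] unfolding has_contour_integral_def K_def .
  have P: "((\<lambda>x. 2 * pi * (A * (1 / (cmod (circlepath 0 1 x - of_real r))^2) + D r)) has_integral 2 * pi * (A * (1 / (1 - r^2)) + D r)) {0..1}"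
   using has_integral_mult_right[OF has_integral_add[OF has_integral_mult_right[OF poisson_integral[OF r], of A] has_integral_const_real[of "D r" 0 1]], of "2 * pi"]
   by simp
  have "norm (integral {0..1} (\<lambda>x. R (circlepath 0 1 x) * K (circlepath 0 1 x) * vector_derivative (circlepath 0 1) (at x within {0..1})))
   \<le> integral {0..1} (\<lambda>x. 2 * pi * (A * (1 / (cmod (circlepath 0 1 x - of_real r))^2) + D r))"
  proof (rule Henstock_Kurzweil_Integration.integral_norm_bound_integral)
   fix x :: real assume x: "x \<in> {0..1}"
   have u1: "cmod (circlepath 0 1 x) = 1" by (simp add: circlepath)
   have "cmod (vector_derivative (circlepath 0 1) (at x within {0..1})) = 2 * pi"
    using x vector_derivative_circlepath01[of x 0 1] by (simp add: norm_mult)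
   then show "cmod (R (circlepath 0 1 x) * K (circlepath 0 1 x) * vector_derivative (circlepath 0 1) (at x within {0..1}))
     \<le> 2 * pi * (A * (1 / (cmod (circlepath 0 1 x - of_real r))^2) + D r)"
    unfolding norm_mult[of "R (circlepath 0 1 x) * K (circlepath 0 1 x)"]
    using mult_right_mono[OF bound[OF u1], of "2 * pi"] by (simp add: mult.commute)
  qed (use hi P in blast)+
  then have "cmod (2 * of_real pi * \<i> * deriv R (of_real r)) \<le> 2 * pi * (A * (1 / (1 - r^2)) + D r)"
   using integral_unique[OF hi] integral_unique[OF P] by simp
  then have "2 * pi * cmod (deriv R (of_real r)) \<le> 2 * pi * (A * (1 / (1 - r^2)) + D r)"
   by (simp add: norm_mult)
  then have "cmod (deriv R (of_real r)) \<le> A * (1 / (1 - r^2)) + D r"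
   using pi_gt_zero by (simp only: mult_le_cancel_left_pos)
  also have "A * (1 / (1 - r^2)) = 8 * \<epsilon> / (1 + r)"
  proof -
   have "1 - r^2 = (1 - r) * (1 + r)" by (simp add: power2_eq_square algebra_simps)
   then show ?thesis using r by (simp add: A_def)
  qed
  also have "8 * \<epsilon> / (1 + r) \<le> 8 * \<epsilon>" using r \<epsilon> by (simp add: divide_le_eq)
  finally show ?case using elim(1) by (simp add: \<epsilon>_def)
 qed
qed

lemma has_vector_derivative_atD:
 assumes "(f has_vector_derivative f') (at x)" "e > 0"
 obtains d where "d > 0" "\<And>y. norm (y - x) < d ==> norm (f y - f x - (y - x) *\<^sub>R f') \<le> e * norm (y - x)"
proof -
 have "\<exists>d>0. \<forall>y. norm (y - x) < d \<longrightarrow> norm (f y - f x - (y - x) *\<^sub>R f') \<le> e * norm (y - x)"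
  using assms unfolding has_vector_derivative_def has_derivative_at_alt by blast
 then show ?thesis using that by blast
qed

text \<open>Subtracting the affine function with the same value and derivative at the boundary point leads to \<open>deriv_radial_limit_0\<close>.\<close>
lemma radial_limit_of_derivative:
 assumes cont: "continuous_on (cball 0 1) g" and der: "\<And>z. z \<in> ball 0 1 ==> (g has_field_derivative \<phi> z) (at z)"
  and vd: "((\<lambda>t. g (cis t)) has_vector_derivative \<gamma>) (at t)"
 shows "((\<lambda>r. \<phi> (of_real r * cis t)) \<longlongrightarrow> \<gamma> / (\<i> * cis t)) (at_left 1)"
proof -
 define \<zeta> where "\<zeta> = cis t"
 define L where "L = \<gamma> / (\<i> * \<zeta>)"
 have \<zeta>: "cmod \<zeta> = 1" "\<zeta> \<noteq> 0" by (auto simp: \<zeta>_def)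
 define R where "R u = g (\<zeta> * u) - g \<zeta> - L * \<zeta> * (u - 1)" for u
 have contR: "continuous_on (cball 0 1) R"
  unfolding R_def
  by (intro continuous_intros continuous_on_compose2[OF cont]) (auto simp: norm_mult \<zeta>)
 have derR: "(R has_field_derivative (\<phi> (\<zeta> * z) * \<zeta> - L * \<zeta>)) (at z)" if z: "z \<in> ball 0 1" for z
 proof -
  have "\<zeta> * z \<in> ball 0 1" using z by (simp add: norm_mult \<zeta>)
  note D = der[OF this]
  have "((\<lambda>z. \<zeta> * z) has_field_derivative \<zeta>) (at z)" by (auto intro!: derivative_eq_intros)
  from DERIV_chain2[where f=g and g="\<lambda>z. \<zeta> * z", OF D this]
  have "((\<lambda>z. g (\<zeta> * z)) has_field_derivative \<phi> (\<zeta> * z) * \<zeta>) (at z)" .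
  then show ?thesis unfolding R_def by (auto intro!: derivative_eq_intros)
 qed
 have holR: "R holomorphic_on ball 0 1"
  unfolding holomorphic_on_def field_differentiable_def using derR
  by (meson has_field_derivative_at_within)
 have small: "\<exists>d>0. \<forall>u. cmod u = 1 \<longrightarrow> cmod (u - 1) < d \<longrightarrow> cmod (R u) \<le> e * cmod (u - 1)" if e: "e > 0" for e
 proof -
  define V where "V s = g (cis s) - g \<zeta> - L * (cis s - \<zeta>)" for s
  have "((\<lambda>z. exp (\<i> * z)) has_field_derivative exp (\<i> * of_real t) * \<i>) (at (of_real t))"
   by (auto intro!: derivative_eq_intros)
  note has_vector_derivative_real_field[OF this, of UNIV]
  then have dcis: "(cis has_vector_derivative \<i> * cis t) (at t)"
   unfolding cis_conv_exp[symmetric] by (simp add: mult.commute)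
  have "(V has_vector_derivative (\<gamma> - 0 - L * (\<i> * cis t - 0))) (at t)"
   unfolding V_def
   by (intro has_vector_derivative_diff vd has_vector_derivative_const has_vector_derivative_mult_right dcis)
  also have "\<gamma> - 0 - L * (\<i> * cis t - 0) = 0" using \<zeta> by (simp add: L_def \<zeta>_def)
  finally have "(V has_vector_derivative 0) (at t)" .
  then obtain d1 where d1: "d1 > 0" "\<And>y. norm (y - t) < d1 ==> norm (V y - V t) \<le> e / 2 * norm (y - t)"
   using has_vector_derivative_atD[OF \<open>(V has_vector_derivative 0) (at t)\<close>, of "e/2"] e by auto
  obtain d2 where d2: "d2 > 0" "\<And>y. norm (y - t) < d2 ==> norm (cis y - cis t - (y - t) *\<^sub>R (\<i> * cis t)) \<le> 1 / 2 * norm (y - t)"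
   using has_vector_derivative_atD[OF dcis, of "1/2"] by auto
  have lower: "norm (y - t) \<le> 2 * cmod (cis y - cis t)" if "norm (y - t) < d2" for y
  proof -
   have "cmod ((y - t) *\<^sub>R (\<i> * cis t)) \<le> cmod (cis y - cis t) + cmod (cis y - cis t - (y - t) *\<^sub>R (\<i> * cis t))"
    using norm_triangle_ineq4[of "cis y - cis t" "cis y - cis t - (y - t) *\<^sub>R (\<i> * cis t)"] by simp
   moreover have "cmod ((y - t) *\<^sub>R (\<i> * cis t)) = norm (y - t)" by (simp add: norm_mult)
   ultimately show ?thesis using d2(2)[OF that] by linarith
  qed
  have "isCont Arg 1" by (rule continuous_at_Arg) (simp add: complex_nonpos_Reals_iff)
  then obtain d where d: "d > 0" "\<And>u. dist u 1 < d ==> dist (Arg u) (Arg 1) < min d1 d2"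
   unfolding continuous_at_eps_delta using d1(1) d2(1) by (metis min_less_iff_conj)
  show ?thesis
  proof (intro exI[of _ d] conjI allI impI d(1))
   fix u assume u: "cmod u = 1" "cmod (u - 1) < d"
   define y where "y = t + Arg u"
   have "u \<noteq> 0" using u by auto
   then have cu: "cis (Arg u) = u" using u cis_Arg[of u] by (simp add: sgn_div_norm)
   have cy: "cis y = \<zeta> * u" by (simp add: y_def \<zeta>_def cu cis_mult[symmetric])
   have yt: "norm (y - t) < d1" "norm (y - t) < d2"
    using d(2)[of u] u by (auto simp: dist_norm y_def)
   have "R u = V y - V t" by (simp add: R_def V_def cy \<zeta>_def[symmetric] algebra_simps)
   then have "cmod (R u) \<le> e / 2 * norm (y - t)" using d1(2)[OF yt(1)] by simp
   also have "\<dots> \<le> e / 2 * (2 * cmod (cis y - cis t))" using lower[OF yt(2)] e by (intro mult_left_mono) auto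
   also have "cis y - cis t = \<zeta> * (u - 1)" by (simp add: cy \<zeta>_def[symmetric] right_diff_distrib)
   finally show "cmod (R u) \<le> e * cmod (u - 1)" using \<zeta> by (simp add: norm_mult)
  qed
 qed
 have "((\<lambda>r. deriv R (of_real r)) \<longlongrightarrow> 0) (at_left 1)"
  by (rule deriv_radial_limit_0[OF contR holR small])
 then have "((\<lambda>r. deriv R (of_real r) / \<zeta> + L) \<longlongrightarrow> 0 / \<zeta> + L) (at_left 1)"
  by (intro tendsto_intros) (use \<zeta> in auto)
 moreover have "\<forall>\<^sub>F r in at_left 1. deriv R (of_real r) / \<zeta> + L = \<phi> (of_real r * cis t)"
  using eventually_at_left_real[of 0 "1::real", OF zero_less_one]
 proof eventually_elim
  case (elim r)
  then have "deriv R (of_real r) = \<phi> (\<zeta> * of_real r) * \<zeta> - L * \<zeta>"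
   by (intro DERIV_imp_deriv derR) auto
  then show ?case using \<zeta> by (simp add: field_simps flip: \<zeta>_def)
 qed
 ultimately have "((\<lambda>r. \<phi> (of_real r * cis t)) \<longlongrightarrow> 0 / \<zeta> + L) (at_left 1)"
  by (rule Lim_transform_eventually)
 then show ?thesis by (simp add: L_def \<zeta>_def)
qed

lemma disc_power_series:
 assumes I: "finite I" and i: "i \<in> I" and hol: "\<phi> holomorphic_on ball 0 1"
 shows "\<exists>c. has_power_series I c (\<lambda>z. \<phi> (z i))"
proof -
 define a where "a n = (deriv ^^ n) \<phi> 0 / fact n" for n
 have sums: "(\<lambda>n. a n * w ^ n) sums \<phi> w" if "cmod w < 1" for w
  using holomorphic_power_series[OF hol, of w] that by (simp add: a_def)
 have hs: "((\<lambda>n. a n * w ^ n) has_sum \<phi> w) UNIV" if w: "cmod w < 1" for w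
 proof (rule norm_summable_imp_has_sum[OF _ sums[OF w]])
  obtain s where s: "cmod w < s" "s < 1" using dense[OF w] by blast
  have s0: "0 \<le> s" using s(1) norm_ge_zero[of w] by linarith
  show "summable (\<lambda>n. norm (a n * w ^ n))"
   by (rule powser_insidea[of a "of_real s"]) (use sums[of "of_real s"] s s0 in \<open>auto simp: sums_iff\<close>)
 qed
 define e where "e n = (\<lambda>j\<in>I. if j = i then n else 0)" for n :: nat
 have inj: "inj e" using i by (auto simp: e_def inj_def dest!: fun_cong[of _ _ i])
 have emi: "e n \<in> multi_indices I" for n by (simp add: e_def multi_indices_def)
 have emon: "mon I (e n) z = z i ^ n" for n z
  unfolding mon_def e_def using I i by (subst prod.remove[of I i]) (auto intro!: prod.neutral)
 define c where "c \<alpha> = (if \<alpha> \<in> range e then a (\<alpha> i) else 0)" for \<alpha>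
 have ce: "c (e n) = a n" for n using i by (simp add: c_def e_def)
 have "((\<lambda>\<alpha>. c \<alpha> * mon I \<alpha> z) has_sum \<phi> (z i)) (multi_indices I)" if z: "z \<in> polydisc I" for z
 proof -
  have "cmod (z i) < 1" using z i by (auto simp: polydisc_def PiE_iff)
  from hs[OF this] have "((\<lambda>n. c (e n) * mon I (e n) z) has_sum \<phi> (z i)) UNIV" by (simp add: ce emon)
  then have "((\<lambda>\<alpha>. c \<alpha> * mon I \<alpha> z) has_sum \<phi> (z i)) (range e)"
   using has_sum_reindex[OF inj, of "\<lambda>\<alpha>. c \<alpha> * mon I \<alpha> z"] by (simp add: o_def)
  then show ?thesis
   by (rule has_sum_cong_neutral[THEN iffD1, rotated -1]) (use emi in \<open>auto simp: c_def\<close>)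
 qed
 then show ?thesis unfolding has_power_series_mon by blast
qed

lemma abel_sum:
 fixes a :: "'a \<Rightarrow> real"
 assumes s: "(a has_sum s) A" and a: "\<And>x. 0 \<le> a x"
  and t: "\<And>k. ((\<lambda>x. a x * r k ^ d x) has_sum t k) A" and r: "\<And>k. 0 \<le> r k" "\<And>k. r k \<le> 1" "r \<longlonglongrightarrow> 1"
 shows "t \<longlonglongrightarrow> s"
proof (rule LIMSEQ_I)
 fix e :: real assume e: "0 < e"
 have up: "t k \<le> s" for k
  by (rule has_sum_mono[OF t s]) (use r a in \<open>auto intro!: mult_left_le power_le_one\<close>)
 obtain F where F: "finite F" "F \<subseteq> A" "dist (sum a F) s \<le> e/3"
  using has_sum_finite_approximation[OF s, of "e/3"] e by auto
 have "(\<lambda>k. \<Sum>x\<in>F. a x * r k ^ d x) \<longlonglongrightarrow> (\<Sum>x\<in>F. a x * 1 ^ d x)"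
  by (rule tendsto_sum, rule tendsto_mult[OF tendsto_const], rule tendsto_power[OF r(3)])
 then have "\<forall>\<^sub>F k in sequentially. (\<Sum>x\<in>F. a x * r k ^ d x) > sum a F - e/3"
  by (rule order_tendstoD(1)) (use e in simp)
 then obtain N where N: "\<And>k. k \<ge> N ==> (\<Sum>x\<in>F. a x * r k ^ d x) > sum a F - e/3"
  by (auto simp: eventually_sequentially)
 have "norm (t k - s) < e" if "k \<ge> N" for k
 proof -
  have "(\<Sum>x\<in>F. a x * r k ^ d x) \<le> t k"
   by (rule finite_sum_le_has_sum[OF t F(1,2)]) (use r a in auto)
  moreover have "sum a F \<ge> s - e/3" using F(3) unfolding dist_real_def by linarith
  ultimately show ?thesis using N[OF that] up[of k] e unfolding real_norm_def by linarith
 qed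
 then show "\<exists>no. \<forall>n\<ge>no. norm (t n - s) < e" by blast
qed

lemma dil_norm_tendsto:
 assumes I: "finite I" and f: "f \<in> H2 I"
 shows "(\<lambda>k. \<integral>\<zeta>. (cmod (f (dil I (of_real (rad k)) \<zeta>)))^2 \<partial>torus_measure I) \<longlonglongrightarrow> (H2_norm I f)^2"
proof (rule abel_sum[OF H2_norm_has_sum[OF I f] _ dil_parseval(2)[OF I H2_power_series[OF f] rad_bounds]])
 show "(\<lambda>k. (rad k)^2) \<longlonglongrightarrow> 1" using tendsto_power[OF rad_tendsto, of 2] by simp
 show "(rad k)^2 \<le> 1" for k using rad_bounds[of k] by (intro power_le_one) auto
qed auto

lemma dil_diff_bound:
 assumes I: "finite I" and f: "f \<in> H2 I" and r: "0 \<le> r" "r < 1" and s: "0 \<le> s" "s < 1"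
 shows "(\<lambda>\<zeta>. f (dil I (of_real r) \<zeta>) - f (dil I (of_real s) \<zeta>)) \<in> borel_measurable (torus_measure I)" (is ?m)
  and "integrable (torus_measure I) (\<lambda>\<zeta>. (cmod (f (dil I (of_real r) \<zeta>) - f (dil I (of_real s) \<zeta>)))^2)" (is ?i)
  and "(\<integral>\<zeta>. (cmod (f (dil I (of_real r) \<zeta>) - f (dil I (of_real s) \<zeta>)))^2 \<partial>torus_measure I)
   \<le> 2 * ((H2_norm I f)^2 - (\<integral>\<zeta>. (cmod (f (dil I (of_real r) \<zeta>)))^2 \<partial>torus_measure I))
    + 2 * ((H2_norm I f)^2 - (\<integral>\<zeta>. (cmod (f (dil I (of_real s) \<zeta>)))^2 \<partial>torus_measure I))" (is ?le)
proof -
 let ?c = "coeffs I f"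
 note ps = H2_power_series[OF f]
 define c' where "c' \<alpha> = ?c \<alpha> * of_real r ^ deg I \<alpha> + (-1) * (?c \<alpha> * of_real s ^ deg I \<alpha>)" for \<alpha>
 have c'abs: "(\<lambda>\<alpha>. cmod (c' \<alpha>)) summable_on multi_indices I"
 proof (rule summable_on_comparison_test)
  show "(\<lambda>\<alpha>. cmod (?c \<alpha> * of_real r ^ deg I \<alpha>) + cmod (?c \<alpha> * of_real s ^ deg I \<alpha>)) summable_on multi_indices I"
   by (intro summable_on_add power_series_abs_summable[OF ps] r s)
  show "cmod (c' \<alpha>) \<le> cmod (?c \<alpha> * of_real r ^ deg I \<alpha>) + cmod (?c \<alpha> * of_real s ^ deg I \<alpha>)" for \<alpha>
   unfolding c'_def using norm_triangle_ineq4[of "?c \<alpha> * of_real r ^ deg I \<alpha>" "?c \<alpha> * of_real s ^ deg I \<alpha>"] by simp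
 qed simp
 have c'sum: "((\<lambda>\<alpha>. c' \<alpha> * mon I \<alpha> \<zeta>) has_sum (f (dil I (of_real r) \<zeta>) - f (dil I (of_real s) \<zeta>))) (multi_indices I)"
  if z: "\<zeta> \<in> torus I" for \<zeta>
 proof -
  have "((\<lambda>\<alpha>. (?c \<alpha> * of_real r ^ deg I \<alpha>) * mon I \<alpha> \<zeta> + (-1) * ((?c \<alpha> * of_real s ^ deg I \<alpha>) * mon I \<alpha> \<zeta>))
    has_sum (f (dil I (of_real r) \<zeta>) + (-1) * f (dil I (of_real s) \<zeta>))) (multi_indices I)"
   by (intro has_sum_add has_sum_cmult_right power_series_dil[OF ps _ z]) (use r s in auto)
  then show ?thesis by (simp add: c'_def distrib_right algebra_simps)
 qed
 note P = torus_parseval[OF I c'abs c'sum]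
 show ?m using P(1) by simp
 show ?i using P(3) by simp
 note E = dil_parseval(2)[OF I ps]
 have rhs: "((\<lambda>\<alpha>. 2 * ((cmod (?c \<alpha>))\<^sup>2 + (-1) * ((cmod (?c \<alpha>))\<^sup>2 * (r\<^sup>2) ^ deg I \<alpha>)) + 2 * ((cmod (?c \<alpha>))\<^sup>2 + (-1) * ((cmod (?c \<alpha>))\<^sup>2 * (s\<^sup>2) ^ deg I \<alpha>)))
   has_sum (2 * ((H2_norm I f)\<^sup>2 + (-1) * (\<integral>\<zeta>. (cmod (f (dil I (of_real r) \<zeta>)))\<^sup>2 \<partial>torus_measure I))
    + 2 * ((H2_norm I f)\<^sup>2 + (-1) * (\<integral>\<zeta>. (cmod (f (dil I (of_real s) \<zeta>)))\<^sup>2 \<partial>torus_measure I)))) (multi_indices I)"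
  by (intro has_sum_add has_sum_cmult_right H2_norm_has_sum[OF I f] E r s)
 have "(\<integral>\<zeta>. (cmod (f (dil I (of_real r) \<zeta>) - f (dil I (of_real s) \<zeta>)))^2 \<partial>torus_measure I)
  \<le> (2 * ((H2_norm I f)\<^sup>2 + (-1) * (\<integral>\<zeta>. (cmod (f (dil I (of_real r) \<zeta>)))\<^sup>2 \<partial>torus_measure I))
    + 2 * ((H2_norm I f)\<^sup>2 + (-1) * (\<integral>\<zeta>. (cmod (f (dil I (of_real s) \<zeta>)))\<^sup>2 \<partial>torus_measure I)))"
 proof (rule has_sum_mono[OF P(2) rhs])
  fix \<alpha>
  define x where "x = r ^ deg I \<alpha>"
  define y where "y = s ^ deg I \<alpha>"
  have xy: "0 \<le> x" "x \<le> 1" "0 \<le> y" "y \<le> 1" using r s by (auto simp: x_def y_def intro!: power_le_one)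
  have x2: "(r^2) ^ deg I \<alpha> = x^2" "(s^2) ^ deg I \<alpha> = y^2" by (simp_all add: x_def y_def power_mult[symmetric] mult.commute)
  have key: "(x - y)^2 \<le> 2 * (1 - x^2) + 2 * (1 - y^2)"
  proof -
   have 1: "(x - y)^2 \<le> 2 * (1 - x)^2 + 2 * (1 - y)^2"
    using zero_le_power2[of "(1 - x) + (1 - y)"] by (simp add: power2_eq_square algebra_simps)
   have 2: "(1 - x)^2 \<le> 1 - x^2"
    using mult_nonneg_nonneg[of x "1 - x"] xy by (simp add: power2_eq_square algebra_simps)
   have 3: "(1 - y)^2 \<le> 1 - y^2"
    using mult_nonneg_nonneg[of y "1 - y"] xy by (simp add: power2_eq_square algebra_simps)
   show ?thesis
    by (rule order_trans[OF 1 add_mono[OF mult_left_mono[OF 2] mult_left_mono[OF 3]]]) simp_all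
  qed
  have "c' \<alpha> = ?c \<alpha> * of_real (x - y)" by (simp add: c'_def x_def y_def algebra_simps)
  then have "(cmod (c' \<alpha>))^2 = (cmod (?c \<alpha>))^2 * (x - y)^2"
   by (simp only: norm_mult norm_of_real power_mult_distrib power2_abs)
  also have "\<dots> \<le> (cmod (?c \<alpha>))^2 * (2 * (1 - x^2) + 2 * (1 - y^2))" by (rule mult_left_mono[OF key]) simp
  also have "\<dots> = 2 * ((cmod (?c \<alpha>))\<^sup>2 + (-1) * ((cmod (?c \<alpha>))\<^sup>2 * x\<^sup>2)) + 2 * ((cmod (?c \<alpha>))\<^sup>2 + (-1) * ((cmod (?c \<alpha>))\<^sup>2 * y\<^sup>2))"
   by (simp add: algebra_simps)
  finally show "(cmod (c' \<alpha>))\<^sup>2 \<le> 2 * ((cmod (?c \<alpha>))\<^sup>2 + (-1) * ((cmod (?c \<alpha>))\<^sup>2 * (r\<^sup>2) ^ deg I \<alpha>)) + 2 * ((cmod (?c \<alpha>))\<^sup>2 + (-1) * ((cmod (?c \<alpha>))\<^sup>2 * (s\<^sup>2) ^ deg I \<alpha>))"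
   unfolding x2 .
 qed
 then show ?le by simp
qed

text \<open>The dilations are Cauchy in the square mean, hence a subsequence converges almost everywhere.\<close>
lemma radial_subsequence:
 assumes I: "finite I" and f: "f \<in> H2 I"
 shows "\<exists>\<rho>. (\<forall>k. 0 \<le> \<rho> k \<and> \<rho> k < 1) \<and> \<rho> \<longlonglongrightarrow> 1 \<and> (AE \<zeta> in torus_measure I. convergent (\<lambda>k. f (dil I (of_real (\<rho> k)) \<zeta>)))"
proof -
 interpret prob_space "torus_measure I" by (rule prob_space_torus)
 define E where "E r = (\<integral>\<zeta>. (cmod (f (dil I (of_real r) \<zeta>)))^2 \<partial>torus_measure I)" for r :: real
 have "\<exists>j\<ge>k. (H2_norm I f)^2 - E (rad j) \<le> (1/4) ^ k" for k
 proof -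
  have "\<forall>\<^sub>F j in sequentially. E (rad j) > (H2_norm I f)^2 - (1/4) ^ k"
   by (rule order_tendstoD(1)[OF dil_norm_tendsto[OF I f, folded E_def]]) simp
  then obtain N where N: "\<And>j. j \<ge> N ==> E (rad j) > (H2_norm I f)^2 - (1/4) ^ k" by (auto simp: eventually_sequentially)
  show ?thesis using N[of "max N k"] by (intro exI[of _ "max N k"]) auto
 qed
 then obtain s where s: "\<And>k. s k \<ge> k" "\<And>k. (H2_norm I f)^2 - E (rad (s k)) \<le> (1/4) ^ k" by metis
 define \<rho> where "\<rho> k = rad (s k)" for k
 have \<rho>: "0 \<le> \<rho> k" "\<rho> k < 1" for k unfolding \<rho>_def by (rule rad_bounds)+
 have "filterlim s at_top sequentially" 
  by (rule filterlim_at_top_mono[OF filterlim_ident]) (use s(1) in auto)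
 from filterlim_compose[OF rad_tendsto this] have \<rho>1: "\<rho> \<longlonglongrightarrow> 1" by (simp add: \<rho>_def[abs_def])
 define b where "b k \<zeta> = cmod (f (dil I (of_real (\<rho> (Suc k))) \<zeta>) - f (dil I (of_real (\<rho> k)) \<zeta>))" for k \<zeta>
 have bm [measurable]: "b k \<in> borel_measurable (torus_measure I)" for k
  unfolding b_def[abs_def] by (rule measurable_compose[OF dil_diff_bound(1)[OF I f \<rho> \<rho>] borel_measurable_norm])
 have bi: "integrable (torus_measure I) (\<lambda>\<zeta>. (b k \<zeta>)^2)" for k
  unfolding b_def by (rule dil_diff_bound(2)[OF I f \<rho> \<rho>])
 have b2: "(\<integral>\<zeta>. (b k \<zeta>)^2 \<partial>torus_measure I) \<le> 4 * (1/4) ^ k" for k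
 proof -
  have "(\<integral>\<zeta>. (b k \<zeta>)^2 \<partial>torus_measure I) \<le> 2 * ((H2_norm I f)^2 - E (\<rho> (Suc k))) + 2 * ((H2_norm I f)^2 - E (\<rho> k))"
   unfolding b_def E_def by (rule dil_diff_bound(3)[OF I f \<rho> \<rho>])
  moreover have "(1/4::real) ^ Suc k \<le> (1/4) ^ k" by simp
  moreover have "X \<le> 2 * A + 2 * B ==> q' \<le> q ==> A \<le> q' ==> B \<le> q ==> X \<le> 4 * q" for X A B q q' :: real
   by linarith
  ultimately show ?thesis using s(2)[of "Suc k"] s(2)[of k] unfolding \<rho>_def by blast
 qed
 have b1: "(\<integral>\<^sup>+\<zeta>. ennreal (b k \<zeta>) \<partial>torus_measure I) \<le> ennreal (5 / 2 * (1/2) ^ k)" for k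
 proof -
  have pt: "b k \<zeta> \<le> 2 ^ k / 2 * (b k \<zeta>)^2 + (1/2) ^ k / 2" for \<zeta>
  proof -
   have "0 \<le> (2 ^ k * b k \<zeta> - 1)^2" by simp
   then have "2 * (2 ^ k * b k \<zeta>) \<le> (2 ^ k * b k \<zeta>)^2 + 1" by (simp add: power2_diff)
   then have "2 * (2 ^ k * b k \<zeta>) * (1/2) ^ k \<le> ((2 ^ k * b k \<zeta>)^2 + 1) * (1/2) ^ k" by (rule mult_right_mono) simp
   moreover have "2 * (2 ^ k * b k \<zeta>) * (1/2) ^ k = 2 * b k \<zeta>" by (simp add: power_divide)
   moreover have "((2 ^ k * b k \<zeta>)^2 + 1) * (1/2) ^ k = 2 ^ k * (b k \<zeta>)^2 + (1/2) ^ k"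
    by (simp add: power_divide power2_eq_square field_simps)
   ultimately show ?thesis by linarith
  qed
  have int: "integrable (torus_measure I) (\<lambda>\<zeta>. 2 ^ k / 2 * (b k \<zeta>)^2 + (1/2) ^ k / 2)"
   by (intro Bochner_Integration.integrable_add integrable_mult_right bi) simp
  have "(\<integral>\<^sup>+\<zeta>. ennreal (b k \<zeta>) \<partial>torus_measure I) \<le> (\<integral>\<^sup>+\<zeta>. ennreal (2 ^ k / 2 * (b k \<zeta>)^2 + (1/2) ^ k / 2) \<partial>torus_measure I)"
   by (intro nn_integral_mono ennreal_leI pt)
  also have "\<dots> = ennreal (\<integral>\<zeta>. 2 ^ k / 2 * (b k \<zeta>)^2 + (1/2) ^ k / 2 \<partial>torus_measure I)"
   by (rule nn_integral_eq_integral[OF int]) auto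
  also have "(\<integral>\<zeta>. 2 ^ k / 2 * (b k \<zeta>)^2 + (1/2) ^ k / 2 \<partial>torus_measure I) = 2 ^ k / 2 * (\<integral>\<zeta>. (b k \<zeta>)^2 \<partial>torus_measure I) + (1/2) ^ k / 2"
   using bi by (subst Bochner_Integration.integral_add) (auto simp: prob_space[unfolded space_torus])
  also have "ennreal \<dots> \<le> ennreal (5 / 2 * (1/2) ^ k)"
  proof (rule ennreal_leI)
   have "2 ^ k / 2 * (\<integral>\<zeta>. (b k \<zeta>)^2 \<partial>torus_measure I) \<le> 2 ^ k / 2 * (4 * (1/4) ^ k)"
    by (rule mult_left_mono[OF b2]) simp
   also have "\<dots> = 2 * (1/2) ^ k"
   proof -
    have "(2::real) ^ k * (1/4) ^ k = (1/2) ^ k" by (simp flip: power_mult_distrib)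
    then show ?thesis by simp
   qed
   finally show "2 ^ k / 2 * (\<integral>\<zeta>. (b k \<zeta>)^2 \<partial>torus_measure I) + (1/2) ^ k / 2 \<le> 5 / 2 * (1/2) ^ k" by simp
  qed
  finally show ?thesis .
 qed
 have "(\<integral>\<^sup>+\<zeta>. (\<Sum>k. ennreal (b k \<zeta>)) \<partial>torus_measure I) = (\<Sum>k. \<integral>\<^sup>+\<zeta>. ennreal (b k \<zeta>) \<partial>torus_measure I)"
  by (rule nn_integral_suminf) measurable
 also have "\<dots> \<le> (\<Sum>k. ennreal (5 / 2 * (1/2) ^ k))" by (intro suminf_le b1) auto
 also have "\<dots> = ennreal (\<Sum>k. 5 / 2 * (1/2) ^ k)"
  by (rule suminf_ennreal2) (auto intro!: summable_mult summable_geometric)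
 also have "\<dots> < \<infinity>" by simp
 finally have fin: "(\<integral>\<^sup>+\<zeta>. (\<Sum>k. ennreal (b k \<zeta>)) \<partial>torus_measure I) \<noteq> \<infinity>" by simp
 have "AE \<zeta> in torus_measure I. (\<Sum>k. ennreal (b k \<zeta>)) \<noteq> \<infinity>"
  by (rule nn_integral_PInf_AE[OF _ fin]) measurable
 then have "AE \<zeta> in torus_measure I. convergent (\<lambda>k. f (dil I (of_real (\<rho> k)) \<zeta>))"
 proof eventually_elim
  case (elim \<zeta>)
  have "summable (\<lambda>k. b k \<zeta>)" by (rule summable_suminf_not_top) (use elim in \<open>auto simp: b_def\<close>)
  then have "summable (\<lambda>k. f (dil I (of_real (\<rho> (Suc k))) \<zeta>) - f (dil I (of_real (\<rho> k)) \<zeta>))"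
   unfolding b_def by (rule summable_norm_cancel)
  then have "convergent (\<lambda>n. \<Sum>k<n. f (dil I (of_real (\<rho> (Suc k))) \<zeta>) - f (dil I (of_real (\<rho> k)) \<zeta>))"
   by (simp only: summable_iff_convergent)
  then have "convergent (\<lambda>n. f (dil I (of_real (\<rho> n)) \<zeta>) - f (dil I (of_real (\<rho> 0)) \<zeta>))"
   unfolding sum_lessThan_telescope[where f="\<lambda>k. f (dil I (of_real (\<rho> k)) \<zeta>)"] .
  from convergent_add[OF this convergent_const[of "f (dil I (of_real (\<rho> 0)) \<zeta>)"]]
  show ?case by simp
 qed
 then show ?thesis using \<rho> \<rho>1 by blast
qed

lemma circle_subsequence:
 assumes hol: "\<phi> holomorphic_on ball 0 1" and bd: "bounded (\<phi> ` ball 0 1)"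
 shows "\<exists>\<rho>. (\<forall>k. 0 \<le> \<rho> k \<and> \<rho> k < 1) \<and> \<rho> \<longlonglongrightarrow> 1 \<and> (AE \<xi> in circle_measure. convergent (\<lambda>k. \<phi> (of_real (\<rho> k) * \<xi>)))"
proof -
 define I :: "nat set" where "I = {0}"
 have I: "finite I" "0 \<in> I" by (auto simp: I_def)
 define f where "f = (\<lambda>z::point. if z \<in> polydisc I then \<phi> (z 0) else 0)"
 have "holomorphic_polydisc I (\<lambda>z. \<phi> (z 0))"
  using disc_power_series[OF I hol] by (auto simp: holomorphic_polydisc_def)
 moreover have "bounded ((\<lambda>z. \<phi> (z 0)) ` polydisc I)"
  by (rule bounded_subset[OF bd]) (auto simp: polydisc_def I_def PiE_iff)
 ultimately have "f \<in> H2 I" unfolding f_def by (rule bounded_H2[OF I(1)])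
 from radial_subsequence[OF I(1) this] obtain \<rho> where
  \<rho>: "\<And>k. 0 \<le> \<rho> k \<and> \<rho> k < 1" "\<rho> \<longlonglongrightarrow> 1" and ae: "AE \<zeta> in torus_measure I. convergent (\<lambda>k. f (dil I (of_real (\<rho> k)) \<zeta>))" by blast
 have m: "(\<lambda>\<xi>. \<phi> (of_real (\<rho> k) * \<xi>)) \<in> borel_measurable circle_measure" for k
  unfolding measurable_cong_sets[OF sets_circle refl]
  by (intro borel_measurable_continuous_on_restrict continuous_on_compose2[OF holomorphic_on_imp_continuous_on[OF hol]] continuous_intros)
    (use \<rho>(1)[of k] in \<open>auto simp: norm_mult\<close>)
 have "{\<xi> \<in> space circle_measure. Cauchy (\<lambda>k. \<phi> (of_real (\<rho> k) * \<xi>))} \<in> sets circle_measure"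
  by (rule sets_Collect_Cauchy[OF m])
 then have ms: "{\<xi> \<in> space circle_measure. convergent (\<lambda>k. \<phi> (of_real (\<rho> k) * \<xi>))} \<in> sets circle_measure"
  unfolding Cauchy_convergent_iff .
 have ae': "AE \<zeta> in PiM I (\<lambda>_. circle_measure). convergent (\<lambda>k. \<phi> (of_real (\<rho> k) * \<zeta> 0))"
  using ae[unfolded torus_measure_def] AE_space
 proof eventually_elim
  case (elim \<zeta>)
  have "\<zeta> \<in> torus I" using elim(2) by (simp add: space_PiM torus_def)
  then have "dil I (of_real (\<rho> k)) \<zeta> \<in> polydisc I" for k using \<rho>(1)[of k] by (intro dil_in_polydisc) auto
  then have "f (dil I (of_real (\<rho> k)) \<zeta>) = \<phi> (of_real (\<rho> k) * \<zeta> 0)" for k by (simp add: f_def dil_def I_def)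
  then show ?case using elim(1) by simp
 qed
 have d: "distr (PiM I (\<lambda>_. circle_measure)) circle_measure (\<lambda>\<omega>. \<omega> 0) = circle_measure"
  by (rule distr_PiM_component[OF circle.prob_space_axioms I(2)])
 have "AE \<xi> in distr (PiM I (\<lambda>_. circle_measure)) circle_measure (\<lambda>\<omega>. \<omega> 0). convergent (\<lambda>k. \<phi> (of_real (\<rho> k) * \<xi>))"
  by (rule AE_distr_iff[THEN iffD2, OF measurable_component_singleton[OF I(2)] ms ae'])
 then show ?thesis unfolding d using \<rho> by blast
qed

lemma circle_AE_D:
 assumes "AE \<xi> in circle_measure. P \<xi>"
 shows "negligible {t \<in> {0..2*pi}. \<not> P (cis t)}"
proof -
 have "AE t in uniform_measure lborel {0..2*pi}. P (cis t)"
  using AE_distrD[OF cis_measurable' assms[unfolded circle_measure_def]] .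
 then have "AE t in lborel. t \<in> {0..2*pi} \<longrightarrow> P (cis t)"
  by (subst (asm) AE_uniform_measure) auto
 then have "AE t in lebesgue. t \<in> {0..2*pi} \<longrightarrow> P (cis t)" by (rule AE_completion)
 then obtain N where "negligible N" "{t. \<not> (t \<in> {0..2*pi} \<longrightarrow> P (cis t))} \<subseteq> N"
  unfolding eventually_ae_filter_negligible by blast
 moreover have "{t \<in> {0..2*pi}. \<not> P (cis t)} \<subseteq> {t. \<not> (t \<in> {0..2*pi} \<longrightarrow> P (cis t))}" by blast
 ultimately show ?thesis using negligible_subset by (metis subset_trans)
qed

lemma circle_AE_I:
 assumes m: "{\<xi> \<in> space circle_measure. P \<xi>} \<in> sets circle_measure" and N: "negligible N"
  and P: "\<And>t. 0 < t ==> t < 2*pi ==> t \<notin> N ==> P (cis t)"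
 shows "AE \<xi> in circle_measure. P \<xi>"
proof -
 have "negligible (N \<union> {0, 2*pi})" using N by (intro negligible_Un) auto
 then have "AE t in lebesgue. t \<in> {0..2*pi} \<longrightarrow> P (cis t)"
  unfolding eventually_ae_filter_negligible using P by (intro exI[of _ "N \<union> {0, 2*pi}"]) force
 then have "AE t in lborel. t \<in> {0..2*pi} \<longrightarrow> P (cis t)" by (simp only: AE_completion_iff)
 then have "AE t in uniform_measure lborel {0..2*pi}. P (cis t)" by (intro AE_uniform_measureI) auto
 then show ?thesis unfolding circle_measure_def
  using m by (subst AE_distr_iff[OF cis_measurable']) (auto simp: sets_circle circle_measure_def space_restrict_space)
qed

subsection \<open>Measurability of radial limits\<close>

lemma le_on_rationals:
 fixes g :: "real \<Rightarrow> real"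
 assumes cont: "continuous_on {a<..<b} g" and q: "\<And>q::rat. a < of_rat q ==> of_rat q < b ==> g (of_rat q) \<le> c"
  and r: "a < r" "r < b"
 shows "g r \<le> c"
proof (rule ccontr)
 assume "\<not> g r \<le> c"
 then have "c < g r" by simp
 have "isCont g r" using cont r by (simp add: continuous_on_eq_continuous_at)
 then have "\<forall>\<^sub>F y in at r. c < g y" using \<open>c < g r\<close> by (intro order_tendstoD(1)) (auto simp: isCont_def)
 then obtain d where d: "d > 0" "\<And>y. y \<noteq> r ==> dist y r < d ==> c < g y" unfolding eventually_at by auto
 obtain q :: rat where qq: "r < of_rat q" "of_rat q < min (r + d) b" using of_rat_dense[of r "min (r + d) b"] d r by auto
 then have "c < g (of_rat q)" by (intro d(2)) (auto simp: dist_real_def)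
 moreover have "g (of_rat q) \<le> c" using qq r by (intro q) auto
 ultimately show False by simp
qed

text \<open>Oscillation over rational radii only, which turns the set of existence of a radial limit into a countable combination of measurable sets.\<close>
definition rat_osc_le :: "(real \<Rightarrow> complex) \<Rightarrow> nat \<Rightarrow> nat \<Rightarrow> bool" where
 "rat_osc_le F n m \<longleftrightarrow> (\<forall>p::rat. \<forall>q::rat. (1 - 1 / real (m + 2) < of_rat p \<and> of_rat p < (1::real)) \<longrightarrow> (1 - 1 / real (m + 2) < of_rat q \<and> of_rat q < (1::real)) \<longrightarrow>
    dist (F (of_rat p)) (F (of_rat q)) \<le> 1 / real (n + 1))"

lemma radial_cauchy_iff:
 fixes F :: "real \<Rightarrow> complex"
 assumes cont: "continuous_on {0<..<1} F"
 shows "(\<exists>l. (F \<longlongrightarrow> l) (at_left 1)) \<longleftrightarrow>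
  (\<forall>n. \<exists>m. rat_osc_le F n m)" (is "?L \<longleftrightarrow> ?R")
proof
 assume ?L
 then obtain l where l: "(F \<longlongrightarrow> l) (at_left 1)" by blast
 show ?R
 proof
  fix n :: nat
  have "\<forall>\<^sub>F r in at_left 1. dist (F r) l < 1 / (2 * real (n + 1))" by (rule tendstoD[OF l]) simp
  then obtain b where b: "b < 1" "\<And>r. b < r ==> r < 1 ==> dist (F r) l < 1 / (2 * real (n + 1))"
   unfolding eventually_at_left_field by blast
  obtain m :: nat where m: "1 / (1 - b) < real m" using reals_Archimedean2 by blast
  have "1 / real (m + 2) \<le> 1 - b"
  proof -
   have "1 / (1 - b) \<le> real (m + 2)" using m by simp
   then show ?thesis using b(1) by (simp add: field_simps)
  qed
  then have mb: "b \<le> 1 - 1 / real (m + 2)" by simp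
  have "dist (F r) (F s) \<le> 1 / real (n + 1)" if "1 - 1 / real (m + 2) < r" "r < 1" "1 - 1 / real (m + 2) < s" "s < 1" for r s
  proof -
   have "dist (F r) (F s) \<le> dist (F r) l + dist (F s) l" by (rule dist_triangle2)
   also have "\<dots> \<le> 1 / (2 * real (n + 1)) + 1 / (2 * real (n + 1))"
    using b(2)[of r] b(2)[of s] that mb by (intro add_mono) auto
   also have "\<dots> = 1 / real (n + 1)" by (simp add: field_simps)
   finally show ?thesis .
  qed
  then have "rat_osc_le F n m" unfolding rat_osc_le_def by simp
  then show "\<exists>m. rat_osc_le F n m" by blast
 qed
next
 assume R: ?R
 have ext: "\<exists>a<1. \<forall>r s. a < r \<longrightarrow> r < 1 \<longrightarrow> a < s \<longrightarrow> s < 1 \<longrightarrow> dist (F r) (F s) \<le> 1 / real (n + 1)" for n :: nat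
 proof -
  obtain m where "rat_osc_le F n m" using R by blast
  then have m: "dist (F (of_rat p)) (F (of_rat q)) \<le> 1 / real (n + 1)"
   if "1 - 1 / real (m + 2) < of_rat p" "of_rat p < (1::real)" "1 - 1 / real (m + 2) < of_rat q" "of_rat q < (1::real)" for p q :: rat
   using that unfolding rat_osc_le_def by simp
  define a where "a = 1 - 1 / real (m + 2)"
  have a: "0 \<le> a" "a < 1" by (auto simp: a_def field_simps)
  have ca: "continuous_on {a<..<1} F" by (rule continuous_on_subset[OF cont]) (use a in auto)
  have 1: "dist (F r) (F (of_rat q)) \<le> 1 / real (n + 1)" if "a < r" "r < 1" "a < of_rat q" "of_rat q < (1::real)" for r and q :: rat
  proof (rule le_on_rationals[of a 1 "\<lambda>r. dist (F r) (F (of_rat q))", OF _ _ that(1,2)])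
   show "continuous_on {a<..<1} (\<lambda>r. dist (F r) (F (of_rat q)))" by (intro continuous_intros ca)
   show "dist (F (of_rat p)) (F (of_rat q)) \<le> 1 / real (n + 1)" if "a < of_rat p" "of_rat p < (1::real)" for p
    using m[of p q] that \<open>a < of_rat q\<close> \<open>of_rat q < (1::real)\<close> unfolding a_def by blast
  qed
  have "dist (F r) (F s) \<le> 1 / real (n + 1)" if "a < r" "r < 1" "a < s" "s < 1" for r s
  proof (rule le_on_rationals[of a 1 "\<lambda>s. dist (F r) (F s)", OF _ _ that(3,4)])
   show "continuous_on {a<..<1} (\<lambda>s. dist (F r) (F s))" by (intro continuous_intros ca)
  qed (use 1 that in auto)
  then show ?thesis using a by blast
 qed
 have small: "\<exists>n::nat. 1 / real (n + 1) < e" if e: "e > 0" for e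
  using reals_Archimedean[OF e] by (auto simp: inverse_eq_divide)
 have radev: "\<exists>N. \<forall>k\<ge>N. a < rad k" if "a < 1" for a
  using order_tendstoD(1)[OF rad_tendsto that] by (auto simp: eventually_sequentially)
 have "Cauchy (\<lambda>k. F (rad k))"
 proof (rule metric_CauchyI)
  fix e :: real assume "0 < e"
  from small[OF this] obtain n :: nat where n: "1 / real (n + 1) < e" by blast
  obtain a where a: "a < 1" "\<And>r s. a < r ==> r < 1 ==> a < s ==> s < 1 ==> dist (F r) (F s) \<le> 1 / real (n + 1)" using ext[of n] by blast
  obtain N where N: "\<And>k. k \<ge> N ==> a < rad k" using radev[OF a(1)] by blast
  have "dist (F (rad i)) (F (rad j)) < e" if "i \<ge> N" "j \<ge> N" for i j
   using a(2)[OF N[OF that(1)] rad_bounds(2) N[OF that(2)] rad_bounds(2)] n by linarith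
  then show "\<exists>M. \<forall>m\<ge>M. \<forall>n\<ge>M. dist (F (rad m)) (F (rad n)) < e" by blast
 qed
 then obtain l where l: "(\<lambda>k. F (rad k)) \<longlonglongrightarrow> l" using Cauchy_convergent convergent_def by blast
 have "(F \<longlongrightarrow> l) (at_left 1)"
 proof (rule tendstoI)
  fix e :: real assume "0 < e"
  from small[OF this] obtain n :: nat where n: "1 / real (n + 1) < e" by blast
  obtain a where a: "a < 1" "\<And>r s. a < r ==> r < 1 ==> a < s ==> s < 1 ==> dist (F r) (F s) \<le> 1 / real (n + 1)" using ext[of n] by blast
  obtain N where N: "\<And>k. k \<ge> N ==> a < rad k" using radev[OF a(1)] by blast
  have "dist (F r) l < e" if "a < r" "r < 1" for r
  proof -
   have "dist (F r) l \<le> 1 / real (n + 1)"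
    by (rule LIMSEQ_le_const2[OF tendsto_dist[OF tendsto_const l]]) (use a(2)[OF that N rad_bounds(2)] in blast)
   then show ?thesis using n by linarith
  qed
  then show "\<forall>\<^sub>F r in at_left 1. dist (F r) l < e" unfolding eventually_at_left_field using a(1) by blast
 qed
 then show ?L by blast
qed

lemma rad_Suc_pos: "0 < rad (Suc k)" by (simp add: rad_def field_simps)

lemma
 fixes F :: "real \<Rightarrow> 'a \<Rightarrow> complex"
 assumes meas: "\<And>r. 0 < r ==> r < 1 ==> F r \<in> borel_measurable M"
  and cont: "\<And>x. x \<in> space M ==> continuous_on {0<..<1} (\<lambda>r. F r x)"
 shows radial_limit_set: "{x \<in> space M. \<exists>l. ((\<lambda>r. F r x) \<longlongrightarrow> l) (at_left 1)} \<in> sets M"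
  and radial_limit_measurable: "(\<lambda>x. Lim (at_left 1) (\<lambda>r. F r x)) \<in> borel_measurable M"
proof -
 define S where "S = {x \<in> space M. \<exists>l. ((\<lambda>r. F r x) \<longlongrightarrow> l) (at_left 1)}"
 define G where "G p = F (if 0 < p \<and> p < 1 then p else 1/2)" for p
 have [measurable]: "G p \<in> borel_measurable M" for p unfolding G_def by (rule meas) auto
 have dm: "(\<lambda>x. dist (G p x) (G q x)) \<in> borel_measurable M" for p q by measurable
 have pm: "Measurable.pred M (\<lambda>x. dist (G p x) (G q x) \<le> c)" for p q c using dm[of p q] by measurable
 have "S = {x \<in> space M. \<forall>n. \<exists>m. rat_osc_le (\<lambda>p. G p x) n m}"
 proof -
  have G: "G p = F p" if "1 - 1 / real (m + 2) < p" "p < 1" for p and m :: nat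
  proof -
   have "0 \<le> 1 - 1 / real (m + 2)" by simp
   then have "0 < p" using that(1) by linarith
   then show ?thesis using that(2) unfolding G_def by simp
  qed
  have "rat_osc_le (\<lambda>p. G p x) n m = rat_osc_le (\<lambda>p. F p x) n m" for x n m
   unfolding rat_osc_le_def using G[of m] by simp
  then have "(\<exists>l. ((\<lambda>r. F r x) \<longlongrightarrow> l) (at_left 1)) = (\<forall>n. \<exists>m. rat_osc_le (\<lambda>p. G p x) n m)" if "x \<in> space M" for x
   using radial_cauchy_iff[OF cont[OF that]] by (simp only:)
  then show ?thesis unfolding S_def by (intro Collect_cong conj_cong refl)
 qed
 also have "\<dots> \<in> sets M"
  unfolding rat_osc_le_def using pm by measurable
 finally have Sm: "S \<in> sets M" .
 then show "{x \<in> space M. \<exists>l. ((\<lambda>r. F r x) \<longlongrightarrow> l) (at_left 1)} \<in> sets M" by (simp add: S_def)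
 have limm: "(\<lambda>x. lim (\<lambda>k. F (rad (Suc k)) x)) \<in> borel_measurable M"
  by (rule borel_measurable_lim_metric[OF meas[OF rad_Suc_pos rad_bounds(2)]])
 have "(\<lambda>x. if x \<in> S then lim (\<lambda>k. F (rad (Suc k)) x) else (THE l::complex. False)) \<in> borel_measurable M"
  by (rule measurable_If[OF limm measurable_const]) (use Sm in \<open>simp_all add: S_def\<close>)
 then show "(\<lambda>x. Lim (at_left 1) (\<lambda>r. F r x)) \<in> borel_measurable M"
 proof (rule measurable_cong[THEN iffD1, rotated])
  fix x assume x: "x \<in> space M"
  show "(if x \<in> S then lim (\<lambda>k. F (rad (Suc k)) x) else (THE l::complex. False)) = Lim (at_left 1) (\<lambda>r. F r x)"
  proof (cases "x \<in> S")
   case True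
   then obtain l where l: "((\<lambda>r. F r x) \<longlongrightarrow> l) (at_left 1)" by (auto simp: S_def)
   have "(\<lambda>k. F (rad (Suc k)) x) \<longlonglongrightarrow> l"
    using filterlim_compose[OF l filterlim_compose[OF rad_at_left filterlim_Suc]] by simp
   then show ?thesis using True l by (simp add: limI tendsto_Lim)
  next
   case False
   then have "\<And>l. \<not> ((\<lambda>r. F r x) \<longlongrightarrow> l) (at_left 1)" using x by (auto simp: S_def)
   then show ?thesis using False by (simp add: t2_space_class.Lim_def)
  qed
 qed
qed

subsection \<open>Fatou on the circle\<close>

text \<open>A primitive of a bounded function is Lipschitz and extends to the closed disc. On the circle it is the indefinite integral of the almost everywhere limit along a sequence of radii, hence differentiable almost everywhere.\<close>
lemma primitive_boundary_differentiable:
 assumes hol: "\<phi> holomorphic_on ball 0 1" and bd: "bounded (\<phi> ` ball 0 1)"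
 shows "\<exists>g N. continuous_on (cball 0 1) g \<and> (\<forall>z\<in>ball 0 1. (g has_field_derivative \<phi> z) (at z)) \<and> negligible N \<and>
  (\<forall>t. 0 < t \<longrightarrow> t < 2*pi \<longrightarrow> t \<notin> N \<longrightarrow> (\<exists>\<gamma>. ((\<lambda>t. g (cis t)) has_vector_derivative \<gamma>) (at t)))"
proof -
 obtain B where B: "B > 0" "\<And>z. z \<in> ball 0 1 ==> cmod (\<phi> z) \<le> B" using bd unfolding bounded_pos by auto
 obtain \<Phi> where \<Phi>: "\<And>z. z \<in> ball 0 1 ==> (\<Phi> has_field_derivative \<phi> z) (at z within ball 0 1)"
  using holomorphic_convex_primitive'[OF convex_ball open_ball hol] by blast
 have lip: "norm (\<Phi> x - \<Phi> y) \<le> B * norm (x - y)" if "x \<in> ball 0 1" "y \<in> ball 0 1" for x y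
  by (rule field_differentiable_bound[OF convex_ball \<Phi> B(2) that])
 have "uniformly_continuous_on (ball 0 1) \<Phi>"
  unfolding uniformly_continuous_on_def
 proof safe
  fix e :: real assume e: "0 < e"
  have "dist (\<Phi> x') (\<Phi> x) < e" if "x \<in> ball 0 1" "x' \<in> ball 0 1" "dist x' x < e / B" for x x'
  proof -
   have "B * norm (x' - x) < e" using that(3) B(1) by (simp add: dist_norm field_simps)
   then show ?thesis using lip[OF that(2,1)] by (simp add: dist_norm)
  qed
  then show "\<exists>d>0. \<forall>x\<in>ball 0 1. \<forall>x'\<in>ball 0 1. dist x' x < d \<longrightarrow> dist (\<Phi> x') (\<Phi> x) < e"
   using e B(1) by (intro exI[of _ "e / B"]) auto
 qed
 then obtain g where g: "uniformly_continuous_on (closure (ball 0 1)) g" "\<And>x. x \<in> ball 0 1 ==> \<Phi> x = g x"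
  by (rule uniformly_continuous_on_extension_on_closure) blast
 have cont: "continuous_on (cball 0 1) g" using uniformly_continuous_imp_continuous[OF g(1)] by simp
 have der: "(g has_field_derivative \<phi> z) (at z)" if z: "z \<in> ball 0 1" for z
 proof -
  have "(\<Phi> has_field_derivative \<phi> z) (at z)" using \<Phi>[OF z] z by (simp add: at_within_open[OF z open_ball])
  then show ?thesis
   by (rule has_field_derivative_transform_within_open[OF _ open_ball z]) (simp add: g(2))
 qed
 obtain \<rho> where \<rho>: "\<And>k. 0 \<le> \<rho> k \<and> \<rho> k < 1" "\<rho> \<longlonglongrightarrow> 1"
  and ae: "AE \<xi> in circle_measure. convergent (\<lambda>k. \<phi> (of_real (\<rho> k) * \<xi>))" using circle_subsequence[OF hol bd] by blast
 define N0 where "N0 = {t \<in> {0..2*pi}. \<not> convergent (\<lambda>k. \<phi> (of_real (\<rho> k) * cis t))}"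
 have N0: "negligible N0" unfolding N0_def by (rule circle_AE_D[OF ae])
 define G where "G t = g (cis t)" for t
 define fk where "fk k u = \<phi> (of_real (\<rho> k) * cis u) * (of_real (\<rho> k) * (\<i> * cis u))" for k u
 define fk' where "fk' k u = (if u \<in> N0 then 0 else fk k u)" for k u
 define f where "f u = (if u \<in> {0..2*pi} - N0 then lim (\<lambda>k. \<phi> (of_real (\<rho> k) * cis u)) * (\<i> * cis u) else 0)" for u
 have inb: "of_real (\<rho> k) * cis u \<in> ball 0 1" for k u using \<rho>(1)[of k] by (simp add: norm_mult)
 have dcis: "(cis has_vector_derivative \<i> * cis t) (at t within A)" for t A
 proof -
  have "((\<lambda>z. exp (\<i> * z)) has_field_derivative exp (\<i> * of_real t) * \<i>) (at (of_real t))"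
   by (auto intro!: derivative_eq_intros)
  from has_vector_derivative_real_field[OF this, of A]
  show ?thesis unfolding cis_conv_exp[symmetric] by (simp add: mult.commute)
 qed
 have ftc: "(fk k has_integral (g (of_real (\<rho> k) * cis t) - g (of_real (\<rho> k) * cis s))) {s..t}" if "s \<le> t" for k s t
 proof (rule fundamental_theorem_of_calculus[OF that])
  fix x
  have "((\<lambda>u. of_real (\<rho> k) * cis u) has_vector_derivative of_real (\<rho> k) * (\<i> * cis x)) (at x within {s..t})"
   by (intro has_vector_derivative_mult_right dcis)
  from field_vector_diff_chain_within[OF this has_field_derivative_at_within[OF der[OF inb]]]
  show "((\<lambda>u. g (of_real (\<rho> k) * cis u)) has_vector_derivative fk k x) (at x within {s..t})"
   by (simp add: o_def fk_def mult.commute)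
 qed
 have main: "f integrable_on {s..t} \<and> integral {s..t} f = G t - G s" if st: "0 \<le> s" "s \<le> t" "t \<le> 2*pi" for s t
 proof -
  have i': "fk' k integrable_on {s..t}" for k
   by (rule integrable_spike[OF _ N0, of "fk k"]) (use ftc[OF st(2)] in \<open>auto simp: fk'_def integrable_on_def\<close>)
  have bound: "norm (fk' k x) \<le> B" for k x
  proof -
   have "cmod (fk k x) = cmod (\<phi> (of_real (\<rho> k) * cis x)) * \<rho> k" using \<rho>(1)[of k] by (simp add: fk_def norm_mult)
   also have "\<dots> \<le> B * 1" using B(2)[OF inb[of k x]] B(1) \<rho>(1)[of k] by (intro mult_mono) auto
   finally show ?thesis using B(1) by (simp add: fk'_def)
  qed
  have conv: "(\<lambda>k. fk' k x) \<longlonglongrightarrow> f x" if "x \<in> {s..t}" for x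
  proof (cases "x \<in> N0")
   case False
   then have x: "x \<in> {0..2*pi} - N0" using that st by auto
   then have "convergent (\<lambda>k. \<phi> (of_real (\<rho> k) * cis x))" by (auto simp: N0_def)
   then have c: "(\<lambda>k. \<phi> (of_real (\<rho> k) * cis x)) \<longlonglongrightarrow> lim (\<lambda>k. \<phi> (of_real (\<rho> k) * cis x))" by (simp add: convergent_LIMSEQ_iff)
   have "(\<lambda>k. \<phi> (of_real (\<rho> k) * cis x) * (of_real (\<rho> k) * (\<i> * cis x))) \<longlonglongrightarrow> lim (\<lambda>k. \<phi> (of_real (\<rho> k) * cis x)) * (of_real 1 * (\<i> * cis x))"
    by (intro tendsto_mult c tendsto_of_real \<rho>(2) tendsto_const)
   then show ?thesis using False x by (simp add: fk'_def f_def fk_def)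
  qed (simp add: fk'_def f_def)
  have hB: "(\<lambda>x. B) integrable_on {s..t}" by (rule integrable_const_ivl)
  note D = dominated_convergence[OF i' hB bound conv]
  have "integral {s..t} (fk' k) = g (of_real (\<rho> k) * cis t) - g (of_real (\<rho> k) * cis s)" for k
  proof -
   have "integral {s..t} (fk' k) = integral {s..t} (fk k)" by (rule integral_spike[OF N0]) (simp add: fk'_def)
   then show ?thesis using ftc[OF st(2), of k] by (simp add: integral_unique)
  qed
  then have "(\<lambda>k. g (of_real (\<rho> k) * cis t) - g (of_real (\<rho> k) * cis s)) \<longlonglongrightarrow> integral {s..t} f" using D(2) by simp
  moreover have "(\<lambda>k. g (of_real (\<rho> k) * cis t) - g (of_real (\<rho> k) * cis s)) \<longlonglongrightarrow> G t - G s"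
  proof -
   have "(\<lambda>k. g (of_real (\<rho> k) * cis v)) \<longlonglongrightarrow> g (cis v)" for v
   proof (rule continuous_on_tendsto_compose[OF cont])
    show "(\<lambda>k. of_real (\<rho> k) * cis v) \<longlonglongrightarrow> cis v"
     using tendsto_mult[OF tendsto_of_real[OF \<rho>(2)] tendsto_const[of "cis v"]] by simp
   qed (use inb in \<open>auto intro!: always_eventually less_imp_le\<close>)
   then show ?thesis unfolding G_def by (intro tendsto_diff)
  qed
  ultimately have "integral {s..t} f = G t - G s" by (rule LIMSEQ_unique)
  then show ?thesis using D(1) by blast
 qed
 have "f integrable_on UNIV"
  by (rule integrable_on_superset[of f "{0..2*pi}"]) (use main[of 0 "2*pi"] in \<open>auto simp: f_def\<close>)
 then have fint: "f integrable_on cbox a b" for a b by (rule integrable_on_subcbox) simp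
 then have fint': "(\<lambda>x. f (-x)) integrable_on cbox a b" for a b
  using integrable_reflect[of f "-a" "-b"] fint[of "-b" "-a"] by simp
 obtain N1 where N1: "negligible N1" "\<And>x e. x \<notin> N1 ==> 0 < e ==> \<exists>d>0. \<forall>h. 0 < h \<and> h < d \<longrightarrow> norm (integral (cbox x (x + h *\<^sub>R One)) f /\<^sub>R h ^ DIM(real) - f x) < e"
  using integrable_ccontinuous_explicit[OF fint] by blast
 obtain N2 where N2: "negligible N2" "\<And>x e. x \<notin> N2 ==> 0 < e ==> \<exists>d>0. \<forall>h. 0 < h \<and> h < d \<longrightarrow> norm (integral (cbox x (x + h *\<^sub>R One)) (\<lambda>x. f (-x)) /\<^sub>R h ^ DIM(real) - f (-x)) < e"
  using integrable_ccontinuous_explicit[OF fint'] by blast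
 define N where "N = N1 \<union> uminus ` N2"
 have "negligible (uminus ` N2)"
  by (rule negligible_differentiable_image_negligible[OF _ N2(1)])
    (auto intro!: derivative_intros simp: differentiable_on_def)
 then have N: "negligible N" unfolding N_def by (rule negligible_Un[OF N1(1)])
 have "(G has_vector_derivative f t) (at t)" if t: "0 < t" "t < 2*pi" "t \<notin> N" for t
  unfolding has_vector_derivative_def has_derivative_at_alt
 proof (intro conjI allI impI)
  show "bounded_linear (\<lambda>x. x *\<^sub>R f t)" by (rule bounded_linear_scaleR_left)
  fix e :: real assume e: "0 < e"
  have t1: "t \<notin> N1" using t(3) by (simp add: N_def)
  have t2: "- t \<notin> N2" using t(3) by (auto simp: N_def image_iff)
  obtain d1 where d1: "d1 > 0" "\<And>h. 0 < h ==> h < d1 ==> norm (integral {t..t + h} f /\<^sub>R h - f t) < e"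
   using N1(2)[OF t1 e] by auto
  obtain d2 where d2: "d2 > 0" "\<And>h. 0 < h ==> h < d2 ==> norm (integral {-t..-t + h} (\<lambda>x. f (-x)) /\<^sub>R h - f t) < e"
   using N2(2)[OF t2 e] by auto
  define d where "d = min (min d1 d2) (min t (2*pi - t))"
  have d: "d > 0" using d1 d2 t by (simp add: d_def)
  have scal: "norm (v - h *\<^sub>R w) \<le> e * h" if "norm (v /\<^sub>R h - w) < e" "h > 0" for v w :: complex and h
  proof -
   have "v - h *\<^sub>R w = h *\<^sub>R (v /\<^sub>R h - w)" using that(2) by (simp add: scaleR_diff_right)
   then have "norm (v - h *\<^sub>R w) = h * norm (v /\<^sub>R h - w)" using that(2) by (metis abs_of_pos norm_scaleR)
   also have "\<dots> \<le> h * e" using that by (intro mult_left_mono) auto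
   finally show ?thesis by (simp add: mult.commute)
  qed
  show "\<exists>d>0. \<forall>y. norm (y - t) < d \<longrightarrow> norm (G y - G t - (y - t) *\<^sub>R f t) \<le> e * norm (y - t)"
  proof (intro exI[of _ d] conjI allI impI d)
   fix y assume y: "norm (y - t) < d"
   consider "y = t" | "y > t" | "y < t" by linarith
   then show "norm (G y - G t - (y - t) *\<^sub>R f t) \<le> e * norm (y - t)"
   proof cases
    case 2
    define h where "h = y - t"
    have h: "0 < h" "h < d1" "y \<le> 2*pi" "y = t + h" using y 2 by (auto simp: h_def d_def)
    have "integral {t..t+h} f = G y - G t" using main[of t y] t h by simp
    then show ?thesis using scal[OF d1(2)[OF h(1,2)] h(1)] h by simp
   next
    case 3
    define h where "h = t - y"
    have h: "0 < h" "h < d2" "0 \<le> y" "y = t - h" using y 3 by (auto simp: h_def d_def)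
    have "integral {-t..-t+h} (\<lambda>x. f (-x)) = integral {y..t} f"
     using Henstock_Kurzweil_Integration.integral_reflect_real[of t y f] h by simp
    also have "\<dots> = G t - G y" using main[of y t] t h by simp
    finally have "norm ((G t - G y) - h *\<^sub>R f t) \<le> e * h" using scal[OF _ h(1)] d2(2)[OF h(1,2)] by metis
    moreover have "y - t = - h" using h by simp
    moreover have "G y - G t - (- h) *\<^sub>R f t = - ((G t - G y) - h *\<^sub>R f t)" by simp
    ultimately show ?thesis using h(1) by (metis abs_minus_cancel abs_of_pos norm_minus_cancel real_norm_def)
   qed simp
  qed
 qed
 then show ?thesis using cont der N unfolding G_def by blast
qed

lemma disc_radial_continuous:
 assumes "\<phi> holomorphic_on ball 0 1" "cmod \<xi> = 1"
 shows "continuous_on {0<..<1} (\<lambda>r. \<phi> (of_real r * \<xi>))"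
 by (rule continuous_on_compose2[OF holomorphic_on_imp_continuous_on[OF assms(1)]])
   (use assms in \<open>auto intro!: continuous_intros simp: norm_mult\<close>)

lemma disc_dilation_measurable:
 assumes "\<phi> holomorphic_on ball 0 1" "0 < r" "r < 1"
 shows "(\<lambda>\<xi>. \<phi> (of_real r * \<xi>)) \<in> borel_measurable circle_measure"
 unfolding measurable_cong_sets[OF sets_circle refl]
 by (intro borel_measurable_continuous_on_restrict continuous_on_compose2[OF holomorphic_on_imp_continuous_on[OF assms(1)]] continuous_intros)
   (use assms in \<open>auto simp: norm_mult\<close>)

theorem fatou_disc:
 assumes hol: "\<phi> holomorphic_on ball 0 1" and bd: "bounded (\<phi> ` ball 0 1)"
 shows "AE \<xi> in circle_measure. \<exists>l. ((\<lambda>r. \<phi> (of_real r * \<xi>)) \<longlongrightarrow> l) (at_left 1)"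
proof -
 obtain g N where g: "continuous_on (cball 0 1) g" "\<And>z. z \<in> ball 0 1 ==> (g has_field_derivative \<phi> z) (at z)" "negligible N"
  "\<And>t. 0 < t ==> t < 2*pi ==> t \<notin> N ==> \<exists>\<gamma>. ((\<lambda>t. g (cis t)) has_vector_derivative \<gamma>) (at t)"
  using primitive_boundary_differentiable[OF hol bd] by blast
 show ?thesis
 proof (rule circle_AE_I[OF _ g(3)])
  show "{\<xi> \<in> space circle_measure. \<exists>l. ((\<lambda>r. \<phi> (of_real r * \<xi>)) \<longlongrightarrow> l) (at_left 1)} \<in> sets circle_measure"
   by (rule radial_limit_set[OF disc_dilation_measurable[OF hol] disc_radial_continuous[OF hol]]) auto
  fix t assume "0 < t" "t < 2*pi" "t \<notin> N"
  then obtain \<gamma> where "((\<lambda>t. g (cis t)) has_vector_derivative \<gamma>) (at t)" using g(4) by blast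
  then show "\<exists>l. ((\<lambda>r. \<phi> (of_real r * cis t)) \<longlongrightarrow> l) (at_left 1)"
   using radial_limit_of_derivative[OF g(1,2)] by blast
 qed
qed

section \<open>Boundary values on the torus\<close>

lemma torus_ray_holomorphic:
 assumes I: "finite I" and f: "has_power_series I c f" and z: "\<zeta> \<in> torus I"
 shows "(\<lambda>w. f (dil I w \<zeta>)) holomorphic_on ball 0 1"
 unfolding dil_def
 by (rule power_series_holomorphic_comp[OF I f open_ball])
   (use z in \<open>auto intro!: holomorphic_intros simp: norm_mult torus_def PiE_iff\<close>)

lemma dil_radial_continuous:
 assumes I: "finite I" and f: "has_power_series I c f" and z: "\<zeta> \<in> torus I"
 shows "continuous_on {0<..<1} (\<lambda>r. f (dil I (of_real r) \<zeta>))"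
 by (rule continuous_on_compose2[OF holomorphic_on_imp_continuous_on[OF torus_ray_holomorphic[OF assms]]])
   (auto intro!: continuous_intros)

lemma torus_radial_limit_set:
 assumes I: "finite I" and f: "has_power_series I c f"
 shows "{\<zeta> \<in> torus I. \<exists>l. ((\<lambda>r. f (dil I (of_real r) \<zeta>)) \<longlongrightarrow> l) (at_left 1)} \<in> sets (torus_measure I)"
 using radial_limit_set[of "\<lambda>r \<zeta>. f (dil I (of_real r) \<zeta>)" "torus_measure I"] dil_parseval(1)[OF I f] dil_radial_continuous[OF I f]
 by simp

lemma radial_polydisc_dil: "radial_polydisc I f \<zeta> = Lim (at_left 1) (\<lambda>r. f (dil I (of_real r) \<zeta>))"
 by (simp add: radial_polydisc_def dil_def)

lemma radial_polydisc_measurable: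
 assumes I: "finite I" and f: "has_power_series I c f"
 shows "radial_polydisc I f \<in> borel_measurable (torus_measure I)"
 unfolding radial_polydisc_dil[abs_def]
 by (rule radial_limit_measurable) (use dil_parseval(1)[OF I f] dil_radial_continuous[OF I f] in simp_all)

lemma joint_rotation_measurable:
 "(\<lambda>p. dil I (snd p) (fst p)) \<in> measurable (torus_measure I \<Otimes>\<^sub>M circle_measure) (torus_measure I)"
proof -
 have "(\<lambda>p. \<lambda>i\<in>I. snd p * fst p i) \<in> measurable (torus_measure I \<Otimes>\<^sub>M circle_measure) (PiM I (\<lambda>_. circle_measure))"
 proof (rule measurable_restrict)
  fix i assume i: "i \<in> I"
  have 1: "(\<lambda>p. snd p) \<in> borel_measurable (torus_measure I \<Otimes>\<^sub>M circle_measure)"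
   by (rule measurable_compose[OF measurable_snd circle_ident_measurable])
  have 2: "(\<lambda>p. fst p i) \<in> borel_measurable (torus_measure I \<Otimes>\<^sub>M circle_measure)"
   by (rule measurable_compose[OF measurable_fst torus_component_measurable[OF i]])
  have "(\<lambda>p. snd p * fst p i) \<in> borel_measurable (torus_measure I \<Otimes>\<^sub>M circle_measure)"
   using 1 2 by measurable
  then show "(\<lambda>p. snd p * fst p i) \<in> measurable (torus_measure I \<Otimes>\<^sub>M circle_measure) circle_measure"
   unfolding measurable_cong_sets[OF refl sets_circle]
   by (intro measurable_restrict_space2) (use i in \<open>auto simp: space_pair_measure norm_mult torus_def PiE_iff\<close>)
 qed
 then show ?thesis by (simp add: dil_def torus_measure_def)
qed

text \<open>Apply Fatou's theorem on the disc to \<open>w \<mapsto> f(w \<zeta>)\<close> for each \<open>\<zeta>\<close>. Since the torus measure is invariant under rotation by each \<open>w\<close> of the circle, Fubini removes the average over \<open>w\<close>.\<close>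
theorem fatou_polydisc:
 assumes I: "finite I" and f: "has_power_series I c f" and bd: "bounded (f ` polydisc I)"
 shows "AE \<zeta> in torus_measure I. \<exists>l. ((\<lambda>r. f (dil I (of_real r) \<zeta>)) \<longlongrightarrow> l) (at_left 1)"
proof -
 let ?T = "torus_measure I"
 interpret T: prob_space ?T by (rule prob_space_torus)
 interpret TC: pair_sigma_finite ?T circle_measure by unfold_locales
 define Z where "Z = {\<zeta> \<in> torus I. \<exists>l. ((\<lambda>r. f (dil I (of_real r) \<zeta>)) \<longlongrightarrow> l) (at_left 1)}"
 have Z: "Z \<in> sets ?T" unfolding Z_def by (rule torus_radial_limit_set[OF I f])
 define N where "N = torus I - Z"
 have N: "N \<in> sets ?T" using Z sets.compl_sets[OF Z] by (simp add: N_def)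
 let ?g = "\<lambda>\<zeta>. indicator N \<zeta> :: ennreal"
 have gm: "?g \<in> borel_measurable ?T" using N by measurable
 have jm: "(\<lambda>p. ?g (dil I (snd p) (fst p))) \<in> borel_measurable (?T \<Otimes>\<^sub>M circle_measure)"
  by (rule measurable_compose[OF joint_rotation_measurable gm])
 have inner1: "(\<integral>\<^sup>+\<zeta>. ?g (dil I \<xi> \<zeta>) \<partial>?T) = emeasure ?T N" if "\<xi> \<in> space circle_measure" for \<xi>
 proof -
  have \<xi>: "cmod \<xi> = 1" using that by simp
  have "(\<integral>\<^sup>+\<zeta>. ?g (dil I \<xi> \<zeta>) \<partial>?T) = (\<integral>\<^sup>+\<zeta>. ?g \<zeta> \<partial>distr ?T ?T (dil I \<xi>))"
   by (rule nn_integral_distr[symmetric, OF dil_measurable[OF \<xi>]]) (use gm in simp)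
  then show ?thesis using N by (simp add: distr_torus_rotate[OF I \<xi>])
 qed
 have inner2: "(\<integral>\<^sup>+\<xi>. ?g (dil I \<xi> \<zeta>) \<partial>circle_measure) = 0" if z: "\<zeta> \<in> space ?T" for \<zeta>
 proof -
  have z': "\<zeta> \<in> torus I" using z by simp
  have "bounded ((\<lambda>w. f (dil I w \<zeta>)) ` ball 0 1)"
   by (rule bounded_subset[OF bd]) (use dil_in_polydisc[OF z'] in auto)
  from fatou_disc[OF torus_ray_holomorphic[OF I f z'] this] AE_space
  have "AE \<xi> in circle_measure. ?g (dil I \<xi> \<zeta>) = 0"
  proof eventually_elim
   case (elim \<xi>)
   have \<xi>: "cmod \<xi> = 1" using elim(2) by simp
   have "dil I (of_real r) (dil I \<xi> \<zeta>) = dil I (of_real r * \<xi>) \<zeta>" for r by (auto simp: dil_def fun_eq_iff)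
   then have "dil I \<xi> \<zeta> \<in> Z" using elim(1) dil_in_torus[OF z' \<xi>] by (simp add: Z_def)
   then show ?case by (simp add: N_def)
  qed
  then have "(\<integral>\<^sup>+\<xi>. ?g (dil I \<xi> \<zeta>) \<partial>circle_measure) = (\<integral>\<^sup>+\<xi>. 0 \<partial>circle_measure)" by (rule nn_integral_cong_AE)
  then show ?thesis by simp
 qed
 have "emeasure ?T N = (\<integral>\<^sup>+\<xi>. emeasure ?T N \<partial>circle_measure)"
  using circle.emeasure_space_1 by (simp add: nn_integral_const)
 also have "\<dots> = (\<integral>\<^sup>+\<xi>. (\<integral>\<^sup>+\<zeta>. ?g (dil I \<xi> \<zeta>) \<partial>?T) \<partial>circle_measure)"
  by (rule nn_integral_cong) (simp add: inner1)
 also have "\<dots> = (\<integral>\<^sup>+\<zeta>. (\<integral>\<^sup>+\<xi>. ?g (dil I \<xi> \<zeta>) \<partial>circle_measure) \<partial>?T)"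
  using TC.Fubini[OF jm] by simp
 also have "\<dots> = (\<integral>\<^sup>+\<zeta>. 0 \<partial>?T)" by (rule nn_integral_cong) (rule inner2)
 also have "\<dots> = 0" by simp
 finally have "emeasure ?T N = 0" .
 then have "N \<in> null_sets ?T" using N by blast
 then show ?thesis by (rule AE_I') (auto simp: N_def Z_def) 
qed

lemma radial_polydisc_AE:
 assumes I: "finite I" and f: "has_power_series I c f" and bd: "bounded (f ` polydisc I)"
 shows "AE \<zeta> in torus_measure I. (\<lambda>k. f (dil I (of_real (rad k)) \<zeta>)) \<longlonglongrightarrow> radial_polydisc I f \<zeta>"
 using fatou_polydisc[OF assms]
proof eventually_elim
 case (elim \<zeta>)
 then obtain l where l: "((\<lambda>r. f (dil I (of_real r) \<zeta>)) \<longlongrightarrow> l) (at_left 1)" by blast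
 have "radial_polydisc I f \<zeta> = l" unfolding radial_polydisc_dil by (rule tendsto_Lim[OF _ l]) simp
 then show ?case using filterlim_compose[OF l rad_at_left] by simp
qed

lemma radial_polydisc_le_AE:
 assumes I: "finite I" and f: "has_power_series I c f" and B: "\<And>z. z \<in> polydisc I ==> cmod (f z) \<le> B"
 shows "AE \<zeta> in torus_measure I. cmod (radial_polydisc I f \<zeta>) \<le> B"
proof -
 have bd: "bounded (f ` polydisc I)" using B by (auto simp: bounded_iff)
 show ?thesis
  using radial_polydisc_AE[OF I f bd] AE_space
 proof eventually_elim
  case (elim \<zeta>)
  show ?case
   by (rule LIMSEQ_le_const2[OF tendsto_norm[OF elim(1)]])
     (use elim(2) rad_bounds in \<open>auto intro!: B dil_in_polydisc\<close>)
 qed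
qed

text \<open>Dominated convergence in Parseval's identity for dilations.\<close>
lemma radial_boundary_norm:
 assumes I: "finite I" and f: "has_power_series I c f" and B: "\<And>z. z \<in> polydisc I ==> cmod (f z) \<le> B" "0 \<le> B"
  and F: "finite F" "F \<subseteq> multi_indices I"
 shows "integrable (torus_measure I) (\<lambda>\<zeta>. (cmod (radial_polydisc I f \<zeta>))^2 * (cmod (\<Sum>\<alpha>\<in>F. d \<alpha> * mon I \<alpha> \<zeta>))^2)"
  and "(\<integral>\<zeta>. (cmod (radial_polydisc I f \<zeta>))^2 * (cmod (\<Sum>\<alpha>\<in>F. d \<alpha> * mon I \<alpha> \<zeta>))^2 \<partial>torus_measure I)
   = (H2_norm I (\<lambda>z. f z * poly_on I F d z))^2"
proof -
 interpret prob_space "torus_measure I" by (rule prob_space_torus)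
 have bd: "bounded (f ` polydisc I)" using B by (auto simp: bounded_iff)
 define h where "h \<zeta> = (\<Sum>\<alpha>\<in>F. d \<alpha> * mon I \<alpha> \<zeta>)" for \<zeta>
 define D where "D = (\<Sum>\<alpha>\<in>F. cmod (d \<alpha>))"
 have D0: "0 \<le> D" unfolding D_def by (rule sum_nonneg) simp
 have hol: "holomorphic_polydisc I f" using f by (auto simp: holomorphic_polydisc_def)
 have fh: "(\<lambda>z. f z * poly_on I F d z) \<in> H2 I" by (rule bounded_mult_H2[OF I hol B poly_on_H2[OF I F]])
 note ps = H2_power_series[OF fh]
 have [measurable]: "radial_polydisc I f \<in> borel_measurable (torus_measure I)" by (rule radial_polydisc_measurable[OF I f])
 have [measurable]: "h \<in> borel_measurable (torus_measure I)" unfolding h_def[abs_def] by measurable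
 have hlim: "(\<lambda>k. poly_on I F d (dil I (of_real (rad k)) \<zeta>)) \<longlonglongrightarrow> h \<zeta>" if "\<zeta> \<in> torus I" for \<zeta>
 proof -
  have "(\<lambda>k. \<Sum>\<alpha>\<in>F. d \<alpha> * (of_real (rad k) ^ deg I \<alpha> * mon I \<alpha> \<zeta>)) \<longlonglongrightarrow> (\<Sum>\<alpha>\<in>F. d \<alpha> * (of_real 1 ^ deg I \<alpha> * mon I \<alpha> \<zeta>))"
   by (rule tendsto_sum, rule tendsto_mult[OF tendsto_const], rule tendsto_mult[OF _ tendsto_const], rule tendsto_power, rule tendsto_of_real[OF rad_tendsto])
  moreover have "poly_on I F d (dil I (of_real (rad k)) \<zeta>) = (\<Sum>\<alpha>\<in>F. d \<alpha> * (of_real (rad k) ^ deg I \<alpha> * mon I \<alpha> \<zeta>))" for k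
   using dil_in_polydisc[OF that, of "of_real (rad k)"] rad_bounds[of k] by (simp add: poly_on_def mon_dil)
  ultimately show ?thesis by (simp add: h_def)
 qed
 have hD: "cmod (h \<zeta>) \<le> D" if "\<zeta> \<in> torus I" for \<zeta>
  unfolding h_def D_def using that by (intro sum_norm_le) (simp add: norm_mult norm_mon_torus)
 have kbound: "cmod (f (dil I (of_real (rad k)) \<zeta>) * poly_on I F d (dil I (of_real (rad k)) \<zeta>)) \<le> B * D" if z: "\<zeta> \<in> torus I" for k \<zeta>
 proof -
  have z': "dil I (of_real (rad k)) \<zeta> \<in> polydisc I" using rad_bounds[of k] by (intro dil_in_polydisc[OF z]) simp
  have "cmod (\<Sum>\<alpha>\<in>F. d \<alpha> * (of_real (rad k) ^ deg I \<alpha> * mon I \<alpha> \<zeta>)) \<le> D"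
   unfolding D_def
  proof (rule sum_norm_le)
   fix \<alpha>
   have "rad k ^ deg I \<alpha> \<le> 1" using rad_bounds[of k] by (intro power_le_one) auto
   then show "cmod (d \<alpha> * (of_real (rad k) ^ deg I \<alpha> * mon I \<alpha> \<zeta>)) \<le> cmod (d \<alpha>)"
    using rad_bounds[of k] z by (simp add: norm_mult norm_power norm_mon_torus mult_left_le)
  qed
  then have "cmod (poly_on I F d (dil I (of_real (rad k)) \<zeta>)) \<le> D" using z' by (simp add: poly_on_def mon_dil)
  then show ?thesis unfolding norm_mult using B(1)[OF z'] B(2) by (intro mult_mono) auto
 qed
 have dom: "AE \<zeta> in torus_measure I. norm ((cmod (f (dil I (of_real (rad k)) \<zeta>) * poly_on I F d (dil I (of_real (rad k)) \<zeta>)))^2) \<le> (B * D)^2" for k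
 proof (rule AE_I2)
  fix \<zeta> assume "\<zeta> \<in> space (torus_measure I)"
  then have "(cmod (f (dil I (of_real (rad k)) \<zeta>) * poly_on I F d (dil I (of_real (rad k)) \<zeta>)))^2 \<le> (B * D)^2"
   by (intro power_mono kbound) auto
  then show "norm ((cmod (f (dil I (of_real (rad k)) \<zeta>) * poly_on I F d (dil I (of_real (rad k)) \<zeta>)))^2) \<le> (B * D)^2" by simp
 qed
 have lim: "AE \<zeta> in torus_measure I. (\<lambda>k. (cmod (f (dil I (of_real (rad k)) \<zeta>) * poly_on I F d (dil I (of_real (rad k)) \<zeta>)))^2)
   \<longlonglongrightarrow> (cmod (radial_polydisc I f \<zeta>))^2 * (cmod (h \<zeta>))^2"
  using radial_polydisc_AE[OF I f bd] AE_space
 proof eventually_elim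
  case (elim \<zeta>)
  have "\<zeta> \<in> torus I" using elim(2) by simp
  from tendsto_power[OF tendsto_norm[OF tendsto_mult[OF elim(1) hlim[OF this]]], of 2]
  show ?case by (simp only: norm_mult power_mult_distrib)
 qed
 have mk: "(\<lambda>\<zeta>. (cmod (f (dil I (of_real (rad k)) \<zeta>) * poly_on I F d (dil I (of_real (rad k)) \<zeta>)))^2) \<in> borel_measurable (torus_measure I)" for k
  using dil_parseval(1)[OF I ps rad_bounds] by measurable
 have m: "(\<lambda>\<zeta>. (cmod (radial_polydisc I f \<zeta>))^2 * (cmod (h \<zeta>))^2) \<in> borel_measurable (torus_measure I)" by measurable
 have int: "integrable (torus_measure I) (\<lambda>_. (B * D)^2)" by simp
 note DC = integrable_dominated_convergence[OF m mk int lim dom] integral_dominated_convergence[OF m mk int lim dom]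
 show "integrable (torus_measure I) (\<lambda>\<zeta>. (cmod (radial_polydisc I f \<zeta>))^2 * (cmod (\<Sum>\<alpha>\<in>F. d \<alpha> * mon I \<alpha> \<zeta>))^2)"
  using DC(1) unfolding h_def .
 show "(\<integral>\<zeta>. (cmod (radial_polydisc I f \<zeta>))^2 * (cmod (\<Sum>\<alpha>\<in>F. d \<alpha> * mon I \<alpha> \<zeta>))^2 \<partial>torus_measure I)
   = (H2_norm I (\<lambda>z. f z * poly_on I F d z))^2"
  using LIMSEQ_unique[OF DC(2) dil_norm_tendsto[OF I fh]] unfolding h_def .
qed

lemma mult_lower_bound_extend:
 assumes I: "finite I" and f: "holomorphic_polydisc I f" and B: "\<And>z. z \<in> polydisc I ==> cmod (f z) \<le> B" "0 \<le> B"
  and low: "\<And>p. is_poly I p ==> \<delta> * H2_norm I p \<le> H2_norm I (\<lambda>z. f z * p z)" and h: "h \<in> H2 I"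
 shows "\<delta> * H2_norm I h \<le> H2_norm I (\<lambda>z. f z * h z)"
proof -
 interpret fun_hilbert "H2 I" "H2_inner I" "H2_norm I" by (rule H2_hilbert[OF I])
 define p where "p N = poly_on I (ibox I N) (coeffs I h)" for N
 have pp: "is_poly I (p N)" for N unfolding p_def by (rule is_poly_trunc[OF I])
 have pX: "p N \<in> H2 I" for N by (rule is_poly_H2[OF I pp])
 have pt: "tends p h" unfolding p_def by (rule poly_tends[OF I h])
 have fX: "(\<lambda>z. f z * g z) \<in> H2 I" if "g \<in> H2 I" for g by (rule bounded_mult_H2[OF I f B that])
 have ft: "tends (\<lambda>N z. f z * p N z) (\<lambda>z. f z * h z)"
 proof (rule tends_bounded_map[OF pt _ fX[OF pX] fX[OF h]])
  fix k
  show "H2_norm I (\<lambda>x. f x * p k x - f x * h x) \<le> B * H2_norm I (\<lambda>x. p k x - h x)"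
   using bounded_mult_norm[OF I f B diff_mem[OF pX h], of k] by (simp add: right_diff_distrib)
 qed
 show ?thesis
  by (rule LIMSEQ_le[OF tendsto_mult[OF tendsto_const tends_nm[OF pt pX h]] tends_nm[OF ft fX[OF pX] fX[OF h]]])
    (use low[OF pp] in blast)
qed

lemma boundary_lower_imp_mult_lower:
 assumes I: "finite I" and f: "holomorphic_polydisc I f" and bd: "bounded (f ` polydisc I)"
  and low: "AE \<zeta> in torus_measure I. \<delta> \<le> cmod (radial_polydisc I f \<zeta>)" and \<delta>: "0 \<le> \<delta>" and h: "h \<in> H2 I"
 shows "\<delta> * H2_norm I h \<le> H2_norm I (\<lambda>z. f z * h z)"
proof -
 obtain c where c: "has_power_series I c f" using f by (auto simp: holomorphic_polydisc_def)
 obtain B where B: "\<And>z. z \<in> polydisc I ==> cmod (f z) \<le> B" "B > 0"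
  using bd unfolding bounded_pos by auto
 then have B': "0 \<le> B" by simp
 show ?thesis
 proof (rule mult_lower_bound_extend[OF I f B(1) B' _ h])
  fix p assume "is_poly I p"
  then obtain F d where F: "finite F" "F \<subseteq> multi_indices I" "p = poly_on I F d" by (auto simp: is_poly_def)
  note N = radial_boundary_norm[OF I c B(1) B' F(1,2), where d=d]
  let ?s = "\<lambda>\<zeta>. (cmod (\<Sum>\<alpha>\<in>F. d \<alpha> * mon I \<alpha> \<zeta>))^2"
  have sm: "?s \<in> borel_measurable (torus_measure I)" by measurable
  have si: "integrable (torus_measure I) ?s"
  proof (rule torus_integrable_bounded[OF sm, where B="(\<Sum>\<alpha>\<in>F. cmod (d \<alpha>))^2"])
   fix \<zeta> assume "\<zeta> \<in> torus I"
   then have "cmod (\<Sum>\<alpha>\<in>F. d \<alpha> * mon I \<alpha> \<zeta>) \<le> (\<Sum>\<alpha>\<in>F. cmod (d \<alpha>))"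
    by (intro sum_norm_le) (simp add: norm_mult norm_mon_torus)
   then show "norm (?s \<zeta>) \<le> (\<Sum>\<alpha>\<in>F. cmod (d \<alpha>))^2" by (simp add: power_mono)
  qed
  have "(\<delta> * H2_norm I p)^2 = \<delta>^2 * (\<integral>\<zeta>. ?s \<zeta> \<partial>torus_measure I)"
   unfolding F(3) power_mult_distrib poly_on_norm[OF I F(1,2)] torus_parseval_finite[OF I F(1,2)] ..
  also have "\<dots> = (\<integral>\<zeta>. \<delta>^2 * ?s \<zeta> \<partial>torus_measure I)" by simp
  also have "\<dots> \<le> (\<integral>\<zeta>. (cmod (radial_polydisc I f \<zeta>))^2 * ?s \<zeta> \<partial>torus_measure I)"
  proof (rule integral_mono_AE[OF integrable_mult_right[OF si] N(1)])
   show "AE \<zeta> in torus_measure I. \<delta>^2 * ?s \<zeta> \<le> (cmod (radial_polydisc I f \<zeta>))^2 * ?s \<zeta>"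
    using low
   proof eventually_elim
    case (elim \<zeta>)
    then have "\<delta>^2 \<le> (cmod (radial_polydisc I f \<zeta>))^2" using \<delta> by (rule power_mono)
    then show ?case by (rule mult_right_mono) simp
   qed
  qed
  also have "\<dots> = (H2_norm I (\<lambda>z. f z * p z))^2" unfolding F(3) by (rule N(2))
  finally show "\<delta> * H2_norm I p \<le> H2_norm I (\<lambda>z. f z * p z)" by (rule power2_le_imp_le[OF _ H2_norm_ge0])
 qed
qed

section \<open>Multiplier bounds and boundary values\<close>

definition mon_sum :: "nat set \<Rightarrow> func \<Rightarrow> bool" where
 "mon_sum I h \<longleftrightarrow> (\<exists>F c. finite F \<and> F \<subseteq> multi_indices I \<and> h = (\<lambda>z. \<Sum>\<alpha>\<in>F. c \<alpha> * mon I \<alpha> z))"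

lemma mon_sum_mon: "\<alpha> \<in> multi_indices I ==> mon_sum I (\<lambda>z. a * mon I \<alpha> z)"
 unfolding mon_sum_def by (intro exI[of _ "{\<alpha>}"] exI[of _ "\<lambda>_. a"]) auto

lemma mon_zero: "mon I (\<lambda>i\<in>I. 0) z = 1"
 by (simp add: mon_def)

lemma mon_sum_const: "mon_sum I (\<lambda>z. a)"
 using mon_sum_mon[OF zero_index, of I a] by (simp add: mon_zero)

lemma mon_sum_add:
 assumes "mon_sum I g" "mon_sum I h" shows "mon_sum I (\<lambda>z. g z + h z)"
proof -
 obtain F c G d where *: "finite F" "F \<subseteq> multi_indices I" "g = (\<lambda>z. \<Sum>\<alpha>\<in>F. c \<alpha> * mon I \<alpha> z)" "finite G" "G \<subseteq> multi_indices I" "h = (\<lambda>z. \<Sum>\<alpha>\<in>G. d \<alpha> * mon I \<alpha> z)"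
  using assms by (auto simp: mon_sum_def)
 have "(\<Sum>\<alpha>\<in>F. c \<alpha> * mon I \<alpha> z) = (\<Sum>\<alpha>\<in>F \<union> G. (if \<alpha> \<in> F then c \<alpha> else 0) * mon I \<alpha> z)"
  "(\<Sum>\<alpha>\<in>G. d \<alpha> * mon I \<alpha> z) = (\<Sum>\<alpha>\<in>F \<union> G. (if \<alpha> \<in> G then d \<alpha> else 0) * mon I \<alpha> z)" for z
  using * by (auto intro!: sum.mono_neutral_cong_left)
 then have "(\<lambda>z. g z + h z) = (\<lambda>z. \<Sum>\<alpha>\<in>F \<union> G. ((if \<alpha> \<in> F then c \<alpha> else 0) + (if \<alpha> \<in> G then d \<alpha> else 0)) * mon I \<alpha> z)"
  unfolding *(3,6) by (auto simp: fun_eq_iff distrib_right sum.distrib)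
 then show ?thesis unfolding mon_sum_def using *(1,2,4,5)
  by (intro exI[of _ "F \<union> G"] exI[of _ "\<lambda>\<alpha>. (if \<alpha> \<in> F then c \<alpha> else 0) + (if \<alpha> \<in> G then d \<alpha> else 0)"] conjI) auto
qed

lemma mon_sum_sum: "(\<And>i. i \<in> A ==> mon_sum I (g i)) ==> mon_sum I (\<lambda>z. \<Sum>i\<in>A. g i z)"
proof (induction A rule: infinite_finite_induct)
 case (insert a A)
 have "mon_sum I (\<lambda>z. g a z + (\<Sum>i\<in>A. g i z))" by (intro mon_sum_add insert.IH insert.prems) auto
 then show ?case using insert.hyps by simp
qed (simp_all add: mon_sum_const)

lemma mon_sum_mult:
 assumes "mon_sum I g" "mon_sum I h" shows "mon_sum I (\<lambda>z. g z * h z)"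
proof -
 obtain F c G d where *: "finite F" "F \<subseteq> multi_indices I" "g = (\<lambda>z. \<Sum>\<alpha>\<in>F. c \<alpha> * mon I \<alpha> z)" "finite G" "G \<subseteq> multi_indices I" "h = (\<lambda>z. \<Sum>\<alpha>\<in>G. d \<alpha> * mon I \<alpha> z)"
  using assms by (auto simp: mon_sum_def)
 have "(\<lambda>z. g z * h z) = (\<lambda>z. \<Sum>\<alpha>\<in>F. \<Sum>\<beta>\<in>G. (c \<alpha> * d \<beta>) * mon I (\<lambda>i\<in>I. \<alpha> i + \<beta> i) z)"
  unfolding *(3,6) by (auto simp: fun_eq_iff sum_product mon_add mult_ac)
 moreover have "mon_sum I (\<lambda>z. \<Sum>\<alpha>\<in>F. \<Sum>\<beta>\<in>G. (c \<alpha> * d \<beta>) * mon I (\<lambda>i\<in>I. \<alpha> i + \<beta> i) z)"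
  by (intro mon_sum_sum mon_sum_mon) (simp add: multi_indices_def)
 ultimately show ?thesis by simp
qed

text \<open>Laurent polynomials, encoded as those functions which a monomial turns into a polynomial on the torus.\<close>
definition trig_poly :: "nat set \<Rightarrow> func \<Rightarrow> bool" where
 "trig_poly I p \<longleftrightarrow> (\<exists>\<beta> h. mon_sum I h \<and> (\<forall>\<zeta>\<in>torus I. mon I \<beta> \<zeta> * p \<zeta> = h \<zeta>))"

lemma trig_poly_mon_sum: "mon_sum I h ==> trig_poly I h"
 unfolding trig_poly_def by (intro exI[of _ "\<lambda>i\<in>I. 0"] exI[of _ h]) (simp add: mon_zero)

lemma trig_poly_add:
 assumes "trig_poly I p" "trig_poly I q" shows "trig_poly I (\<lambda>\<zeta>. p \<zeta> + q \<zeta>)"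
proof -
 obtain \<beta> h \<gamma> g where *: "mon_sum I h" "\<And>\<zeta>. \<zeta> \<in> torus I ==> mon I \<beta> \<zeta> * p \<zeta> = h \<zeta>" "mon_sum I g" "\<And>\<zeta>. \<zeta> \<in> torus I ==> mon I \<gamma> \<zeta> * q \<zeta> = g \<zeta>"
  using assms unfolding trig_poly_def by blast
 have m: "mon_sum I (mon I \<delta>)" for \<delta>
 proof -
  have "mon I \<delta> = (\<lambda>z. 1 * mon I (\<lambda>i\<in>I. \<delta> i) z)" by (auto simp: mon_def)
  then show ?thesis using mon_sum_mon[of "\<lambda>i\<in>I. \<delta> i" I 1] by (simp add: multi_indices_def)
 qed
 show ?thesis unfolding trig_poly_def
 proof (intro exI conjI ballI)
  show "mon_sum I (\<lambda>z. mon I \<gamma> z * h z + mon I \<beta> z * g z)" by (intro mon_sum_add mon_sum_mult m *)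
  fix \<zeta> assume z: "\<zeta> \<in> torus I"
  show "mon I (\<lambda>i\<in>I. \<beta> i + \<gamma> i) \<zeta> * (p \<zeta> + q \<zeta>) = mon I \<gamma> \<zeta> * h \<zeta> + mon I \<beta> \<zeta> * g \<zeta>"
   unfolding mon_add *(2)[OF z, symmetric] *(4)[OF z, symmetric] by (simp add: algebra_simps)
 qed
qed

lemma trig_poly_mult:
 assumes "trig_poly I p" "trig_poly I q" shows "trig_poly I (\<lambda>\<zeta>. p \<zeta> * q \<zeta>)"
proof -
 obtain \<beta> h \<gamma> g where *: "mon_sum I h" "\<And>\<zeta>. \<zeta> \<in> torus I ==> mon I \<beta> \<zeta> * p \<zeta> = h \<zeta>" "mon_sum I g" "\<And>\<zeta>. \<zeta> \<in> torus I ==> mon I \<gamma> \<zeta> * q \<zeta> = g \<zeta>"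
  using assms unfolding trig_poly_def by blast
 show ?thesis unfolding trig_poly_def
 proof (intro exI conjI ballI)
  show "mon_sum I (\<lambda>z. h z * g z)" by (intro mon_sum_mult *)
  fix \<zeta> assume z: "\<zeta> \<in> torus I"
  show "mon I (\<lambda>i\<in>I. \<beta> i + \<gamma> i) \<zeta> * (p \<zeta> * q \<zeta>) = h \<zeta> * g \<zeta>"
   unfolding mon_add *(2)[OF z, symmetric] *(4)[OF z, symmetric] by (simp add: algebra_simps)
 qed
qed

lemma trig_poly_const: "trig_poly I (\<lambda>\<zeta>. a)" by (rule trig_poly_mon_sum[OF mon_sum_const])

lemma trig_poly_power: "trig_poly I p ==> trig_poly I (\<lambda>\<zeta>. p \<zeta> ^ n)"
 by (induction n) (auto intro: trig_poly_const trig_poly_mult)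

lemma trig_poly_sum: "(\<And>i. i \<in> A ==> trig_poly I (g i)) ==> trig_poly I (\<lambda>z. \<Sum>i\<in>A. g i z)"
proof (induction A rule: infinite_finite_induct)
 case (insert a A)
 have "trig_poly I (\<lambda>z. g a z + (\<Sum>i\<in>A. g i z))" by (intro trig_poly_add insert.IH insert.prems) auto
 then show ?case using insert.hyps by simp
qed (simp_all add: trig_poly_const)

lemma trig_poly_cnj_mon: "trig_poly I (\<lambda>\<zeta>. cnj (mon I \<alpha> \<zeta>))"
 unfolding trig_poly_def
proof (intro exI conjI ballI)
 show "mon_sum I (\<lambda>z. 1)" by (rule mon_sum_const)
 fix \<zeta> assume "\<zeta> \<in> torus I"
 then show "mon I \<alpha> \<zeta> * cnj (mon I \<alpha> \<zeta>) = 1"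
  using complex_norm_square[of "mon I \<alpha> \<zeta>"] norm_mon_torus by simp
qed

lemma trig_poly_norm_sq:
 assumes "mon_sum I s" shows "trig_poly I (\<lambda>\<zeta>. of_real ((cmod (s \<zeta>))^2))"
proof -
 obtain F c where F: "finite F" "s = (\<lambda>z. \<Sum>\<alpha>\<in>F. c \<alpha> * mon I \<alpha> z)" using assms by (auto simp: mon_sum_def)
 have "trig_poly I (\<lambda>\<zeta>. \<Sum>\<alpha>\<in>F. cnj (c \<alpha>) * cnj (mon I \<alpha> \<zeta>))"
  by (intro trig_poly_sum trig_poly_mult trig_poly_const trig_poly_cnj_mon)
 then have "trig_poly I (\<lambda>\<zeta>. cnj (s \<zeta>))" by (simp add: F(2))
 then have "trig_poly I (\<lambda>\<zeta>. s \<zeta> * cnj (s \<zeta>))" by (rule trig_poly_mult[OF trig_poly_mon_sum[OF assms]])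
 then show ?thesis unfolding complex_norm_square .
qed

lemma trig_poly_real_polynomial:
 assumes "real_polynomial_function P" "trig_poly I (\<lambda>\<zeta>. of_real (t \<zeta>))"
 shows "trig_poly I (\<lambda>\<zeta>. of_real (P (t \<zeta>)))"
proof -
 obtain a n where P: "P = (\<lambda>x. \<Sum>i\<le>(n::nat). a i * x ^ i)" 
  using assms(1) unfolding real_polynomial_function_iff_sum by blast
 have "trig_poly I (\<lambda>\<zeta>. \<Sum>i\<le>n. of_real (a i) * (of_real (t \<zeta>)) ^ i)"
  by (intro trig_poly_sum trig_poly_mult trig_poly_const trig_poly_power assms(2))
 then show ?thesis by (simp add: P)
qed

lemma dilation_uniform_approx:
 assumes I: "finite I" and f: "has_power_series I c f" and r: "0 \<le> r" "r < 1" and e: "e > 0"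
 shows "\<exists>s. mon_sum I s \<and> (\<forall>\<zeta>\<in>torus I. cmod (s \<zeta> - f (dil I (of_real r) \<zeta>)) \<le> e)"
proof -
 define a where "a \<alpha> = c \<alpha> * of_real r ^ deg I \<alpha>" for \<alpha>
 have "uniform_limit (torus I) (\<lambda>F \<zeta>. \<Sum>\<alpha>\<in>F. a \<alpha> * mon I \<alpha> \<zeta>) (\<lambda>\<zeta>. f (dil I (of_real r) \<zeta>)) (finite_subsets_at_top (multi_indices I))"
 proof (rule Weierstrass_m_test_general'[where M="\<lambda>\<alpha>. cmod (a \<alpha>)"])
  show "(\<lambda>\<alpha>. cmod (a \<alpha>)) summable_on multi_indices I" unfolding a_def by (rule power_series_abs_summable[OF f r])
  show "((\<lambda>\<alpha>. a \<alpha> * mon I \<alpha> \<zeta>) has_sum f (dil I (of_real r) \<zeta>)) (multi_indices I)" if "\<zeta> \<in> torus I" for \<zeta>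
   unfolding a_def by (rule power_series_dil[OF f _ that]) (use r in simp)
 qed (simp add: norm_mult norm_mon_torus)
 note ev = uniform_limitD[OF this e]
 have "\<forall>\<^sub>F F in finite_subsets_at_top (multi_indices I). finite F \<and> F \<subseteq> multi_indices I"
  by (rule eventually_finite_subsets_at_top_weakI) simp
 then have "\<forall>\<^sub>F F in finite_subsets_at_top (multi_indices I). finite F \<and> F \<subseteq> multi_indices I \<and> (\<forall>\<zeta>\<in>torus I. dist (\<Sum>\<alpha>\<in>F. a \<alpha> * mon I \<alpha> \<zeta>) (f (dil I (of_real r) \<zeta>)) < e)"
  using ev by eventually_elim simp
 from eventually_happens'[OF finite_subsets_at_top_neq_bot this]
 obtain F where F: "finite F" "F \<subseteq> multi_indices I" "\<forall>\<zeta>\<in>torus I. dist (\<Sum>\<alpha>\<in>F. a \<alpha> * mon I \<alpha> \<zeta>) (f (dil I (of_real r) \<zeta>)) < e"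
  by (elim exE conjE)
 have "mon_sum I (\<lambda>z. \<Sum>\<alpha>\<in>F. a \<alpha> * mon I \<alpha> z)" unfolding mon_sum_def using F(1,2) by blast
 then show ?thesis using F(3) by (intro exI[of _ "\<lambda>z. \<Sum>\<alpha>\<in>F. a \<alpha> * mon I \<alpha> z"]) (auto simp: dist_norm less_imp_le)
qed

lemma mon_sum_measurable: "mon_sum I s ==> s \<in> borel_measurable (torus_measure I)"
 unfolding mon_sum_def by auto

text \<open>On the torus a trigonometric polynomial has the same modulus as a polynomial, so the lower bound for polynomials passes to it.\<close>
lemma trig_poly_lower:
 assumes I: "finite I" and f: "has_power_series I c f" and B: "\<And>z. z \<in> polydisc I ==> cmod (f z) \<le> B" "0 \<le> B"
  and low: "\<And>p. is_poly I p ==> \<delta> * H2_norm I p \<le> H2_norm I (\<lambda>z. f z * p z)" and \<delta>: "0 \<le> \<delta>"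
  and p: "trig_poly I p"
 shows "0 \<le> (\<integral>\<zeta>. ((cmod (radial_polydisc I f \<zeta>))^2 - \<delta>^2) * (cmod (p \<zeta>))^2 \<partial>torus_measure I)"
proof -
 obtain \<beta> h where h: "mon_sum I h" "\<And>\<zeta>. \<zeta> \<in> torus I ==> mon I \<beta> \<zeta> * p \<zeta> = h \<zeta>" using p unfolding trig_poly_def by blast
 obtain F d where F: "finite F" "F \<subseteq> multi_indices I" "h = (\<lambda>z. \<Sum>\<alpha>\<in>F. d \<alpha> * mon I \<alpha> z)" using h(1) by (auto simp: mon_sum_def)
 have ph: "cmod (p \<zeta>) = cmod (h \<zeta>)" if "\<zeta> \<in> torus I" for \<zeta>
  using h(2)[OF that, symmetric] by (simp add: norm_mult norm_mon_torus[OF that])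
 define D where "D = (\<Sum>\<alpha>\<in>F. cmod (d \<alpha>))"
 have hi: "integrable (torus_measure I) (\<lambda>\<zeta>. (cmod (h \<zeta>))^2)"
 proof (rule torus_integrable_bounded[where B="D^2"])
  show "(\<lambda>\<zeta>. (cmod (h \<zeta>))^2) \<in> borel_measurable (torus_measure I)" using mon_sum_measurable[OF h(1)] by measurable
  fix \<zeta> assume "\<zeta> \<in> torus I"
  then have "cmod (h \<zeta>) \<le> D" unfolding F(3) D_def by (intro sum_norm_le) (simp add: norm_mult norm_mon_torus)
  then show "norm ((cmod (h \<zeta>))^2) \<le> D^2" by (simp add: power_mono)
 qed
 have Ni: "integrable (torus_measure I) (\<lambda>\<zeta>. (cmod (radial_polydisc I f \<zeta>))^2 * (cmod (h \<zeta>))^2)"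
  and Nv: "(\<integral>\<zeta>. (cmod (radial_polydisc I f \<zeta>))^2 * (cmod (h \<zeta>))^2 \<partial>torus_measure I) = (H2_norm I (\<lambda>z. f z * poly_on I F d z))^2"
  using radial_boundary_norm[OF I f B F(1,2), where d=d] by (simp_all add: F(3))
 have "(\<integral>\<zeta>. ((cmod (radial_polydisc I f \<zeta>))^2 - \<delta>^2) * (cmod (p \<zeta>))^2 \<partial>torus_measure I)
  = (\<integral>\<zeta>. (cmod (radial_polydisc I f \<zeta>))^2 * (cmod (h \<zeta>))^2 - \<delta>^2 * (cmod (h \<zeta>))^2 \<partial>torus_measure I)"
  by (rule Bochner_Integration.integral_cong) (simp_all add: ph left_diff_distrib)
 also have "\<dots> = (H2_norm I (\<lambda>z. f z * poly_on I F d z))^2 - \<delta>^2 * (\<integral>\<zeta>. (cmod (h \<zeta>))^2 \<partial>torus_measure I)"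
  using Ni hi Nv by (subst Bochner_Integration.integral_diff) auto
 also have "(\<integral>\<zeta>. (cmod (h \<zeta>))^2 \<partial>torus_measure I) = (H2_norm I (poly_on I F d))^2"
  unfolding poly_on_norm[OF I F(1,2)] F(3) by (rule torus_parseval_finite[OF I F(1,2)])
 finally have eq: "(\<integral>\<zeta>. ((cmod (radial_polydisc I f \<zeta>))^2 - \<delta>^2) * (cmod (p \<zeta>))^2 \<partial>torus_measure I)
  = (H2_norm I (\<lambda>z. f z * poly_on I F d z))^2 - (\<delta> * H2_norm I (poly_on I F d))^2" by (simp add: power_mult_distrib)
 have "is_poly I (poly_on I F d)" unfolding is_poly_def using F by blast
 then have "\<delta> * H2_norm I (poly_on I F d) \<le> H2_norm I (\<lambda>z. f z * poly_on I F d z)" by (rule low)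
 then have "(\<delta> * H2_norm I (poly_on I F d))^2 \<le> (H2_norm I (\<lambda>z. f z * poly_on I F d z))^2"
  by (rule power_mono) (intro mult_nonneg_nonneg \<delta> H2_norm_ge0)
 then show ?thesis unfolding eq by simp
qed

text \<open>Let \<open>\<phi>\<close> be the squared modulus of the boundary function. Real polynomials in \<open>\<phi>\<close> are limits of trigonometric polynomials, and by Weierstrass they approximate the square root of \<open>max 0 (\<delta>^2 - \<phi>)\<close>. Testing \<open>\<phi> - \<delta>^2\<close> against the square of this function gives a nonnegative integral of a nonpositive function, which therefore vanishes.\<close>
lemma mult_lower_imp_boundary_lower:
 assumes I: "finite I" and f: "holomorphic_polydisc I f" and bd: "bounded (f ` polydisc I)"
  and low: "\<And>p. is_poly I p ==> \<delta> * H2_norm I p \<le> H2_norm I (\<lambda>z. f z * p z)" and \<delta>: "0 \<le> \<delta>"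
 shows "AE \<zeta> in torus_measure I. \<delta> \<le> cmod (radial_polydisc I f \<zeta>)"
proof -
 interpret prob_space "torus_measure I" by (rule prob_space_torus)
 let ?T = "torus_measure I"
 obtain c where c: "has_power_series I c f" using f by (auto simp: holomorphic_polydisc_def)
 obtain B where B: "\<And>z. z \<in> polydisc I ==> cmod (f z) \<le> B" "B > 0" using bd unfolding bounded_pos by auto
 then have B0: "0 \<le> B" by simp
 define \<phi> where "\<phi> \<zeta> = (cmod (radial_polydisc I f \<zeta>))^2" for \<zeta>
 have fm: "radial_polydisc I f \<in> borel_measurable ?T" by (rule radial_polydisc_measurable[OF I c])
 have \<phi>m [measurable]: "\<phi> \<in> borel_measurable ?T" unfolding \<phi>_def[abs_def] using fm by measurable
 have "AE \<zeta> in ?T. cmod (radial_polydisc I f \<zeta>) \<le> B" by (rule radial_polydisc_le_AE[OF I c]) (rule B(1))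
 then have \<phi>B: "AE \<zeta> in ?T. \<phi> \<zeta> \<le> B^2"
  by eventually_elim (simp add: \<phi>_def power_mono)
 have "\<exists>s. mon_sum I s \<and> (\<forall>\<zeta>\<in>torus I. cmod (s \<zeta> - f (dil I (of_real (rad k)) \<zeta>)) \<le> 1 / real (Suc k))" for k
  by (rule dilation_uniform_approx[OF I c rad_bounds]) simp
 then have "\<forall>k. \<exists>s. mon_sum I s \<and> (\<forall>\<zeta>\<in>torus I. cmod (s \<zeta> - f (dil I (of_real (rad k)) \<zeta>)) \<le> 1 / real (Suc k))" by blast
 from choice[OF this] obtain s where s: "\<And>k. mon_sum I (s k)" "\<And>k \<zeta>. \<zeta> \<in> torus I ==> cmod (s k \<zeta> - f (dil I (of_real (rad k)) \<zeta>)) \<le> 1 / real (Suc k)" by blast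
 define t where "t k \<zeta> = (cmod (s k \<zeta>))^2" for k \<zeta>
 have tm: "t k \<in> borel_measurable ?T" for k unfolding t_def[abs_def] using mon_sum_measurable[OF s(1)[of k]] by measurable
 have tlim: "AE \<zeta> in ?T. (\<lambda>k. t k \<zeta>) \<longlonglongrightarrow> \<phi> \<zeta>"
  using radial_polydisc_AE[OF I c bd] AE_space
 proof eventually_elim
  case (elim \<zeta>)
  have "(\<lambda>k. s k \<zeta> - f (dil I (of_real (rad k)) \<zeta>)) \<longlonglongrightarrow> 0"
   by (rule Lim_null_comparison[OF _ LIMSEQ_inverse_real_of_nat]) (use s(2) elim(2) in \<open>simp add: inverse_eq_divide\<close>)
  from tendsto_power[OF tendsto_norm[OF tendsto_add[OF this elim(1)]], of 2]
  show ?case by (simp add: t_def \<phi>_def)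
 qed
 define R where "R = (B + 1)^2"
 have tR: "t k \<zeta> \<in> {0..R}" if z: "\<zeta> \<in> torus I" for k \<zeta>
 proof -
  have "cmod (f (dil I (of_real (rad k)) \<zeta>)) \<le> B" using rad_bounds[of k] by (intro B dil_in_polydisc[OF z]) simp
  moreover have "1 / real (Suc k) \<le> 1" by simp
  moreover have "cmod (s k \<zeta>) \<le> cmod (f (dil I (of_real (rad k)) \<zeta>)) + cmod (s k \<zeta> - f (dil I (of_real (rad k)) \<zeta>))"
   using norm_triangle_ineq[of "f (dil I (of_real (rad k)) \<zeta>)" "s k \<zeta> - f (dil I (of_real (rad k)) \<zeta>)"] by simp
  ultimately have "cmod (s k \<zeta>) \<le> B + 1"
   using s(2)[OF z, of k] by linarith
  then show ?thesis by (auto simp: t_def R_def intro: power_mono)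
 qed
 have poly_ineq: "0 \<le> (\<integral>\<zeta>. (\<phi> \<zeta> - \<delta>^2) * (P (\<phi> \<zeta>))^2 \<partial>?T)" if P: "real_polynomial_function P" for P
 proof (rule LIMSEQ_le_const)
  have contP: "continuous_on UNIV P" using P by (simp add: continuous_on_polymonial_function real_polynomial_function_eq)
  have Pm: "P \<in> borel_measurable borel" by (rule borel_measurable_continuous_onI[OF contP])
  have "bounded (P ` {0..R})" by (intro compact_imp_bounded compact_continuous_image continuous_on_subset[OF contP]) auto
  then obtain K where "\<forall>y\<in>P ` {0..R}. norm y \<le> K" unfolding bounded_iff by (elim exE)
  then have K: "\<bar>P x\<bar> \<le> K" if "x \<in> {0..R}" for x using that by simp
  show "(\<lambda>k. \<integral>\<zeta>. (\<phi> \<zeta> - \<delta>^2) * (P (t k \<zeta>))^2 \<partial>?T) \<longlonglongrightarrow> (\<integral>\<zeta>. (\<phi> \<zeta> - \<delta>^2) * (P (\<phi> \<zeta>))^2 \<partial>?T)"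
  proof (rule integral_dominated_convergence[where w="\<lambda>_. (B^2 + \<delta>^2) * K^2"])
   show "(\<lambda>\<zeta>. (\<phi> \<zeta> - \<delta>^2) * (P (\<phi> \<zeta>))^2) \<in> borel_measurable ?T"
    using measurable_compose[OF \<phi>m Pm] by measurable
   show "(\<lambda>\<zeta>. (\<phi> \<zeta> - \<delta>^2) * (P (t k \<zeta>))^2) \<in> borel_measurable ?T" for k
    using measurable_compose[OF tm Pm, of k] by measurable
   show "AE \<zeta> in ?T. (\<lambda>k. (\<phi> \<zeta> - \<delta>^2) * (P (t k \<zeta>))^2) \<longlonglongrightarrow> (\<phi> \<zeta> - \<delta>^2) * (P (\<phi> \<zeta>))^2"
    using tlim
   proof eventually_elim
    case (elim \<zeta>)
    have "(\<lambda>k. P (t k \<zeta>)) \<longlonglongrightarrow> P (\<phi> \<zeta>)"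
     by (rule continuous_on_tendsto_compose[OF contP elim]) auto
    then show ?case by (intro tendsto_mult tendsto_const tendsto_power)
   qed
   show "AE \<zeta> in ?T. norm ((\<phi> \<zeta> - \<delta>^2) * (P (t k \<zeta>))^2) \<le> (B^2 + \<delta>^2) * K^2" for k
    using \<phi>B AE_space
   proof eventually_elim
    case (elim \<zeta>)
    have "\<bar>\<phi> \<zeta> - \<delta>^2\<bar> \<le> B^2 + \<delta>^2" using elim(1) zero_le_power2[of \<delta>] zero_le_power2[of "cmod (radial_polydisc I f \<zeta>)"]
     unfolding \<phi>_def by linarith
    moreover have "(P (t k \<zeta>))^2 \<le> K^2" using power_mono[OF K[OF tR, of \<zeta> k], of 2] elim(2) by simp
    ultimately show ?case unfolding real_norm_def abs_mult abs_power2 by (intro mult_mono) auto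
   qed
  qed simp
  have "0 \<le> (\<integral>\<zeta>. (\<phi> \<zeta> - \<delta>^2) * (P (t k \<zeta>))^2 \<partial>?T)" for k
  proof -
   have "trig_poly I (\<lambda>\<zeta>. of_real (P (t k \<zeta>)))"
    unfolding t_def by (rule trig_poly_real_polynomial[OF P trig_poly_norm_sq[OF s(1)]])
   from trig_poly_lower[OF I c B(1) B0 low \<delta> this] show ?thesis by (simp add: \<phi>_def)
  qed
  then show "\<exists>N. \<forall>k\<ge>N. 0 \<le> (\<integral>\<zeta>. (\<phi> \<zeta> - \<delta>^2) * (P (t k \<zeta>))^2 \<partial>?T)" by blast
 qed
 define g where "g x = sqrt (max 0 (\<delta>^2 - x))" for x :: real
 have "\<exists>P. real_polynomial_function P \<and> (\<forall>x\<in>{0..R}. \<bar>g x - P x\<bar> < 1 / real (Suc k))" for k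
 proof -
  have cg: "continuous_on {0..R} g" unfolding g_def by (intro continuous_intros)
  have e: "0 < 1 / real (Suc k)" by simp
  obtain Q where Q: "real_polynomial_function Q" "\<And>x. x \<in> {0..R} ==> \<bar>g x - Q x\<bar> < 1 / real (Suc k)"
   by (rule Stone_Weierstrass_real_polynomial_function[OF compact_Icc cg e]) blast
  have "\<forall>x\<in>{0..R}. \<bar>g x - Q x\<bar> < 1 / real (Suc k)" using Q(2) by (rule ballI)
  with Q(1) show ?thesis by (intro exI[of _ Q] conjI)
 qed
 then have "\<forall>k. \<exists>P. real_polynomial_function P \<and> (\<forall>x\<in>{0..R}. \<bar>g x - P x\<bar> < 1 / real (Suc k))" by blast
 from choice[OF this] obtain P where P: "\<And>k. real_polynomial_function (P k)" "\<And>k x. x \<in> {0..R} ==> \<bar>g x - P k x\<bar> < 1 / real (Suc k)" by blast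
 have gm: "g \<in> borel_measurable borel" unfolding g_def[abs_def] by measurable
 have Pm: "P k \<in> borel_measurable borel" for k
  using P(1)[of k] by (intro borel_measurable_continuous_onI) (simp add: continuous_on_polymonial_function real_polynomial_function_eq)
 have BR: "B^2 \<le> R" unfolding R_def using B0 by (intro power_mono) auto
 have gd: "0 \<le> g x" "x \<ge> 0 ==> g x \<le> \<delta>" for x
  using \<delta> real_sqrt_le_mono[of "max 0 (\<delta>^2 - x)" "\<delta>^2"] by (auto simp: g_def)
 have fin: "0 \<le> (\<integral>\<zeta>. (\<phi> \<zeta> - \<delta>^2) * (g (\<phi> \<zeta>))^2 \<partial>?T)"
 proof (rule LIMSEQ_le_const)
  show "(\<lambda>k. \<integral>\<zeta>. (\<phi> \<zeta> - \<delta>^2) * (P k (\<phi> \<zeta>))^2 \<partial>?T) \<longlonglongrightarrow> (\<integral>\<zeta>. (\<phi> \<zeta> - \<delta>^2) * (g (\<phi> \<zeta>))^2 \<partial>?T)"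
  proof (rule integral_dominated_convergence[where w="\<lambda>_. (B^2 + \<delta>^2) * (\<delta> + 1)^2"])
   show "(\<lambda>\<zeta>. (\<phi> \<zeta> - \<delta>^2) * (g (\<phi> \<zeta>))^2) \<in> borel_measurable ?T"
    using measurable_compose[OF \<phi>m gm] by measurable
   show "(\<lambda>\<zeta>. (\<phi> \<zeta> - \<delta>^2) * (P k (\<phi> \<zeta>))^2) \<in> borel_measurable ?T" for k
    using measurable_compose[OF \<phi>m Pm, of k] by measurable
   show "AE \<zeta> in ?T. (\<lambda>k. (\<phi> \<zeta> - \<delta>^2) * (P k (\<phi> \<zeta>))^2) \<longlonglongrightarrow> (\<phi> \<zeta> - \<delta>^2) * (g (\<phi> \<zeta>))^2"
    using \<phi>B
   proof eventually_elim
    case (elim \<zeta>)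
    then have x: "\<phi> \<zeta> \<in> {0..R}" using BR by (simp add: \<phi>_def)
    have "(\<lambda>k. P k (\<phi> \<zeta>) - g (\<phi> \<zeta>)) \<longlonglongrightarrow> 0"
     by (rule Lim_null_comparison[OF _ LIMSEQ_inverse_real_of_nat])
       (use P(2)[OF x] in \<open>simp add: inverse_eq_divide abs_minus_commute less_imp_le\<close>)
    then have "(\<lambda>k. P k (\<phi> \<zeta>)) \<longlonglongrightarrow> g (\<phi> \<zeta>)" by (rule LIM_zero_cancel)
    then show ?case by (intro tendsto_mult tendsto_const tendsto_power)
   qed
   show "AE \<zeta> in ?T. norm ((\<phi> \<zeta> - \<delta>^2) * (P k (\<phi> \<zeta>))^2) \<le> (B^2 + \<delta>^2) * (\<delta> + 1)^2" for k
    using \<phi>B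
   proof eventually_elim
    case (elim \<zeta>)
    then have x: "\<phi> \<zeta> \<in> {0..R}" "0 \<le> \<phi> \<zeta>" using BR by (simp_all add: \<phi>_def)
    have 1: "\<bar>\<phi> \<zeta> - \<delta>^2\<bar> \<le> B^2 + \<delta>^2" using elim x(2) zero_le_power2[of \<delta>] by linarith
    have "1 / real (Suc k) \<le> 1" by simp
    then have "\<bar>P k (\<phi> \<zeta>)\<bar> \<le> \<bar>\<delta> + 1\<bar>" using P(2)[OF x(1), of k] gd(1)[of "\<phi> \<zeta>"] gd(2)[OF x(2)] by linarith
    then have "(P k (\<phi> \<zeta>))^2 \<le> (\<delta> + 1)^2" by (simp only: abs_le_square_iff)
    then show ?case unfolding real_norm_def abs_mult abs_power2 using 1 by (intro mult_mono) auto
   qed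
  qed simp
  show "\<exists>N. \<forall>k\<ge>N. 0 \<le> (\<integral>\<zeta>. (\<phi> \<zeta> - \<delta>^2) * (P k (\<phi> \<zeta>))^2 \<partial>?T)" using poly_ineq[OF P(1)] by blast
 qed
 have sq: "(\<phi> \<zeta> - \<delta>\<^sup>2) * (g (\<phi> \<zeta>))\<^sup>2 = - (max 0 (\<delta>\<^sup>2 - \<phi> \<zeta>))\<^sup>2" for \<zeta>
  by (cases "\<delta>^2 - \<phi> \<zeta> \<le> 0") (auto simp: g_def max_def power2_eq_square algebra_simps)
 have mi: "integrable ?T (\<lambda>\<zeta>. (max 0 (\<delta>^2 - \<phi> \<zeta>))^2)"
 proof (rule torus_integrable_bounded[where B="(\<delta>^2)^2"])
  show "(\<lambda>\<zeta>. (max 0 (\<delta>^2 - \<phi> \<zeta>))^2) \<in> borel_measurable ?T" by measurable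
  show "norm ((max 0 (\<delta>^2 - \<phi> \<zeta>))^2) \<le> (\<delta>^2)^2" for \<zeta>
  proof -
   have "max 0 (\<delta>^2 - \<phi> \<zeta>) \<le> \<delta>^2" by (simp add: \<phi>_def)
   then have "(max 0 (\<delta>^2 - \<phi> \<zeta>))^2 \<le> (\<delta>^2)^2" by (rule power_mono) simp
   then show ?thesis by simp
  qed
 qed
 have "(\<integral>\<zeta>. (max 0 (\<delta>^2 - \<phi> \<zeta>))^2 \<partial>?T) \<le> 0" using fin unfolding sq by simp
 moreover have "0 \<le> (\<integral>\<zeta>. (max 0 (\<delta>^2 - \<phi> \<zeta>))^2 \<partial>?T)" by (rule Bochner_Integration.integral_nonneg) simp
 ultimately have "(\<integral>\<zeta>. (max 0 (\<delta>^2 - \<phi> \<zeta>))^2 \<partial>?T) = 0" by linarith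
 then have "AE \<zeta> in ?T. (max 0 (\<delta>^2 - \<phi> \<zeta>))^2 = 0"
  by (subst (asm) integral_nonneg_eq_0_iff_AE[OF mi]) simp_all
 then show ?thesis
 proof eventually_elim
  case (elim \<zeta>)
  then have "\<delta>^2 \<le> (cmod (radial_polydisc I f \<zeta>))^2" by (simp add: \<phi>_def max_def split: if_splits)
  then show ?case by (rule power2_le_imp_le) simp
 qed
qed

section \<open>Generators of invariant subspaces\<close>

lemma inverse_in_Linf_lower:
 assumes "inverse_in_Linf M g"
 obtains \<delta> where "\<delta> > 0" "AE x in M. \<delta> \<le> cmod (g x)"
proof -
 obtain C where C: "AE x in M. cmod (1 / g x) \<le> C" and ne: "AE x in M. g x \<noteq> 0"
  using assms by (auto simp: inverse_in_Linf_def Linf_def)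
 define D where "D = max C 1"
 have D: "D > 0" "C \<le> D" by (auto simp: D_def)
 have "AE x in M. 1 / D \<le> cmod (g x)"
  using C ne
 proof eventually_elim
  case (elim x)
  then have "1 / cmod (g x) \<le> D" using D by (simp add: norm_divide)
  then show ?case using elim(2) D(1) by (simp add: field_simps)
 qed
 then show ?thesis using that[of "1 / D"] D by simp
qed

lemma lower_inverse_in_Linf:
 assumes "g \<in> borel_measurable M" "\<delta> > 0" "AE x in M. \<delta> \<le> cmod (g x)"
 shows "inverse_in_Linf M g"
proof -
 have "AE x in M. g x \<noteq> 0" using assms(3) by eventually_elim (use assms(2) in auto)
 moreover have "AE x in M. cmod (1 / g x) \<le> 1 / \<delta>"
  using assms(3)
 proof eventually_elim
  case (elim x) then show ?case using assms(2) by (simp add: norm_divide frac_le)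
 qed
 moreover have "(\<lambda>x. 1 / g x) \<in> borel_measurable M" using assms(1) by measurable
 ultimately show ?thesis unfolding inverse_in_Linf_def Linf_def by blast
qed

lemma mult_lower_of_inverse_in_Linf:
 assumes I: "finite I" and f: "holomorphic_polydisc I f" and bd: "bounded (f ` polydisc I)"
  and inv: "inverse_in_Linf (torus_measure I) (radial_polydisc I f)"
 shows "\<exists>\<delta>>0. \<forall>h\<in>H2 I. \<delta> * H2_norm I h \<le> H2_norm I (\<lambda>z. f z * h z)"
proof -
 obtain \<delta> where \<delta>: "\<delta> > 0" "AE x in torus_measure I. \<delta> \<le> cmod (radial_polydisc I f x)"
  by (rule inverse_in_Linf_lower[OF inv])
 then show ?thesis using boundary_lower_imp_mult_lower[OF I f bd \<delta>(2)] by (intro exI[of _ \<delta>]) auto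
qed

lemma inverse_in_Linf_of_mult_lower:
 assumes I: "finite I" and f: "holomorphic_polydisc I f" and bd: "bounded (f ` polydisc I)"
  and \<delta>: "\<delta> > 0" and low: "\<And>p. is_poly I p ==> \<delta> * H2_norm I p \<le> H2_norm I (\<lambda>z. f z * p z)"
 shows "inverse_in_Linf (torus_measure I) (radial_polydisc I f)"
proof -
 obtain c where c: "has_power_series I c f" using f by (auto simp: holomorphic_polydisc_def)
 have "AE \<zeta> in torus_measure I. \<delta> \<le> cmod (radial_polydisc I f \<zeta>)"
  by (rule mult_lower_imp_boundary_lower[OF I f bd]) (use low \<delta> in auto)
 then show ?thesis by (rule lower_inverse_in_Linf[OF radial_polydisc_measurable[OF I c] \<delta>])
qed

lemma H2_no_zero_divisors:
 assumes I: "finite I" and f: "f \<in> H2 I" and h: "h \<in> H2 I" and f0: "f \<noteq> (\<lambda>z. 0)" and fh: "\<And>z. f z * h z = 0"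
 shows "h = (\<lambda>z. 0)"
proof (rule ccontr)
 assume "h \<noteq> (\<lambda>z. 0)"
 then obtain b where hb: "h b \<noteq> 0" by auto
 obtain a where fa: "f a \<noteq> 0" using f0 by auto
 have ab: "a \<in> polydisc I" "b \<in> polydisc I" using fa hb H2_off[OF f] H2_off[OF h] by blast+
 define l where "l i w = a i + w * (b i - a i)" for i and w :: complex
 define \<Omega> where "\<Omega> = (\<Inter>i\<in>I. {w. cmod (l i w) < 1})"
 have "open \<Omega>" unfolding \<Omega>_def l_def
  by (intro open_INT I ballI open_Collect_less continuous_intros)
 have "convex \<Omega>" unfolding \<Omega>_def
 proof (intro convex_INT)
  fix i
  have "{w. cmod (l i w) < 1} = (\<lambda>w. l i w) -` ball 0 1" by auto
  moreover have "convex ((\<lambda>w. l i w) -` ball 0 1)"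
   unfolding convex_def
  proof (intro ballI allI impI)
   fix x y :: complex and u v :: real
   assume xy: "x \<in> l i -` ball 0 1" "y \<in> l i -` ball 0 1" and uv: "0 \<le> u" "0 \<le> v" "u + v = 1"
   have "l i (u *\<^sub>R x + v *\<^sub>R y) = u *\<^sub>R l i x + v *\<^sub>R l i y"
   proof -
    have "u *\<^sub>R a i + v *\<^sub>R a i = a i" using uv by (simp flip: scaleR_left_distrib)
    then show ?thesis by (simp add: l_def scaleR_conv_of_real algebra_simps)
   qed
   then show "u *\<^sub>R x + v *\<^sub>R y \<in> l i -` ball 0 1"
    using convexD[OF convex_ball[of "0::complex" 1], of "l i x" "l i y" u v] xy uv by simp
  qed
  ultimately show "convex {w. cmod (l i w) < 1}" by simp
 qed
 then have conn: "connected \<Omega>" by (rule convex_connected)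
 have hol: "(\<lambda>w. g (\<lambda>i\<in>I. l i w)) holomorphic_on \<Omega>" if "g \<in> H2 I" for g
  by (rule power_series_holomorphic_comp[OF I H2_power_series[OF that] \<open>open \<Omega>\<close>])
    (auto simp: l_def \<Omega>_def intro!: holomorphic_intros)
 define U where "U = {w \<in> \<Omega>. f (\<lambda>i\<in>I. l i w) \<noteq> 0}"
 have "open U"
 proof -
  have "open (\<Omega> \<inter> (\<lambda>w. f (\<lambda>i\<in>I. l i w)) -` (-{0}))"
   by (rule continuous_open_preimage[OF holomorphic_on_imp_continuous_on[OF hol[OF f]] \<open>open \<Omega>\<close>]) auto
  moreover have "\<Omega> \<inter> (\<lambda>w. f (\<lambda>i\<in>I. l i w)) -` (-{0}) = U" by (auto simp: U_def)
  ultimately show ?thesis by simp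
 qed
 have a: "(\<lambda>i\<in>I. l i 0) = a" and b: "(\<lambda>i\<in>I. l i 1) = b"
  using ab by (auto simp: l_def polydisc_def fun_eq_iff PiE_iff extensional_def)
 have in\<Omega>: "0 \<in> \<Omega>" "1 \<in> \<Omega>" using ab by (auto simp: \<Omega>_def l_def polydisc_def PiE_iff)
 have "0 \<in> U" using fa in\<Omega> a by (simp add: U_def)
 have "h (\<lambda>i\<in>I. l i 1) = 0"
 proof (rule analytic_continuation_open[of U \<Omega> "\<lambda>w. h (\<lambda>i\<in>I. l i w)" "\<lambda>_. 0" 1])
  show "U \<noteq> {}" using \<open>0 \<in> U\<close> by blast
  show "h (\<lambda>i\<in>I. l i w) = 0" if "w \<in> U" for w using that fh[of "\<lambda>i\<in>I. l i w"] by (auto simp: U_def)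
 qed (use \<open>open U\<close> \<open>open \<Omega>\<close> conn hol[OF h] in\<Omega> in \<open>auto simp: U_def\<close>)
 then show False using hb b by simp
qed

lemma H2_closedD:
 assumes I: "finite I" and S: "H2_closed I S" and u: "\<And>k. u k \<in> S" and l: "l \<in> H2 I" and t: "H2_tends I u l"
 shows "l \<in> S"
proof -
 interpret H: fun_hilbert "H2 I" "H2_inner I" "H2_norm I" by (rule H2_hilbert[OF I])
 have "\<forall>k. u k \<in> S" using u by (rule allI)
 with S[unfolded H.closed_in_def, THEN conjunct2, THEN spec[of _ u], THEN spec[of _ l]] l t show ?thesis by blast
qed

lemma tends_unique:
 assumes I: "finite I" and "H2_tends I u l" "H2_tends I u l'" "\<And>k. u k \<in> H2 I" "l \<in> H2 I" "l' \<in> H2 I"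
 shows "l = l'"
proof
 fix z show "l z = l' z"
  using LIMSEQ_unique[OF tends_pointwise[OF I assms(2,4,5)] tends_pointwise[OF I assms(3,4,6)]] .
qed

text \<open>Compare the norm of \<open>h\<close>, the norm of \<open>f h\<close> and their sum. All three are complete: the second because the range is closed, the sum because \<open>H2\<close> convergence implies pointwise convergence, which makes multiplication by \<open>f\<close> closed. So both are equivalent to the sum.\<close>
theorem closed_range_multiplier_bounds:
 assumes I: "finite I" and f: "f \<in> H2 I" and f0: "f \<noteq> (\<lambda>z. 0)"
  and mult: "\<And>h. h \<in> H2 I ==> (\<lambda>z. f z * h z) \<in> H2 I"
  and closed: "H2_closed I {\<lambda>z. f z * h z |h. h \<in> H2 I}"
 shows "\<exists>C\<ge>0. \<forall>h\<in>H2 I. H2_norm I (\<lambda>z. f z * h z) \<le> C * H2_norm I h"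
  and "\<exists>\<delta>>0. \<forall>h\<in>H2 I. \<delta> * H2_norm I h \<le> H2_norm I (\<lambda>z. f z * h z)"
proof -
 interpret H: fun_hilbert "H2 I" "H2_inner I" "H2_norm I" by (rule H2_hilbert[OF I])
 define p where "p h = H2_norm I (\<lambda>z. f z * h z)" for h
 define q where "q h = H2_norm I h + p h" for h
 have add: "(\<lambda>z. f z * (g z + h z)) = (\<lambda>z. f z * g z + f z * h z)" for g h by (simp add: distrib_left)
 have dif: "(\<lambda>z. f z * (g z - h z)) = (\<lambda>z. f z * g z - f z * h z)" for g h by (simp add: right_diff_distrib)
 have scale: "(\<lambda>z. f z * (a * h z)) = (\<lambda>z. a * (f z * h z))" for a h by (simp add: mult.left_commute)
 have p_tri: "p (\<lambda>x. g x + h x) \<le> p g + p h" if "g \<in> H2 I" "h \<in> H2 I" for g h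
  unfolding p_def add by (rule H.nm_triangle[OF mult mult]) fact+
 have p_scale: "p (\<lambda>x. a * h x) = cmod a * p h" if "h \<in> H2 I" for a h
  unfolding p_def scale by (rule H.nm_scale[OF mult[OF that]])
 have p_def0: "h = (\<lambda>x. 0)" if h: "h \<in> H2 I" and "p h = 0" for h
 proof -
  have "(\<lambda>z. f z * h z) = (\<lambda>x. 0)" using that(2) unfolding p_def by (rule H.nm_definite[OF mult[OF h]])
  then have fz: "f z * h z = 0" for z using fun_cong[of "\<lambda>z. f z * h z" "\<lambda>x. 0" z] by simp
  show ?thesis by (rule H2_no_zero_divisors[OF I f h f0 fz])
 qed
 have p_ge0: "0 \<le> p h" for h unfolding p_def by (rule H2_norm_ge0)
 have pn: "fun_normed (H2 I) p"
 proof
  show "(\<lambda>x. 0) \<in> H2 I" by (rule H2_zero)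
 qed (fact H.add_mem H.scale_mem p_tri p_scale p_def0)+
 interpret P: fun_normed "H2 I" p by (rule pn)
 have qn: "fun_normed (H2 I) q"
 proof
  show "(\<lambda>x. 0) \<in> H2 I" by (rule H2_zero)
  show "q (\<lambda>x. g x + h x) \<le> q g + q h" if "g \<in> H2 I" "h \<in> H2 I" for g h
   unfolding q_def using p_tri[OF that] H.nm_triangle[OF that] by linarith
  show "q (\<lambda>x. a * h x) = cmod a * q h" if "h \<in> H2 I" for a h
   unfolding q_def p_scale[OF that] H.nm_scale[OF that] by (simp add: distrib_left)
  show "h = (\<lambda>x. 0)" if "h \<in> H2 I" "q h = 0" for h
   using H.nm_definite[OF that(1)] p_ge0[of h] H2_norm_ge0[of I h] that(2) unfolding q_def by linarith
 qed (fact H.add_mem H.scale_mem)+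
 interpret Q: fun_normed "H2 I" q by (rule qn)
 have fcauchy: "H.cauchy (\<lambda>k z. f z * u k z)" if "P.cauchy u" for u
  using that unfolding P.cauchy_def H.cauchy_def p_def dif .
 have ftends: "P.tends u l \<longleftrightarrow> H.tends (\<lambda>k z. f z * u k z) (\<lambda>z. f z * l z)" for u l
  unfolding P.tends_def H.tends_def p_def dif ..
 have pb: "fun_banach (H2 I) p"
 proof (intro fun_banach.intro pn fun_banach_axioms.intro)
  fix u assume u: "\<And>k. u k \<in> H2 I" "P.cauchy u"
  obtain g where g: "g \<in> H2 I" "H.tends (\<lambda>k z. f z * u k z) g"
   using H.complete[OF mult[OF u(1)] fcauchy[OF u(2)]] by blast
  have "(\<lambda>z. f z * u k z) \<in> {\<lambda>z. f z * h z |h. h \<in> H2 I}" for k using u(1) by blast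
  from H2_closedD[OF I closed this g] have "g \<in> {\<lambda>z. f z * h z |h. h \<in> H2 I}" .
  then obtain h where "h \<in> H2 I" "g = (\<lambda>z. f z * h z)" by blast
  then show "\<exists>l\<in>H2 I. P.tends u l" using g(2) ftends by blast
 qed
 have qb: "fun_banach (H2 I) q"
 proof (intro fun_banach.intro qn fun_banach_axioms.intro)
  fix u assume u: "\<And>k. u k \<in> H2 I" "Q.cauchy u"
  have c1: "H.cauchy u"
   unfolding H.cauchy_def
  proof (intro allI impI)
   fix e :: real assume "0 < e"
   then obtain N where "\<forall>m\<ge>N. \<forall>n\<ge>N. q (\<lambda>x. u m x - u n x) < e" using u(2) unfolding Q.cauchy_def by blast
   moreover have "H2_norm I h \<le> q h" for h using p_ge0[of h] by (simp add: q_def)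
   ultimately show "\<exists>N. \<forall>m\<ge>N. \<forall>n\<ge>N. H2_norm I (\<lambda>x. u m x - u n x) < e" using order_le_less_trans by blast
  qed
  have c2: "P.cauchy u"
   unfolding P.cauchy_def
  proof (intro allI impI)
   fix e :: real assume "0 < e"
   then obtain N where "\<forall>m\<ge>N. \<forall>n\<ge>N. q (\<lambda>x. u m x - u n x) < e" using u(2) unfolding Q.cauchy_def by blast
   moreover have "p h \<le> q h" for h using H2_norm_ge0[of I h] by (simp add: q_def)
   ultimately show "\<exists>N. \<forall>m\<ge>N. \<forall>n\<ge>N. p (\<lambda>x. u m x - u n x) < e" using order_le_less_trans by blast
  qed
  obtain h where h: "h \<in> H2 I" "H.tends u h" using H.complete[OF u(1) c1] by blast
  obtain g where g: "g \<in> H2 I" "H.tends (\<lambda>k z. f z * u k z) g"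
   using H.complete[OF mult[OF u(1)] fcauchy[OF c2]] by blast
  have "g z = f z * h z" for z
   using LIMSEQ_unique[OF tends_pointwise[OF I g(2) mult[OF u(1)] g(1)] tendsto_mult[OF tendsto_const tends_pointwise[OF I h(2) u(1) h(1)]]] .
  then have "g = (\<lambda>z. f z * h z)" by (rule ext)
  then have "P.tends u h" using g(2) ftends by blast
  then have "Q.tends u h"
   using tendsto_add[OF h(2)[unfolded H.tends_def]] unfolding P.tends_def Q.tends_def q_def by force
  then show "\<exists>l\<in>H2 I. Q.tends u l" using h(1) by blast
 qed
 interpret PB: fun_banach "H2 I" p by (rule pb)
 obtain C where C: "C \<ge> 0" "\<forall>h\<in>H2 I. q h \<le> C * H2_norm I h"
  using H.comparable_norms_equivalent[OF qb] p_ge0 unfolding q_def by auto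
 have "p h \<le> C * H2_norm I h" if "h \<in> H2 I" for h
  using C(2) that H2_norm_ge0[of I h] unfolding q_def by force
 then show "\<exists>C\<ge>0. \<forall>h\<in>H2 I. H2_norm I (\<lambda>z. f z * h z) \<le> C * H2_norm I h" using C(1) unfolding p_def by blast
 obtain D where D: "D \<ge> 0" "\<forall>h\<in>H2 I. q h \<le> D * p h"
  using PB.comparable_norms_equivalent[OF qb] H2_norm_ge0 unfolding q_def by auto
 have "(1 / (D + 1)) * H2_norm I h \<le> p h" if "h \<in> H2 I" for h
 proof -
  have "H2_norm I h \<le> D * p h" using D(2) that p_ge0[of h] unfolding q_def by force
  also have "\<dots> \<le> (D + 1) * p h" using p_ge0[of h] by (simp add: distrib_right)
  finally show ?thesis using D(1) by (simp add: field_simps)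
 qed
 then show "\<exists>\<delta>>0. \<forall>h\<in>H2 I. \<delta> * H2_norm I h \<le> H2_norm I (\<lambda>z. f z * h z)"
  using D(1) unfolding p_def by (intro exI[of _ "1 / (D + 1)"]) auto
qed

lemma multiplier_range_closed:
 assumes I: "finite I"
  and mult: "\<And>h. h \<in> H2 I ==> (\<lambda>z. f z * h z) \<in> H2 I \<and> H2_norm I (\<lambda>z. f z * h z) \<le> C * H2_norm I h"
  and \<delta>: "\<delta> > 0" "\<And>h. h \<in> H2 I ==> \<delta> * H2_norm I h \<le> H2_norm I (\<lambda>z. f z * h z)"
 shows "H2_closed I {\<lambda>z. f z * h z |h. h \<in> H2 I}"
proof -
 interpret H: fun_hilbert "H2 I" "H2_inner I" "H2_norm I" by (rule H2_hilbert[OF I])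
 have dif: "(\<lambda>z. f z * (g z - h z)) = (\<lambda>z. f z * g z - f z * h z)" for g h by (simp add: right_diff_distrib)
 show ?thesis
  unfolding H.closed_in_def
 proof (intro conjI allI impI)
  show "{\<lambda>z. f z * h z |h. h \<in> H2 I} \<subseteq> H2 I" using mult by blast
  fix u l assume u: "\<forall>k. u k \<in> {\<lambda>z. f z * h z |h. h \<in> H2 I}" and l: "l \<in> H2 I" and t: "H.tends u l"
  from u have "\<forall>k. \<exists>h. h \<in> H2 I \<and> u k = (\<lambda>z. f z * h z)" by blast
  from choice[OF this] obtain h where h: "\<And>k. h k \<in> H2 I" "\<And>k. u k = (\<lambda>z. f z * h k z)" by blast
  have uX: "u k \<in> H2 I" for k unfolding h(2) using mult[OF h(1)] by blast
  have "H.cauchy h"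
  proof (rule H.cauchy_bounded_map[OF H.tends_cauchy[OF t uX l] _ uX])
   fix i j
   show "H2_norm I (\<lambda>x. h i x - h j x) \<le> (1 / \<delta>) * H2_norm I (\<lambda>x. u i x - u j x)"
    using \<delta>(2)[OF H.diff_mem[OF h(1) h(1)], of i j] \<delta>(1) unfolding h(2) dif by (simp add: field_simps)
  qed
  then obtain m where m: "m \<in> H2 I" "H.tends h m" using H.complete h(1) by blast
  have "H.tends u (\<lambda>z. f z * m z)"
  proof (rule H.tends_bounded_map[OF m(2) _ uX])
   show "H2_norm I (\<lambda>x. u k x - f x * m x) \<le> C * H2_norm I (\<lambda>x. h k x - m x)" for k
    using mult[OF H.diff_mem[OF h(1) m(1)], of k] unfolding h(2) dif by blast
  qed (use mult[OF m(1)] in blast)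
  then have "l = (\<lambda>z. f z * m z)" using tends_unique[OF I t _ uX l] mult[OF m(1)] by blast
  then show "l \<in> {\<lambda>z. f z * h z |h. h \<in> H2 I}" using m(1) by blast
 qed
qed

lemma multiplier_range_invariant:
 assumes I: "finite I"
  and mult: "\<And>h. h \<in> H2 I ==> (\<lambda>z. f z * h z) \<in> H2 I \<and> H2_norm I (\<lambda>z. f z * h z) \<le> C * H2_norm I h"
  and \<delta>: "\<delta> > 0" "\<And>h. h \<in> H2 I ==> \<delta> * H2_norm I h \<le> H2_norm I (\<lambda>z. f z * h z)"
 shows "invariant_subspace I {\<lambda>z. f z * h z |h. h \<in> H2 I}" (is "invariant_subspace I ?N")
proof -
 have N: "u \<in> ?N \<longleftrightarrow> (\<exists>h\<in>H2 I. u = (\<lambda>z. f z * h z))" for u by blast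
 show ?thesis
  unfolding invariant_subspace_def
 proof (intro conjI ballI allI)
  show "?N \<subseteq> H2 I" using mult by blast
  show "(\<lambda>z. 0) \<in> ?N" unfolding N by (intro bexI[of _ "\<lambda>z. 0"] H2_zero) simp
  show "closedin (Metric_space.mtopology (H2 I) (H2_dist I)) ?N"
   unfolding closedin_H2_iff[OF I] by (rule multiplier_range_closed[OF I mult \<delta>])
  fix u assume "u \<in> ?N"
  then obtain h where h: "h \<in> H2 I" "u = (\<lambda>z. f z * h z)" by blast
  show "(\<lambda>z. a * u z) \<in> ?N" for a
   unfolding N by (intro bexI[OF _ H2_scale[OF I h(1), of a]]) (simp add: h(2) mult.left_commute)
  show "(\<lambda>z. z i * u z) \<in> ?N" if "i \<in> I" for i
   unfolding N by (intro bexI[OF _ shift_H2[OF I that h(1)]]) (simp add: h(2) mult.left_commute)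
  fix v assume "v \<in> ?N"
  then obtain k where k: "k \<in> H2 I" "v = (\<lambda>z. f z * k z)" by blast
  show "(\<lambda>z. u z + v z) \<in> ?N"
   unfolding N by (intro bexI[OF _ H2_add[OF I h(1) k(1)]]) (simp add: h(2) k(2) distrib_left)
 qed
qed

lemma invariant_subspaceD:
 assumes "invariant_subspace I N"
 shows invariant_subset: "N \<subseteq> H2 I" and invariant_zero: "(\<lambda>z. 0) \<in> N"
  and invariant_add: "f \<in> N ==> g \<in> N ==> (\<lambda>z. f z + g z) \<in> N"
  and invariant_scale: "f \<in> N ==> (\<lambda>z. a * f z) \<in> N"
  and invariant_closed: "finite I ==> H2_closed I N"
  and invariant_shift: "i \<in> I ==> f \<in> N ==> (\<lambda>z. z i * f z) \<in> N"
proof -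
 note c = assms[unfolded invariant_subspace_def]
 show "N \<subseteq> H2 I" by (rule c[THEN conjunct1])
 show "(\<lambda>z. 0) \<in> N" by (rule c[THEN conjunct2, THEN conjunct1])
 show "f \<in> N ==> g \<in> N ==> (\<lambda>z. f z + g z) \<in> N"
  by (rule c[THEN conjunct2, THEN conjunct2, THEN conjunct1, rule_format])
 show "f \<in> N ==> (\<lambda>z. a * f z) \<in> N"
  by (rule c[THEN conjunct2, THEN conjunct2, THEN conjunct2, THEN conjunct1, rule_format])
 show "finite I ==> H2_closed I N"
  by (rule closedin_H2_iff[THEN iffD1, OF _ c[THEN conjunct2, THEN conjunct2, THEN conjunct2, THEN conjunct2, THEN conjunct1]])
 show "i \<in> I ==> f \<in> N ==> (\<lambda>z. z i * f z) \<in> N"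
  by (rule c[THEN conjunct2, THEN conjunct2, THEN conjunct2, THEN conjunct2, THEN conjunct2, rule_format])
qed

lemma invariant_mon_mult:
 assumes I: "finite I" and N: "invariant_subspace I N" and f: "f \<in> N" and a: "\<alpha> \<in> multi_indices I"
 shows "(\<lambda>z. mon I \<alpha> z * f z) \<in> N"
 using a
proof (induction "deg I \<alpha>" arbitrary: \<alpha>)
 case 0
 then have "mon I \<alpha> z = 1" for z using I by (simp add: mon_def deg_def)
 then show ?case using f by simp
next
 case (Suc n)
 then obtain i where i: "i \<in> I" "\<alpha> i \<noteq> 0" by (metis deg_def sum.neutral nat.distinct(1))
 define \<beta> where "\<beta> = \<alpha>(i := \<alpha> i - 1)"
 have b: "\<beta> \<in> multi_indices I" using Suc.prems i(1) by (auto simp: \<beta>_def multi_indices_def PiE_iff extensional_def)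
 have up: "\<alpha> = up i \<beta>" using i(2) by (auto simp: up_def \<beta>_def)
 have "deg I \<alpha> = Suc (deg I \<beta>)"
  unfolding up deg_def up_def using I i(1) by (subst (1 2) sum.remove[of I i]) (auto intro!: sum.cong)
 then have "(\<lambda>z. mon I \<beta> z * f z) \<in> N" using Suc.hyps b by simp
 from invariant_shift[OF N i(1) this] have "(\<lambda>z. z i * (mon I \<beta> z * f z)) \<in> N" .
 then show ?case unfolding up mon_up[OF I i(1)] by (simp add: mult.assoc)
qed

lemma invariant_sum:
 assumes "invariant_subspace I N" "\<And>i. i \<in> A ==> u i \<in> N"
 shows "(\<lambda>z. \<Sum>i\<in>A. u i z) \<in> N"
 using assms(2)
proof (induction A rule: infinite_finite_induct)
 case (insert a A)
 have "(\<lambda>z. u a z + (\<Sum>i\<in>A. u i z)) \<in> N"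
  by (rule invariant_add[OF assms(1)]) (use insert in auto)
 then show ?case using insert.hyps by simp
qed (simp_all add: invariant_zero[OF assms(1)])

text \<open>Every invariant subspace containing \<open>f\<close> contains \<open>f p\<close> for polynomials \<open>p\<close>, and these are dense in \<open>f H2\<close>.\<close>
lemma multiplier_range_hull:
 assumes I: "finite I" and f: "f \<in> H2 I"
  and mult: "\<And>h. h \<in> H2 I ==> (\<lambda>z. f z * h z) \<in> H2 I \<and> H2_norm I (\<lambda>z. f z * h z) \<le> C * H2_norm I h"
  and \<delta>: "\<delta> > 0" "\<And>h. h \<in> H2 I ==> \<delta> * H2_norm I h \<le> H2_norm I (\<lambda>z. f z * h z)"
 shows "invariant_hull I f = {\<lambda>z. f z * h z |h. h \<in> H2 I}" (is "_ = ?N")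
proof
 interpret H: fun_hilbert "H2 I" "H2_inner I" "H2_norm I" by (rule H2_hilbert[OF I])
 have "f = (\<lambda>z. f z * one_on I z)" using H2_off[OF f] by (auto simp: one_on_def fun_eq_iff)
 then have "f \<in> ?N" using one_on_H2[OF I] by blast
 then show "invariant_hull I f \<subseteq> ?N"
  unfolding invariant_hull_def using multiplier_range_invariant[OF I mult \<delta>] by blast
 show "?N \<subseteq> invariant_hull I f"
  unfolding invariant_hull_def
 proof (intro Inter_greatest subsetI)
  fix N u assume N: "N \<in> {N. invariant_subspace I N \<and> f \<in> N}" and "u \<in> ?N"
  then obtain h where h: "h \<in> H2 I" "u = (\<lambda>z. f z * h z)" by blast
  have inv: "invariant_subspace I N" and fN: "f \<in> N" using N by auto
  have cl: "H.closed_in N" by (rule invariant_closed[OF inv I])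
  define p where "p k = poly_on I (ibox I k) (coeffs I h)" for k
  have pX: "p k \<in> H2 I" for k unfolding p_def by (rule poly_on_H2[OF I finite_box[OF I] box_subset])
  have fp: "(\<lambda>z. f z * p k z) \<in> N" for k
  proof -
   have "(\<lambda>z. \<Sum>\<alpha>\<in>ibox I k. coeffs I h \<alpha> * (mon I \<alpha> z * f z)) \<in> N"
   proof (rule invariant_sum[OF inv])
    fix \<alpha> assume "\<alpha> \<in> ibox I k"
    then have "(\<lambda>z. mon I \<alpha> z * f z) \<in> N" using box_subset by (intro invariant_mon_mult[OF I inv fN]) auto
    then show "(\<lambda>z. coeffs I h \<alpha> * (mon I \<alpha> z * f z)) \<in> N" by (rule invariant_scale[OF inv])
   qed
   moreover have "(\<Sum>\<alpha>\<in>ibox I k. coeffs I h \<alpha> * (mon I \<alpha> z * f z)) = f z * p k z" for z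
    using H2_off[OF f, of z] by (auto simp: p_def poly_on_def sum_distrib_left mult_ac)
   ultimately show ?thesis by simp
  qed
  have "H.tends (\<lambda>k z. f z * p k z) (\<lambda>z. f z * h z)"
  proof (rule H.tends_bounded_map[OF poly_tends[OF I h(1), folded p_def]])
   show "H2_norm I (\<lambda>x. f x * p k x - f x * h x) \<le> C * H2_norm I (\<lambda>x. p k x - h x)" for k
    using mult[OF H.diff_mem[OF pX h(1)], of k] by (simp add: right_diff_distrib)
  qed (use mult[OF pX] mult[OF h(1)] in blast)+
  from H2_closedD[OF I cl fp mult[OF h(1), THEN conjunct1] this] show "u \<in> N" unfolding h(2) .
 qed
qed

subsection \<open>Functions of one variable\<close>

lemma Hinf_disc_polydisc:
 assumes I: "finite I" and i: "i \<in> I" and q: "q \<in> Hinf_disc"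
 shows "holomorphic_polydisc I (\<lambda>z. q (z i))" "bounded ((\<lambda>z. q (z i)) ` polydisc I)"
proof -
 show "holomorphic_polydisc I (\<lambda>z. q (z i))"
  using disc_power_series[OF I i] q by (auto simp: Hinf_disc_def holomorphic_polydisc_def)
 have "bounded (q ` ball 0 1)" using q by (simp add: Hinf_disc_def)
 then show "bounded ((\<lambda>z. q (z i)) ` polydisc I)"
  by (rule bounded_subset) (use i in \<open>auto simp: polydisc_def PiE_iff\<close>)
qed

lemma radial_polydisc_disc: "i \<in> I ==> radial_polydisc I (\<lambda>z. q (z i)) \<zeta> = radial_disc q (\<zeta> i)"
 by (simp add: radial_polydisc_def radial_disc_def)

lemma radial_disc_measurable:
 assumes "q \<in> Hinf_disc" shows "radial_disc q \<in> borel_measurable circle_measure"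
 unfolding radial_disc_def[abs_def]
 by (rule radial_limit_measurable[OF disc_dilation_measurable disc_radial_continuous])
   (use assms in \<open>auto simp: Hinf_disc_def\<close>)

lemma circle_AE_component:
 assumes "i \<in> I" "AE \<xi> in circle_measure. P \<xi>"
 shows "AE \<zeta> in torus_measure I. P (\<zeta> i)"
 unfolding torus_measure_def by (rule AE_PiM_component[OF circle.prob_space_axioms assms])

lemma torus_AE_component:
 assumes "i \<in> I" "{\<xi> \<in> space circle_measure. P \<xi>} \<in> sets circle_measure" "AE \<zeta> in torus_measure I. P (\<zeta> i)"
 shows "AE \<xi> in circle_measure. P \<xi>"
proof -
 have d: "distr (PiM I (\<lambda>_. circle_measure)) circle_measure (\<lambda>\<omega>. \<omega> i) = circle_measure"
  by (rule distr_PiM_component[OF circle.prob_space_axioms assms(1)])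
 have "AE \<xi> in distr (PiM I (\<lambda>_. circle_measure)) circle_measure (\<lambda>\<omega>. \<omega> i). P \<xi>"
  by (rule AE_distr_iff[THEN iffD2, OF measurable_component_singleton[OF assms(1)] assms(2)])
    (rule assms(3)[unfolded torus_measure_def])
 then show ?thesis unfolding d .
qed

section \<open>Separating the first variable\<close>

text \<open>The first variable carries the index \<open>1\<close>, which must not turn into \<open>Suc 0\<close>.\<close>
declare One_nat_def [simp del]

lemma bounded_opsD:
 assumes "A \<in> bounded_ops J"
 shows bounded_op_mem: "f \<in> H2 J ==> A f \<in> H2 J"
  and bounded_op_add: "f \<in> H2 J ==> g \<in> H2 J ==> A (\<lambda>z. f z + g z) = (\<lambda>z. A f z + A g z)"
  and bounded_op_scale: "f \<in> H2 J ==> A (\<lambda>z. a * f z) = (\<lambda>z. a * A f z)"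
  and bounded_op_bound: "\<exists>C\<ge>0. \<forall>f\<in>H2 J. H2_norm J (A f) \<le> C * H2_norm J f"
proof -
 note c = assms[unfolded bounded_ops_def mem_Collect_eq]
 show "f \<in> H2 J ==> A f \<in> H2 J" by (rule c[THEN conjunct1, rule_format])
 show "f \<in> H2 J ==> g \<in> H2 J ==> A (\<lambda>z. f z + g z) = (\<lambda>z. A f z + A g z)"
  by (rule c[THEN conjunct2, THEN conjunct1, rule_format])
 show "f \<in> H2 J ==> A (\<lambda>z. a * f z) = (\<lambda>z. a * A f z)"
  by (rule c[THEN conjunct2, THEN conjunct2, THEN conjunct1, rule_format])
 obtain C where C: "\<forall>f\<in>H2 J. H2_norm J (A f) \<le> C * H2_norm J f"
  using c[THEN conjunct2, THEN conjunct2, THEN conjunct2] by blast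
 have "H2_norm J (A f) \<le> max C 0 * H2_norm J f" if "f \<in> H2 J" for f
  using C that mult_right_mono[OF max.cobounded1[of C 0] H2_norm_ge0[of J f]] by force
 then show "\<exists>C\<ge>0. \<forall>f\<in>H2 J. H2_norm J (A f) \<le> C * H2_norm J f" by (intro exI[of _ "max C 0"]) auto
qed

lemma bounded_op_sum:
 assumes J: "finite J" and A: "A \<in> bounded_ops J" and f: "\<And>i. i \<in> S ==> f i \<in> H2 J"
 shows "A (\<lambda>z. \<Sum>i\<in>S. a i * f i z) = (\<lambda>z. \<Sum>i\<in>S. a i * A (f i) z)"
proof -
 interpret fun_hilbert "H2 J" "H2_inner J" "H2_norm J" by (rule H2_hilbert[OF J])
 show ?thesis using f
 proof (induction S rule: infinite_finite_induct)
  case (insert s S)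
  have 1: "(\<lambda>z. a s * f s z) \<in> H2 J" by (rule scale_mem) (use insert.prems in auto)
  have 2: "(\<lambda>z. \<Sum>i\<in>S. a i * f i z) \<in> H2 J" by (intro sum_mem scale_mem) (use insert.prems in auto)
  have "A (\<lambda>z. a s * f s z + (\<Sum>i\<in>S. a i * f i z)) = (\<lambda>z. a s * A (f s) z + (\<Sum>i\<in>S. a i * A (f i) z))"
   using bounded_op_add[OF A 1 2] bounded_op_scale[OF A, of "f s" "a s"] insert by simp
  then show ?case using insert.hyps by simp
 qed (use bounded_op_scale[OF A zero_mem, of 0] in simp_all)
qed

lemma bounded_op_diff:
 assumes J: "finite J" and A: "A \<in> bounded_ops J" and f: "f \<in> H2 J" and g: "g \<in> H2 J"
 shows "A (\<lambda>z. f z - g z) = (\<lambda>z. A f z - A g z)"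
 using bounded_op_add[OF A f H2_scale[OF J g, of "-1"]] bounded_op_scale[OF A g, of "-1"] by simp

lemma bounded_op_tends:
 assumes J: "finite J" and A: "A \<in> bounded_ops J" and t: "H2_tends J u l" and u: "\<And>k. u k \<in> H2 J" and l: "l \<in> H2 J"
 shows "H2_tends J (\<lambda>k. A (u k)) (A l)"
proof -
 interpret fun_hilbert "H2 J" "H2_inner J" "H2_norm J" by (rule H2_hilbert[OF J])
 obtain C where C: "\<forall>f\<in>H2 J. H2_norm J (A f) \<le> C * H2_norm J f" using bounded_op_bound[OF A] by blast
 show ?thesis
 proof (rule tends_bounded_map[OF t])
  show "H2_norm J (\<lambda>x. A (u k) x - A l x) \<le> C * H2_norm J (\<lambda>x. u k x - l x)" for k
   unfolding bounded_op_diff[OF J A u l, symmetric] by (rule C[rule_format, OF diff_mem[OF u l]])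
 qed (intro bounded_op_mem[OF A] u l)+
qed

locale polydisc_split =
 fixes n :: nat
 assumes n2: "n \<ge> 2"
begin

abbreviation "I \<equiv> {1..n}"
abbreviation "J \<equiv> {2..n}"

lemma I_insert: "I = insert 1 J" using n2 by auto

lemma one_in: "1 \<in> I" and one_notin: "1 \<notin> J" and J_sub: "J \<subseteq> I" using n2 by auto

lemma point_split: "z \<in> polydisc I \<longleftrightarrow> z \<in> extensional I \<and> cmod (z 1) < 1 \<and> restrict z J \<in> polydisc J"
 unfolding polydisc_def I_insert by (auto simp: PiE_iff)

lemma point_join: "x \<in> polydisc J ==> cmod w < 1 ==> x(1 := w) \<in> polydisc I"
 unfolding polydisc_def I_insert by (auto simp: PiE_iff extensional_def)

lemma restrict_join: "x \<in> polydisc J ==> restrict (x(1 := w)) J = x"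
 using one_notin by (auto simp: polydisc_def PiE_iff fun_eq_iff restrict_def extensional_def)

lemma join_restrict: "z \<in> polydisc I ==> (restrict z J)(1 := z 1) = z"
 unfolding polydisc_def I_insert by (auto simp: PiE_iff fun_eq_iff restrict_def extensional_def)

lemma index_join: "\<beta> \<in> multi_indices J ==> \<beta>(1 := j) \<in> multi_indices I"
 unfolding multi_indices_def I_insert by (auto simp: PiE_iff extensional_def)

lemma index_restrict: "restrict \<alpha> J \<in> multi_indices J" by (simp add: multi_indices_def)

lemma index_restrict_join: "\<beta> \<in> multi_indices J ==> restrict (\<beta>(1 := j)) J = \<beta>"
 using one_notin by (auto simp: multi_indices_def PiE_iff fun_eq_iff restrict_def extensional_def)

lemma index_join_restrict: "\<alpha> \<in> multi_indices I ==> (restrict \<alpha> J)(1 := \<alpha> 1) = \<alpha>"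
 unfolding multi_indices_def I_insert by (auto simp: PiE_iff fun_eq_iff restrict_def extensional_def)

lemma mon_join:
 assumes "z \<in> polydisc I" "\<beta> \<in> multi_indices J"
 shows "mon I (\<beta>(1 := j)) z = z 1 ^ j * mon J \<beta> (restrict z J)"
proof -
 have "mon I (\<beta>(1 := j)) z = z 1 ^ j * (\<Prod>i\<in>J. z i ^ (\<beta>(1 := j)) i)"
  unfolding mon_def I_insert using one_notin by simp
 also have "(\<Prod>i\<in>J. z i ^ (\<beta>(1 := j)) i) = mon J \<beta> (restrict z J)"
  unfolding mon_def using one_notin by (intro prod.cong) auto
 finally show ?thesis .
qed

lemma has_sum_split:
 "(f has_sum s) (multi_indices I) \<longleftrightarrow> ((\<lambda>(j, \<beta>). f (\<beta>(1 := j))) has_sum s) (UNIV \<times> multi_indices J)"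
proof (rule has_sum_reindex_bij_witness[where i="\<lambda>(j, \<beta>). \<beta>(1 := j)" and j="\<lambda>\<alpha>. (\<alpha> 1, restrict \<alpha> J)"])
 fix a assume a: "a \<in> multi_indices I"
 show "(case (a 1, restrict a J) of (j, \<beta>) \<Rightarrow> \<beta>(1 := j)) = a" unfolding prod.case by (rule index_join_restrict[OF a])
 show "(a 1, restrict a J) \<in> UNIV \<times> multi_indices J" using index_restrict by blast
 show "(case (a 1, restrict a J) of (j, \<beta>) \<Rightarrow> f (\<beta>(1 := j))) = f a" unfolding prod.case index_join_restrict[OF a] ..
next
 fix b :: "nat \<times> (nat \<Rightarrow> nat)" assume "b \<in> UNIV \<times> multi_indices J"
 then obtain j \<beta> where b: "b = (j, \<beta>)" "\<beta> \<in> multi_indices J" by blast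
 show "((case b of (j, \<beta>) \<Rightarrow> \<beta>(1 := j)) 1, restrict (case b of (j, \<beta>) \<Rightarrow> \<beta>(1 := j)) J) = b"
  unfolding b prod.case index_restrict_join[OF b(2)] by simp
 show "(case b of (j, \<beta>) \<Rightarrow> \<beta>(1 := j)) \<in> multi_indices I" unfolding b prod.case by (rule index_join[OF b(2)])
qed simp

text \<open>The coefficients of the \<open>K\<close>-valued power series in \<open>z\<^sub>1\<close>.\<close>
definition sl :: "func \<Rightarrow> nat \<Rightarrow> func" where
 "sl F j = of_coeffs J (\<lambda>\<beta>. coeffs I F (\<beta>(1 := j)))"

lemma sl_sq_summable:
 assumes F: "F \<in> H2 I" shows "sq_summable J (\<lambda>\<beta>. coeffs I F (\<beta>(1 := j)))"
proof (rule sq_summable_bdd)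
 fix X assume X: "finite X" "X \<subseteq> multi_indices J"
 have inj: "inj_on (\<lambda>\<beta>. \<beta>(1 := j)) X"
  by (rule inj_on_inverseI[where g="\<lambda>\<alpha>. restrict \<alpha> J"]) (use X index_restrict_join in auto)
 have "(\<Sum>\<beta>\<in>X. (cmod (coeffs I F (\<beta>(1 := j))))^2) = (\<Sum>\<alpha>\<in>(\<lambda>\<beta>. \<beta>(1 := j)) ` X. (cmod (coeffs I F \<alpha>))^2)"
  by (subst sum.reindex[OF inj]) (simp add: o_def)
 also have "\<dots> \<le> (H2_norm I F)^2"
  by (rule H2_norm_partial[OF _ F]) (use X index_join in auto)
 finally show "(\<Sum>\<beta>\<in>X. (cmod (coeffs I F (\<beta>(1 := j))))^2) \<le> (H2_norm I F)^2" .
qed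

lemma sl_H2: "F \<in> H2 I ==> sl F j \<in> H2 J"
 unfolding sl_def by (rule of_coeffs_H2[OF _ sl_sq_summable]) auto

lemma coeffs_sl: "F \<in> H2 I ==> \<beta> \<in> multi_indices J ==> coeffs J (sl F j) \<beta> = coeffs I F (\<beta>(1 := j))"
 unfolding sl_def by (rule coeffs_of_coeffs[OF _ sl_sq_summable]) auto

lemma sl_norm_has_sum:
 assumes F: "F \<in> H2 I" shows "((\<lambda>j. (H2_norm J (sl F j))^2) has_sum (H2_norm I F)^2) UNIV"
proof (rule has_sum_SigmaD)
 show "((\<lambda>(j, \<beta>). (cmod (coeffs I F (\<beta>(1 := j))))^2) has_sum (H2_norm I F)^2) (Sigma UNIV (\<lambda>_. multi_indices J))"
  using H2_norm_has_sum[OF _ F] has_sum_split[of "\<lambda>\<alpha>. (cmod (coeffs I F \<alpha>))^2"] by simp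
 fix j :: nat
 show "((\<lambda>\<beta>. case (j, \<beta>) of (j, \<beta>) \<Rightarrow> (cmod (coeffs I F (\<beta>(1 := j))))^2) has_sum (H2_norm J (sl F j))^2) (multi_indices J)"
  using H2_norm_has_sum[OF _ sl_H2[OF F], of j] by (simp add: coeffs_sl[OF F] cong: has_sum_cong)
qed

lemma sl_norm_le: "F \<in> H2 I ==> H2_norm J (sl F j) \<le> H2_norm I F"
proof -
 assume F: "F \<in> H2 I"
 have "(H2_norm J (sl F j))^2 \<le> (H2_norm I F)^2"
  using finite_sum_le_has_sum[OF sl_norm_has_sum[OF F], of "{j}"] by simp
 then show ?thesis by (rule power2_le_imp_le[OF _ H2_norm_ge0])
qed

lemma sl_eqI:
 assumes "F \<in> H2 I" "G \<in> H2 I" "\<And>j. sl F j = sl G j" shows "F = G"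
proof (rule H2_eqI[OF _ assms(1,2)])
 fix \<alpha> assume a: "\<alpha> \<in> multi_indices I"
 have "coeffs J (sl F (\<alpha> 1)) (restrict \<alpha> J) = coeffs J (sl G (\<alpha> 1)) (restrict \<alpha> J)" by (simp add: assms(3))
 then show "coeffs I F \<alpha> = coeffs I G \<alpha>"
  by (simp add: coeffs_sl[OF assms(1) index_restrict] coeffs_sl[OF assms(2) index_restrict] index_join_restrict[OF a])
qed simp

text \<open>The function with prescribed \<open>K\<close>-valued coefficients, inverse to \<open>sl\<close>.\<close>
definition unsl :: "(nat \<Rightarrow> func) \<Rightarrow> func" where
 "unsl G = of_coeffs I (\<lambda>\<alpha>. coeffs J (G (\<alpha> 1)) (restrict \<alpha> J))"

lemma
 assumes G: "\<And>j. G j \<in> H2 J" and s: "(\<lambda>j. (H2_norm J (G j))^2) summable_on UNIV"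
 shows unsl_H2: "unsl G \<in> H2 I" and sl_unsl: "sl (unsl G) j = G j"
proof -
 define S where "S = infsum (\<lambda>j. (H2_norm J (G j))^2) UNIV"
 have sq: "sq_summable I (\<lambda>\<alpha>. coeffs J (G (\<alpha> 1)) (restrict \<alpha> J))"
 proof (rule sq_summable_bdd[where B=S])
  fix X assume X: "finite X" "X \<subseteq> multi_indices I"
  define A where "A = (\<lambda>\<alpha>. \<alpha> 1) ` X"
  define C where "C = (\<lambda>\<alpha>. restrict \<alpha> J) ` X"
  have fin: "finite A" "finite C" "C \<subseteq> multi_indices J" using X index_restrict by (auto simp: A_def C_def)
  let ?f = "\<lambda>(j, \<beta>). (cmod (coeffs J (G j) \<beta>))^2"
  have inj: "inj_on (\<lambda>\<alpha>. (\<alpha> 1, restrict \<alpha> J)) X"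
   by (rule inj_on_inverseI[where g="\<lambda>(j,\<beta>). \<beta>(1 := j)"]) (use X index_join_restrict in auto)
  have "(\<Sum>\<alpha>\<in>X. (cmod (coeffs J (G (\<alpha> 1)) (restrict \<alpha> J)))^2) = sum ?f ((\<lambda>\<alpha>. (\<alpha> 1, restrict \<alpha> J)) ` X)"
   by (subst sum.reindex[OF inj]) (simp add: o_def)
  also have "\<dots> \<le> sum ?f (A \<times> C)" by (rule sum_mono2) (use fin in \<open>auto simp: A_def C_def\<close>)
  also have "\<dots> = (\<Sum>j\<in>A. \<Sum>\<beta>\<in>C. (cmod (coeffs J (G j) \<beta>))^2)" by (simp add: sum.cartesian_product)
  also have "\<dots> \<le> (\<Sum>j\<in>A. (H2_norm J (G j))^2)" by (rule sum_mono) (use fin G in \<open>auto intro!: H2_norm_partial\<close>)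
  also have "\<dots> \<le> S" unfolding S_def by (rule finite_sum_le_infsum[OF s fin(1)]) auto
  finally show "(\<Sum>\<alpha>\<in>X. (cmod (coeffs J (G (\<alpha> 1)) (restrict \<alpha> J)))^2) \<le> S" .
 qed
 show X: "unsl G \<in> H2 I" unfolding unsl_def by (rule of_coeffs_H2[OF _ sq]) simp
 show "sl (unsl G) j = G j"
 proof (rule H2_eqI[OF _ sl_H2[OF X] G])
  fix \<beta> assume b: "\<beta> \<in> multi_indices J"
  have "coeffs I (unsl G) (\<beta>(1 := j)) = coeffs J (G ((\<beta>(1 := j)) 1)) (restrict (\<beta>(1 := j)) J)"
   unfolding unsl_def by (rule coeffs_of_coeffs[OF _ sq index_join[OF b]]) simp
  then show "coeffs J (sl (unsl G) j) \<beta> = coeffs J (G j) \<beta>"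
   unfolding coeffs_sl[OF X b] index_restrict_join[OF b] by simp
 qed simp
qed

lemma slice_eval:
 assumes F: "F \<in> H2 I" and w: "cmod w < 1" and x: "x \<in> polydisc J"
 shows "((\<lambda>j. w ^ j * sl F j x) has_sum slice n F w x) UNIV"
proof (rule has_sum_SigmaD)
 note z = point_join[OF x w]
 have "((\<lambda>\<alpha>. coeffs I F \<alpha> * mon I \<alpha> (x(1 := w))) has_sum F (x(1 := w))) (multi_indices I)" by (rule H2_eval[OF F z])
 then show "((\<lambda>(j, \<beta>). coeffs I F (\<beta>(1 := j)) * mon I (\<beta>(1 := j)) (x(1 := w))) has_sum slice n F w x) (Sigma UNIV (\<lambda>_. multi_indices J))"
  unfolding has_sum_split using x by (simp add: slice_def)
 fix j :: nat
 show "((\<lambda>\<beta>. case (j, \<beta>) of (j, \<beta>) \<Rightarrow> coeffs I F (\<beta>(1 := j)) * mon I (\<beta>(1 := j)) (x(1 := w))) has_sum w ^ j * sl F j x) (multi_indices J)"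
  using has_sum_cmult_right[OF H2_eval[OF sl_H2[OF F, of j] x], of "w ^ j"]
  by (simp add: coeffs_sl[OF F] mon_join[OF z] restrict_join[OF x] mult.left_commute cong: has_sum_cong)
qed

lemma
 assumes F: "F \<in> H2 I" and w: "cmod w < 1"
 shows slice_H2: "slice n F w \<in> H2 J"
  and slice_tends: "H2_tends J (\<lambda>m x. \<Sum>j<m. w ^ j * sl F j x) (slice n F w)"
  and slice_norm: "H2_norm J (\<lambda>x. \<Sum>j<m. w ^ j * sl F j x) \<le> H2_norm I F / (1 - cmod w)"
proof -
 interpret H: fun_hilbert "H2 J" "H2_inner J" "H2_norm J" by (rule H2_hilbert) simp
 define u where "u m x = (\<Sum>j<m. w ^ j * sl F j x)" for m x
 have tX: "(\<lambda>x. w ^ j * sl F j x) \<in> H2 J" for j by (rule H.scale_mem[OF sl_H2[OF F]])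
 have uX: "u m \<in> H2 J" for m unfolding u_def[abs_def] by (rule H.sum_mem) (rule tX)
 define N where "N = H2_norm I F"
 have tn: "H2_norm J (\<lambda>x. w ^ j * sl F j x) \<le> N * cmod w ^ j" for j
  unfolding H.nm_scale[OF sl_H2[OF F]] N_def norm_power
  using mult_left_mono[OF sl_norm_le[OF F, of j], of "cmod w ^ j"] by (simp add: mult.commute)
 have N0: "0 \<le> N" by (simp add: N_def H2_norm_ge0)
 have geo: "(\<lambda>j. N * cmod w ^ j) sums (N * (1 / (1 - cmod w)))"
  by (intro sums_mult geometric_sums) (use w in simp)
 have seg: "H2_norm J (\<lambda>x. \<Sum>j\<in>A. w ^ j * sl F j x) \<le> (\<Sum>j\<in>A. N * cmod w ^ j)" for A
  by (rule order_trans[OF H.nm_sum[OF tX] sum_mono[OF tn]])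
 show "H2_norm J (\<lambda>x. \<Sum>j<m. w ^ j * sl F j x) \<le> H2_norm I F / (1 - cmod w)" for m
 proof -
  have "(\<Sum>j<m. N * cmod w ^ j) \<le> (\<Sum>j. N * cmod w ^ j)"
   by (rule sum_le_suminf[OF sums_summable[OF geo]]) (use N0 in auto)
  then show ?thesis using seg[of "{..<m}"] sums_unique[OF geo] by (simp add: N_def)
 qed
 have "H.cauchy u"
  unfolding H.cauchy_def
 proof (intro allI impI)
  fix e :: real assume e: "0 < e"
  have "Cauchy (\<lambda>m. \<Sum>j<m. N * cmod w ^ j)"
   using geo unfolding sums_def by (rule LIMSEQ_imp_Cauchy)
  from metric_CauchyD[OF this e] obtain M where M: "\<And>i j. i \<ge> M ==> j \<ge> M ==> dist (\<Sum>j<i. N * cmod w ^ j) (\<Sum>j<j. N * cmod w ^ j) < e" by blast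
  have *: "H2_norm J (\<lambda>x. u b x - u a x) < e" if "M \<le> a" "a \<le> b" for a b
  proof -
   have "(\<lambda>x. u b x - u a x) = (\<lambda>x. \<Sum>j\<in>{a..<b}. w ^ j * sl F j x)"
   proof
    fix x show "u b x - u a x = (\<Sum>j\<in>{a..<b}. w ^ j * sl F j x)"
     using sum.atLeastLessThan_concat[of 0 a b "\<lambda>j. w ^ j * sl F j x"] that
     by (simp add: u_def atLeast0LessThan[symmetric] algebra_simps)
   qed
   moreover have "(\<Sum>j\<in>{a..<b}. N * cmod w ^ j) = (\<Sum>j<b. N * cmod w ^ j) - (\<Sum>j<a. N * cmod w ^ j)"
    using sum.atLeastLessThan_concat[of 0 a b "\<lambda>j. N * cmod w ^ j"] that
    by (simp add: atLeast0LessThan[symmetric])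
   moreover have "(\<Sum>j<b. N * cmod w ^ j) - (\<Sum>j<a. N * cmod w ^ j) < e"
    using M[of b a] that unfolding dist_real_def by simp
   ultimately show ?thesis using seg[of "{a..<b}"] by simp
  qed
  have "H2_norm J (\<lambda>x. u a x - u b x) < e" if "M \<le> a" "M \<le> b" for a b
   using *[of a b] *[of b a] that H.nm_commute[OF uX uX, of a b] by (cases "a \<le> b") auto
  then show "\<exists>N. \<forall>m\<ge>N. \<forall>n\<ge>N. H2_norm J (\<lambda>x. u m x - u n x) < e" by blast
 qed
 then obtain L where L: "L \<in> H2 J" "H.tends u L" using H.complete[of u] uX by blast
 have "L x = slice n F w x" for x
 proof (cases "x \<in> polydisc J")
  case True
  have "(\<lambda>m. u m x) \<longlonglongrightarrow> slice n F w x"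
   using has_sum_imp_sums[OF slice_eval[OF F w True]] unfolding sums_def u_def .
  then show ?thesis using LIMSEQ_unique[OF tends_pointwise[OF _ L(2) uX L(1)]] by simp
 qed (simp add: H2_off[OF L(1)] slice_def)
 then have "L = slice n F w" by (rule ext)
 then show "slice n F w \<in> H2 J" "H2_tends J (\<lambda>m x. \<Sum>j<m. w ^ j * sl F j x) (slice n F w)"
  using L unfolding u_def[abs_def] by auto
qed

lemma eval_slice: "F \<in> H2 I ==> z \<in> polydisc I ==> F z = slice n F (z 1) (restrict z J)"
 using point_split[of z] join_restrict[of z] by (simp add: slice_def)

lemma slice_eqI:
 assumes F: "F \<in> H2 I" and G: "\<And>z. z \<notin> polydisc I ==> G z = 0" "\<And>z. z \<in> polydisc I ==> G z = slice n F (z 1) (restrict z J)"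
 shows "G = F"
proof
 fix z show "G z = F z" using G eval_slice[OF F, of z] H2_off[OF F, of z] by (cases "z \<in> polydisc I") auto
qed

lemma
 assumes A: "A \<in> bounded_ops J" and F: "F \<in> H2 I"
 shows lift_H2: "op_mult n (\<lambda>_. A) F \<in> H2 I"
  and sl_lift: "sl (op_mult n (\<lambda>_. A) F) j = A (sl F j)"
  and slice_lift: "cmod w < 1 ==> slice n (op_mult n (\<lambda>_. A) F) w = A (slice n F w)"
proof -
 obtain C where C: "C \<ge> 0" "\<forall>f\<in>H2 J. H2_norm J (A f) \<le> C * H2_norm J f" using bounded_op_bound[OF A] by blast
 define G where "G j = A (sl F j)" for j
 have GX: "G j \<in> H2 J" for j unfolding G_def by (rule bounded_op_mem[OF A sl_H2[OF F]])
 have s: "(\<lambda>j. (H2_norm J (G j))^2) summable_on UNIV"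
 proof (rule summable_on_comparison_test[where f="\<lambda>j. C^2 * (H2_norm J (sl F j))^2"])
  show "(\<lambda>j. C^2 * (H2_norm J (sl F j))^2) summable_on UNIV"
   using has_sum_imp_summable[OF sl_norm_has_sum[OF F]] by (rule summable_on_cmult_right)
  fix j
  have "(H2_norm J (G j))^2 \<le> (C * H2_norm J (sl F j))^2"
   by (rule power_mono) (use C(2) sl_H2[OF F] H2_norm_ge0 in \<open>auto simp: G_def\<close>)
  then show "(H2_norm J (G j))^2 \<le> C^2 * (H2_norm J (sl F j))^2" by (simp add: power_mult_distrib)
 qed simp
 define H where "H = unsl G"
 have HX: "H \<in> H2 I" unfolding H_def by (rule unsl_H2[OF GX s])
 have slH: "sl H j = G j" for j unfolding H_def by (rule sl_unsl[OF GX s])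
 have sliceH: "slice n H w = A (slice n F w)" if w: "cmod w < 1" for w
 proof -
  interpret K: fun_hilbert "H2 J" "H2_inner J" "H2_norm J" by (rule H2_hilbert) simp
  have pX: "(\<lambda>x. \<Sum>j<m. w ^ j * sl F j x) \<in> H2 J" for m by (intro K.sum_mem K.scale_mem sl_H2[OF F])
  have "H2_tends J (\<lambda>m. A (\<lambda>x. \<Sum>j<m. w ^ j * sl F j x)) (A (slice n F w))"
   by (rule bounded_op_tends[OF _ A slice_tends[OF F w] pX slice_H2[OF F w]]) simp
  moreover have "A (\<lambda>x. \<Sum>j<m. w ^ j * sl F j x) = (\<lambda>x. \<Sum>j<m. w ^ j * sl H j x)" for m
   unfolding slH G_def by (rule bounded_op_sum[OF _ A]) (auto intro: sl_H2[OF F])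
  ultimately have t: "H2_tends J (\<lambda>m x. \<Sum>j<m. w ^ j * sl H j x) (A (slice n F w))" by simp
  have qX: "(\<lambda>x. \<Sum>j<m. w ^ j * sl H j x) \<in> H2 J" for m by (intro K.sum_mem K.scale_mem sl_H2[OF HX])
  show ?thesis
   by (rule tends_unique[OF _ slice_tends[OF HX w] t qX slice_H2[OF HX w] bounded_op_mem[OF A slice_H2[OF F w]]]) simp
 qed
 have eq: "op_mult n (\<lambda>_. A) F = H"
 proof (rule slice_eqI[OF HX])
  show "op_mult n (\<lambda>_. A) F z = 0" if "z \<notin> polydisc I" for z unfolding op_mult_def using that by (rule if_not_P)
  show "op_mult n (\<lambda>_. A) F z = slice n H (z 1) (restrict z J)" if z: "z \<in> polydisc I" for z
   using sliceH[of "z 1"] z point_split[of z] unfolding op_mult_def by simp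
 qed
 show "op_mult n (\<lambda>_. A) F \<in> H2 I" unfolding eq by (rule HX)
 show "sl (op_mult n (\<lambda>_. A) F) j = A (sl F j)" unfolding eq slH G_def ..
 show "cmod w < 1 ==> slice n (op_mult n (\<lambda>_. A) F) w = A (slice n F w)" unfolding eq by (rule sliceH)
qed

subsection \<open>Constants\<close>

text \<open>The copy of \<open>K\<close> in \<open>H\<^sup>2(K)\<close>.\<close>
definition const1 :: "func \<Rightarrow> func" where
 "const1 k = (\<lambda>z. if z \<in> polydisc I then k (restrict z J) else 0)"

lemma slice_const1: "k \<in> H2 J ==> cmod w < 1 ==> slice n (const1 k) w = k"
proof
 fix x assume k: "k \<in> H2 J" "cmod w < 1"
 show "slice n (const1 k) w x = k x"
 proof (cases "x \<in> polydisc J")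
  case True
  have "slice n (const1 k) w x = k (restrict (x(1 := w)) J)"
   unfolding slice_def const1_def using True point_join[OF True k(2)] by (simp only: if_True)
  then show ?thesis unfolding restrict_join[OF True] .
 qed (simp add: slice_def H2_off[OF k(1)])
qed

lemma
 assumes k: "k \<in> H2 J"
 shows const1_H2: "const1 k \<in> H2 I" and sl_const1: "sl (const1 k) j = (if j = 0 then k else (\<lambda>x. 0))"
  and const1_norm: "H2_norm I (const1 k) = H2_norm J k"
proof -
 interpret K: fun_hilbert "H2 J" "H2_inner J" "H2_norm J" by (rule H2_hilbert) simp
 define G where "G j = (if j = 0 then k else (\<lambda>x. 0))" for j :: nat
 have GX: "G j \<in> H2 J" for j using k by (simp add: G_def)
 have hs: "((\<lambda>j. (H2_norm J (G j))^2) has_sum (H2_norm J k)^2) UNIV"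
  by (rule has_sum_finite_neutralI[where B="{0}"]) (auto simp: G_def)
 note s = has_sum_imp_summable[OF hs]
 have eq: "const1 k = unsl G"
 proof (rule slice_eqI[OF unsl_H2[OF GX s]])
  fix z assume z: "z \<in> polydisc I"
  then have w: "cmod (z 1) < 1" and x: "restrict z J \<in> polydisc J" using point_split[of z] by auto
  have "((\<lambda>j. z 1 ^ j * sl (unsl G) j (restrict z J)) has_sum slice n (unsl G) (z 1) (restrict z J)) UNIV"
   by (rule slice_eval[OF unsl_H2[OF GX s] w x])
  moreover have "((\<lambda>j. z 1 ^ j * sl (unsl G) j (restrict z J)) has_sum k (restrict z J)) UNIV"
   unfolding sl_unsl[OF GX s] by (rule has_sum_finite_neutralI[where B="{0}"]) (auto simp: G_def)
  ultimately show "const1 k z = slice n (unsl G) (z 1) (restrict z J)"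
   using has_sum_unique z unfolding const1_def by (metis (no_types, lifting))
 qed (simp add: const1_def)
 show X: "const1 k \<in> H2 I" unfolding eq by (rule unsl_H2[OF GX s])
 show sc: "sl (const1 k) j = (if j = 0 then k else (\<lambda>x. 0))" for j unfolding eq sl_unsl[OF GX s] G_def ..
 have "((\<lambda>j. (H2_norm J (sl (const1 k) j))^2) has_sum (H2_norm J k)^2) UNIV"
  using hs unfolding sc G_def .
 then have "(H2_norm I (const1 k))^2 = (H2_norm J k)^2" using has_sum_unique[OF sl_norm_has_sum[OF X]] by blast
 then show "H2_norm I (const1 k) = H2_norm J k" by (rule power2_eq_imp_eq[OF _ H2_norm_ge0 H2_norm_ge0])
qed

lemma const1_orthogonal_shift:
 assumes k: "k \<in> H2 J" and G: "G \<in> H2 I"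
 shows "H2_inner I (const1 k) (\<lambda>z. z 1 * G z) = 0"
proof -
 have sX: "(\<lambda>z. z 1 * G z) \<in> H2 I" by (rule shift_H2[OF _ one_in G]) simp
 have "coeffs I (const1 k) \<alpha> * cnj (coeffs I (\<lambda>z. z 1 * G z) \<alpha>) = 0" if a: "\<alpha> \<in> multi_indices I" for \<alpha>
 proof (cases "\<alpha> 1 = 0")
  case True
  then have "coeffs I (\<lambda>z. z 1 * G z) \<alpha> = 0" using coeffs_shift_0[OF _ one_in G a] by simp
  then show ?thesis by simp
 next
  case False
  have "coeffs I (const1 k) ((restrict \<alpha> J)(1 := \<alpha> 1)) = coeffs J (sl (const1 k) (\<alpha> 1)) (restrict \<alpha> J)"
   by (rule coeffs_sl[OF const1_H2[OF k] index_restrict, symmetric])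
  also have "\<dots> = 0" using False coeffs_zero[OF _ index_restrict] unfolding sl_const1[OF k] by simp
  finally show ?thesis unfolding index_join_restrict[OF a] by simp
 qed
 then have "((\<lambda>\<alpha>. coeffs I (const1 k) \<alpha> * cnj (coeffs I (\<lambda>z. z 1 * G z) \<alpha>)) has_sum 0) (multi_indices I)"
  by (subst has_sum_cong[where g="\<lambda>_. 0"]) auto
 then show ?thesis using has_sum_unique[OF H2_inner_has_sum[OF _ const1_H2[OF k] sX]] by simp
qed

lemma const1_shift_decomposition:
 assumes F: "F \<in> H2 I"
 shows "\<exists>G\<in>H2 I. F = (\<lambda>z. const1 (sl F 0) z + z 1 * G z)"
proof -
 define g where "g j = sl F (Suc j)" for j
 have gX: "g j \<in> H2 J" for j unfolding g_def by (rule sl_H2[OF F])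
 have "(\<lambda>j. (H2_norm J (sl F j))^2) summable_on (range Suc)"
  by (rule summable_on_subset_banach[OF has_sum_imp_summable[OF sl_norm_has_sum[OF F]]]) simp
 then have s: "(\<lambda>j. (H2_norm J (g j))^2) summable_on UNIV"
  unfolding g_def by (subst (asm) summable_on_reindex) (auto simp: o_def)
 define G where "G = unsl g"
 have GX: "G \<in> H2 I" unfolding G_def by (rule unsl_H2[OF gX s])
 note kX = const1_H2[OF sl_H2[OF F, of 0]]
 have shX: "(\<lambda>z. z 1 * G z) \<in> H2 I" by (rule shift_H2[OF _ one_in GX]) simp
 have "F = (\<lambda>z. const1 (sl F 0) z + z 1 * G z)"
 proof (rule H2_eqI[OF _ F H2_add[OF _ kX shX]])
  fix \<alpha> assume a: "\<alpha> \<in> multi_indices I"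
  have add: "coeffs I (\<lambda>z. const1 (sl F 0) z + z 1 * G z) \<alpha> = coeffs I (const1 (sl F 0)) \<alpha> + coeffs I (\<lambda>z. z 1 * G z) \<alpha>"
   by (rule coeffs_add[OF _ kX shX a]) simp
  have c1: "coeffs I (const1 (sl F 0)) \<alpha> = coeffs J (sl (const1 (sl F 0)) (\<alpha> 1)) (restrict \<alpha> J)"
   using coeffs_sl[OF kX index_restrict[of \<alpha>], where j="\<alpha> 1"] unfolding index_join_restrict[OF a] by simp
  have cF: "coeffs I F \<alpha> = coeffs J (sl F (\<alpha> 1)) (restrict \<alpha> J)"
   using coeffs_sl[OF F index_restrict[of \<alpha>], where j="\<alpha> 1"] unfolding index_join_restrict[OF a] by simp
  show "coeffs I F \<alpha> = coeffs I (\<lambda>z. const1 (sl F 0) z + z 1 * G z) \<alpha>"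
  proof (cases "\<alpha> 1")
   case 0
   then have "coeffs I (\<lambda>z. z 1 * G z) \<alpha> = 0" using coeffs_shift_0[OF _ one_in GX a] by simp
   then show ?thesis unfolding add c1 cF sl_const1[OF sl_H2[OF F]] 0 by simp
  next
   case (Suc j)
   define \<beta> where "\<beta> = (restrict \<alpha> J)(1 := j)"
   have b: "\<beta> \<in> multi_indices I" unfolding \<beta>_def by (rule index_join[OF index_restrict])
   have up: "up 1 \<beta> = \<alpha>"
    using index_join_restrict[OF a] unfolding Suc up_def \<beta>_def by (simp only: fun_upd_upd fun_upd_same)
   have "coeffs I (\<lambda>z. z 1 * G z) \<alpha> = coeffs I G \<beta>"
    using coeffs_shift_up[OF _ one_in GX b] unfolding up by simp
   also have "\<dots> = coeffs J (sl G j) (restrict \<alpha> J)"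
    unfolding \<beta>_def by (rule coeffs_sl[OF GX index_restrict, symmetric])
   also have "sl G j = sl F (Suc j)" unfolding G_def by (simp add: sl_unsl[OF gX s] g_def)
   finally have "coeffs I (\<lambda>z. z 1 * G z) \<alpha> = coeffs I F \<alpha>" unfolding cF Suc .
   moreover have "coeffs I (const1 (sl F 0)) \<alpha> = 0"
    unfolding c1 sl_const1[OF sl_H2[OF F]] Suc using coeffs_zero[OF _ index_restrict] by simp
   ultimately show ?thesis unfolding add by simp
  qed
 qed simp_all
 then show ?thesis using GX by blast
qed

end

section \<open>Integration over the boundary of the first disc\<close>

context polydisc_split
begin

lemma
 assumes k: "\<And>j. k j \<in> H2 J"
 shows circle_poly_norm_integrable: "integrable circle_measure (\<lambda>\<xi>. (H2_norm J (\<lambda>x. \<Sum>j<m. \<xi> ^ j * k j x))^2)"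
  and circle_poly_norm: "(\<integral>\<xi>. (H2_norm J (\<lambda>x. \<Sum>j<m. \<xi> ^ j * k j x))^2 \<partial>circle_measure) = (\<Sum>j<m. (H2_norm J (k j))^2)"
proof -
 interpret K: fun_hilbert "H2 J" "H2_inner J" "H2_norm J" by (rule H2_hilbert) simp
 have X: "(\<lambda>x. \<Sum>j<m. \<xi> ^ j * k j x) \<in> H2 J" for m \<xi> by (intro K.sum_mem K.scale_mem k)
 have ips: "H2_inner J (\<lambda>x. \<Sum>j<m. \<xi> ^ j * k j x) g = (\<Sum>j<m. \<xi> ^ j * H2_inner J (k j) g)" if g: "g \<in> H2 J" for g m \<xi>
 proof (induction m)
  case (Suc m)
  then show ?case using K.ip_add[OF X K.scale_mem[OF k] g, of \<xi> m "\<xi> ^ m" m] K.ip_scale[OF k g] by simp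
 qed (use g in simp)
 have ipr: "H2_inner J g (\<lambda>x. \<Sum>j<m. \<xi> ^ j * k j x) = (\<Sum>j<m. cnj \<xi> ^ j * H2_inner J g (k j))" if g: "g \<in> H2 J" for g m \<xi>
  using K.ip_cnj[OF X g, of \<xi> m] unfolding ips[OF g] using K.ip_cnj[OF k g] by simp
 have expand: "complex_of_real ((H2_norm J (\<lambda>x. \<Sum>j<m. \<xi> ^ j * k j x))^2) =
   (\<Sum>i<m. \<Sum>j<m. (\<xi> ^ i * cnj \<xi> ^ j) * H2_inner J (k i) (k j))" for \<xi>
  unfolding K.ip_nm[OF X, symmetric] ips[OF X] ipr[OF k] sum_distrib_left
  by (intro sum.cong refl) simp
 have "integrable circle_measure (\<lambda>\<xi>. complex_of_real ((H2_norm J (\<lambda>x. \<Sum>j<m. \<xi> ^ j * k j x))^2))"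
  unfolding expand by (intro Bochner_Integration.integrable_sum integrable_mult_left circle_power_integrable)
 then show "integrable circle_measure (\<lambda>\<xi>. (H2_norm J (\<lambda>x. \<Sum>j<m. \<xi> ^ j * k j x))^2)"
  using integrable_Re by fastforce
 have "complex_of_real (\<integral>\<xi>. (H2_norm J (\<lambda>x. \<Sum>j<m. \<xi> ^ j * k j x))^2 \<partial>circle_measure)
   = (\<integral>\<xi>. complex_of_real ((H2_norm J (\<lambda>x. \<Sum>j<m. \<xi> ^ j * k j x))^2) \<partial>circle_measure)"
  by (rule integral_complex_of_real[symmetric])
 also have "\<dots> = (\<Sum>i<m. \<Sum>j<m. (if i = j then 1 else 0) * H2_inner J (k i) (k j))"
  unfolding expand
  by (simp only: Bochner_Integration.integral_sum integrable_mult_left circle_power_integrable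
    Bochner_Integration.integrable_sum integral_mult_left_zero circle_power_integral)
 also have "\<dots> = (\<Sum>i<m. H2_inner J (k i) (k i))"
  by (rule sum.cong[OF refl]) (simp add: if_distrib[of "\<lambda>a. a * _"] cong: if_cong)
 also have "\<dots> = complex_of_real (\<Sum>i<m. (H2_norm J (k i))^2)"
  unfolding K.ip_nm[OF k] by simp
 finally show "(\<integral>\<xi>. (H2_norm J (\<lambda>x. \<Sum>j<m. \<xi> ^ j * k j x))^2 \<partial>circle_measure) = (\<Sum>j<m. (H2_norm J (k j))^2)"
  by (simp only: of_real_eq_iff)
qed

lemma
 assumes F: "F \<in> H2 I" and r: "0 \<le> r" "r < 1"
 shows slice_norm_measurable: "(\<lambda>\<xi>. (H2_norm J (slice n F (of_real r * \<xi>)))^2) \<in> borel_measurable circle_measure"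
  and slice_norm_integral: "((\<lambda>j. (H2_norm J (sl F j))^2 * (r^2) ^ j) has_sum
    (\<integral>\<xi>. (H2_norm J (slice n F (of_real r * \<xi>)))^2 \<partial>circle_measure)) UNIV"
proof -
 interpret K: fun_hilbert "H2 J" "H2_inner J" "H2_norm J" by (rule H2_hilbert) simp
 define k where "k j = (\<lambda>x. of_real (r ^ j) * sl F j x)" for j
 have k: "k j \<in> H2 J" for j unfolding k_def by (intro K.scale_mem sl_H2 F)
 have nk: "(H2_norm J (k j))^2 = (H2_norm J (sl F j))^2 * (r^2) ^ j" for j
  unfolding k_def K.nm_scale[OF sl_H2[OF F]] using r
  by (simp add: power_mult_distrib norm_power power_mult[symmetric] mult.commute)
 have pw: "(of_real r * \<xi>) ^ j * sl F j x = \<xi> ^ j * k j x" for \<xi> j x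
  by (simp add: k_def power_mult_distrib)
 define u where "u m \<xi> = (H2_norm J (\<lambda>x. \<Sum>j<m. \<xi> ^ j * k j x))^2" for m \<xi>
 define L where "L \<xi> = (H2_norm J (slice n F (of_real r * \<xi>)))^2" for \<xi>
 have in_disc: "cmod (of_real r * \<xi>) = r" if "\<xi> \<in> sphere 0 1" for \<xi> using that r by (simp add: norm_mult)
 have um: "u m \<in> borel_measurable circle_measure" for m
  unfolding u_def[abs_def] by (rule borel_measurable_integrable[OF circle_poly_norm_integrable[OF k]])
 have lim: "(\<lambda>m. u m \<xi>) \<longlonglongrightarrow> L \<xi>" if x: "\<xi> \<in> sphere 0 1" for \<xi>
 proof -
  have w: "cmod (of_real r * \<xi>) < 1" using in_disc[OF x] r by simp
  have "(\<lambda>m. H2_norm J (\<lambda>x. \<Sum>j<m. (of_real r * \<xi>) ^ j * sl F j x)) \<longlonglongrightarrow> H2_norm J (slice n F (of_real r * \<xi>))"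
   by (rule K.tends_nm[OF slice_tends[OF F w] _ slice_H2[OF F w]]) (intro K.sum_mem K.scale_mem sl_H2 F)
  then show ?thesis unfolding u_def L_def pw by (rule tendsto_power)
 qed
 have bd: "u m \<xi> \<le> (H2_norm I F / (1 - r))^2" if x: "\<xi> \<in> sphere 0 1" for m \<xi>
 proof -
  have w: "cmod (of_real r * \<xi>) < 1" using in_disc[OF x] r by simp
  show ?thesis unfolding u_def
   by (rule power_mono[OF _ K.nm_ge0])
     (use slice_norm[OF F w, of m] in_disc[OF x] in \<open>simp add: pw\<close>, intro K.sum_mem K.scale_mem k)
 qed
 show Lm: "(\<lambda>\<xi>. (H2_norm J (slice n F (of_real r * \<xi>)))^2) \<in> borel_measurable circle_measure"
  by (rule borel_measurable_LIMSEQ_real[OF _ um]) (use lim in \<open>simp add: L_def\<close>)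
 have AEl: "AE \<xi> in circle_measure. (\<lambda>m. u m \<xi>) \<longlonglongrightarrow> L \<xi>" by (rule AE_I2) (use lim in simp)
 have AEb: "AE \<xi> in circle_measure. norm (u m \<xi>) \<le> (H2_norm I F / (1 - r))^2" for m
 proof (rule AE_I2)
  fix \<xi> assume "\<xi> \<in> space circle_measure"
  then show "norm (u m \<xi>) \<le> (H2_norm I F / (1 - r))^2" using bd[of \<xi> m] by (simp add: u_def)
 qed
 have "(\<lambda>m. \<integral>\<xi>. u m \<xi> \<partial>circle_measure) \<longlonglongrightarrow> (\<integral>\<xi>. L \<xi> \<partial>circle_measure)"
  by (rule integral_dominated_convergence[OF Lm[folded L_def] um _ AEl AEb]) simp
 then have "(\<lambda>j. (H2_norm J (k j))^2) sums (\<integral>\<xi>. L \<xi> \<partial>circle_measure)"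
  unfolding sums_def u_def circle_poly_norm[OF k] .
 then show "((\<lambda>j. (H2_norm J (sl F j))^2 * (r^2) ^ j) has_sum
    (\<integral>\<xi>. (H2_norm J (slice n F (of_real r * \<xi>)))^2 \<partial>circle_measure)) UNIV"
  unfolding nk L_def by (rule sums_nonneg_imp_has_sum) auto
qed

lemma slice_norm_tendsto:
 assumes F: "F \<in> H2 I"
 shows "(\<lambda>k. \<integral>\<xi>. (H2_norm J (slice n F (of_real (rad k) * \<xi>)))^2 \<partial>circle_measure) \<longlonglongrightarrow> (H2_norm I F)^2"
proof (rule abel_sum[OF sl_norm_has_sum[OF F] _ slice_norm_integral[OF F rad_bounds]])
 show "(\<lambda>k. (rad k)^2) \<longlonglongrightarrow> 1" using tendsto_power[OF rad_tendsto, of 2] by simp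
 show "(rad k)^2 \<le> 1" for k using rad_bounds[of k] by (intro power_le_one) auto
qed auto

lemma slice_norm_integrable:
 assumes F: "F \<in> H2 I" and r: "0 \<le> r" "r < 1"
 shows "integrable circle_measure (\<lambda>\<xi>. (H2_norm J (slice n F (of_real r * \<xi>)))^2)"
proof (rule circle.integrable_const_bound[OF AE_I2 slice_norm_measurable[OF F r]])
 interpret K: fun_hilbert "H2 J" "H2_inner J" "H2_norm J" by (rule H2_hilbert) simp
 fix \<xi> assume "\<xi> \<in> space circle_measure"
 then have c: "cmod (of_real r * \<xi>) = r" using r by (simp add: norm_mult)
 then have w: "cmod (of_real r * \<xi>) < 1" using r by simp
 have "H2_norm J (slice n F (of_real r * \<xi>)) \<le> H2_norm I F / (1 - r)"
 proof (rule LIMSEQ_le_const2[OF K.tends_nm[OF slice_tends[OF F w] _ slice_H2[OF F w]]])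
  show "(\<lambda>x. \<Sum>j<m. (of_real r * \<xi>) ^ j * sl F j x) \<in> H2 J" for m by (intro K.sum_mem K.scale_mem sl_H2 F)
  show "\<exists>N. \<forall>m\<ge>N. H2_norm J (\<lambda>x. \<Sum>j<m. (of_real r * \<xi>) ^ j * sl F j x) \<le> H2_norm I F / (1 - r)"
   using slice_norm[OF F w] unfolding c by blast
 qed
 then show "norm ((H2_norm J (slice n F (of_real r * \<xi>)))^2) \<le> (H2_norm I F / (1 - r))^2"
  using power_mono[OF _ H2_norm_ge0] by simp
qed

text \<open>Pythagoras in \<open>K\<close> at each point, integrated over circles of radius tending to 1.\<close>
lemma slices_pythagoras:
 assumes F: "F \<in> H2 I" and G: "G \<in> H2 I"
  and orth: "\<And>w. cmod w < 1 ==> H2_inner J (slice n F w) (slice n G w) = 0"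
 shows "(H2_norm I (\<lambda>z. F z + G z))^2 = (H2_norm I F)^2 + (H2_norm I G)^2"
proof -
 interpret K: fun_hilbert "H2 J" "H2_inner J" "H2_norm J" by (rule H2_hilbert) simp
 have FG: "(\<lambda>z. F z + G z) \<in> H2 I" by (rule H2_add[OF _ F G]) simp
 have eq: "(H2_norm J (slice n (\<lambda>z. F z + G z) (of_real (rad k) * \<xi>)))^2
   = (H2_norm J (slice n F (of_real (rad k) * \<xi>)))^2 + (H2_norm J (slice n G (of_real (rad k) * \<xi>)))^2"
  if "\<xi> \<in> space circle_measure" for k \<xi>
 proof -
  have w: "cmod (of_real (rad k) * \<xi>) < 1" using that rad_bounds[of k] by (simp add: norm_mult)
  have "slice n (\<lambda>z. F z + G z) (of_real (rad k) * \<xi>) = (\<lambda>x. slice n F (of_real (rad k) * \<xi>) x + slice n G (of_real (rad k) * \<xi>) x)"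
   by (auto simp: slice_def)
  then show ?thesis using K.pythagoras[OF slice_H2[OF F w] slice_H2[OF G w] orth[OF w]] by simp
 qed
 have "(\<integral>\<xi>. (H2_norm J (slice n (\<lambda>z. F z + G z) (of_real (rad k) * \<xi>)))^2 \<partial>circle_measure)
   = (\<integral>\<xi>. (H2_norm J (slice n F (of_real (rad k) * \<xi>)))^2 \<partial>circle_measure)
   + (\<integral>\<xi>. (H2_norm J (slice n G (of_real (rad k) * \<xi>)))^2 \<partial>circle_measure)" for k
  unfolding Bochner_Integration.integral_add[OF slice_norm_integrable[OF F rad_bounds] slice_norm_integrable[OF G rad_bounds], symmetric]
  by (rule Bochner_Integration.integral_cong[OF refl eq])
 then show ?thesis
  using LIMSEQ_unique[OF slice_norm_tendsto[OF FG]] tendsto_add[OF slice_norm_tendsto[OF F] slice_norm_tendsto[OF G]] by simp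
qed

lemma slice_add:
 "slice n (\<lambda>z. F z + G z) w = (\<lambda>x. slice n F w x + slice n G w x)"
 by (auto simp: slice_def)

lemma slice_mult1: "slice n (\<lambda>z. \<phi> (z 1) * F z) w = (\<lambda>x. \<phi> w * slice n F w x)"
 by (auto simp: slice_def)

text \<open>Reduces every identity between lifted operators to an identity between operators on \<open>H2 J\<close>.\<close>
lemma slices_eqI:
 assumes "F \<in> H2 I" "G \<in> H2 I" "\<And>w. cmod w < 1 ==> slice n F w = slice n G w"
 shows "F = G"
proof (rule slice_eqI[OF assms(2)])
 show "F z = 0" if "z \<notin> polydisc I" for z using H2_off[OF assms(1) that] .
 show "F z = slice n G (z 1) (restrict z J)" if "z \<in> polydisc I" for z
  using eval_slice[OF assms(1) that] assms(3)[of "z 1"] point_split[of z] that by simp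
qed

definition trunc :: "func \<Rightarrow> nat \<Rightarrow> func" where
 "trunc F m = unsl (\<lambda>j. if j < m then sl F j else (\<lambda>x. 0))"

lemma
 assumes F: "F \<in> H2 I"
 shows trunc_H2: "trunc F m \<in> H2 I" and sl_trunc: "sl (trunc F m) j = (if j < m then sl F j else (\<lambda>x. 0))"
  and trunc_slice: "cmod w < 1 ==> slice n (trunc F m) w = (\<lambda>x. \<Sum>j<m. w ^ j * sl F j x)"
  and trunc_norm: "(H2_norm I (trunc F m))^2 = (\<Sum>j<m. (H2_norm J (sl F j))^2)"
  and trunc_tends: "H2_tends I (trunc F) F"
proof -
 interpret H: fun_hilbert "H2 I" "H2_inner I" "H2_norm I" by (rule H2_hilbert) simp
 interpret K: fun_hilbert "H2 J" "H2_inner J" "H2_norm J" by (rule H2_hilbert) simp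
 define g where "g m j = (if j < m then sl F j else (\<lambda>x. 0))" for m j
 have gX: "g m j \<in> H2 J" for m j using sl_H2[OF F] by (simp add: g_def)
 have hs: "((\<lambda>j. (H2_norm J (g m j))^2) has_sum (\<Sum>j<m. (H2_norm J (sl F j))^2)) UNIV" for m
  by (rule has_sum_finite_neutralI[where B="{..<m}"]) (auto simp: g_def)
 note s = has_sum_imp_summable[OF hs]
 have tr: "trunc F m = unsl (g m)" for m by (simp add: trunc_def g_def[abs_def])
 show X: "trunc F m \<in> H2 I" for m unfolding tr by (rule unsl_H2[OF gX s])
 show st: "sl (trunc F m) j = (if j < m then sl F j else (\<lambda>x. 0))" for m j
  unfolding tr sl_unsl[OF gX s] g_def ..
 show "slice n (trunc F m) w = (\<lambda>x. \<Sum>j<m. w ^ j * sl F j x)" if w: "cmod w < 1" for m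
 proof
  fix x show "slice n (trunc F m) w x = (\<Sum>j<m. w ^ j * sl F j x)"
  proof (cases "x \<in> polydisc J")
   case True
   have "((\<lambda>j. w ^ j * sl (trunc F m) j x) has_sum (\<Sum>j<m. w ^ j * sl F j x)) UNIV"
    unfolding st by (rule has_sum_finite_neutralI[where B="{..<m}"]) auto
   then show ?thesis by (rule has_sum_unique[OF slice_eval[OF X w True]])
  qed (simp add: slice_def H2_off[OF sl_H2[OF F]])
 qed
 show "(H2_norm I (trunc F m))^2 = (\<Sum>j<m. (H2_norm J (sl F j))^2)" for m
  using has_sum_unique[OF sl_norm_has_sum[OF X[of m]]] hs[of m] unfolding st g_def by blast
 have "(\<lambda>m. (H2_norm I (\<lambda>z. trunc F m z - F z))^2) \<longlonglongrightarrow> 0"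
 proof -
  have sd: "sl (\<lambda>z. trunc F m z - F z) j = (if j < m then (\<lambda>x. 0) else (\<lambda>x. - sl F j x))" for m j
  proof (rule H2_eqI[OF _ sl_H2[OF H.diff_mem[OF X F]]])
   show "(if j < m then (\<lambda>x. 0) else (\<lambda>x. - sl F j x)) \<in> H2 J"
    using K.uminus_mem[OF sl_H2[OF F]] by simp
   fix \<beta> assume b: "\<beta> \<in> multi_indices J"
   have "coeffs J (sl (\<lambda>z. trunc F m z - F z) j) \<beta> = coeffs J (sl (trunc F m) j) \<beta> - coeffs J (sl F j) \<beta>"
    unfolding coeffs_sl[OF H.diff_mem[OF X F] b] coeffs_sl[OF X b] coeffs_sl[OF F b]
    by (rule coeffs_diff[OF _ X F index_join[OF b]]) simp
   also have "\<dots> = coeffs J (if j < m then (\<lambda>x. 0) else (\<lambda>x. - sl F j x)) \<beta>"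
    unfolding st using coeffs_zero[OF _ b] coeffs_scale[OF _ sl_H2[OF F] b, of "-1"] by simp
   finally show "coeffs J (sl (\<lambda>z. trunc F m z - F z) j) \<beta> = coeffs J (if j < m then (\<lambda>x. 0) else (\<lambda>x. - sl F j x)) \<beta>" .
  qed simp
  have "((\<lambda>j. (H2_norm J (sl F j))^2) has_sum (\<Sum>j<m. (H2_norm J (sl F j))^2) + (H2_norm I (\<lambda>z. trunc F m z - F z))^2) UNIV" for m
  proof -
   have "((\<lambda>j. (H2_norm J (g m j))^2 + (H2_norm J (sl (\<lambda>z. trunc F m z - F z) j))^2) has_sum
     (\<Sum>j<m. (H2_norm J (sl F j))^2) + (H2_norm I (\<lambda>z. trunc F m z - F z))^2) UNIV"
    by (rule has_sum_add[OF hs sl_norm_has_sum[OF H.diff_mem[OF X F]]])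
   moreover have "(H2_norm J (g m j))^2 + (H2_norm J (sl (\<lambda>z. trunc F m z - F z) j))^2 = (H2_norm J (sl F j))^2" for j
    unfolding sd g_def using K.nm_uminus[OF sl_H2[OF F]] by simp
   ultimately show ?thesis by simp
  qed
  then have "(\<Sum>j<m. (H2_norm J (sl F j))^2) + (H2_norm I (\<lambda>z. trunc F m z - F z))^2 = (H2_norm I F)^2" for m
   using has_sum_unique[OF sl_norm_has_sum[OF F]] by metis
  then have "(\<lambda>m. (H2_norm I (\<lambda>z. trunc F m z - F z))^2) = (\<lambda>m. (H2_norm I F)^2 - (\<Sum>j<m. (H2_norm J (sl F j))^2))"
   by (simp add: fun_eq_iff algebra_simps)
  moreover have "(\<lambda>m. \<Sum>j<m. (H2_norm J (sl F j))^2) \<longlonglongrightarrow> (H2_norm I F)^2"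
   using has_sum_imp_sums[OF sl_norm_has_sum[OF F]] unfolding sums_def .
  ultimately show ?thesis using tendsto_diff[OF tendsto_const[of "(H2_norm I F)^2"]] by fastforce
 qed
 from tendsto_real_sqrt[OF this] show "H2_tends I (trunc F) F"
  unfolding H.tends_def by (simp add: H2_norm_ge0)
qed

end

section \<open>Multiplication by an operator inner function\<close>

locale inner_multiplier = polydisc_split +
 fixes \<Theta> :: "complex \<Rightarrow> oper"
 assumes inner: "operator_inner {2..n} \<Theta>"
  and range_H2: "F \<in> H2 {1..n} ==> op_mult n \<Theta> F \<in> H2 {1..n}"
begin

lemma \<Theta>_op: "cmod w < 1 ==> \<Theta> w \<in> bounded_ops J"
 using inner unfolding operator_inner_def Hinf_op_def by simp

lemma \<Theta>_bound: "\<exists>C\<ge>0. \<forall>w k. cmod w < 1 \<longrightarrow> k \<in> H2 J \<longrightarrow> H2_norm J (\<Theta> w k) \<le> C * H2_norm J k"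
proof -
 interpret K: fun_hilbert "H2 J" "H2_inner J" "H2_norm J" by (rule H2_hilbert) simp
 obtain C where C: "\<And>w. w \<in> ball 0 1 ==> op_norm J (\<Theta> w) \<le> C"
  using inner unfolding operator_inner_def Hinf_op_def by blast
 have "H2_norm J (\<Theta> w k) \<le> max C 0 * H2_norm J k" if w: "cmod w < 1" and k: "k \<in> H2 J" for w k
 proof (cases "H2_norm J k = 0")
  case True
  then have "k = (\<lambda>x. 0)" by (rule K.nm_definite[OF k])
  then show ?thesis using bounded_op_scale[OF \<Theta>_op[OF w] K.zero_mem, of 0] True by simp
 next
  case False
  then have pos: "H2_norm J k > 0" using H2_norm_ge0[of J k] by linarith
  obtain D where D: "D \<ge> 0" "\<forall>f\<in>H2 J. H2_norm J (\<Theta> w f) \<le> D * H2_norm J f" using bounded_op_bound[OF \<Theta>_op[OF w]] by blast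
  define a where "a = complex_of_real (1 / H2_norm J k)"
  have "H2_norm J (\<Theta> w (\<lambda>x. a * k x)) \<le> op_norm J (\<Theta> w)"
   unfolding op_norm_def
  proof (rule cSUP_upper)
   show "(\<lambda>x. a * k x) \<in> {f \<in> H2 J. H2_norm J f \<le> 1}"
   proof (rule CollectI, rule conjI[OF K.scale_mem[OF k]])
    show "H2_norm J (\<lambda>x. a * k x) \<le> 1" unfolding K.nm_scale[OF k] using pos by (simp add: a_def norm_divide)
   qed
   have "H2_norm J (\<Theta> w f) \<le> D" if "f \<in> H2 J" "H2_norm J f \<le> 1" for f
    using D(2)[rule_format, OF that(1)] mult_left_mono[OF that(2) D(1)] by simp
   then show "bdd_above ((\<lambda>f. H2_norm J (\<Theta> w f)) ` {f \<in> H2 J. H2_norm J f \<le> 1})"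
    by (intro bdd_aboveI[of _ D]) auto
  qed
  also have "\<dots> \<le> max C 0" using C[of w] w by simp
  finally have "cmod a * H2_norm J (\<Theta> w k) \<le> max C 0"
   unfolding bounded_op_scale[OF \<Theta>_op[OF w] k] K.nm_scale[OF bounded_op_mem[OF \<Theta>_op[OF w] k]] .
  then show ?thesis using pos by (simp add: a_def norm_divide field_simps)
 qed
 then show ?thesis by (intro exI[of _ "max C 0"]) auto
qed

lemma slice_op_mult: "cmod w < 1 ==> F \<in> H2 I ==> slice n (op_mult n \<Theta> F) w = \<Theta> w (slice n F w)"
proof
 fix x assume w: "cmod w < 1" and F: "F \<in> H2 I"
 show "slice n (op_mult n \<Theta> F) w x = \<Theta> w (slice n F w) x"
 proof (cases "x \<in> polydisc J")
  case True
  have "slice n (op_mult n \<Theta> F) w x = \<Theta> w (slice n F w) (restrict (x(1 := w)) J)"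
   unfolding slice_def[of n "op_mult n \<Theta> F"] unfolding op_mult_def using True point_join[OF True w]
   by (simp only: if_True fun_upd_same)
  then show ?thesis unfolding restrict_join[OF True] .
 next
  case False
  then show ?thesis using H2_off[OF bounded_op_mem[OF \<Theta>_op[OF w] slice_H2[OF F w]] False] by (simp add: slice_def)
 qed
qed

lemma op_mult_add:
 assumes F: "F \<in> H2 I" and G: "G \<in> H2 I"
 shows "op_mult n \<Theta> (\<lambda>z. F z + G z) = (\<lambda>z. op_mult n \<Theta> F z + op_mult n \<Theta> G z)"
proof (rule slices_eqI)
 show FG: "op_mult n \<Theta> (\<lambda>z. F z + G z) \<in> H2 I" by (rule range_H2[OF H2_add[OF _ F G]]) simp
 show "(\<lambda>z. op_mult n \<Theta> F z + op_mult n \<Theta> G z) \<in> H2 I" by (rule H2_add[OF _ range_H2[OF F] range_H2[OF G]]) simp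
 show "slice n (op_mult n \<Theta> (\<lambda>z. F z + G z)) w = slice n (\<lambda>z. op_mult n \<Theta> F z + op_mult n \<Theta> G z) w" if w: "cmod w < 1" for w
 proof -
  have X: "(\<lambda>z. F z + G z) \<in> H2 I" by (rule H2_add[OF _ F G]) simp
  show ?thesis
   unfolding slice_add slice_op_mult[OF w F] slice_op_mult[OF w G] slice_op_mult[OF w X]
   by (rule bounded_op_add[OF \<Theta>_op[OF w] slice_H2[OF F w] slice_H2[OF G w]])
 qed
qed

lemma op_mult_function_of_z1:
 assumes F: "F \<in> H2 I" and \<phi>F: "(\<lambda>z. \<phi> (z 1) * F z) \<in> H2 I" "(\<lambda>z. \<phi> (z 1) * op_mult n \<Theta> F z) \<in> H2 I"
 shows "op_mult n \<Theta> (\<lambda>z. \<phi> (z 1) * F z) = (\<lambda>z. \<phi> (z 1) * op_mult n \<Theta> F z)"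
proof (rule slices_eqI[OF range_H2[OF \<phi>F(1)] \<phi>F(2)])
 fix w :: complex assume w: "cmod w < 1"
 show "slice n (op_mult n \<Theta> (\<lambda>z. \<phi> (z 1) * F z)) w = slice n (\<lambda>z. \<phi> (z 1) * op_mult n \<Theta> F z) w"
  unfolding slice_mult1 slice_op_mult[OF w F] slice_op_mult[OF w \<phi>F(1)]
  by (rule bounded_op_scale[OF \<Theta>_op[OF w] slice_H2[OF F w]])
qed

lemma op_mult_scale:
 assumes F: "F \<in> H2 I" shows "op_mult n \<Theta> (\<lambda>z. a * F z) = (\<lambda>z. a * op_mult n \<Theta> F z)"
 by (rule op_mult_function_of_z1[OF F]) (auto intro!: H2_scale F range_H2)

lemma op_mult_z1:
 assumes F: "F \<in> H2 I" shows "op_mult n \<Theta> (\<lambda>z. z 1 * F z) = (\<lambda>z. z 1 * op_mult n \<Theta> F z)"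
 by (rule op_mult_function_of_z1[OF F]) (auto intro!: shift_H2[OF _ one_in] F range_H2)

lemma boundary_isometry:
 "AE \<xi> in circle_measure. \<exists>T. has_boundary_value J \<Theta> \<xi> T \<and> (\<forall>k\<in>H2 J. H2_norm J (T k) = H2_norm J k)"
proof -
 interpret K: fun_hilbert "H2 J" "H2_inner J" "H2_norm J" by (rule H2_hilbert) simp
 have iso: "H2_norm J (T k) = H2_norm J k"
  if b: "has_boundary_value J \<Theta> \<xi> T" and S: "S \<in> bounded_ops J" "is_adjoint J T S" "\<forall>f\<in>H2 J. S (T f) = f" and k: "k \<in> H2 J" for \<xi> T S k
 proof -
  have T: "T \<in> bounded_ops J" using b unfolding has_boundary_value_def by (rule conjunct1)
  have "H2_inner J (T k) (T k) = H2_inner J k (S (T k))"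
   using S(2) bounded_op_mem[OF T k] k unfolding is_adjoint_def by (elim ballE) auto
  also have "S (T k) = k" using S(3) k by (rule bspec)
  finally have "complex_of_real ((H2_norm J (T k))^2) = of_real ((H2_norm J k)^2)"
   unfolding K.ip_nm[OF bounded_op_mem[OF T k]] K.ip_nm[OF k] .
  then have "(H2_norm J (T k))^2 = (H2_norm J k)^2" by (simp only: of_real_eq_iff)
  then show ?thesis by (rule power2_eq_imp_eq[OF _ H2_norm_ge0 H2_norm_ge0])
 qed
 have "AE \<xi> in circle_measure. \<exists>T. has_boundary_value J \<Theta> \<xi> T \<and> (\<exists>S\<in>bounded_ops J. is_adjoint J T S \<and> (\<forall>f\<in>H2 J. S (T f) = f))"
  using inner unfolding operator_inner_def by (rule conjunct2)
 then show ?thesis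
 proof (eventually_elim)
  case (elim \<xi>)
  then obtain T S where TS: "has_boundary_value J \<Theta> \<xi> T" "S \<in> bounded_ops J" "is_adjoint J T S" "\<forall>f\<in>H2 J. S (T f) = f"
   by blast
  show ?case
  proof (rule exI[of _ T], rule conjI[OF TS(1)], rule ballI)
   fix k assume "k \<in> H2 J"
   with TS show "H2_norm J (T k) = H2_norm J k" by (rule iso[where \<xi>=\<xi> and T=T and S=S and k=k])
  qed
 qed
qed

text \<open>For a polynomial in \<open>z\<^sub>1\<close> the slices of its image converge along almost every radius to an isometric image of the value on the circle, and they stay bounded; integrate over the circle.\<close>
lemma op_mult_trunc_norm:
 assumes F: "F \<in> H2 I" shows "H2_norm I (op_mult n \<Theta> (trunc F m)) = H2_norm I (trunc F m)"
proof -
 interpret K: fun_hilbert "H2 J" "H2_inner J" "H2_norm J" by (rule H2_hilbert) simp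
 obtain C where C: "C \<ge> 0" "\<And>w k. cmod w < 1 ==> k \<in> H2 J ==> H2_norm J (\<Theta> w k) \<le> C * H2_norm J k" using \<Theta>_bound by blast
 define p where "p w = (\<lambda>x. \<Sum>j<m. w ^ j * sl F j x)" for w
 have pX: "p w \<in> H2 J" for w unfolding p_def by (intro K.sum_mem K.scale_mem sl_H2 F)
 define G where "G = op_mult n \<Theta> (trunc F m)"
 have G: "G \<in> H2 I" unfolding G_def by (rule range_H2[OF trunc_H2[OF F]])
 have sG: "slice n G w = \<Theta> w (p w)" if w: "cmod w < 1" for w
  unfolding G_def slice_op_mult[OF w trunc_H2[OF F]] trunc_slice[OF F w] p_def ..
 define B where "B = (\<Sum>j<m. H2_norm J (sl F j))"
 have pB: "H2_norm J (p w) \<le> B" if "cmod w \<le> 1" for w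
 proof -
  have "H2_norm J (p w) \<le> (\<Sum>j<m. H2_norm J (\<lambda>x. w ^ j * sl F j x))"
   unfolding p_def by (rule K.nm_sum) (intro K.scale_mem sl_H2 F)
  also have "\<dots> \<le> B" unfolding B_def
  proof (rule sum_mono)
   fix j
   have "cmod w ^ j \<le> 1" using that by (intro power_le_one) auto
   then show "H2_norm J (\<lambda>x. w ^ j * sl F j x) \<le> H2_norm J (sl F j)"
    unfolding K.nm_scale[OF sl_H2[OF F]] norm_power
    using mult_right_mono[of "cmod w ^ j" 1 "H2_norm J (sl F j)"] H2_norm_ge0[of J] by simp
  qed
  finally show ?thesis .
 qed
 have disc: "cmod (of_real (rad k) * \<xi>) < 1" if "\<xi> \<in> space circle_measure" for k \<xi>
  using that rad_bounds[of k] by (simp add: norm_mult)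
 have lim: "AE \<xi> in circle_measure. (\<lambda>k. (H2_norm J (slice n G (of_real (rad k) * \<xi>)))^2) \<longlonglongrightarrow> (H2_norm J (p \<xi>))^2"
  using boundary_isometry AE_space
 proof eventually_elim
  case (elim \<xi>)
  from elim(1) obtain T where T: "has_boundary_value J \<Theta> \<xi> T" "\<forall>k\<in>H2 J. H2_norm J (T k) = H2_norm J k"
   by (elim exE conjE) (rule that)
  note b = T(1)[unfolded has_boundary_value_def]
  have Tb: "T \<in> bounded_ops J" by (rule b[THEN conjunct1])
  have Tl: "((\<lambda>r. H2_dist J (\<Theta> (of_real r * \<xi>) f) (T f)) \<longlongrightarrow> 0) (at_left 1)" if "f \<in> H2 J" for f
   using b[THEN conjunct2] that by (rule bspec)
  define v where "v k = \<Theta> (of_real (rad k) * \<xi>) (p (of_real (rad k) * \<xi>))" for k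
  have vX: "v k \<in> H2 J" for k unfolding v_def by (rule bounded_op_mem[OF \<Theta>_op[OF disc[OF elim(2)]] pX])
  have t1: "H2_tends J (\<lambda>k. \<Theta> (of_real (rad k) * \<xi>) (p \<xi>)) (T (p \<xi>))"
   unfolding K.tends_def using filterlim_compose[OF Tl[OF pX] rad_at_left] unfolding H2_dist_def .
  have t2: "(\<lambda>k. \<Sum>j<m. cmod ((of_real (rad k) * \<xi>) ^ j - \<xi> ^ j) * H2_norm J (sl F j)) \<longlonglongrightarrow> 0"
  proof -
   have "(\<lambda>k. (of_real (rad k) * \<xi>) ^ j) \<longlonglongrightarrow> (of_real 1 * \<xi>) ^ j" for j
    by (intro tendsto_intros rad_tendsto)
   then have "(\<lambda>k. cmod ((of_real (rad k) * \<xi>) ^ j - \<xi> ^ j)) \<longlonglongrightarrow> 0" for j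
    by (intro tendsto_norm_zero LIM_zero) simp
   then show ?thesis by (intro tendsto_null_sum tendsto_mult_left_zero)
  qed
  have d: "H2_norm J (\<lambda>x. p (of_real (rad k) * \<xi>) x - p \<xi> x) \<le> (\<Sum>j<m. cmod ((of_real (rad k) * \<xi>) ^ j - \<xi> ^ j) * H2_norm J (sl F j))" for k
  proof -
   have "(\<lambda>x. p (of_real (rad k) * \<xi>) x - p \<xi> x) = (\<lambda>x. \<Sum>j<m. ((of_real (rad k) * \<xi>) ^ j - \<xi> ^ j) * sl F j x)"
    by (simp add: p_def sum_subtractf left_diff_distrib)
   then show ?thesis using K.nm_sum[of "{..<m}" "\<lambda>j x. ((of_real (rad k) * \<xi>) ^ j - \<xi> ^ j) * sl F j x"] K.scale_mem[OF sl_H2[OF F]]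
    by (simp add: K.nm_scale[OF sl_H2[OF F]])
  qed
  have "H2_tends J v (T (p \<xi>))"
   unfolding K.tends_def
  proof (rule Lim_null_comparison[OF _ tendsto_add_zero[OF tendsto_mult_right_zero[OF t2, of C] t1[unfolded K.tends_def]]], rule always_eventually, rule allI)
   fix k
   note op = \<Theta>_op[OF disc[OF elim(2), of k]]
   have "H2_norm J (\<lambda>x. v k x - T (p \<xi>) x) \<le> H2_norm J (\<lambda>x. v k x - \<Theta> (of_real (rad k) * \<xi>) (p \<xi>) x)
     + H2_norm J (\<lambda>x. \<Theta> (of_real (rad k) * \<xi>) (p \<xi>) x - T (p \<xi>) x)"
    by (rule K.nm_triangle_diff[OF vX bounded_op_mem[OF op pX] bounded_op_mem[OF Tb pX]])
   moreover have "(\<lambda>x. v k x - \<Theta> (of_real (rad k) * \<xi>) (p \<xi>) x) = \<Theta> (of_real (rad k) * \<xi>) (\<lambda>x. p (of_real (rad k) * \<xi>) x - p \<xi> x)"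
    unfolding v_def by (rule bounded_op_diff[OF _ op pX pX, symmetric]) simp
   moreover have "H2_norm J (\<Theta> (of_real (rad k) * \<xi>) (\<lambda>x. p (of_real (rad k) * \<xi>) x - p \<xi> x))
     \<le> C * (\<Sum>j<m. cmod ((of_real (rad k) * \<xi>) ^ j - \<xi> ^ j) * H2_norm J (sl F j))"
    by (rule order_trans[OF C(2)[OF disc[OF elim(2)] K.diff_mem[OF pX pX]] mult_left_mono[OF d C(1)]])
   ultimately show "norm (H2_norm J (\<lambda>x. v k x - T (p \<xi>) x)) \<le> C * (\<Sum>j<m. cmod ((of_real (rad k) * \<xi>) ^ j - \<xi> ^ j) * H2_norm J (sl F j))
     + H2_norm J (\<lambda>x. \<Theta> (of_real (rad k) * \<xi>) (p \<xi>) x - T (p \<xi>) x)"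
    by (simp add: H2_norm_ge0)
  qed
  from K.tends_nm[OF this vX bounded_op_mem[OF Tb pX]]
  have "(\<lambda>k. H2_norm J (v k)) \<longlonglongrightarrow> H2_norm J (p \<xi>)" using T(2) pX by simp
  then show ?case unfolding sG[OF disc[OF elim(2)]] v_def by (rule tendsto_power)
 qed
 have bound: "AE \<xi> in circle_measure. norm ((H2_norm J (slice n G (of_real (rad k) * \<xi>)))^2) \<le> (C * B)^2" for k
 proof (rule AE_I2)
  fix \<xi> assume x: "\<xi> \<in> space circle_measure"
  have "H2_norm J (slice n G (of_real (rad k) * \<xi>)) \<le> C * B"
   unfolding sG[OF disc[OF x]]
   by (rule order_trans[OF C(2)[OF disc[OF x] pX] mult_left_mono[OF pB C(1)]]) (use disc[OF x, of k] in simp)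
  then show "norm ((H2_norm J (slice n G (of_real (rad k) * \<xi>)))^2) \<le> (C * B)^2"
   using power_mono[OF _ H2_norm_ge0, of J _ "C * B" 2] by simp
 qed
 have mp: "(\<lambda>\<xi>. (H2_norm J (p \<xi>))^2) \<in> borel_measurable circle_measure"
  unfolding p_def by (rule borel_measurable_integrable[OF circle_poly_norm_integrable[OF sl_H2[OF F]]])
 have "(\<lambda>k. \<integral>\<xi>. (H2_norm J (slice n G (of_real (rad k) * \<xi>)))^2 \<partial>circle_measure) \<longlonglongrightarrow> (\<integral>\<xi>. (H2_norm J (p \<xi>))^2 \<partial>circle_measure)"
  by (rule integral_dominated_convergence[OF mp slice_norm_measurable[OF G rad_bounds] _ lim bound]) simp
 from LIMSEQ_unique[OF slice_norm_tendsto[OF G] this]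
 have "(H2_norm I G)^2 = (H2_norm I (trunc F m))^2"
  unfolding trunc_norm[OF F] p_def circle_poly_norm[OF sl_H2[OF F]] .
 then show ?thesis unfolding G_def by (rule power2_eq_imp_eq[OF _ H2_norm_ge0 H2_norm_ge0])
qed

text \<open>The images of the truncations form a Cauchy sequence whose limit is identified slicewise.\<close>
lemma op_mult_norm:
 assumes F: "F \<in> H2 I" shows "H2_norm I (op_mult n \<Theta> F) = H2_norm I F"
proof -
 interpret H: fun_hilbert "H2 I" "H2_inner I" "H2_norm I" by (rule H2_hilbert) simp
 interpret K: fun_hilbert "H2 J" "H2_inner J" "H2_norm J" by (rule H2_hilbert) simp
 note tX = trunc_H2[OF F]
 define v where "v m = op_mult n \<Theta> (trunc F m)" for m
 have vX: "v m \<in> H2 I" for m unfolding v_def by (rule range_H2[OF tX])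
 have dtr: "trunc (\<lambda>z. trunc F a z - trunc F b z) (max a b) = (\<lambda>z. trunc F a z - trunc F b z)" for a b
 proof (rule sl_eqI[OF trunc_H2[OF H.diff_mem[OF tX tX]] H.diff_mem[OF tX tX]])
  fix j
  have z: "sl (\<lambda>z. trunc F a z - trunc F b z) j = (\<lambda>x. 0)" if "\<not> j < max a b"
  proof (rule H2_eqI[OF _ sl_H2[OF H.diff_mem[OF tX tX]] K.zero_mem])
   fix \<beta> assume b: "\<beta> \<in> multi_indices J"
   have "coeffs J (sl (\<lambda>z. trunc F a z - trunc F b z) j) \<beta> = coeffs J (sl (trunc F a) j) \<beta> - coeffs J (sl (trunc F b) j) \<beta>"
    unfolding coeffs_sl[OF H.diff_mem[OF tX tX] b] coeffs_sl[OF tX b]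
    by (rule coeffs_diff[OF _ tX tX index_join[OF b]]) simp
   then show "coeffs J (sl (\<lambda>z. trunc F a z - trunc F b z) j) \<beta> = coeffs J (\<lambda>x. 0) \<beta>"
    using that unfolding sl_trunc[OF F] by (cases "j < a"; cases "j < b") (simp_all add: coeffs_zero b)
  qed simp
  show "sl (trunc (\<lambda>z. trunc F a z - trunc F b z) (max a b)) j = sl (\<lambda>z. trunc F a z - trunc F b z) j"
   unfolding sl_trunc[OF H.diff_mem[OF tX tX]] using z by auto
 qed
 have vd: "H2_norm I (\<lambda>z. v a z - v b z) = H2_norm I (\<lambda>z. trunc F a z - trunc F b z)" for a b
 proof -
  have "(\<lambda>z. v a z - v b z) = op_mult n \<Theta> (\<lambda>z. trunc F a z - trunc F b z)"
   using op_mult_add[OF tX H2_scale[OF _ tX, of "-1"], of a b] op_mult_scale[OF tX, of "-1" b] by (simp add: v_def)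
  then show ?thesis
   using op_mult_trunc_norm[OF H.diff_mem[OF tX tX], of a b "max a b"] unfolding dtr by simp
 qed
 have "H.cauchy v"
  using H.tends_cauchy[OF trunc_tends[OF F] tX F] unfolding H.cauchy_def vd .
 then obtain G where G: "G \<in> H2 I" "H2_tends I v G" using H.complete[of v] vX by blast
 have "op_mult n \<Theta> F = G"
 proof
  fix z show "op_mult n \<Theta> F z = G z"
  proof (cases "z \<in> polydisc I")
   case True
   then have w: "cmod (z 1) < 1" using point_split by blast
   have "H2_tends J (\<lambda>m. \<Theta> (z 1) (slice n (trunc F m) (z 1))) (\<Theta> (z 1) (slice n F (z 1)))"
    by (rule bounded_op_tends[OF _ \<Theta>_op[OF w] _ slice_H2[OF tX w] slice_H2[OF F w]])
      (use slice_tends[OF F w] in \<open>simp_all add: trunc_slice[OF F w]\<close>)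
   then have "(\<lambda>m. \<Theta> (z 1) (slice n (trunc F m) (z 1)) (restrict z J)) \<longlonglongrightarrow> \<Theta> (z 1) (slice n F (z 1)) (restrict z J)"
    by (rule tends_pointwise[rotated]) (auto intro!: bounded_op_mem[OF \<Theta>_op[OF w]] slice_H2 tX F w)
   then have "(\<lambda>m. v m z) \<longlonglongrightarrow> op_mult n \<Theta> F z" unfolding v_def op_mult_def using True by simp
   then show ?thesis by (rule LIMSEQ_unique[OF _ tends_pointwise[OF _ G(2) vX G(1)]]) simp
  qed (simp add: op_mult_def H2_off[OF G(1)])
 qed
 moreover have "(\<lambda>m. H2_norm I (v m)) \<longlonglongrightarrow> H2_norm I F"
  unfolding v_def op_mult_trunc_norm[OF F] by (rule H.tends_nm[OF trunc_tends[OF F] tX F])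
 ultimately show ?thesis using LIMSEQ_unique[OF H.tends_nm[OF G(2) vX G(1)]] by simp
qed

end

section \<open>Inner-outer factorisation on the disc\<close>

context fun_prehilbert
begin

text \<open>Applied to \<open>z^j q\<close> this makes an inner function an isometric multiplier on polynomials.\<close>
lemma orthonormal_norm:
 assumes "finite A" "\<And>a. a \<in> A ==> e a \<in> X" "\<And>a b. a \<in> A ==> b \<in> A ==> ip (e a) (e b) = (if a = b then 1 else 0)"
 shows "(nm (\<lambda>x. \<Sum>a\<in>A. c a * e a x))^2 = (\<Sum>a\<in>A. (cmod (c a))^2)"
 using assms
proof (induction A rule: finite_induct)
 case empty
 then show ?case using nm_zero by simp
next
 case (insert a A)
 note on = insert.prems(2)
 have eX: "e b \<in> X" if "b \<in> insert a A" for b by (rule insert.prems(1)[OF that])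
 have sX: "(\<lambda>x. \<Sum>b\<in>B. c b * e b x) \<in> X" if "B \<subseteq> insert a A" for B
  by (rule sum_mem, rule scale_mem, rule eX) (use that in blast)
 have z: "ip (\<lambda>x. \<Sum>b\<in>B. c b * e b x) (e a) = 0" if "finite B" "B \<subseteq> A" for B
  using that
 proof (induction B rule: finite_induct)
  case empty
  then show ?case using ip_zero(1)[OF eX[of a]] by simp
 next
  case (insert b B)
  have ba: "ip (e b) (e a) = 0" using on[of b a] insert.prems \<open>a \<notin> A\<close> by auto
  show ?case
   using ip_add[OF scale_mem[OF eX[of b]] sX[of B] eX[of a], of "c b"] ip_scale[OF eX[of b] eX[of a], of "c b"] ba insert by auto
 qed
 have "ip (\<lambda>x. c a * e a x) (\<lambda>x. \<Sum>b\<in>A. c b * e b x) = 0"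
  unfolding ip_scale[OF eX[OF insertI1] sX[OF subset_insertI]]
  using ip_eq_0_sym[OF sX[OF subset_insertI] eX[OF insertI1] z[OF insert.hyps(1) subset_refl]] by simp
 from pythagoras[OF scale_mem[OF eX[OF insertI1]] sX[OF subset_insertI] this]
 have "(nm (\<lambda>x. c a * e a x + (\<Sum>b\<in>A. c b * e b x)))^2 = (cmod (c a) * nm (e a))^2 + (\<Sum>b\<in>A. (cmod (c b))^2)"
  using insert.IH insert.prems unfolding nm_scale[OF eX[OF insertI1]] by simp
 moreover have "(nm (e a))^2 = 1"
 proof -
  have "complex_of_real ((nm (e a))^2) = 1" using ip_nm[OF eX[of a]] insert.prems(2)[of a a] by simp
  then show ?thesis by (simp only: of_real_eq_1_iff)
 qed
 ultimately show ?case using insert.hyps by (simp add: power_mult_distrib)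
qed

end

lemma shift_divide:
 assumes I: "finite I" and i: "i \<in> I" and h: "h \<in> H2 I"
  and z: "\<And>\<alpha>. \<alpha> \<in> multi_indices I ==> \<alpha> i = 0 ==> coeffs I h \<alpha> = 0"
 shows "\<exists>g\<in>H2 I. h = (\<lambda>x. x i * g x)"
proof -
 define d where "d \<alpha> = coeffs I h (up i \<alpha>)" for \<alpha>
 have "((\<lambda>\<alpha>. (cmod (d \<alpha>))^2) has_sum (H2_norm I h)^2) (multi_indices I)"
  unfolding d_def by (rule iffD1[OF has_sum_up[OF i] H2_norm_has_sum[OF I h]]) (simp add: z)
 then have sq: "sq_summable I d" unfolding sq_summable_def by (rule has_sum_imp_summable)
 note gX = of_coeffs_H2[OF I sq]
 have "h = (\<lambda>x. x i * of_coeffs I d x)"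
 proof (rule H2_eqI[OF I h shift_H2[OF I i gX]])
  fix \<alpha> assume a: "\<alpha> \<in> multi_indices I"
  show "coeffs I h \<alpha> = coeffs I (\<lambda>x. x i * of_coeffs I d x) \<alpha>"
  proof (cases "\<alpha> i")
   case 0 then show ?thesis using z[OF a] coeffs_shift_0[OF I i gX a] by simp
  next
   case (Suc k)
   define \<beta> where "\<beta> = \<alpha>(i := k)"
   have b: "\<beta> \<in> multi_indices I" using a i by (auto simp: \<beta>_def multi_indices_def PiE_iff extensional_def)
   have up: "up i \<beta> = \<alpha>" using Suc by (auto simp: \<beta>_def up_def)
   show ?thesis using coeffs_shift_up[OF I i gX b] unfolding coeffs_of_coeffs[OF I sq b] up d_def by simp
  qed
 qed
 then show ?thesis using gX by (rule bexI)
qed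

lemma disc_mult_lower:
 assumes I: "finite I" and i: "i \<in> I" and q: "q \<in> Hinf_disc" and \<delta>: "0 \<le> \<delta>"
  and low: "AE \<xi> in circle_measure. \<delta> \<le> cmod (radial_disc q \<xi>)" and h: "h \<in> H2 I"
 shows "\<delta> * H2_norm I h \<le> H2_norm I (\<lambda>z. q (z i) * h z)"
 by (rule boundary_lower_imp_mult_lower[OF I Hinf_disc_polydisc[OF I i q] _ \<delta> h])
   (unfold radial_polydisc_disc[OF i], rule circle_AE_component[OF i low])

lemma disc_mult:
 assumes I: "finite I" and i: "i \<in> I" and q: "q \<in> Hinf_disc" and B: "\<And>w. cmod w < 1 ==> cmod (q w) \<le> B" and h: "h \<in> H2 I"
 shows "(\<lambda>z. q (z i) * h z) \<in> H2 I" "H2_norm I (\<lambda>z. q (z i) * h z) \<le> B * H2_norm I h"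
proof -
 have "cmod (q (z i)) \<le> B" if "z \<in> polydisc I" for z using that i by (intro B) (auto simp: polydisc_def PiE_iff)
 moreover have "0 \<le> B" by (rule order_trans[OF norm_ge_zero B[of 0]]) simp
 ultimately show "(\<lambda>z. q (z i) * h z) \<in> H2 I" "H2_norm I (\<lambda>z. q (z i) * h z) \<le> B * H2_norm I h"
  using bounded_mult_H2[OF I Hinf_disc_polydisc(1)[OF I i q] _ _ h] bounded_mult_norm[OF I Hinf_disc_polydisc(1)[OF I i q] _ _ h] by blast+
qed

lemma Hinf_disc_bound: "q \<in> Hinf_disc ==> \<exists>B\<ge>0. \<forall>w. cmod w < 1 \<longrightarrow> cmod (q w) \<le> B"
proof -
 assume "q \<in> Hinf_disc"
 then obtain B where "\<forall>x\<in>q ` ball 0 1. cmod x \<le> B" "B > 0" unfolding Hinf_disc_def bounded_pos by blast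
 then show ?thesis by (intro exI[of _ B]) auto
qed

text \<open>The passage from the one-dimensional polydisc, whose points are functions on \<open>{i}\<close>, to the disc.\<close>
lemma H2_disc_Hinf:
 assumes f: "f \<in> H2 {i}" and B: "\<forall>x\<in>polydisc {i}. cmod (f x) \<le> B"
 shows "(\<lambda>w. f (\<lambda>j\<in>{i}. w)) \<in> Hinf_disc" "x \<in> polydisc {i} ==> f (\<lambda>j\<in>{i}. x i) = f x"
  "cmod w < 1 ==> cmod (f (\<lambda>j\<in>{i}. w)) \<le> B"
proof -
 show b: "cmod (f (\<lambda>j\<in>{i}. w)) \<le> B" if "cmod w < 1" for w
  by (rule B[rule_format]) (use that in \<open>auto simp: polydisc_def\<close>)
 show "(\<lambda>w. f (\<lambda>j\<in>{i}. w)) \<in> Hinf_disc"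
  unfolding Hinf_disc_def
 proof (intro CollectI conjI)
  show "(\<lambda>w. f (\<lambda>j\<in>{i}. w)) holomorphic_on ball 0 1"
   by (rule power_series_holomorphic_comp[OF _ H2_power_series[OF f]]) (auto intro: holomorphic_intros)
  show "bounded ((\<lambda>w. f (\<lambda>j\<in>{i}. w)) ` ball 0 1)" by (rule boundedI[of _ B]) (use b in auto)
 qed
 show "x \<in> polydisc {i} ==> f (\<lambda>j\<in>{i}. x i) = f x"
  by (rule arg_cong[of _ _ f]) (auto simp: polydisc_def PiE_iff extensional_def fun_eq_iff)
qed

text \<open>Let \<open>q\<close> be the normalised component of \<open>f\<close> orthogonal to \<open>z f H\<^sup>2\<close>. The functions \<open>z^j q\<close> are orthonormal, so \<open>q\<close> is an isometric multiplier, hence bounded by 1 with boundary modulus at least 1. By construction \<open>q = f g\<close>. Conversely \<open>f\<close> lies in \<open>q H\<^sup>2\<close>: an element of \<open>f H\<^sup>2\<close> orthogonal to \<open>q H\<^sup>2\<close> is \<open>z\<close> times another one, hence divisible by all powers of \<open>z\<close>. Both quotients are bounded, since \<open>f\<close> is bounded above and below as a multiplier.\<close>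
theorem inner_factor:
 assumes f: "f \<in> Hinf_disc" and inv: "inverse_in_Linf circle_measure (radial_disc f)"
 shows "\<exists>q\<in>Hinf_disc. \<exists>g\<in>Hinf_disc. \<exists>h\<in>Hinf_disc.
  (\<forall>w. cmod w < 1 \<longrightarrow> cmod (q w) \<le> 1 \<and> q w = f w * g w \<and> f w = q w * h w) \<and>
  (AE \<xi> in circle_measure. 1 \<le> cmod (radial_disc q \<xi>))"
proof -
 define D :: "nat set" where "D = {1}"
 have D: "finite D" and one: "1 \<in> D" by (simp_all add: D_def)
 interpret fun_hilbert "H2 D" "H2_inner D" "H2_norm D" by (rule H2_hilbert[OF D])
 obtain B where B: "B \<ge> 0" "\<And>w. cmod w < 1 ==> cmod (f w) \<le> B" using Hinf_disc_bound[OF f] by blast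
 obtain \<delta> where \<delta>: "\<delta> > 0" "AE \<xi> in circle_measure. \<delta> \<le> cmod (radial_disc f \<xi>)" using inverse_in_Linf_lower[OF inv] by blast
 define F where "F x = f (x 1) * one_on D x" for x
 have FX: "F \<in> H2 D" unfolding F_def by (rule disc_mult(1)[OF D one f B(2) one_on_H2[OF D]])
 have Fh: "(\<lambda>x. F x * h x) = (\<lambda>x. f (x 1) * h x)" if "h \<in> H2 D" for h
  using H2_off[OF that] by (auto simp: F_def one_on_def)
 have FhX: "(\<lambda>x. F x * h x) \<in> H2 D" and Fup: "H2_norm D (\<lambda>x. F x * h x) \<le> B * H2_norm D h"
  and Flow: "\<delta> * H2_norm D h \<le> H2_norm D (\<lambda>x. F x * h x)" if "h \<in> H2 D" for h
  unfolding Fh[OF that]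
  using disc_mult[OF D one f B(2) that] disc_mult_lower[OF D one f less_imp_le[OF \<delta>(1)] \<delta>(2) that] by blast+
 have F0: "F \<noteq> (\<lambda>x. 0)"
  using Flow[OF one_on_H2[OF D]] \<delta>(1) one_on_norm[OF D] by auto
 have shX: "(\<lambda>x. x 1 * h x) \<in> H2 D" if "h \<in> H2 D" for h by (rule shift_H2[OF D one that])
 \<comment> \<open>\<open>Y\<close> is the closed subspace \<open>z f H\<^sup>2\<close>.\<close>
 define \<phi> where "\<phi> x = x 1 * F x" for x
 have \<phi>h: "(\<lambda>x. \<phi> x * h x) = (\<lambda>x. x 1 * (F x * h x))" for h by (simp add: \<phi>_def mult.assoc)
 define Y where "Y = {\<lambda>x. \<phi> x * h x |h. h \<in> H2 D}"
 have \<phi>m: "(\<lambda>x. \<phi> x * h x) \<in> H2 D \<and> H2_norm D (\<lambda>x. \<phi> x * h x) \<le> B * H2_norm D h" if "h \<in> H2 D" for h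
  unfolding \<phi>h using shX[OF FhX[OF that]] shift_norm[OF D one FhX[OF that]] Fup[OF that] by simp
 have \<phi>l: "\<delta> * H2_norm D h \<le> H2_norm D (\<lambda>x. \<phi> x * h x)" if "h \<in> H2 D" for h
  unfolding \<phi>h shift_norm[OF D one FhX[OF that]] by (rule Flow[OF that])
 have mult_subspace: "subspace {\<lambda>x. u x * h x |h. h \<in> H2 D}" (is "subspace ?N")
  if u: "\<And>h. h \<in> H2 D ==> (\<lambda>x. u x * h x) \<in> H2 D \<and> H2_norm D (\<lambda>x. u x * h x) \<le> C * H2_norm D h"
   and l: "d > 0" "\<And>h. h \<in> H2 D ==> d * H2_norm D h \<le> H2_norm D (\<lambda>x. u x * h x)" for u C d
 proof -
  note N = multiplier_range_invariant[OF D u l]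
  show ?thesis unfolding subspace_def
   by (intro conjI ballI allI invariant_closed[OF N D] invariant_zero[OF N] invariant_add[OF N] invariant_scale[OF N])
 qed
 have Ysub: "subspace Y" unfolding Y_def by (rule mult_subspace[OF \<phi>m \<delta>(1) \<phi>l])
 obtain p where p: "p \<in> Y" "\<forall>y\<in>Y. H2_inner D (\<lambda>x. F x - p x) y = 0" using projection_exists[OF Ysub FX] by blast
 obtain h0 where h0: "h0 \<in> H2 D" "p = (\<lambda>x. \<phi> x * h0 x)" using p(1) unfolding Y_def by blast
 define u0 where "u0 x = one_on D x - x 1 * h0 x" for x
 have u0X: "u0 \<in> H2 D" unfolding u0_def[abs_def] by (rule diff_mem[OF one_on_H2[OF D] shX[OF h0(1)]])
 have q0: "(\<lambda>x. F x - p x) = (\<lambda>x. F x * u0 x)"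
  unfolding h0(2) \<phi>_def u0_def F_def by (auto simp: one_on_def algebra_simps)
 have u00: "u0 \<noteq> (\<lambda>x. 0)"
 proof
  assume "u0 = (\<lambda>x. 0)"
  then have "u0 (\<lambda>i\<in>D. 0) = 0" by simp
  then show False using one by (simp add: u0_def one_on_def polydisc_def)
 qed
 define s where "s = H2_norm D (\<lambda>x. F x * u0 x)"
 have s: "s > 0"
 proof -
  have "s \<noteq> 0"
  proof
   assume "s = 0"
   then have "(\<lambda>x. F x * u0 x) = (\<lambda>x. 0)" unfolding s_def by (rule nm_definite[OF FhX[OF u0X]])
   then have "u0 = (\<lambda>x. 0)" by (intro H2_no_zero_divisors[OF D FX u0X F0]) (simp add: fun_eq_iff)
   then show False using u00 by simp
  qed
  then show ?thesis using nm_ge0[OF FhX[OF u0X]] by (simp add: s_def)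
 qed
 \<comment> \<open>\<open>F - p = F u\<^sub>0\<close> is the component of \<open>f\<close> orthogonal to \<open>Y\<close>, and \<open>s\<close> is its norm.\<close>
 define g0 where "g0 x = complex_of_real (1 / s) * u0 x" for x
 have g0X: "g0 \<in> H2 D" unfolding g0_def[abs_def] by (rule scale_mem[OF u0X])
 define q where "q x = F x * g0 x" for x
 have qX: "q \<in> H2 D" unfolding q_def by (rule FhX[OF g0X])
 have qs: "q = (\<lambda>x. complex_of_real (1 / s) * (F x * u0 x))" by (auto simp: q_def g0_def)
 have qn: "H2_norm D q = 1"
  unfolding qs nm_scale[OF FhX[OF u0X]] s_def[symmetric] using s by (simp add: norm_divide)
 have qY: "H2_inner D q y = 0" if y: "y \<in> Y" for y
 proof -
  have yX: "y \<in> H2 D" using y \<phi>m unfolding Y_def by blast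
  have "H2_inner D (\<lambda>x. F x * u0 x) y = 0" using p(2) y unfolding q0 by blast
  then show ?thesis unfolding qs ip_scale[OF FhX[OF u0X] yX] by simp
 qed
 have Ymem: "(\<lambda>x. \<phi> x * h x) \<in> Y" if "h \<in> H2 D" for h
  unfolding Y_def by (rule CollectI, rule exI, rule conjI[OF refl that])
 have pwX: "(\<lambda>x. x 1 ^ j * h x) \<in> H2 D" if "h \<in> H2 D" for h j
 proof (induction j)
  case (Suc j) then show ?case using shX[OF Suc] by (simp add: mult.assoc)
 qed (use that in simp)
 have qshift: "H2_inner D q (\<lambda>x. x 1 ^ Suc j * q x) = 0" for j
 proof (rule qY)
  have "(\<lambda>x. x 1 ^ Suc j * q x) = (\<lambda>x. \<phi> x * (x 1 ^ j * g0 x))" by (auto simp: q_def \<phi>_def mult_ac)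
  then show "(\<lambda>x. x 1 ^ Suc j * q x) \<in> Y" using Ymem[OF pwX[OF g0X, of j]] by (simp only:)
 qed
 have qq: "H2_inner D q q = 1" using ip_nm[OF qX] qn by simp
 have shl: "H2_inner D (\<lambda>x. x 1 ^ j * g x) (\<lambda>x. x 1 ^ j * h x) = H2_inner D g h" if "g \<in> H2 D" "h \<in> H2 D" for g h j
 proof (induction j)
  case (Suc j)
  then show ?case using shift_inner[OF D one pwX[OF that(1)] pwX[OF that(2)], of j j] by (simp add: mult.assoc)
 qed simp
 have orth_le: "H2_inner D (\<lambda>x. x 1 ^ i * q x) (\<lambda>x. x 1 ^ j * q x) = (if i = j then 1 else 0)" if le: "i \<le> j" for i j
 proof (cases "i = j")
  case True then show ?thesis using shl[OF qX qX] qq by simp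
 next
  case False
  then obtain k where k: "j = i + Suc k" using le less_imp_Suc_add[of i j] by auto
  have "H2_inner D (\<lambda>x. x 1 ^ i * q x) (\<lambda>x. x 1 ^ i * (x 1 ^ Suc k * q x)) = 0"
   unfolding shl[OF qX pwX[OF qX]] by (rule qshift)
  then show ?thesis using False unfolding k power_add by (simp add: mult.assoc)
 qed
 have orth: "H2_inner D (\<lambda>x. x 1 ^ i * q x) (\<lambda>x. x 1 ^ j * q x) = (if i = j then 1 else 0)" for i j
  using orth_le[of i j] orth_le[of j i] ip_eq_0_sym[OF pwX[OF qX] pwX[OF qX], of j i] by (cases "i \<le> j") auto
 have monD: "mon D \<alpha> x = x 1 ^ \<alpha> 1" for \<alpha> x by (simp add: mon_def D_def)
 have idx: "\<alpha> = \<beta>" if "\<alpha> \<in> multi_indices D" "\<beta> \<in> multi_indices D" "\<alpha> 1 = \<beta> 1" for \<alpha> \<beta>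
  by (rule multi_indices_eqI[OF that(1,2)]) (use that(3) in \<open>simp add: D_def\<close>)
 have qpoly: "H2_norm D (\<lambda>x. q x * P x) = H2_norm D P" if P: "is_poly D P" for P
 proof -
  obtain A c where A: "finite A" "A \<subseteq> multi_indices D" "P = poly_on D A c" using P unfolding is_poly_def by blast
  have "(\<lambda>x. q x * P x) = (\<lambda>x. \<Sum>\<alpha>\<in>A. c \<alpha> * (x 1 ^ \<alpha> 1 * q x))"
   unfolding A(3) poly_on_def monD using H2_off[OF qX] by (auto simp: sum_distrib_left mult_ac)
  moreover have "(H2_norm D (\<lambda>x. \<Sum>\<alpha>\<in>A. c \<alpha> * (x 1 ^ \<alpha> 1 * q x)))^2 = (\<Sum>\<alpha>\<in>A. (cmod (c \<alpha>))^2)"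
   by (rule orthonormal_norm[OF A(1) pwX[OF qX]]) (unfold orth, use idx A(2) in \<open>auto\<close>)
  ultimately have "(H2_norm D (\<lambda>x. q x * P x))^2 = (H2_norm D P)^2"
   unfolding A(3) poly_on_norm[OF D A(1,2)] by simp
  then show ?thesis by (rule power2_eq_imp_eq[OF _ H2_norm_ge0 H2_norm_ge0])
 qed
 have qm: "(\<lambda>x. q x * h x) \<in> H2 D \<and> H2_norm D (\<lambda>x. q x * h x) \<le> 1 * H2_norm D h" if "h \<in> H2 D" for h
  using multiplier_extend[OF D qX _ that, of 1] qpoly by simp
 have qbd: "cmod (q x) \<le> 1" if "x \<in> polydisc D" for x by (rule multiplier_bounded[OF D _ qm that]) simp
 have qhol: "holomorphic_polydisc D q" using H2_power_series[OF qX] unfolding holomorphic_polydisc_def by blast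
 have qlow: "1 * H2_norm D h \<le> H2_norm D (\<lambda>x. q x * h x)" if "h \<in> H2 D" for h
  by (rule mult_lower_bound_extend[OF D qhol qbd _ _ that]) (simp_all add: qpoly)
 have g0m: "(\<lambda>x. g0 x * h x) \<in> H2 D \<and> H2_norm D (\<lambda>x. g0 x * h x) \<le> 1 / \<delta> * H2_norm D h" if h: "h \<in> H2 D" for h
 proof -
  have "H2_norm D (\<lambda>x. g0 x * P x) \<le> 1 / \<delta> * H2_norm D P" if P: "is_poly D P" for P
  proof -
   have "\<delta> * H2_norm D (\<lambda>x. g0 x * P x) \<le> H2_norm D (\<lambda>x. F x * (g0 x * P x))"
    by (rule Flow[OF poly_mult_H2[OF D P g0X]])
   also have "\<dots> = H2_norm D P" using qpoly[OF P] by (simp add: q_def mult.assoc)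
   finally show ?thesis using \<delta>(1) by (simp add: field_simps)
  qed
  from multiplier_extend[OF D g0X this h] show ?thesis by blast
 qed
 have g0bd: "cmod (g0 x) \<le> 1 / \<delta>" if "x \<in> polydisc D" for x by (rule multiplier_bounded[OF D _ g0m that]) (use \<delta>(1) in simp)
 define N where "N = {\<lambda>x. q x * h x |h. h \<in> H2 D}"
 have Nsub: "subspace N" unfolding N_def by (rule mult_subspace[OF qm zero_less_one qlow])
 obtain e' where e': "e' \<in> N" "\<forall>y\<in>N. H2_inner D (\<lambda>x. F x - e' x) y = 0" using projection_exists[OF Nsub FX] by blast
 obtain k where k: "k \<in> H2 D" "e' = (\<lambda>x. q x * k x)" using e'(1) unfolding N_def by blast
 \<comment> \<open>Elements of \<open>F H\<^sup>2\<close> orthogonal to \<open>q H\<^sup>2\<close> are divisible by every power of the variable.\<close>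
 define E where "E = {e. (\<exists>h\<in>H2 D. e = (\<lambda>x. F x * h x)) \<and> (\<forall>j. H2_inner D e (\<lambda>x. x 1 ^ j * q x) = 0)}"
 have EX: "e \<in> H2 D" if "e \<in> E" for e using that FhX unfolding E_def by blast
 have Ediv: "\<exists>y\<in>E. e = (\<lambda>x. x 1 * y x)" if e: "e \<in> E" for e
 proof -
  obtain h where h: "h \<in> H2 D" "e = (\<lambda>x. F x * h x)" using e unfolding E_def by blast
  define c where "c = coeffs D h (\<lambda>i\<in>D. 0)"
  have cX: "(\<lambda>x. h x - c * one_on D x) \<in> H2 D" by (rule diff_mem[OF h(1) scale_mem[OF one_on_H2[OF D]]])
  have "coeffs D (\<lambda>x. h x - c * one_on D x) \<alpha> = 0" if a: "\<alpha> \<in> multi_indices D" "\<alpha> 1 = 0" for \<alpha>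
  proof -
   have a0: "\<alpha> = (\<lambda>i\<in>D. 0)" by (rule idx[OF a(1) zero_index]) (use a(2) one in simp)
   have "coeffs D (one_on D) \<alpha> = 1" unfolding one_on_poly a0 using zero_index
    by (subst coeffs_poly_on[OF D]) auto
   then show ?thesis
    unfolding coeffs_diff[OF D h(1) scale_mem[OF one_on_H2[OF D]] a(1)] coeffs_scale[OF D one_on_H2[OF D] a(1)]
    by (simp add: c_def a0)
  qed
  from shift_divide[OF D one cX this] obtain h1 where h1: "h1 \<in> H2 D" "(\<lambda>x. h x - c * one_on D x) = (\<lambda>x. x 1 * h1 x)" by blast
  have hx: "h x = c * one_on D x + x 1 * h1 x" for x using fun_cong[OF h1(2), of x] by (simp add: algebra_simps)
  \<comment> \<open>Splitting off the constant term of \<open>h\<close> shows that \<open>e = c s q + z y\<close> with \<open>y\<close> again in \<open>f H\<^sup>2\<close>; orthogonality to \<open>q\<close> forces \<open>c = 0\<close>.\<close>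
  have Fx: "F x = of_real s * q x + x 1 * (F x * h0 x)" for x
   using fun_cong[OF q0, of x] s unfolding h0(2) \<phi>_def q_def g0_def by (simp add: algebra_simps)
  define h2 where "h2 x = c * h0 x + h1 x" for x
  have h2X: "h2 \<in> H2 D" unfolding h2_def[abs_def] by (rule add_mem[OF scale_mem[OF h0(1)] h1(1)])
  define y where "y x = F x * h2 x" for x
  have yX: "y \<in> H2 D" unfolding y_def[abs_def] by (rule FhX[OF h2X])
  have one_F: "F x * one_on D x = F x" for x using H2_off[OF FX, of x] by (simp add: one_on_def)
  have split: "e x = c * of_real s * q x + x 1 * y x" for x
  proof -
   have "e x = c * F x + x 1 * (F x * h1 x)" unfolding h(2) hx using one_F[of x] by (simp add: algebra_simps)
   also have "c * F x = c * of_real s * q x + c * (x 1 * (F x * h0 x))" by (subst Fx) (simp add: algebra_simps)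
   finally show ?thesis by (simp add: y_def h2_def algebra_simps)
  qed
  have zyX: "(\<lambda>x. x 1 * y x) \<in> H2 D" by (rule shX[OF yX])
  have zyY: "(\<lambda>x. x 1 * y x) \<in> Y" unfolding y_def \<phi>h[symmetric] by (rule Ymem[OF h2X])
  have "H2_inner D e q = c * of_real s"
  proof -
   have "H2_inner D e q = H2_inner D (\<lambda>x. c * of_real s * q x + x 1 * y x) q" by (rule arg_cong[of _ _ "\<lambda>u. H2_inner D u q"]) (rule ext, rule split)
   also have "\<dots> = c * of_real s * H2_inner D q q + H2_inner D (\<lambda>x. x 1 * y x) q"
    unfolding ip_add[OF scale_mem[OF qX] zyX qX] ip_scale[OF qX qX] ..
   finally show ?thesis unfolding qq ip_eq_0_sym[OF qX zyX qY[OF zyY]] by simp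
  qed
  moreover have "H2_inner D e q = 0"
  proof -
   have "H2_inner D e (\<lambda>x. x 1 ^ 0 * q x) = 0" using e unfolding E_def by blast
   then show ?thesis by simp
  qed
  ultimately have ez: "e = (\<lambda>x. x 1 * y x)" using s by (auto simp: split fun_eq_iff)
  have "H2_inner D y (\<lambda>x. x 1 ^ j * q x) = 0" for j
  proof -
   have "H2_inner D e (\<lambda>x. x 1 ^ Suc j * q x) = 0" using e unfolding E_def by blast
   then show ?thesis using shift_inner[OF D one yX pwX[OF qX, of j]] unfolding ez by (simp add: mult.assoc)
  qed
  then have "y \<in> E" unfolding E_def y_def[abs_def] using h2X by blast
  then show ?thesis using ez by blast
 qed
 have Ecoeff: "coeffs D e \<alpha> = 0" if "e \<in> E" "\<alpha> \<in> multi_indices D" "\<alpha> 1 = m" for e \<alpha> m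
  using that
 proof (induction m arbitrary: e \<alpha>)
  case 0
  obtain y where y: "y \<in> E" "e = (\<lambda>x. x 1 * y x)" using Ediv[OF 0(1)] by blast
  show ?case unfolding y(2) by (rule coeffs_shift_0[OF D one EX[OF y(1)] 0(2,3)])
 next
  case (Suc m)
  obtain y where y: "y \<in> E" "e = (\<lambda>x. x 1 * y x)" using Ediv[OF Suc.prems(1)] by blast
  define \<beta> where "\<beta> = \<alpha>(1 := m)"
  have b: "\<beta> \<in> multi_indices D" using Suc.prems(2) one by (auto simp: \<beta>_def multi_indices_def PiE_iff extensional_def)
  have up: "up 1 \<beta> = \<alpha>" using Suc.prems(3) by (auto simp: \<beta>_def up_def)
  have b1: "\<beta> 1 = m" by (simp add: \<beta>_def)
  show ?case using coeffs_shift_up[OF D one EX[OF y(1)] b] Suc.IH[OF y(1) b b1] unfolding y(2) up by simp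
 qed
 have FqE: "(\<lambda>x. F x - e' x) \<in> E" unfolding E_def
 proof (intro CollectI conjI allI)
  have "(\<lambda>x. one_on D x - g0 x * k x) \<in> H2 D" using diff_mem[OF one_on_H2[OF D]] g0m[OF k(1)] by blast
  moreover have "(\<lambda>x. F x - e' x) = (\<lambda>x. F x * (one_on D x - g0 x * k x))"
   unfolding k(2) q_def F_def by (auto simp: one_on_def algebra_simps)
  ultimately show "\<exists>h\<in>H2 D. (\<lambda>x. F x - e' x) = (\<lambda>x. F x * h x)" by (intro bexI[of _ "\<lambda>x. one_on D x - g0 x * k x"])
  fix j
  have "(\<lambda>x. x 1 ^ j * q x) = (\<lambda>x. q x * (x 1 ^ j * one_on D x))"
   using H2_off[OF qX] by (auto simp: one_on_def)
  moreover have "(\<lambda>x. q x * (x 1 ^ j * one_on D x)) \<in> N"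
   unfolding N_def by (rule CollectI, rule exI, rule conjI[OF refl pwX[OF one_on_H2[OF D]]])
  ultimately have "(\<lambda>x. x 1 ^ j * q x) \<in> N" by (simp only:)
  then show "H2_inner D (\<lambda>x. F x - e' x) (\<lambda>x. x 1 ^ j * q x) = 0" using e'(2) by blast
 qed
 have "(\<lambda>x. F x - e' x) = (\<lambda>x. 0)"
  by (rule H2_eqI[OF D EX[OF FqE] zero_mem]) (simp add: Ecoeff[OF FqE] coeffs_zero[OF D])
 then have Fqk: "F x = q x * k x" for x unfolding k(2) by (simp add: fun_eq_iff)
 have km: "(\<lambda>x. k x * h x) \<in> H2 D \<and> H2_norm D (\<lambda>x. k x * h x) \<le> B * H2_norm D h" if h: "h \<in> H2 D" for h
 proof -
  have "H2_norm D (\<lambda>x. k x * P x) \<le> B * H2_norm D P" if P: "is_poly D P" for P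
   using qlow[OF poly_mult_H2[OF D P k(1)]] Fup[OF is_poly_H2[OF D P]] by (simp add: Fqk mult.assoc)
  from multiplier_extend[OF D k(1) this h] show ?thesis by blast
 qed
 have kbd: "cmod (k x) \<le> B" if "x \<in> polydisc D" for x by (rule multiplier_bounded[OF D B(1) km that])
 have "\<forall>x\<in>polydisc {1}. cmod (q x) \<le> 1" using qbd unfolding D_def by blast
 note Hq = H2_disc_Hinf[OF qX[unfolded D_def] this]
 have "\<forall>x\<in>polydisc {1}. cmod (g0 x) \<le> 1 / \<delta>" using g0bd unfolding D_def by blast
 note Hg = H2_disc_Hinf[OF g0X[unfolded D_def] this]
 have "\<forall>x\<in>polydisc {1}. cmod (k x) \<le> B" using kbd unfolding D_def by blast
 note Hk = H2_disc_Hinf[OF k(1)[unfolded D_def] this]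
 have pt: "(\<lambda>j\<in>{1}. w) \<in> polydisc D" if "cmod w < 1" for w :: complex using that by (auto simp: polydisc_def D_def)
 have Fw: "F (\<lambda>j\<in>{1}. w) = f w" if "cmod w < 1" for w using pt[OF that] by (simp add: F_def one_on_def)
 have low: "AE \<xi> in circle_measure. 1 \<le> cmod (radial_disc (\<lambda>w. q (\<lambda>j\<in>{1}. w)) \<xi>)"
 proof (rule torus_AE_component[OF one])
  show "{\<xi> \<in> space circle_measure. 1 \<le> cmod (radial_disc (\<lambda>w. q (\<lambda>j\<in>{1}. w)) \<xi>)} \<in> sets circle_measure"
   using radial_disc_measurable[OF Hq(1)] by measurable
  have "AE \<zeta> in torus_measure D. 1 \<le> cmod (radial_polydisc D (\<lambda>x. q (\<lambda>j\<in>{1}. x 1)) \<zeta>)"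
  proof (rule mult_lower_imp_boundary_lower[OF D Hinf_disc_polydisc[OF D one Hq(1)]])
   fix P assume P: "is_poly D P"
   have "(\<lambda>x. q (\<lambda>j\<in>{1}. x 1) * P x) = (\<lambda>x. q x * P x)"
    using Hq(2) H2_off[OF is_poly_H2[OF D P]] unfolding D_def by (auto simp: fun_eq_iff)
   then show "1 * H2_norm D P \<le> H2_norm D (\<lambda>x. q (\<lambda>j\<in>{1}. x 1) * P x)" using qpoly[OF P] by simp
  qed (rule zero_le_one)
  then show "AE \<zeta> in torus_measure D. 1 \<le> cmod (radial_disc (\<lambda>w. q (\<lambda>j\<in>{1}. w)) (\<zeta> 1))"
   unfolding radial_polydisc_disc[OF one, where q="\<lambda>w. q (\<lambda>j\<in>{1}. w)"] .
 qed
 show ?thesis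
 proof (rule bexI[OF _ Hq(1)], rule bexI[OF _ Hg(1)], rule bexI[OF _ Hk(1)], intro conjI allI impI low)
  fix w :: complex assume w: "cmod w < 1"
  show "cmod (q (\<lambda>j\<in>{1}. w)) \<le> 1" by (rule qbd[OF pt[OF w]])
  show "q (\<lambda>j\<in>{1}. w) = f w * g0 (\<lambda>j\<in>{1}. w)" unfolding q_def Fw[OF w] ..
  show "f w = q (\<lambda>j\<in>{1}. w) * k (\<lambda>j\<in>{1}. w)" unfolding Fqk[symmetric] Fw[OF w] ..
 qed
qed

section \<open>Orthogonal projections and multiplication operators\<close>

lemma bounded_opsI:
 assumes "\<And>f. f \<in> H2 J ==> A f \<in> H2 J"
  "\<And>f g. f \<in> H2 J ==> g \<in> H2 J ==> A (\<lambda>z. f z + g z) = (\<lambda>z. A f z + A g z)"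
  "\<And>a f. f \<in> H2 J ==> A (\<lambda>z. a * f z) = (\<lambda>z. a * A f z)"
  "\<And>f. f \<in> H2 J ==> H2_norm J (A f) \<le> C * H2_norm J f"
 shows "A \<in> bounded_ops J"
 unfolding bounded_ops_def
proof (rule CollectI, intro conjI)
 show "\<forall>f\<in>H2 J. A f \<in> H2 J" by (rule ballI) (rule assms(1))
 show "\<forall>f\<in>H2 J. \<forall>g\<in>H2 J. A (\<lambda>z. f z + g z) = (\<lambda>z. A f z + A g z)" by (rule ballI, rule ballI) (rule assms(2))
 show "\<forall>a. \<forall>f\<in>H2 J. A (\<lambda>z. a * f z) = (\<lambda>z. a * A f z)" by (rule allI, rule ballI) (rule assms(3))
 show "\<exists>C. \<forall>f\<in>H2 J. H2_norm J (A f) \<le> C * H2_norm J f" by (rule exI[of _ C], rule ballI) (rule assms(4))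
qed

lemma orth_projectionD:
 assumes "orth_projection I N P" "f \<in> H2 I"
 shows "P f \<in> N" and "g \<in> N ==> H2_inner I (\<lambda>z. f z - P f z) g = 0"
 using assms(1)[unfolded orth_projection_def, THEN bspec, OF assms(2)] by (blast, simp)

lemma orth_projection_unique:
 assumes I: "finite I" and N: "invariant_subspace I N" and P: "orth_projection I N P" and k: "k \<in> H2 I"
  and p: "p \<in> N" "\<And>g. g \<in> N ==> H2_inner I (\<lambda>z. k z - p z) g = 0"
 shows "P k = p"
proof -
 interpret fun_hilbert "H2 I" "H2_inner I" "H2_norm I" by (rule H2_hilbert[OF I])
 have NX: "g \<in> H2 I" if "g \<in> N" for g using invariant_subset[OF N] that by (rule subsetD)
 note Pk = orth_projectionD(1)[OF P k]
 define d where "d z = p z - P k z" for z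
 have dN: "d \<in> N" unfolding d_def[abs_def] using invariant_add[OF N p(1) invariant_scale[OF N Pk, of "-1"]] by simp
 have "d = (\<lambda>z. (k z - P k z) - (k z - p z))" by (simp add: d_def fun_eq_iff)
 then have "H2_inner I d d = H2_inner I (\<lambda>z. (k z - P k z) - (k z - p z)) d" by simp
 also have "\<dots> = 0"
  unfolding ip_diff[OF diff_mem[OF k NX[OF Pk]] diff_mem[OF k NX[OF p(1)]] NX[OF dN]]
  using orth_projectionD(2)[OF P k dN] p(2)[OF dN] by simp
 finally have "H2_norm I d = 0" using ip_nm[OF NX[OF dN]] by simp
 then have "d = (\<lambda>z. 0)" by (rule nm_definite[OF NX[OF dN]])
 then show ?thesis by (simp add: d_def fun_eq_iff)
qed

lemma orth_projection_range:
 assumes I: "finite I" and N: "invariant_subspace I N" and P: "orth_projection I N P" and k: "k \<in> N"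
 shows "P k = k"
proof -
 interpret fun_hilbert "H2 I" "H2_inner I" "H2_norm I" by (rule H2_hilbert[OF I])
 have NX: "g \<in> H2 I" if "g \<in> N" for g using invariant_subset[OF N] that by (rule subsetD)
 show ?thesis by (rule orth_projection_unique[OF I N P NX[OF k] k]) (simp add: NX)
qed

lemma
 assumes I: "finite I" and N: "invariant_subspace I N" and P: "orth_projection I N P"
 shows orth_projection_bounded: "P \<in> bounded_ops I"
  and orth_complement_bounded: "(\<lambda>k x. k x - P k x) \<in> bounded_ops I"
proof -
 interpret fun_hilbert "H2 I" "H2_inner I" "H2_norm I" by (rule H2_hilbert[OF I])
 have NX: "g \<in> H2 I" if "g \<in> N" for g using invariant_subset[OF N] that by (rule subsetD)
 have PX: "P k \<in> H2 I" if "k \<in> H2 I" for k by (rule NX[OF orth_projectionD(1)[OF P that]])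
 have cX: "(\<lambda>x. k x - P k x) \<in> H2 I" if "k \<in> H2 I" for k by (rule diff_mem[OF that PX[OF that]])
 have add: "P (\<lambda>z. f z + g z) = (\<lambda>z. P f z + P g z)" if f: "f \<in> H2 I" and g: "g \<in> H2 I" for f g
 proof (rule orth_projection_unique[OF I N P add_mem[OF f g] invariant_add[OF N orth_projectionD(1)[OF P f] orth_projectionD(1)[OF P g]]])
  fix y assume y: "y \<in> N"
  have "(\<lambda>z. f z + g z - (P f z + P g z)) = (\<lambda>z. (f z - P f z) + (g z - P g z))" by (simp add: fun_eq_iff)
  then show "H2_inner I (\<lambda>z. f z + g z - (P f z + P g z)) y = 0"
   using ip_add[OF cX[OF f] cX[OF g] NX[OF y]] orth_projectionD(2)[OF P f y] orth_projectionD(2)[OF P g y] by simp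
 qed
 have scale: "P (\<lambda>z. a * f z) = (\<lambda>z. a * P f z)" if f: "f \<in> H2 I" for f a
 proof (rule orth_projection_unique[OF I N P scale_mem[OF f] invariant_scale[OF N orth_projectionD(1)[OF P f]]])
  fix y assume y: "y \<in> N"
  have "(\<lambda>z. a * f z - a * P f z) = (\<lambda>z. a * (f z - P f z))" by (simp add: fun_eq_iff right_diff_distrib)
  then show "H2_inner I (\<lambda>z. a * f z - a * P f z) y = 0"
   using ip_scale[OF cX[OF f] NX[OF y]] orth_projectionD(2)[OF P f y] by simp
 qed
 have pyth: "(H2_norm I k)^2 = (H2_norm I (\<lambda>x. k x - P k x))^2 + (H2_norm I (P k))^2" if k: "k \<in> H2 I" for k
  using pythagoras[OF cX[OF k] PX[OF k] orth_projectionD(2)[OF P k orth_projectionD(1)[OF P k]]] by simp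
 show "P \<in> bounded_ops I"
 proof (rule bounded_opsI[where C=1])
  fix k assume k: "k \<in> H2 I"
  have "(H2_norm I (P k))^2 \<le> (H2_norm I k)^2" using pyth[OF k] by simp
  then show "H2_norm I (P k) \<le> 1 * H2_norm I k" using power2_le_imp_le[OF _ H2_norm_ge0] by simp
 qed (fact PX add scale)+
 show "(\<lambda>k x. k x - P k x) \<in> bounded_ops I"
 proof (rule bounded_opsI[where C=1])
  fix k assume k: "k \<in> H2 I"
  have "(H2_norm I (\<lambda>x. k x - P k x))^2 \<le> (H2_norm I k)^2" using pyth[OF k] by simp
  then show "H2_norm I (\<lambda>x. k x - P k x) \<le> 1 * H2_norm I k" using power2_le_imp_le[OF _ H2_norm_ge0] by simp
 qed (fact cX, simp_all add: add scale algebra_simps)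
qed

lemma divide_op:
 assumes J: "finite J" and mult: "\<And>h. h \<in> H2 J ==> (\<lambda>z. f z * h z) \<in> H2 J"
  and \<delta>: "\<delta> > 0" "\<And>h. h \<in> H2 J ==> \<delta> * H2_norm J h \<le> H2_norm J (\<lambda>z. f z * h z)"
  and P: "P \<in> bounded_ops J" and ran: "\<And>k. k \<in> H2 J ==> \<exists>b\<in>H2 J. P k = (\<lambda>x. f x * b x)"
 shows "\<exists>B\<in>bounded_ops J. \<forall>k\<in>H2 J. P k = (\<lambda>x. f x * B k x)"
proof -
 interpret fun_hilbert "H2 J" "H2_inner J" "H2_norm J" by (rule H2_hilbert[OF J])
 define B where "B k = (SOME b. b \<in> H2 J \<and> P k = (\<lambda>x. f x * b x))" for k
 have B: "B k \<in> H2 J" "P k = (\<lambda>x. f x * B k x)" if k: "k \<in> H2 J" for k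
 proof -
  obtain b where "b \<in> H2 J" "P k = (\<lambda>x. f x * b x)" using ran[OF k] by (rule bexE)
  then have "b \<in> H2 J \<and> P k = (\<lambda>x. f x * b x)" by (rule conjI)
  from someI[of "\<lambda>b. b \<in> H2 J \<and> P k = (\<lambda>x. f x * b x)", OF this]
  show "B k \<in> H2 J" "P k = (\<lambda>x. f x * B k x)" unfolding B_def by (rule conjunct1, rule conjunct2)
 qed
 have inj: "b = c" if "b \<in> H2 J" "c \<in> H2 J" and eq: "\<And>x. f x * b x = f x * c x" for b c
 proof -
  have "(\<lambda>x. f x * (b x - c x)) = (\<lambda>x. 0)" using eq by (simp add: right_diff_distrib fun_eq_iff)
  then have "\<delta> * H2_norm J (\<lambda>x. b x - c x) \<le> 0" using \<delta>(2)[OF diff_mem[OF that(1,2)]] by simp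
  then have "H2_norm J (\<lambda>x. b x - c x) = 0" using \<delta>(1) H2_norm_ge0[of J "\<lambda>x. b x - c x"] by (simp add: mult_le_0_iff)
  then have "(\<lambda>x. b x - c x) = (\<lambda>x. 0)" by (rule nm_definite[OF diff_mem[OF that(1,2)]])
  then show ?thesis by (simp add: fun_eq_iff)
 qed
 have PB: "f x * B k x = P k x" if "k \<in> H2 J" for k x using fun_cong[OF B(2)[OF that], of x] by simp
 obtain C where C: "\<forall>k\<in>H2 J. H2_norm J (P k) \<le> C * H2_norm J k" using bounded_op_bound[OF P] by blast
 have "B \<in> bounded_ops J"
 proof (rule bounded_opsI[where C="C / \<delta>"])
  fix u v assume u: "u \<in> H2 J" and v: "v \<in> H2 J"
  show "B (\<lambda>z. u z + v z) = (\<lambda>z. B u z + B v z)"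
   by (rule inj[OF B(1)[OF add_mem[OF u v]] add_mem[OF B(1)[OF u] B(1)[OF v]]])
     (simp add: PB[OF add_mem[OF u v]] bounded_op_add[OF P u v] distrib_left PB[OF u] PB[OF v])
 next
  fix a u assume u: "u \<in> H2 J"
  show "B (\<lambda>z. a * u z) = (\<lambda>z. a * B u z)"
   by (rule inj[OF B(1)[OF scale_mem[OF u]] scale_mem[OF B(1)[OF u]]])
     (simp add: PB[OF scale_mem[OF u]] bounded_op_scale[OF P u] mult.left_commute[of _ a] PB[OF u])
 next
  fix u assume u: "u \<in> H2 J"
  have "\<delta> * H2_norm J (B u) \<le> C * H2_norm J u"
   using order_trans[OF \<delta>(2)[OF B(1)[OF u]]] C u unfolding B(2)[OF u, symmetric] by blast
  then show "H2_norm J (B u) \<le> C / \<delta> * H2_norm J u" using \<delta>(1) by (simp add: field_simps)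
 qed (fact B(1))
 then show ?thesis using B(2) by (intro bexI[of _ B] ballI)
qed

section \<open>Isometries that commute with the first shift\<close>

locale shift_isometry = polydisc_split +
 fixes A :: oper
 assumes A_mem: "F \<in> H2 {1..n} ==> A F \<in> H2 {1..n}"
  and A_norm: "F \<in> H2 {1..n} ==> H2_norm {1..n} (A F) = H2_norm {1..n} F"
  and A_add: "F \<in> H2 {1..n} ==> G \<in> H2 {1..n} ==> A (\<lambda>z. F z + G z) = (\<lambda>z. A F z + A G z)"
  and A_scale: "F \<in> H2 {1..n} ==> A (\<lambda>z. a * F z) = (\<lambda>z. a * A F z)"
  and A_shift: "F \<in> H2 {1..n} ==> A (\<lambda>z. z 1 * F z) = (\<lambda>z. z 1 * A F z)"
begin

lemma A_inner: "F \<in> H2 I ==> G \<in> H2 I ==> H2_inner I (A F) (A G) = H2_inner I F G"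
proof -
 interpret fun_hilbert "H2 I" "H2_inner I" "H2_norm I" by (rule H2_hilbert) simp
 show "F \<in> H2 I ==> G \<in> H2 I ==> H2_inner I (A F) (A G) = H2_inner I F G"
  by (rule isometry_ip[of A, OF A_mem A_norm A_add A_scale])
qed

lemma A_inj:
 assumes F: "F \<in> H2 I" and G: "G \<in> H2 I" and eq: "A F = A G" shows "F = G"
proof -
 interpret fun_hilbert "H2 I" "H2_inner I" "H2_norm I" by (rule H2_hilbert) simp
 have "A (\<lambda>z. F z - G z) = (\<lambda>z. 0)"
  using A_add[OF F scale_mem[OF G], of "-1"] A_scale[OF G, of "-1"] eq by simp
 then have "H2_norm I (\<lambda>z. F z - G z) = 0" using A_norm[OF diff_mem[OF F G]] by simp
 then have "(\<lambda>z. F z - G z) = (\<lambda>z. 0)" by (rule nm_definite[OF diff_mem[OF F G]])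
 then show ?thesis by (simp add: fun_eq_iff)
qed

end

context polydisc_split
begin

lemma sl_const1_0: "k \<in> H2 J ==> sl (const1 k) 0 = k" by (simp add: sl_const1)

lemma const1_inj: "k \<in> H2 J ==> l \<in> H2 J ==> const1 k = const1 l ==> k = l"
proof -
 assume k: "k \<in> H2 J" and l: "l \<in> H2 J" and eq: "const1 k = const1 l"
 show "k = l" by (rule trans[OF sl_const1_0[OF k, symmetric] sl_const1_0[OF l, folded eq]])
qed

text \<open>
 The constants are the orthogonal complement of \<open>z\<^sub>1 H\<^sup>2\<close>, hence \<open>A\<close> maps them onto the orthogonal
 complement of \<open>z\<^sub>1 R\<close> in the range \<open>R\<close> of \<open>A\<close>: the wandering subspace depends on \<open>R\<close> only.
\<close>
lemma wandering_subspace: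
 assumes A: "shift_isometry n A" and B: "shift_isometry n B" and R: "A ` H2 I = B ` H2 I" and k: "k \<in> H2 J"
 shows "\<exists>u\<in>H2 J. A (const1 u) = B (const1 k)"
proof -
 interpret A: shift_isometry n A by (rule A)
 interpret B: shift_isometry n B by (rule B)
 interpret fun_hilbert "H2 I" "H2_inner I" "H2_norm I" by (rule H2_hilbert) simp
 note kX = const1_H2[OF k]
 have "B (const1 k) \<in> A ` H2 I" unfolding R by (rule imageI[OF kX])
 then obtain F where F: "F \<in> H2 I" "B (const1 k) = A F" by (rule imageE)
 from const1_shift_decomposition[OF F(1)] obtain G where G: "G \<in> H2 I" "F = (\<lambda>z. const1 (sl F 0) z + z 1 * G z)" by (rule bexE)
 define u where "u = sl F 0"
 have u: "u \<in> H2 J" unfolding u_def by (rule sl_H2[OF F(1)])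
 have zG: "(\<lambda>z. z 1 * G z) \<in> H2 I" by (rule shift_H2[OF _ one_in G(1)]) simp
 have Fu: "F = (\<lambda>z. const1 u z + z 1 * G z)" unfolding u_def by (rule G(2))
 have "A G \<in> B ` H2 I" unfolding R[symmetric] by (rule imageI[OF G(1)])
 then obtain H where H: "H \<in> H2 I" "A G = B H" by (rule imageE)
 have zH: "(\<lambda>z. z 1 * H z) \<in> H2 I" by (rule shift_H2[OF _ one_in H(1)]) simp
 have "H2_inner I F (\<lambda>z. z 1 * G z) = H2_inner I (A F) (A (\<lambda>z. z 1 * G z))" by (rule A.A_inner[OF F(1) zG, symmetric])
 also have "\<dots> = H2_inner I (B (const1 k)) (B (\<lambda>z. z 1 * H z))"
  unfolding A.A_shift[OF G(1)] B.A_shift[OF H(1)] H(2) F(2) ..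
 also have "\<dots> = 0" unfolding B.A_inner[OF kX zH] by (rule const1_orthogonal_shift[OF k H(1)])
 finally have "H2_inner I F (\<lambda>z. z 1 * G z) = 0" .
 moreover have "H2_inner I F (\<lambda>z. z 1 * G z) = H2_inner I (const1 u) (\<lambda>z. z 1 * G z) + H2_inner I (\<lambda>z. z 1 * G z) (\<lambda>z. z 1 * G z)"
  by (subst Fu) (rule ip_add[OF const1_H2[OF u] zG zG])
 ultimately have "H2_inner I (\<lambda>z. z 1 * G z) (\<lambda>z. z 1 * G z) = 0" using const1_orthogonal_shift[OF u G(1)] by simp
 then have "H2_norm I (\<lambda>z. z 1 * G z) = 0" unfolding ip_nm[OF zG] by simp
 then have "(\<lambda>z. z 1 * G z) = (\<lambda>z. 0)" by (rule nm_definite[OF zG])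
 then have "F = const1 u" using Fu by (simp add: fun_eq_iff)
 then show ?thesis using F(2) u by (intro bexI[of _ u]) simp_all
qed

lemma const1_add: "const1 (\<lambda>x. k x + l x) = (\<lambda>z. const1 k z + const1 l z)" by (auto simp: const1_def)
lemma const1_scale: "const1 (\<lambda>x. a * k x) = (\<lambda>z. a * const1 k z)" by (auto simp: const1_def)

text \<open>The unitary carries \<open>k\<close> to the unique \<open>u\<close> of \<open>wandering_subspace\<close>; exchanging the two isometries gives its inverse.\<close>
lemma same_range_unitary:
 assumes A: "shift_isometry n A" and B: "shift_isometry n B" and R: "A ` H2 I = B ` H2 I"
 shows "\<exists>U. unitary_op J U \<and> (\<forall>k\<in>H2 J. A (const1 (U k)) = B (const1 k))"
proof -
 interpret K: fun_hilbert "H2 J" "H2_inner J" "H2_norm J" by (rule H2_hilbert) simp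
 define T where "T X Y k = (SOME u. u \<in> H2 J \<and> X (const1 u) = Y (const1 k))" for X Y :: oper and k
 have T: "T X Y k \<in> H2 J" "X (const1 (T X Y k)) = Y (const1 k)"
  if X: "shift_isometry n X" and Y: "shift_isometry n Y" and r: "X ` H2 I = Y ` H2 I" and k: "k \<in> H2 J" for X Y k
 proof -
  from wandering_subspace[OF X Y r k] obtain u where "u \<in> H2 J" "X (const1 u) = Y (const1 k)" by (rule bexE)
  then have "u \<in> H2 J \<and> X (const1 u) = Y (const1 k)" by (rule conjI)
  from someI[of "\<lambda>u. u \<in> H2 J \<and> X (const1 u) = Y (const1 k)", OF this]
  show "T X Y k \<in> H2 J" "X (const1 (T X Y k)) = Y (const1 k)" unfolding T_def by (rule conjunct1, rule conjunct2)
 qed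
 have uniq: "u = v" if X: "shift_isometry n X" and "u \<in> H2 J" "v \<in> H2 J" "X (const1 u) = X (const1 v)" for X u v
 proof -
  interpret X: shift_isometry n X by (rule X)
  show ?thesis by (rule const1_inj[OF that(2,3) X.A_inj[OF const1_H2[OF that(2)] const1_H2[OF that(3)] that(4)]])
 qed
 have Tb: "T X Y \<in> bounded_ops J" and Tn: "\<And>k. k \<in> H2 J ==> H2_norm J (T X Y k) = H2_norm J k"
  if X: "shift_isometry n X" and Y: "shift_isometry n Y" and r: "X ` H2 I = Y ` H2 I" for X Y
 proof -
  interpret X: shift_isometry n X by (rule X)
  interpret Y: shift_isometry n Y by (rule Y)
  note T = T[OF X Y r] note uq = uniq[OF X]
  show nm: "H2_norm J (T X Y k) = H2_norm J k" if k: "k \<in> H2 J" for k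
   using X.A_norm[OF const1_H2[OF T(1)[OF k]]] Y.A_norm[OF const1_H2[OF k]]
   unfolding T(2)[OF k] const1_norm[OF k] const1_norm[OF T(1)[OF k]] by simp
  show "T X Y \<in> bounded_ops J"
  proof (rule bounded_opsI[where C=1])
   fix f g assume f: "f \<in> H2 J" and g: "g \<in> H2 J"
   show "T X Y (\<lambda>z. f z + g z) = (\<lambda>z. T X Y f z + T X Y g z)"
   proof (rule uq[OF T(1)[OF K.add_mem[OF f g]] K.add_mem[OF T(1)[OF f] T(1)[OF g]]])
    show "X (const1 (T X Y (\<lambda>z. f z + g z))) = X (const1 (\<lambda>z. T X Y f z + T X Y g z))"
     unfolding T(2)[OF K.add_mem[OF f g]] const1_add Y.A_add[OF const1_H2[OF f] const1_H2[OF g]]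
      X.A_add[OF const1_H2[OF T(1)[OF f]] const1_H2[OF T(1)[OF g]]] T(2)[OF f] T(2)[OF g] ..
   qed
  next
   fix a f assume f: "f \<in> H2 J"
   show "T X Y (\<lambda>z. a * f z) = (\<lambda>z. a * T X Y f z)"
   proof (rule uq[OF T(1)[OF K.scale_mem[OF f]] K.scale_mem[OF T(1)[OF f]]])
    show "X (const1 (T X Y (\<lambda>z. a * f z))) = X (const1 (\<lambda>z. a * T X Y f z))"
     unfolding T(2)[OF K.scale_mem[OF f]] const1_scale Y.A_scale[OF const1_H2[OF f]]
      X.A_scale[OF const1_H2[OF T(1)[OF f]]] T(2)[OF f] ..
   qed
  next
   fix f assume f: "f \<in> H2 J"
   show "T X Y f \<in> H2 J" by (rule T(1)[OF f])
   show "H2_norm J (T X Y f) \<le> 1 * H2_norm J f" unfolding nm[OF f] by simp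
  qed
 qed
 define U where "U = T A B"
 define S where "S = T B A"
 note U = T[OF A B R, folded U_def] and S = T[OF B A R[symmetric], folded S_def]
 note Ub = Tb[OF A B R, folded U_def] and Sb = Tb[OF B A R[symmetric], folded S_def]
 have SU: "S (U f) = f" if f: "f \<in> H2 J" for f
  by (rule uniq[OF B S(1)[OF U(1)[OF f]] f]) (simp add: S(2)[OF U(1)[OF f]] U(2)[OF f])
 have US: "U (S f) = f" if f: "f \<in> H2 J" for f
  by (rule uniq[OF A U(1)[OF S(1)[OF f]] f]) (simp add: U(2)[OF S(1)[OF f]] S(2)[OF f])
 have iso: "H2_inner J (U f) (U g) = H2_inner J f g" if "f \<in> H2 J" "g \<in> H2 J" for f g
  by (rule K.isometry_ip[of U, OF U(1) Tn[OF A B R, folded U_def] bounded_op_add[OF Ub] bounded_op_scale[OF Ub] that])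
 have adj: "is_adjoint J U S" unfolding is_adjoint_def
 proof (intro ballI)
  fix f g assume f: "f \<in> H2 J" and g: "g \<in> H2 J"
  show "H2_inner J (U f) g = H2_inner J f (S g)" using iso[OF f S(1)[OF g]] unfolding US[OF g] .
 qed
 have "unitary_op J U" unfolding unitary_op_def
 proof (rule conjI[OF Ub], rule bexI[OF _ Sb], rule conjI[OF adj], rule ballI)
  fix f assume f: "f \<in> H2 J"
  show "S (U f) = f \<and> U (S f) = f" using SU[OF f] US[OF f] by (rule conjI)
 qed
 moreover have "\<forall>k\<in>H2 J. A (const1 (U k)) = B (const1 k)" by (rule ballI) (rule U(2))
 ultimately show ?thesis by (intro exI[of _ U] conjI)
qed

end

section \<open>The operator function \<open>f\<^sub>1(z\<^sub>1) P\<^sub>0 + P\<^sub>1\<close>\<close>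

context polydisc_split
begin

abbreviation lift :: "oper \<Rightarrow> oper" where "lift A \<equiv> op_mult n (\<lambda>_. A)"

abbreviation sum_space :: "(complex \<Rightarrow> complex) \<Rightarrow> func \<Rightarrow> func set" where
 "sum_space a u \<equiv> {\<lambda>z. a (z 1) * g z + u (restrict z J) * h z |g h. g \<in> H2 I \<and> h \<in> H2 I}"

lemma sum_space_mono:
 assumes a: "\<And>g. g \<in> H2 I ==> \<exists>g'\<in>H2 I. (\<lambda>z. a (z 1) * g z) = (\<lambda>z. b (z 1) * g' z)"
  and u: "\<And>h. h \<in> H2 I ==> \<exists>h'\<in>H2 I. (\<lambda>z. u (restrict z J) * h z) = (\<lambda>z. v (restrict z J) * h' z)"
 shows "sum_space a u \<subseteq> sum_space b v"
proof
 fix F assume "F \<in> sum_space a u"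
 then obtain g h where F: "F = (\<lambda>z. a (z 1) * g z + u (restrict z J) * h z)" "g \<in> H2 I" "h \<in> H2 I"
  by (elim CollectE exE conjE) (rule that)
 from a[OF F(2)] obtain g' where g': "g' \<in> H2 I" "(\<lambda>z. a (z 1) * g z) = (\<lambda>z. b (z 1) * g' z)" by (rule bexE)
 from u[OF F(3)] obtain h' where h': "h' \<in> H2 I" "(\<lambda>z. u (restrict z J) * h z) = (\<lambda>z. v (restrict z J) * h' z)" by (rule bexE)
 have "F = (\<lambda>z. b (z 1) * g' z + v (restrict z J) * h' z)"
  unfolding F(1) by (rule ext) (rule arg_cong2[of _ _ _ _ "(+)", OF fun_cong[OF g'(2)] fun_cong[OF h'(2)]])
 then show "F \<in> sum_space b v" using g'(1) h'(1) by (intro CollectI exI[of _ g'] exI[of _ h'] conjI)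
qed

lemma factor_exchange:
 assumes c: "c \<in> Hinf_disc" and abc: "\<And>w. cmod w < 1 ==> a w = b w * c w" and g: "g \<in> H2 I"
 shows "\<exists>g'\<in>H2 I. (\<lambda>z. a (z 1) * g z) = (\<lambda>z. b (z 1) * g' z)"
proof -
 obtain C where C: "C \<ge> 0" "\<forall>w. cmod w < 1 \<longrightarrow> cmod (c w) \<le> C" using Hinf_disc_bound[OF c] by blast
 have X: "(\<lambda>z. c (z 1) * g z) \<in> H2 I" by (rule disc_mult(1)[OF _ one_in c _ g, of C]) (use C(2) in auto)
 have "(\<lambda>z. a (z 1) * g z) = (\<lambda>z. b (z 1) * (c (z 1) * g z))"
 proof
  fix z show "a (z 1) * g z = b (z 1) * (c (z 1) * g z)"
   using abc[of "z 1"] point_split[of z] H2_off[OF g, of z] by (cases "z \<in> polydisc I") auto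
 qed
 then show ?thesis using X by (intro bexI[of _ "\<lambda>z. c (z 1) * g z"])
qed

lemma lift_multiplication:
 assumes h: "h \<in> H2 I"
 shows "lift (\<lambda>k x. f x * k x) h = (\<lambda>z. f (restrict z J) * h z)"
proof
 fix z
 show "lift (\<lambda>k x. f x * k x) h z = f (restrict z J) * h z"
  unfolding op_mult_def using eval_slice[OF h, of z] H2_off[OF h, of z] by (cases "z \<in> polydisc I") simp_all
qed

definition proj_mult :: "(complex \<Rightarrow> complex) \<Rightarrow> oper \<Rightarrow> oper \<Rightarrow> oper" where
 "proj_mult q P0 P1 F = (\<lambda>z. q (z 1) * lift P0 F z + lift P1 F z)"

lemma
 assumes q: "q \<in> Hinf_disc" and P: "P0 \<in> bounded_ops J" "P1 \<in> bounded_ops J" and F: "F \<in> H2 I"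
 shows mult_lift_H2: "(\<lambda>z. q (z 1) * lift P0 F z) \<in> H2 I"
  and proj_mult_H2: "proj_mult q P0 P1 F \<in> H2 I"
  and slice_proj_mult: "cmod w < 1 ==> slice n (proj_mult q P0 P1 F) w = (\<lambda>x. q w * P0 (slice n F w) x + P1 (slice n F w) x)"
proof -
 obtain C where C: "C \<ge> 0" "\<forall>w. cmod w < 1 \<longrightarrow> cmod (q w) \<le> C" using Hinf_disc_bound[OF q] by blast
 show X: "(\<lambda>z. q (z 1) * lift P0 F z) \<in> H2 I"
  by (rule disc_mult(1)[OF _ one_in q _ lift_H2[OF P(1) F], of C]) (use C(2) in auto)
 show "proj_mult q P0 P1 F \<in> H2 I" unfolding proj_mult_def by (rule H2_add[OF _ X lift_H2[OF P(2) F]]) simp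
 show "slice n (proj_mult q P0 P1 F) w = (\<lambda>x. q w * P0 (slice n F w) x + P1 (slice n F w) x)" if w: "cmod w < 1"
  unfolding proj_mult_def slice_add slice_mult1 slice_lift[OF P(1) F w] slice_lift[OF P(2) F w] ..
qed

text \<open>Since \<open>P\<^sub>1\<close> has range \<open>f H2 J\<close> and \<open>f\<close> is bounded below, \<open>P\<^sub>1\<close> factors as \<open>f\<close> times a bounded operator, which gives one inclusion after lifting; the preimage for the other is \<open>P\<^sub>0 g + q P\<^sub>1 g + f h\<close>.\<close>
lemma proj_mult_range:
 assumes q: "q \<in> Hinf_disc"
  and mult: "\<And>h. h \<in> H2 J ==> (\<lambda>z. f z * h z) \<in> H2 J \<and> H2_norm J (\<lambda>z. f z * h z) \<le> C * H2_norm J h"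
  and \<delta>: "\<delta> > 0" "\<And>h. h \<in> H2 J ==> \<delta> * H2_norm J h \<le> H2_norm J (\<lambda>z. f z * h z)"
  and P1: "orth_projection J {\<lambda>z. f z * h z |h. h \<in> H2 J} P1" (is "orth_projection J ?N P1")
  and P0: "P0 \<in> bounded_ops J" and sum: "\<And>k. k \<in> H2 J ==> (\<lambda>x. P0 k x + P1 k x) = k"
 shows "sum_space q f = proj_mult q P0 P1 ` H2 I"
proof -
 interpret K: fun_hilbert "H2 J" "H2_inner J" "H2_norm J" by (rule H2_hilbert) simp
 have Jf: "finite J" by simp
 have N: "invariant_subspace J ?N" by (rule multiplier_range_invariant[OF Jf mult \<delta>])
 note P1b = orth_projection_bounded[OF Jf N P1]
 have P0x: "P0 k x = k x - P1 k x" if "k \<in> H2 J" for k x using fun_cong[OF sum[OF that], of x] by (simp add: eq_diff_eq)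
 have P0': "P0 k = (\<lambda>x. k x - P1 k x)" if "k \<in> H2 J" for k by (rule ext) (rule P0x[OF that])
 have fixN: "P1 k = k" if "k \<in> ?N" for k by (rule orth_projection_range[OF Jf N P1 that])
 have P1N: "P1 k \<in> ?N" if "k \<in> H2 J" for k by (rule orth_projectionD(1)[OF P1 that])
 have fN: "(\<lambda>x. f x * h x) \<in> ?N" if "h \<in> H2 J" for h by (rule CollectI, rule exI, rule conjI[OF refl that])
 have Mf: "(\<lambda>k x. f x * k x) \<in> bounded_ops J"
  by (rule bounded_opsI[where C=C]) (use mult in \<open>simp_all add: algebra_simps\<close>)
 have "\<exists>b\<in>H2 J. P1 k = (\<lambda>x. f x * b x)" if "k \<in> H2 J" for k using P1N[OF that] by blast
 from divide_op[OF Jf mult[THEN conjunct1] \<delta> P1b this] obtain B where B: "B \<in> bounded_ops J" "\<forall>k\<in>H2 J. P1 k = (\<lambda>x. f x * B k x)" by (rule bexE)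
 show ?thesis
 proof (intro subset_antisym subsetI)
  fix F assume "F \<in> proj_mult q P0 P1 ` H2 I"
  then obtain G where G: "G \<in> H2 I" "F = proj_mult q P0 P1 G" by blast
  have "lift P1 G = lift (\<lambda>k x. f x * k x) (lift B G)"
  proof (rule slices_eqI[OF lift_H2[OF P1b G(1)] lift_H2[OF Mf lift_H2[OF B(1) G(1)]]])
   fix w :: complex assume w: "cmod w < 1"
   have "slice n (lift P1 G) w = P1 (slice n G w)" by (rule slice_lift[OF P1b G(1) w])
   also have "\<dots> = (\<lambda>x. f x * B (slice n G w) x)" by (rule B(2)[THEN bspec, OF slice_H2[OF G(1) w]])
   also have "\<dots> = slice n (lift (\<lambda>k x. f x * k x) (lift B G)) w"
    unfolding slice_lift[OF Mf lift_H2[OF B(1) G(1)] w] slice_lift[OF B(1) G(1) w] ..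
   finally show "slice n (lift P1 G) w = slice n (lift (\<lambda>k x. f x * k x) (lift B G)) w" .
  qed
  then have "F = (\<lambda>z. q (z 1) * lift P0 G z + f (restrict z J) * lift B G z)"
   unfolding G(2) proj_mult_def lift_multiplication[OF lift_H2[OF B(1) G(1)]] by simp
  then show "F \<in> sum_space q f"
   using lift_H2[OF P0 G(1)] lift_H2[OF B(1) G(1)] by (intro CollectI exI[of _ "lift P0 G"] exI[of _ "lift B G"] conjI)
 next
  fix F assume "F \<in> sum_space q f"
  then obtain g h where F: "F = (\<lambda>z. q (z 1) * g z + f (restrict z J) * h z)" and g: "g \<in> H2 I" and h: "h \<in> H2 I"
   by (elim CollectE exE conjE) (rule that)
  \<comment> \<open>\<open>G = P\<^sub>0 g + q P\<^sub>1 g + f h\<close> satisfies \<open>P\<^sub>0 G = P\<^sub>0 g\<close> and \<open>P\<^sub>1 G = q P\<^sub>1 g + f h\<close>.\<close>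
  define A where "A = (\<lambda>z. q (z 1) * lift P1 g z + lift (\<lambda>k x. f x * k x) h z)"
  define G where "G = (\<lambda>z. A z + lift P0 g z)"
  have qX: "(\<lambda>z. q (z 1) * lift P1 g z) \<in> H2 I" by (rule mult_lift_H2[OF q P1b P1b g])
  have AX: "A \<in> H2 I" unfolding A_def by (rule H2_add[OF _ qX lift_H2[OF Mf h]]) simp
  have GX: "G \<in> H2 I" unfolding G_def by (rule H2_add[OF _ AX lift_H2[OF P0 g]]) simp
  have fhX: "(\<lambda>z. f (restrict z J) * h z) \<in> H2 I" using lift_H2[OF Mf h] unfolding lift_multiplication[OF h] .
  obtain Cq where Cq: "Cq \<ge> 0" "\<forall>w. cmod w < 1 \<longrightarrow> cmod (q w) \<le> Cq" using Hinf_disc_bound[OF q] by blast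
  have qgX: "(\<lambda>z. q (z 1) * g z) \<in> H2 I" by (rule disc_mult(1)[OF _ one_in q _ g, of Cq]) (use Cq(2) in auto)
  have FX: "F \<in> H2 I" unfolding F by (rule H2_add[OF _ qgX fhX]) simp
  have "F = proj_mult q P0 P1 G"
  proof (rule slices_eqI[OF FX proj_mult_H2[OF q P0 P1b GX]])
   fix w :: complex assume w: "cmod w < 1"
   define s where "s = slice n g w"
   define t where "t = slice n h w"
   have s: "s \<in> H2 J" and t: "t \<in> H2 J" unfolding s_def t_def by (rule slice_H2[OF g w], rule slice_H2[OF h w])
   define a where "a = (\<lambda>x. q w * P1 s x + f x * t x)"
   have aN: "a \<in> ?N" unfolding a_def by (rule invariant_add[OF N invariant_scale[OF N P1N[OF s]] fN[OF t]])
   have aX: "a \<in> H2 J" using invariant_subset[OF N] aN by (rule subsetD)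
   have sG: "slice n G w = (\<lambda>x. a x + P0 s x)"
    unfolding G_def A_def slice_add slice_mult1 slice_lift[OF P1b g w] slice_lift[OF Mf h w] slice_lift[OF P0 g w] a_def s_def t_def ..
   have p0X: "P0 s \<in> H2 J" by (rule bounded_op_mem[OF P0 s])
   have P1s: "P1 (P1 s) = P1 s" by (rule fixN[OF P1N[OF s]])
   have P1P0: "P1 (P0 s) = (\<lambda>x. 0)"
    unfolding P0'[OF s] bounded_op_diff[OF Jf P1b s bounded_op_mem[OF P1b s]] P1s by simp
   have e1: "P1 (slice n G w) = a"
    unfolding sG bounded_op_add[OF P1b aX p0X] P1P0 fixN[OF aN] by simp
   have e0: "P0 (slice n G w) = P0 s"
    unfolding P0'[OF slice_H2[OF GX w]] e1 unfolding sG by simp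
   have sF: "slice n F w = (\<lambda>x. q w * s x + f x * t x)"
    unfolding F lift_multiplication[OF h, symmetric] slice_add slice_mult1 slice_lift[OF Mf h w] s_def t_def ..
   show "slice n F w = slice n (proj_mult q P0 P1 G) w"
    unfolding slice_proj_mult[OF q P0 P1b GX w] e0 e1 sF a_def by (rule ext) (simp add: P0x[OF s] algebra_simps)
  qed
  then show "F \<in> proj_mult q P0 P1 ` H2 I" using GX by (rule image_eqI)
 qed
qed

lemma proj_mult_isometry:
 assumes q: "q \<in> Hinf_disc" and q1: "\<And>w. cmod w < 1 ==> cmod (q w) \<le> 1"
  and low: "AE \<xi> in circle_measure. 1 \<le> cmod (radial_disc q \<xi>)"
  and N: "invariant_subspace J N" and P1: "orth_projection J N P1"
  and P0: "P0 \<in> bounded_ops J" and sum: "\<And>k. k \<in> H2 J ==> (\<lambda>x. P0 k x + P1 k x) = k"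
 shows "shift_isometry n (proj_mult q P0 P1)"
proof -
 interpret K: fun_hilbert "H2 J" "H2_inner J" "H2_norm J" by (rule H2_hilbert) simp
 have Jf: "finite J" and If: "finite I" by simp_all
 note P1b = orth_projection_bounded[OF Jf N P1]
 have P0x: "P0 k x = k x - P1 k x" if "k \<in> H2 J" for k x using fun_cong[OF sum[OF that], of x] by (simp add: eq_diff_eq)
 have P0': "P0 k = (\<lambda>x. k x - P1 k x)" if "k \<in> H2 J" for k by (rule ext) (rule P0x[OF that])
 have orth: "H2_inner J (P0 k) (P1 k) = 0" if "k \<in> H2 J" for k
  unfolding P0'[OF that] by (rule orth_projectionD(2)[OF P1 that orth_projectionD(1)[OF P1 that]])
 note X = proj_mult_H2[OF q P0 P1b] and sl = slice_proj_mult[OF q P0 P1b]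
 have norm: "H2_norm I (proj_mult q P0 P1 F) = H2_norm I F" if F: "F \<in> H2 I" for F
 proof -
  note L0 = lift_H2[OF P0 F] and L1 = lift_H2[OF P1b F]
  note qL0 = mult_lift_H2[OF q P0 P1b F]
  have "(H2_norm I (proj_mult q P0 P1 F))^2 = (H2_norm I (\<lambda>z. q (z 1) * lift P0 F z))^2 + (H2_norm I (lift P1 F))^2"
   unfolding proj_mult_def
  proof (rule slices_pythagoras[OF qL0 L1])
   fix w :: complex assume w: "cmod w < 1"
   show "H2_inner J (slice n (\<lambda>z. q (z 1) * lift P0 F z) w) (slice n (lift P1 F) w) = 0"
    unfolding slice_mult1 slice_lift[OF P0 F w] slice_lift[OF P1b F w]
     K.ip_scale[OF bounded_op_mem[OF P0 slice_H2[OF F w]] bounded_op_mem[OF P1b slice_H2[OF F w]]] orth[OF slice_H2[OF F w]] by simp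
  qed
  also have "H2_norm I (\<lambda>z. q (z 1) * lift P0 F z) = H2_norm I (lift P0 F)"
   using disc_mult(2)[OF If one_in q q1 L0] disc_mult_lower[OF If one_in q zero_le_one low L0] by simp
  also have "(H2_norm I (lift P0 F))^2 + (H2_norm I (lift P1 F))^2 = (H2_norm I (\<lambda>z. lift P0 F z + lift P1 F z))^2"
  proof (rule slices_pythagoras[OF L0 L1, symmetric])
   fix w :: complex assume w: "cmod w < 1"
   show "H2_inner J (slice n (lift P0 F) w) (slice n (lift P1 F) w) = 0"
    unfolding slice_lift[OF P0 F w] slice_lift[OF P1b F w] by (rule orth[OF slice_H2[OF F w]])
  qed
  also have "(\<lambda>z. lift P0 F z + lift P1 F z) = F"
  proof (rule slices_eqI[OF H2_add[OF If L0 L1] F])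
   fix w :: complex assume w: "cmod w < 1"
   show "slice n (\<lambda>z. lift P0 F z + lift P1 F z) w = slice n F w"
    unfolding slice_add slice_lift[OF P0 F w] slice_lift[OF P1b F w] by (rule sum[OF slice_H2[OF F w]])
  qed
  finally show ?thesis by (rule power2_eq_imp_eq[OF _ H2_norm_ge0 H2_norm_ge0])
 qed
 show ?thesis
 proof (intro shift_isometry.intro shift_isometry_axioms.intro)
  show "polydisc_split n" by (rule polydisc_split_axioms)
  show "F \<in> H2 I ==> proj_mult q P0 P1 F \<in> H2 I" for F by (rule X)
  show "F \<in> H2 I ==> H2_norm I (proj_mult q P0 P1 F) = H2_norm I F" for F by (rule norm)
  show "proj_mult q P0 P1 (\<lambda>z. F z + G z) = (\<lambda>z. proj_mult q P0 P1 F z + proj_mult q P0 P1 G z)"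
   if F: "F \<in> H2 I" and G: "G \<in> H2 I" for F G
  proof (rule slices_eqI[OF X[OF H2_add[OF If F G]] H2_add[OF If X[OF F] X[OF G]]])
   fix w :: complex assume w: "cmod w < 1"
   note b = slice_H2[OF F w] slice_H2[OF G w]
   show "slice n (proj_mult q P0 P1 (\<lambda>z. F z + G z)) w = slice n (\<lambda>z. proj_mult q P0 P1 F z + proj_mult q P0 P1 G z) w"
    unfolding sl[OF H2_add[OF If F G] w] slice_add sl[OF F w] sl[OF G w] bounded_op_add[OF P0 b] bounded_op_add[OF P1b b]
    by (rule ext) (simp add: algebra_simps)
  qed
  have mult1: "proj_mult q P0 P1 (\<lambda>z. \<phi> (z 1) * F z) = (\<lambda>z. \<phi> (z 1) * proj_mult q P0 P1 F z)"
   if F: "F \<in> H2 I" and m: "\<And>G. G \<in> H2 I ==> (\<lambda>z. \<phi> (z 1) * G z) \<in> H2 I" for F \<phi>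
  proof (rule slices_eqI[OF X[OF m[OF F]] m[OF X[OF F]]])
   fix w :: complex assume w: "cmod w < 1"
   note b = slice_H2[OF F w]
   show "slice n (proj_mult q P0 P1 (\<lambda>z. \<phi> (z 1) * F z)) w = slice n (\<lambda>z. \<phi> (z 1) * proj_mult q P0 P1 F z) w"
    unfolding sl[OF m[OF F] w] slice_mult1 sl[OF F w] bounded_op_scale[OF P0 b] bounded_op_scale[OF P1b b]
    by (rule ext) (simp add: algebra_simps)
  qed
  show "proj_mult q P0 P1 (\<lambda>z. a * F z) = (\<lambda>z. a * proj_mult q P0 P1 F z)" if "F \<in> H2 I" for F a
   by (rule mult1[OF that, of "\<lambda>_. a"]) (rule H2_scale[OF If])
  show "proj_mult q P0 P1 (\<lambda>z. z 1 * F z) = (\<lambda>z. z 1 * proj_mult q P0 P1 F z)" if "F \<in> H2 I" for F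
   by (rule mult1[OF that, of "\<lambda>w. w"]) (rule shift_H2[OF If one_in])
 qed
qed

end

context inner_multiplier
begin

lemma op_mult_isometry: "shift_isometry n (op_mult n \<Theta>)"
proof (intro shift_isometry.intro shift_isometry_axioms.intro)
 show "polydisc_split n" by (rule polydisc_split_axioms)
qed (fact range_H2 op_mult_norm op_mult_add op_mult_scale op_mult_z1)+

lemma op_mult_range:
 assumes U: "unitary_op J U" and q: "q \<in> Hinf_disc" and P0: "P0 \<in> bounded_ops J" and P1: "P1 \<in> bounded_ops J"
  and \<Theta>U: "\<And>w k. cmod w < 1 ==> k \<in> H2 J ==> \<Theta> w (U k) = (\<lambda>x. q w * P0 k x + P1 k x)"
 shows "op_mult n \<Theta> ` H2 I = proj_mult q P0 P1 ` H2 I"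
proof -
 note u = U[unfolded unitary_op_def]
 have Ub: "U \<in> bounded_ops J" by (rule u[THEN conjunct1])
 from u[THEN conjunct2] obtain S where Sb: "S \<in> bounded_ops J"
  and SU: "is_adjoint J U S \<and> (\<forall>f\<in>H2 J. S (U f) = f \<and> U (S f) = f)" by (rule bexE)
 have US: "U (S f) = f" if "f \<in> H2 J" for f
  by (rule SU[THEN conjunct2, THEN bspec, OF that, THEN conjunct2])
 have eq: "op_mult n \<Theta> (lift U F) = proj_mult q P0 P1 F" if F: "F \<in> H2 I" for F
 proof (rule slices_eqI[OF range_H2[OF lift_H2[OF Ub F]] proj_mult_H2[OF q P0 P1 F]])
  fix w :: complex assume w: "cmod w < 1"
  show "slice n (op_mult n \<Theta> (lift U F)) w = slice n (proj_mult q P0 P1 F) w"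
   unfolding slice_op_mult[OF w lift_H2[OF Ub F]] slice_lift[OF Ub F w] slice_proj_mult[OF q P0 P1 F w]
   by (rule \<Theta>U[OF w slice_H2[OF F w]])
 qed
 have onto: "lift U (lift S F) = F" if F: "F \<in> H2 I" for F
 proof (rule slices_eqI[OF lift_H2[OF Ub lift_H2[OF Sb F]] F])
  fix w :: complex assume w: "cmod w < 1"
  show "slice n (lift U (lift S F)) w = slice n F w"
   unfolding slice_lift[OF Ub lift_H2[OF Sb F] w] slice_lift[OF Sb F w] by (rule US[OF slice_H2[OF F w]])
 qed
 show ?thesis
 proof (intro subset_antisym image_subsetI)
  fix F assume F: "F \<in> H2 I"
  show "proj_mult q P0 P1 F \<in> op_mult n \<Theta> ` H2 I" unfolding eq[OF F, symmetric] by (rule imageI[OF lift_H2[OF Ub F]])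
  have "op_mult n \<Theta> F = proj_mult q P0 P1 (lift S F)" using eq[OF lift_H2[OF Sb F]] unfolding onto[OF F] .
  then show "op_mult n \<Theta> F \<in> proj_mult q P0 P1 ` H2 I" by (rule image_eqI[OF _ lift_H2[OF Sb F]])
 qed
qed

text \<open>Replacing \<open>f\<^sub>1\<close> by its inner factor makes the operator function isometric, so that it is comparable with \<open>\<Theta>\<close>.\<close>
lemma projection_form_of_sum:
 assumes f1: "f1 \<in> Hinf_disc" and i1: "inverse_in_Linf circle_measure (radial_disc f1)"
  and f2: "f2 \<in> Hinf_polydisc J" and i2: "inverse_in_Linf (torus_measure J) (radial_polydisc J f2)"
  and M: "op_mult n \<Theta> ` H2 I = sum_space f1 f2"
 shows "\<exists>q\<in>Hinf_disc. \<exists>N P0 P1 U.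
      inverse_in_Linf circle_measure (radial_disc q) \<and>
      invariant_subspace J N \<and> singly_generated J N \<and> orth_projection J N P1 \<and> P0 \<in> bounded_ops J \<and>
      (\<forall>k\<in>H2 J. P0 (P1 k) = (\<lambda>x. 0)) \<and> (\<forall>k\<in>H2 J. (\<lambda>x. P0 k x + P1 k x) = k) \<and> unitary_op J U \<and>
      (\<forall>w\<in>ball 0 1. \<forall>k\<in>H2 J. \<Theta> w (U k) = (\<lambda>x. q w * P0 k x + P1 k x))"
proof -
 interpret K: fun_hilbert "H2 J" "H2_inner J" "H2_norm J" by (rule H2_hilbert) simp
 have Jf: "finite J" by simp
 have hol: "holomorphic_polydisc J f2" and bd: "bounded (f2 ` polydisc J)" using f2 unfolding Hinf_polydisc_def by blast+
 obtain C where C: "C > 0" "\<forall>y\<in>f2 ` polydisc J. cmod y \<le> C" using bd unfolding bounded_pos by blast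
 have CB: "cmod (f2 z) \<le> C" if "z \<in> polydisc J" for z using C(2) that by blast
 obtain \<delta> where \<delta>: "\<delta> > 0" "\<forall>h\<in>H2 J. \<delta> * H2_norm J h \<le> H2_norm J (\<lambda>z. f2 z * h z)"
  using mult_lower_of_inverse_in_Linf[OF Jf hol bd i2] by blast
 define f where "f z = (if z \<in> polydisc J then f2 z else 0)" for z
 have fX: "f \<in> H2 J" unfolding f_def by (rule bounded_H2[OF Jf hol bd])
 have fh: "(\<lambda>z. f z * h z) = (\<lambda>z. f2 z * h z)" if "h \<in> H2 J" for h
  using H2_off[OF that] by (auto simp: f_def fun_eq_iff)
 have mult: "(\<lambda>z. f z * h z) \<in> H2 J \<and> H2_norm J (\<lambda>z. f z * h z) \<le> C * H2_norm J h" if "h \<in> H2 J" for h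
  unfolding fh[OF that]
  using bounded_mult_H2[OF Jf hol CB less_imp_le[OF C(1)] that] bounded_mult_norm[OF Jf hol CB less_imp_le[OF C(1)] that] by (rule conjI)
 have low: "\<delta> * H2_norm J h \<le> H2_norm J (\<lambda>z. f z * h z)" if "h \<in> H2 J" for h
  unfolding fh[OF that] using \<delta>(2) that by (rule bspec)
 define N where "N = {\<lambda>z. f z * h z |h. h \<in> H2 J}"
 have N: "invariant_subspace J N" unfolding N_def by (rule multiplier_range_invariant[OF Jf mult \<delta>(1) low])
 have hull: "invariant_hull J f = N" unfolding N_def by (rule multiplier_range_hull[OF Jf fX mult \<delta>(1) low])
 have "f \<noteq> (\<lambda>z. 0)" using low[OF one_on_H2[OF Jf]] \<delta>(1) one_on_norm[OF Jf] by auto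
 then have gen: "singly_generated J N" unfolding singly_generated_def
  by (intro bexI[OF _ fX] conjI) (simp_all add: hull N_def)
 have Nsub: "K.subspace N" unfolding K.subspace_def
  by (intro conjI ballI allI invariant_closed[OF N Jf] invariant_zero[OF N] invariant_add[OF N] invariant_scale[OF N])
 define P1 where "P1 k = (SOME p. p \<in> N \<and> (\<forall>g\<in>N. H2_inner J (\<lambda>x. k x - p x) g = 0))" for k
 have P1: "orth_projection J N P1" unfolding orth_projection_def
 proof
  fix k assume k: "k \<in> H2 J"
  from K.projection_exists[OF Nsub k] obtain p where "p \<in> N" "\<forall>g\<in>N. H2_inner J (\<lambda>x. k x - p x) g = 0" by (rule bexE)
  then have "p \<in> N \<and> (\<forall>g\<in>N. H2_inner J (\<lambda>x. k x - p x) g = 0)" by (rule conjI)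
  from someI[of "\<lambda>p. p \<in> N \<and> (\<forall>g\<in>N. H2_inner J (\<lambda>x. k x - p x) g = 0)", OF this]
  show "P1 k \<in> N \<and> (\<forall>g\<in>N. H2_inner J (\<lambda>x. k x - P1 k x) g = 0)" unfolding P1_def .
 qed
 note P1b = orth_projection_bounded[OF Jf N P1]
 define P0 where "P0 = (\<lambda>k x. k x - P1 k x)"
 have P0: "P0 \<in> bounded_ops J" unfolding P0_def by (rule orth_complement_bounded[OF Jf N P1])
 have sum: "(\<lambda>x. P0 k x + P1 k x) = k" for k by (simp add: P0_def)
 have P01: "P0 (P1 k) = (\<lambda>x. 0)" if "k \<in> H2 J" for k
  unfolding P0_def orth_projection_range[OF Jf N P1 orth_projectionD(1)[OF P1 that]] by simp
 obtain q g h where q: "q \<in> Hinf_disc" and g: "g \<in> Hinf_disc" and h: "h \<in> Hinf_disc"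
  and fac: "\<forall>w. cmod w < 1 \<longrightarrow> cmod (q w) \<le> 1 \<and> q w = f1 w * g w \<and> f1 w = q w * h w"
  and qlow: "AE \<xi> in circle_measure. 1 \<le> cmod (radial_disc q \<xi>)"
  using inner_factor[OF f1 i1] by (elim bexE conjE) (rule that)
 have q1: "cmod (q w) \<le> 1" and qf: "q w = f1 w * g w" and fq: "f1 w = q w * h w" if "cmod w < 1" for w
  using fac that by blast+
 have qinv: "inverse_in_Linf circle_measure (radial_disc q)"
  by (rule lower_inverse_in_Linf[OF radial_disc_measurable[OF q] zero_less_one qlow])
 have f2f: "(\<lambda>z. f2 (restrict z J) * h z) = (\<lambda>z. f (restrict z J) * h z)" if "h \<in> H2 I" for h
 proof
  fix z show "f2 (restrict z J) * h z = f (restrict z J) * h z"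
   using point_split[of z] H2_off[OF that, of z] by (cases "z \<in> polydisc I") (auto simp: f_def)
 qed
 have "sum_space f1 f2 = sum_space q f"
 proof (rule subset_antisym)
  show "sum_space f1 f2 \<subseteq> sum_space q f"
  proof (rule sum_space_mono[OF factor_exchange[OF h fq]])
   show "\<exists>h'\<in>H2 I. (\<lambda>z. f2 (restrict z J) * h z) = (\<lambda>z. f (restrict z J) * h' z)" if "h \<in> H2 I" for h
    by (rule bexI[of _ h]) (rule f2f[OF that], rule that)
  qed
  show "sum_space q f \<subseteq> sum_space f1 f2"
  proof (rule sum_space_mono[OF factor_exchange[OF g qf]])
   show "\<exists>h'\<in>H2 I. (\<lambda>z. f (restrict z J) * h z) = (\<lambda>z. f2 (restrict z J) * h' z)" if "h \<in> H2 I" for h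
    by (rule bexI[of _ h]) (rule f2f[OF that, symmetric], rule that)
  qed
 qed
 also have "\<dots> = proj_mult q P0 P1 ` H2 I"
  by (rule proj_mult_range[OF q mult \<delta>(1) low P1[unfolded N_def] P0 sum])
 finally have R: "op_mult n \<Theta> ` H2 I = proj_mult q P0 P1 ` H2 I" unfolding M .
 have iso: "shift_isometry n (proj_mult q P0 P1)" by (rule proj_mult_isometry[OF q q1 qlow N P1 P0 sum])
 from same_range_unitary[OF op_mult_isometry iso R]
 obtain U where U: "unitary_op J U" "\<forall>k\<in>H2 J. op_mult n \<Theta> (const1 (U k)) = proj_mult q P0 P1 (const1 k)"
  by (elim exE conjE) (rule that)
 have Ub: "U \<in> bounded_ops J" using U(1) unfolding unitary_op_def by (rule conjunct1)
 have form: "\<Theta> w (U k) = (\<lambda>x. q w * P0 k x + P1 k x)" if w: "w \<in> ball 0 1" and k: "k \<in> H2 J" for w k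
 proof -
  have w: "cmod w < 1" using w by simp
  note Uk = bounded_op_mem[OF Ub k]
  have "\<Theta> w (U k) = slice n (op_mult n \<Theta> (const1 (U k))) w"
   unfolding slice_op_mult[OF w const1_H2[OF Uk]] slice_const1[OF Uk w] ..
  also have "op_mult n \<Theta> (const1 (U k)) = proj_mult q P0 P1 (const1 k)" by (rule U(2)[THEN bspec, OF k])
  also have "slice n (proj_mult q P0 P1 (const1 k)) w = (\<lambda>x. q w * P0 k x + P1 k x)"
   unfolding slice_proj_mult[OF q P0 P1b const1_H2[OF k] w] slice_const1[OF k w] ..
  finally show ?thesis .
 qed
 show ?thesis
  by (rule bexI[OF _ q], rule exI[of _ N], rule exI[of _ P0], rule exI[of _ P1], rule exI[of _ U])
    (intro conjI ballI qinv N gen P1 P0 P01 sum U(1) form)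
qed

lemma sum_of_projection_form:
 assumes f1: "f1 \<in> Hinf_disc" and N: "invariant_subspace J N" and gen: "singly_generated J N"
  and P1: "orth_projection J N P1" and P0: "P0 \<in> bounded_ops J"
  and sum: "\<And>k. k \<in> H2 J ==> (\<lambda>x. P0 k x + P1 k x) = k" and U: "unitary_op J U"
  and form: "\<And>w k. cmod w < 1 ==> k \<in> H2 J ==> \<Theta> w (U k) = (\<lambda>x. f1 w * P0 k x + P1 k x)"
 shows "\<exists>f2\<in>Hinf_polydisc J. inverse_in_Linf (torus_measure J) (radial_polydisc J f2) \<and> op_mult n \<Theta> ` H2 I = sum_space f1 f2"
proof -
 have Jf: "finite J" by simp
 from gen[unfolded singly_generated_def] obtain f where f: "f \<in> H2 J" "f \<noteq> (\<lambda>z. 0)" and Nf: "N = {\<lambda>z. f z * h z |h. h \<in> H2 J}"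
  by (elim bexE conjE) (rule that)
 have mX: "(\<lambda>z. f z * h z) \<in> H2 J" if "h \<in> H2 J" for h
 proof -
  have "(\<lambda>z. f z * h z) \<in> N" unfolding Nf by (rule CollectI, rule exI, rule conjI[OF refl that])
  then show ?thesis by (rule subsetD[OF invariant_subset[OF N]])
 qed
 note cl = invariant_closed[OF N Jf, unfolded Nf]
 obtain C where C: "C \<ge> 0" "\<forall>h\<in>H2 J. H2_norm J (\<lambda>z. f z * h z) \<le> C * H2_norm J h"
  using closed_range_multiplier_bounds(1)[OF Jf f mX cl] by blast
 obtain \<delta> where \<delta>: "\<delta> > 0" "\<forall>h\<in>H2 J. \<delta> * H2_norm J h \<le> H2_norm J (\<lambda>z. f z * h z)"
  using closed_range_multiplier_bounds(2)[OF Jf f mX cl] by blast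
 have mult: "(\<lambda>z. f z * h z) \<in> H2 J \<and> H2_norm J (\<lambda>z. f z * h z) \<le> C * H2_norm J h" if "h \<in> H2 J" for h
  using mX[OF that] C(2)[THEN bspec, OF that] by (rule conjI)
 note low = \<delta>(2)[THEN bspec]
 have hol: "holomorphic_polydisc J f" using H2_power_series[OF f(1)] unfolding holomorphic_polydisc_def by blast
 have bd: "bounded (f ` polydisc J)"
  by (rule boundedI[of _ C]) (use multiplier_bounded[OF Jf C(1) mult] in auto)
 have fH: "f \<in> Hinf_polydisc J" unfolding Hinf_polydisc_def using hol bd by blast
 have inv: "inverse_in_Linf (torus_measure J) (radial_polydisc J f)"
  by (rule inverse_in_Linf_of_mult_lower[OF Jf hol bd \<delta>(1) low[OF is_poly_H2[OF Jf]]])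
 have "op_mult n \<Theta> ` H2 I = proj_mult f1 P0 P1 ` H2 I"
  by (rule op_mult_range[OF U f1 P0 orth_projection_bounded[OF Jf N P1] form])
 also have "\<dots> = sum_space f1 f"
  by (rule proj_mult_range[OF f1 mult \<delta>(1) low P1[unfolded Nf] P0 sum, symmetric])
 finally show ?thesis using inv fH by (intro bexI[of _ f] conjI)
qed

end

theorem theorem3p2:
  fixes n :: nat and M :: "func set" and \<Theta> :: "complex \<Rightarrow> oper"
  assumes "n \<ge> 2"
    and "invariant_subspace {1..n} M"
    and "operator_inner {2..n} \<Theta>"
    and "M = op_mult n \<Theta> ` H2 {1..n}"
  shows "(\<exists>f1\<in>Hinf_disc. \<exists>f2\<in>Hinf_polydisc {2..n}.
            inverse_in_Linf circle_measure (radial_disc f1) \<and>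
            inverse_in_Linf (torus_measure {2..n}) (radial_polydisc {2..n} f2) \<and>
            M = {\<lambda>z. f1 (z 1) * g z + f2 (restrict z {2..n}) * h z |g h.
                   g \<in> H2 {1..n} \<and> h \<in> H2 {1..n}})
     \<longleftrightarrow>
         (\<exists>f1\<in>Hinf_disc. \<exists>N P0 P1 U.
            inverse_in_Linf circle_measure (radial_disc f1) \<and>
            invariant_subspace {2..n} N \<and> singly_generated {2..n} N \<and>
            orth_projection {2..n} N P1 \<and>
            P0 \<in> bounded_ops {2..n} \<and>
            (\<forall>k\<in>H2 {2..n}. P0 (P1 k) = (\<lambda>x. 0)) \<and>
            (\<forall>k\<in>H2 {2..n}. (\<lambda>x. P0 k x + P1 k x) = k) \<and>
            unitary_op {2..n} U \<and>
            (\<forall>w\<in>ball 0 1. \<forall>k\<in>H2 {2..n}.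
               \<Theta> w (U k) = (\<lambda>x. f1 w * P0 k x + P1 k x)))"
    (is "?L \<longleftrightarrow> ?R")
proof -
 have ran: "op_mult n \<Theta> F \<in> H2 {1..n}" if "F \<in> H2 {1..n}" for F
  by (rule subsetD[OF invariant_subset[OF assms(2)]]) (unfold assms(4), rule imageI[OF that])
 interpret inner_multiplier n \<Theta>
  by (intro inner_multiplier.intro polydisc_split.intro inner_multiplier_axioms.intro assms(1,3) ran)
 show ?thesis
 proof
  assume ?L
  then obtain f1 f2 where f: "f1 \<in> Hinf_disc" "f2 \<in> Hinf_polydisc {2..n}"
   "inverse_in_Linf circle_measure (radial_disc f1)" "inverse_in_Linf (torus_measure {2..n}) (radial_polydisc {2..n} f2)"
   and M: "M = sum_space f1 f2" by (elim bexE conjE) (rule that)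
  show ?R by (rule projection_form_of_sum[OF f(1,3,2,4)]) (unfold assms(4)[symmetric], rule M)
 next
  assume ?R
  then obtain f1 N P0 P1 U where f1: "f1 \<in> Hinf_disc" "inverse_in_Linf circle_measure (radial_disc f1)"
   and N: "invariant_subspace {2..n} N" "singly_generated {2..n} N" and P1: "orth_projection {2..n} N P1"
   and P0: "P0 \<in> bounded_ops {2..n}" and sum: "\<forall>k\<in>H2 {2..n}. (\<lambda>x. P0 k x + P1 k x) = k" and U: "unitary_op {2..n} U"
   and form: "\<forall>w\<in>ball 0 1. \<forall>k\<in>H2 {2..n}. \<Theta> w (U k) = (\<lambda>x. f1 w * P0 k x + P1 k x)"
   by (elim bexE exE conjE) (rule that)
  have "\<exists>f2\<in>Hinf_polydisc {2..n}. inverse_in_Linf (torus_measure {2..n}) (radial_polydisc {2..n} f2) \<and>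
    op_mult n \<Theta> ` H2 {1..n} = sum_space f1 f2"
  proof (rule sum_of_projection_form[OF f1(1) N P1 P0 _ U])
   show "(\<lambda>x. P0 k x + P1 k x) = k" if "k \<in> H2 {2..n}" for k using sum that by (rule bspec)
   show "\<Theta> w (U k) = (\<lambda>x. f1 w * P0 k x + P1 k x)" if "cmod w < 1" "k \<in> H2 {2..n}" for w k
    by (rule form[THEN bspec, THEN bspec, OF _ that(2)]) (use that(1) in simp)
  qed
  then obtain f2 where f2: "f2 \<in> Hinf_polydisc {2..n}" "inverse_in_Linf (torus_measure {2..n}) (radial_polydisc {2..n} f2)"
   "op_mult n \<Theta> ` H2 {1..n} = sum_space f1 f2" by (elim bexE conjE) (rule that)
  show ?L by (rule bexI[OF _ f1(1)], rule bexI[OF _ f2(1)]) (intro conjI f1(2) f2(2), unfold assms(4), rule f2(3))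
 qed
qed

end
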